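(* Let $\mathcal C^c\text{-}\mathcal A$ be a nonsymmetric type of generalized bialgebras over a field $\mathbb K$ (of arbitrary characteristic), with distributive compatibility relations. Suppose that: (H1) the free $\mathcal A$-algebra $\mathcal A(V)$ is naturally (functorially in $V$) equipped with a $\mathcal C^c\text{-}\mathcal A$-bialgebra structure; (nonsymmetric H2epi) the natural coalgebra map $\varphi(V):\mathcal A(V)\to\mathcal C^c(V)$ is surjective and admits a natural coalgebra map splitting which is induced by linear maps $\mathcal C^c_n\to\mathcal A_n$ (not involving the symmetric groups). Let $\mathcal P=\mathrm{Prim}_{\mathcal C}\mathcal A$. Then for any $\mathcal C^c\text{-}\mathcal A$-bialgebra $\mathcal H$ the following are equivalent: (a) the $\mathcal C^c\text{-}\mathcal A$-bialgebra $\mathcal H$ is connected; (b) there is an isomorphism of bialgebras $\mathcal H\cong U(\mathrm{Prim}\,\mathcal H)$; (c) there is an isomorphism of connected coalgebras $\mathcal H\cong\mathcal C^c(\mathrm{Prim}\,\mathcal H)$.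
   Context: A nonsymmetric operad $\mathcal A$ is given by spaces $\mathcal A_n$ with compositions $\mathcal A_k\otimes\mathcal A_{i_1}\otimes\cdots\otimes\mathcal A_{i_k}\to\mathcal A_{i_1+\cdots+i_k}$ (the symmetric operad being $\mathcal A(n)=\mathcal A_n\otimes\mathbb K[S_n]$), and the free $\mathcal A$-algebra is $\mathcal A(V)=\bigoplus_{n\ge1}\mathcal A_n\otimes V^{\otimes n}$. Both $\mathcal A$ and $\mathcal C$ have finitely many generating operations in each arity, $\mathcal A_0=\mathcal C_0=0$, $\mathcal A_1=\mathcal C_1=\mathbb K\,\mathrm{id}$, all $\mathcal A_n,\mathcal C_n$ finite dimensional. A $\mathcal C$-coalgebra is a vector space $C$ with maps $\mathcal C_n\otimes C\to C^{\otimes n}$, $\delta\otimes c\mapsto\delta(c)$, compatible with the operad structure; elements of $\mathcal C_n$ are called cooperations. $\mathcal C^c_n=\mathcal C_n^*$; $\mathcal C^c(V)=\bigoplus_n\mathcal C^c_n\otimes V^{\otimes n}$ is the cofree connected $\mathcal C$-coalgebra on $V$. For a $\mathcal C$-coalgebra $C$: $\mathrm{Prim}\,C=\{x:\delta(x)=0\ \forall\delta\in\mathcal C_n,n\ge2\}$; $F_rC=\{x:\delta(x)=0\ \forall\delta\in\mathcal C_n,n>r\}$; $C$ is connected if $C=\bigcup_rF_rC$. A nonsymmetric type of generalized bialgebras $\mathcal C^c\text{-}\mathcal A$ consists of nonsymmetric operads $\mathcal A,\mathcal C$ and, for each operation $\mu\in\mathcal A_n$ and cooperation $\delta\in\mathcal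 C_m$, a distributive compatibility relation in which the only permutation is the identity: $\delta\circ\mu=\sum_i(\mu^i_1\otimes\cdots\otimes\mu^i_m)\circ(\delta^i_1\otimes\cdots\otimes\delta^i_n)$ with $\mu^i_j$ operations and $\delta^i_j$ cooperations whose arities have equal sums. A bialgebra is an $\mathcal A$-algebra and $\mathcal C$-coalgebra satisfying these relations. $\varphi(V):\mathcal A(V)\to\mathcal C^c(V)$ is the unique coalgebra map induced by the projection $\mathcal A(V)\to V$. $\mu\in\mathcal A_n$ is primitive if $\mu(x_1,\dots,x_n)$ is a primitive element of $\mathcal A(\mathbb Kx_1\oplus\cdots\oplus\mathbb Kx_n)$, and likewise for elements of $\mathcal A(n)$; primitive operations form a suboperad $\mathcal P=\mathrm{Prim}_{\mathcal C}\mathcal A$ of $\mathcal A$, and primitive parts of bialgebras are $\mathcal P$-algebras. $U:\mathcal P\text{-alg}\to\mathcal A\text{-alg}$ is the left adjoint of the forgetful functor; $U(L)$ inherits a bialgebra structure as a quotient of $\mathcal A(L)$. *)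

theory Defs
  imports Complex_Main "HOL-Library.Function_Algebras" "HOL-Combinatorics.Permutations"
begin

section \<open>Vector spaces\<close>

text \<open>
  A vector space is a subspace \<open>carr V\<close> of a type equipped with a scalar multiplication.
\<close>

record ('k, 'v) vs =
  carr :: "'v set"
  smul :: "'k \<Rightarrow> 'v \<Rightarrow> 'v"

definition vec_space :: "('k::field, 'v::ab_group_add) vs \<Rightarrow> bool" where
  "vec_space V \<longleftrightarrow> vector_space (smul V) \<and> module.subspace (smul V) (carr V)"

definition vspan :: "('k::field, 'v::ab_group_add) vs \<Rightarrow> 'v set \<Rightarrow> ('k, 'v) vs" where
  "vspan V S = V\<lparr>carr := module.span (smul V) S\<rparr>"

definition subsp :: "('k::field, 'v::ab_group_add) vs \<Rightarrow> ('k, 'v) vs \<Rightarrow> bool" where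
  "subsp W V \<longleftrightarrow> vec_space W \<and> smul W = smul V \<and> carr W \<subseteq> carr V"

definition fin_dim :: "('k::field, 'v::ab_group_add) vs \<Rightarrow> bool" where
  "fin_dim V \<longleftrightarrow> (\<exists>B. finite B \<and> carr V = module.span (smul V) B)"

definition lin_on ::
    "('k::field, 'v::ab_group_add) vs \<Rightarrow> ('k, 'w::ab_group_add) vs \<Rightarrow> ('v \<Rightarrow> 'w) \<Rightarrow> bool" where
  "lin_on V W f \<longleftrightarrow>
     (\<forall>x\<in>carr V. f x \<in> carr W) \<and>
     (\<forall>x\<in>carr V. \<forall>y\<in>carr V. f (x + y) = f x + f y) \<and>
     (\<forall>c. \<forall>x\<in>carr V. f (smul V c x) = smul W c (f x))"

definition tuples :: "('k, 'v) vs list \<Rightarrow> 'v list set" where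
  "tuples Xs = listset (map carr Xs)"

definition mlin ::
    "('k::field, 'v::ab_group_add) vs list \<Rightarrow> ('k, 'w::ab_group_add) vs \<Rightarrow> ('v list \<Rightarrow> 'w) \<Rightarrow> bool"
where
  "mlin Xs W F \<longleftrightarrow>
     (\<forall>xs\<in>tuples Xs. F xs \<in> carr W) \<and>
     (\<forall>j<length Xs. \<forall>xs\<in>tuples Xs. lin_on (Xs ! j) W (\<lambda>x. F (xs[j := x])))"

definition fld :: "('k::field, 'k) vs" where
  "fld = \<lparr>carr = UNIV, smul = (*)\<rparr>"

definition fscale :: "'k::field \<Rightarrow> ('b \<Rightarrow> 'k) \<Rightarrow> 'b \<Rightarrow> 'k" where
  "fscale c f = (\<lambda>x. c * f x)"

definition dual :: "('k::field, 'v::ab_group_add) vs \<Rightarrow> ('k, 'v \<Rightarrow> 'k) vs" where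
  "dual V = \<lparr>carr = {\<xi>. lin_on V fld \<xi> \<and> (\<forall>x. x \<notin> carr V \<longrightarrow> \<xi> x = 0)}, smul = fscale\<rparr>"

definition some_basis :: "('k::field, 'v::ab_group_add) vs \<Rightarrow> 'v set" where
  "some_basis V = (SOME B. \<not> module.dependent (smul V) B \<and> module.span (smul V) B = carr V)"

definition dual_vec :: "('k::field, 'v::ab_group_add) vs \<Rightarrow> 'v \<Rightarrow> 'v \<Rightarrow> 'k" where
  "dual_vec V b = (\<lambda>x. module.representation (smul V) (some_basis V) x b)"


section \<open>Spaces given by generators\<close>

text \<open>
  Tensor products, free algebras and quotients all have generators \<open>G\<close> subject to
  relations, and are determined by the scalar functions \<open>\<Phi>\<close> on the generators that respect
  the relations (multilinear forms, or linear forms vanishing on a subspace).  Over a field the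
  space so presented embeds into the dual of the space of those functions, as the span of the
  evaluations \<open>ev \<Phi> g\<close> with \<open>g \<in> G\<close>.  The lemmas \<open>tpow_universal\<close>,
  \<open>schur_universal\<close>, \<open>quot_map_kernel\<close> and \<open>quot_map_image\<close> show that this
  yields the usual objects.
\<close>

definition ev :: "('g \<Rightarrow> 'k::field) set \<Rightarrow> 'g \<Rightarrow> ('g \<Rightarrow> 'k) \<Rightarrow> 'k" where
  "ev \<Phi> g = (\<lambda>f. if f \<in> \<Phi> then f g else 0)"

definition presented :: "('g \<Rightarrow> 'k::field) set \<Rightarrow> 'g set \<Rightarrow> ('k, ('g \<Rightarrow> 'k) \<Rightarrow> 'k) vs" where
  "presented \<Phi> G = \<lparr>carr = module.span fscale (ev \<Phi> ` G), smul = fscale\<rparr>"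

definition lift ::
    "('g \<Rightarrow> 'k::field) set \<Rightarrow> 'g set \<Rightarrow> ('k, 'w::ab_group_add) vs \<Rightarrow> ('g \<Rightarrow> 'w)
      \<Rightarrow> (('g \<Rightarrow> 'k) \<Rightarrow> 'k) \<Rightarrow> 'w" where
  "lift \<Phi> G W F = (SOME h. lin_on (presented \<Phi> G) W h \<and> (\<forall>g\<in>G. h (ev \<Phi> g) = F g))"

subsection \<open>Tensor powers\<close>

type_synonym ('k, 'v) tensor = "('v list \<Rightarrow> 'k) \<Rightarrow> 'k"

definition tforms :: "('k::field, 'v::ab_group_add) vs \<Rightarrow> nat \<Rightarrow> ('v list \<Rightarrow> 'k) set" where
  "tforms V n = {f. mlin (replicate n V) fld f}"

definition tens :: "('k::field, 'v::ab_group_add) vs \<Rightarrow> 'v list \<Rightarrow> ('k, 'v) tensor" where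
  "tens V xs = ev (tforms V (length xs)) xs"

definition tpow :: "('k::field, 'v::ab_group_add) vs \<Rightarrow> nat \<Rightarrow> ('k, ('k, 'v) tensor) vs" where
  "tpow V n = presented (tforms V n) (tuples (replicate n V))"

definition tlift ::
    "('k::field, 'v::ab_group_add) vs \<Rightarrow> nat \<Rightarrow> ('k, 'w::ab_group_add) vs \<Rightarrow> ('v list \<Rightarrow> 'w)
      \<Rightarrow> ('k, 'v) tensor \<Rightarrow> 'w" where
  "tlift V n W F = lift (tforms V n) (tuples (replicate n V)) W F"

definition tmap ::
    "('k::field, 'v::ab_group_add) vs \<Rightarrow> ('k, 'w::ab_group_add) vs \<Rightarrow> nat \<Rightarrow> ('v \<Rightarrow> 'w)
      \<Rightarrow> ('k, 'v) tensor \<Rightarrow> ('k, 'w) tensor" where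
  "tmap V W n f = tlift V n (tpow W n) (\<lambda>xs. tens W (map f xs))"

definition tmul ::
    "('k::field, 'v::ab_group_add) vs \<Rightarrow> nat \<Rightarrow> nat
      \<Rightarrow> ('k, 'v) tensor \<Rightarrow> ('k, 'v) tensor \<Rightarrow> ('k, 'v) tensor" where
  "tmul V p q s t =
     tlift V p (tpow V (p + q)) (\<lambda>xs. tlift V q (tpow V (p + q)) (\<lambda>ys. tens V (xs @ ys)) t) s"

primrec tconcat ::
    "('k::field, 'v::ab_group_add) vs \<Rightarrow> nat list \<Rightarrow> ('k, 'v) tensor list \<Rightarrow> ('k, 'v) tensor"
where
  "tconcat V [] ts = tens V []"
| "tconcat V (i # is) ts = tmul V i (sum_list is) (hd ts) (tconcat V is (tl ts))"

primrec blocks :: "nat list \<Rightarrow> 'v list \<Rightarrow> 'v list list" where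
  "blocks [] xs = []"
| "blocks (i # is) xs = take i xs # blocks is (drop i xs)"

subsection \<open>The space \<open>\<Oplus>\<^sub>n S\<^sub>n \<otimes> V\<^sup>\<otimes>\<^sup>n\<close>\<close>

text \<open>
  A generator \<open>(\<mu>, xs)\<close> stands for \<open>\<mu> \<otimes> x\<^sub>1 \<otimes> \<dots> \<otimes> x\<^sub>n\<close> with \<open>n = length xs\<close>.  As
  \<open>schur_forms\<close> imposes no condition relating different lengths, the sum over \<open>n\<close> is direct.
  The summand \<open>n = 0\<close> vanishes for the families used below, where \<open>S\<^sub>0 = 0\<close>.
\<close>

type_synonym ('k, 's, 'v) schur = "('s \<times> 'v list \<Rightarrow> 'k) \<Rightarrow> 'k"

definition schur_gens ::
    "(nat \<Rightarrow> ('k::field, 's::ab_group_add) vs) \<Rightarrow> ('k, 'v::ab_group_add) vs \<Rightarrow> ('s \<times> 'v list) set"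
where
  "schur_gens S V =
     {(\<mu>, xs). \<mu> \<in> carr (S (length xs)) \<and> xs \<in> tuples (replicate (length xs) V)}"

definition schur_mlin ::
    "(nat \<Rightarrow> ('k::field, 's::ab_group_add) vs) \<Rightarrow> ('k, 'v::ab_group_add) vs
      \<Rightarrow> ('k, 'w::ab_group_add) vs \<Rightarrow> ('s \<times> 'v list \<Rightarrow> 'w) \<Rightarrow> bool" where
  "schur_mlin S V W F \<longleftrightarrow>
     (\<forall>n. (\<forall>\<mu>\<in>carr (S n). mlin (replicate n V) W (\<lambda>xs. F (\<mu>, xs))) \<and>
          (\<forall>xs\<in>tuples (replicate n V). lin_on (S n) W (\<lambda>\<mu>. F (\<mu>, xs))))"

definition schur_forms ::
    "(nat \<Rightarrow> ('k::field, 's::ab_group_add) vs) \<Rightarrow> ('k, 'v::ab_group_add) vs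
      \<Rightarrow> ('s \<times> 'v list \<Rightarrow> 'k) set" where
  "schur_forms S V = {f. schur_mlin S V fld f}"

definition sgen ::
    "(nat \<Rightarrow> ('k::field, 's::ab_group_add) vs) \<Rightarrow> ('k, 'v::ab_group_add) vs
      \<Rightarrow> 's \<Rightarrow> 'v list \<Rightarrow> ('k, 's, 'v) schur" where
  "sgen S V \<mu> xs = ev (schur_forms S V) (\<mu>, xs)"

definition schur ::
    "(nat \<Rightarrow> ('k::field, 's::ab_group_add) vs) \<Rightarrow> ('k, 'v::ab_group_add) vs
      \<Rightarrow> ('k, ('k, 's, 'v) schur) vs" where
  "schur S V = presented (schur_forms S V) (schur_gens S V)"

definition slift ::
    "(nat \<Rightarrow> ('k::field, 's::ab_group_add) vs) \<Rightarrow> ('k, 'v::ab_group_add) vs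
      \<Rightarrow> ('k, 'w::ab_group_add) vs \<Rightarrow> ('s \<Rightarrow> 'v list \<Rightarrow> 'w) \<Rightarrow> ('k, 's, 'v) schur \<Rightarrow> 'w" where
  "slift S V W F = lift (schur_forms S V) (schur_gens S V) W (\<lambda>(\<mu>, xs). F \<mu> xs)"

definition smap ::
    "(nat \<Rightarrow> ('k::field, 's::ab_group_add) vs) \<Rightarrow> ('k, 'v::ab_group_add) vs
      \<Rightarrow> ('k, 'w::ab_group_add) vs \<Rightarrow> ('v \<Rightarrow> 'w) \<Rightarrow> ('k, 's, 'v) schur \<Rightarrow> ('k, 's, 'w) schur" where
  "smap S V W f = slift S V (schur S W) (\<lambda>\<mu> xs. sgen S W \<mu> (map f xs))"

subsection \<open>Quotients\<close>

definition quot_forms :: "('k::field, 'v::ab_group_add) vs \<Rightarrow> 'v set \<Rightarrow> ('v \<Rightarrow> 'k) set" where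
  "quot_forms V N = {f. lin_on V fld f \<and> (\<forall>x\<in>N. f x = 0)}"

definition quot_map ::
    "('k::field, 'v::ab_group_add) vs \<Rightarrow> 'v set \<Rightarrow> 'v \<Rightarrow> ('v \<Rightarrow> 'k) \<Rightarrow> 'k" where
  "quot_map V N = ev (quot_forms V N)"

definition quot :: "('k::field, 'v::ab_group_add) vs \<Rightarrow> 'v set \<Rightarrow> ('k, ('v \<Rightarrow> 'k) \<Rightarrow> 'k) vs" where
  "quot V N = presented (quot_forms V N) (carr V)"

definition quot_rep ::
    "('k::field, 'v::ab_group_add) vs \<Rightarrow> 'v set \<Rightarrow> (('v \<Rightarrow> 'k) \<Rightarrow> 'k) \<Rightarrow> 'v" where
  "quot_rep V N = inv_into (carr V) (quot_map V N)"


subsection \<open>The constructions are the intended ones\<close>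

lemma vector_space_fscale: "vector_space (fscale :: 'k::field \<Rightarrow> ('b \<Rightarrow> 'k) \<Rightarrow> 'b \<Rightarrow> 'k)"
  by unfold_locales (auto simp: fscale_def fun_eq_iff algebra_simps)

lemma vector_space_field: "vector_space ((*) :: 'k::field \<Rightarrow> 'k \<Rightarrow> 'k)"
  by unfold_locales (auto simp: algebra_simps)

lemma separating_form:
  fixes V :: "('k::field, 'v::ab_group_add) vs"
  assumes V: "vec_space V" and N: "module.subspace (smul V) N" and x: "x \<notin> N"
  obtains f where "Vector_Spaces.linear (smul V) (*) f" "\<And>y. y \<in> N \<Longrightarrow> f y = (0::'k)" "f x = 1"
proof -
  interpret V: vector_space "smul V" using V by (simp add: vec_space_def)
  interpret K: vector_space "(*) :: 'k \<Rightarrow> 'k \<Rightarrow> 'k" by (rule vector_space_field)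
  interpret VK: vector_space_pair "smul V" "(*) :: 'k \<Rightarrow> 'k \<Rightarrow> 'k" ..
  obtain B where B: "B \<subseteq> N" "V.independent B" "N \<subseteq> V.span B"
    by (rule V.maximal_independent_subset)
  have spB: "V.span B = N" using B V.span_minimal[OF B(1) N] by auto
  have ind: "V.independent (insert x B)" using B spB x by (intro V.independent_insertI) auto
  define f where "f = VK.construct (insert x B) (\<lambda>b. if b = x then 1 else 0)"
  have lf: "Vector_Spaces.linear (smul V) (*) f"
    unfolding f_def by (rule VK.linear_construct[OF ind])
  have fb: "f b = (if b = x then 1 else 0)" if "b \<in> insert x B" for b
    unfolding f_def by (rule VK.construct_basis[OF ind that])
  have "f y = 0" if "y \<in> N" for y
  proof (rule VK.linear_eq_0_on_span[OF lf])
    show "f b = 0" if "b \<in> B" for b using fb[of b] B(1) x that by auto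
    show "y \<in> V.span B" using \<open>y \<in> N\<close> spB by simp
  qed
  then show ?thesis using that[of f] lf fb[of x] by simp
qed

lemma vec_space_presented:
  fixes \<Phi> :: "('g \<Rightarrow> 'k::field) set"
  shows "vec_space (presented \<Phi> G)"
proof -
  interpret vector_space "fscale :: 'k \<Rightarrow> (('g \<Rightarrow> 'k) \<Rightarrow> 'k) \<Rightarrow> ('g \<Rightarrow> 'k) \<Rightarrow> 'k"
    by (rule vector_space_fscale)
  show ?thesis
    by (simp add: vec_space_def presented_def vector_space_fscale)
qed

lemma ev_in_presented:
  fixes \<Phi> :: "('g \<Rightarrow> 'k::field) set"
  assumes "g \<in> G"
  shows "ev \<Phi> g \<in> carr (presented \<Phi> G)"
proof -
  interpret vector_space "fscale :: 'k \<Rightarrow> (('g \<Rightarrow> 'k) \<Rightarrow> 'k) \<Rightarrow> ('g \<Rightarrow> 'k) \<Rightarrow> 'k"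
    by (rule vector_space_fscale)
  show ?thesis using assms by (auto simp: presented_def intro: span_base)
qed

lemma lift_presented:
  fixes \<Phi> :: "('g \<Rightarrow> 'k::field) set" and W :: "('k, 'w::ab_group_add) vs"
  assumes W: "vec_space W" and FW: "\<And>g. g \<in> G \<Longrightarrow> F g \<in> carr W"
    and F: "\<And>l. Vector_Spaces.linear (smul W) (*) l \<Longrightarrow> (\<lambda>g. l (F g)) \<in> \<Phi>"
  shows "lin_on (presented \<Phi> G) W (lift \<Phi> G W F)"
    and "\<And>g. g \<in> G \<Longrightarrow> lift \<Phi> G W F (ev \<Phi> g) = F g"
proof -
  let ?fs = "fscale :: 'k \<Rightarrow> (('g \<Rightarrow> 'k) \<Rightarrow> 'k) \<Rightarrow> ('g \<Rightarrow> 'k) \<Rightarrow> 'k"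
  interpret D: vector_space ?fs by (rule vector_space_fscale)
  interpret W: vector_space "smul W" using W by (simp add: vec_space_def)
  interpret K: vector_space "(*) :: 'k \<Rightarrow> 'k \<Rightarrow> 'k" by (rule vector_space_field)
  interpret DW: vector_space_pair ?fs "smul W" ..
  interpret DK: vector_space_pair ?fs "(*) :: 'k \<Rightarrow> 'k \<Rightarrow> 'k" ..
  obtain B where B: "B \<subseteq> ev \<Phi> ` G" "D.independent B" "ev \<Phi> ` G \<subseteq> D.span B"
    by (rule D.maximal_independent_subset)
  define c where "c = inv_into G (ev \<Phi>)"
  have c: "c b \<in> G" "ev \<Phi> (c b) = b" if "b \<in> B" for b
    using B(1) that unfolding c_def by (auto intro: inv_into_into f_inv_into_f)
  define h where "h = DW.construct B (\<lambda>b. F (c b))"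
  have lh: "Vector_Spaces.linear ?fs (smul W) h"
    unfolding h_def by (rule DW.linear_construct[OF B(2)])
  have hb: "h b = F (c b)" if "b \<in> B" for b
    unfolding h_def by (rule DW.construct_basis[OF B(2) that])
  interpret h: Vector_Spaces.linear ?fs "smul W" h by (rule lh)
  have spB: "D.span B = D.span (ev \<Phi> ` G)"
    by (intro subset_antisym D.span_mono B(1) D.span_minimal B(3) D.subspace_span)
  have hg: "h (ev \<Phi> g) = F g" if g: "g \<in> G" for g
  proof (rule ccontr)
    assume "h (ev \<Phi> g) \<noteq> F g"
    then have ne: "h (ev \<Phi> g) - F g \<notin> {0}" by simp
    then obtain l where l: "Vector_Spaces.linear (smul W) (*) l" "l (h (ev \<Phi> g) - F g) = (1::'k)"
      using separating_form[OF W W.subspace_single_0 ne] by blast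
    interpret l: Vector_Spaces.linear "smul W" "(*)" l by (rule l(1))
    let ?f = "\<lambda>g. l (F g)"
    have 1: "Vector_Spaces.linear ?fs (*) (\<lambda>t. l (h t))"
      using Vector_Spaces.linear_compose[OF lh l(1)] by (simp add: o_def)
    have 2: "Vector_Spaces.linear ?fs (*) (\<lambda>t. t ?f)"
      by (simp add: Vector_Spaces.linear_iff fscale_def vector_space_field D.vector_space_axioms)
    have eqB: "l (h b) = b ?f" if "b \<in> B" for b
    proof -
      have "b ?f = ev \<Phi> (c b) ?f" using c(2)[OF that] by (rule arg_cong[OF sym])
      also have "\<dots> = l (F (c b))" using F[OF l(1)] by (simp add: ev_def)
      finally show ?thesis using hb[OF that] by simp
    qed
    have mem: "ev \<Phi> g \<in> D.span B" using B(3) g by (rule subsetD[OF _ imageI])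
    have "l (h (ev \<Phi> g)) = ev \<Phi> g ?f"
      by (rule DK.linear_eq_on[OF 1 2 mem eqB])
    also have "\<dots> = l (F g)" using F[OF l(1)] by (simp add: ev_def)
    finally show False using l(2) by (simp add: l.diff)
  qed
  have sW: "W.subspace (carr W)" using W by (simp add: vec_space_def)
  have "h t \<in> carr W" if "t \<in> D.span (ev \<Phi> ` G)" for t
  proof -
    have "h ` (ev \<Phi> ` G) \<subseteq> carr W" using hg FW by auto
    then have "W.span (h ` (ev \<Phi> ` G)) \<subseteq> carr W" using sW by (rule W.span_minimal)
    then show ?thesis using that h.span_image[of "ev \<Phi> ` G"] by auto
  qed
  then have "lin_on (presented \<Phi> G) W h"
    by (auto simp: lin_on_def presented_def h.add h.scale)
  then have "\<exists>h. lin_on (presented \<Phi> G) W h \<and> (\<forall>g\<in>G. h (ev \<Phi> g) = F g)"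
    using hg by blast
  from someI_ex[OF this]
  show "lin_on (presented \<Phi> G) W (lift \<Phi> G W F)"
    and "\<And>g. g \<in> G \<Longrightarrow> lift \<Phi> G W F (ev \<Phi> g) = F g"
    unfolding lift_def by auto
qed

lemma presented_unique:
  fixes \<Phi> :: "('g \<Rightarrow> 'k::field) set" and W :: "('k, 'w::ab_group_add) vs"
  assumes W: "vec_space W" and h: "lin_on (presented \<Phi> G) W h" "lin_on (presented \<Phi> G) W h'"
    and eq: "\<And>g. g \<in> G \<Longrightarrow> h (ev \<Phi> g) = h' (ev \<Phi> g)" and t: "t \<in> carr (presented \<Phi> G)"
  shows "h t = h' t"
proof -
  interpret D: vector_space "fscale :: 'k \<Rightarrow> (('g \<Rightarrow> 'k) \<Rightarrow> 'k) \<Rightarrow> ('g \<Rightarrow> 'k) \<Rightarrow> 'k"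
    by (rule vector_space_fscale)
  interpret W: vector_space "smul W" using W by (simp add: vec_space_def)
  have z: "k 0 = 0" if "lin_on (presented \<Phi> G) W k" for k
  proof -
    have "0 \<in> carr (presented \<Phi> G)" by (simp add: presented_def D.span_zero)
    then have "k (0 + 0) = k 0 + k 0" using that unfolding lin_on_def by blast
    then show ?thesis by simp
  qed
  have "t \<in> D.span (ev \<Phi> ` G)" using t by (simp add: presented_def)
  then have "t \<in> D.span (ev \<Phi> ` G) \<and> h t = h' t"
  proof (induction rule: D.span_induct_alt)
    case base
    have "h 0 = h' 0" using z[OF h(1)] z[OF h(2)] by (rule trans[OF _ sym])
    with D.span_zero show ?case by (rule conjI)
  next
    case (step c x y)
    then obtain g where g: "g \<in> G" "x = ev \<Phi> g" by (elim imageE)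
    have x: "x \<in> D.span (ev \<Phi> ` G)" using step(1) by (rule D.span_base)
    have cx: "fscale c x \<in> D.span (ev \<Phi> ` G)" using x by (rule D.span_scale)
    have y: "y \<in> D.span (ev \<Phi> ` G)" "h y = h' y" using step.IH by (rule conjunct1, rule conjunct2)
    have k: "k (fscale c x + y) = smul W c (k x) + k y" if "lin_on (presented \<Phi> G) W k" for k
    proof -
      have "k (fscale c x + y) = k (fscale c x) + k y"
        using that cx y(1) unfolding lin_on_def presented_def vs.simps by blast
      moreover have "k (fscale c x) = smul W c (k x)"
        using that x unfolding lin_on_def presented_def vs.simps by blast
      ultimately show ?thesis by (rule trans[OF _ arg_cong])
    qed
    have "h (fscale c x + y) = h' (fscale c x + y)"
      unfolding k[OF h(1)] k[OF h(2)] unfolding y(2) g(2) eq[OF g(1)] by (rule refl)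
    with D.span_add[OF cx y(1)] show ?case by (rule conjI)
  qed
  then show ?thesis by (rule conjunct2)
qed

lemma lin_on_linear_comp:
  assumes "lin_on V W f" "Vector_Spaces.linear (smul W) (*) l"
  shows "lin_on V fld (\<lambda>x. l (f x))"
  using assms by (auto simp: lin_on_def fld_def Vector_Spaces.linear_iff)

lemma length_tuples: "xs \<in> tuples Xs \<Longrightarrow> length xs = length Xs"
  unfolding tuples_def by (induction Xs arbitrary: xs) (auto simp: set_Cons_def)

lemma tuples_update:
  "xs \<in> tuples Xs \<Longrightarrow> j < length Xs \<Longrightarrow> x \<in> carr (Xs ! j) \<Longrightarrow> xs[j := x] \<in> tuples Xs"
  unfolding tuples_def
  by (induction Xs arbitrary: xs j) (auto simp: set_Cons_def nth_Cons split: nat.splits)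

lemma mlin_linear_comp:
  assumes "mlin Xs W F" "Vector_Spaces.linear (smul W) (*) l"
  shows "mlin Xs fld (\<lambda>xs. l (F xs))"
  unfolding mlin_def
proof (intro conjI ballI allI impI)
  show "lin_on (Xs ! j) fld (\<lambda>x. l (F (xs[j := x])))"
    if "j < length Xs" "xs \<in> tuples Xs" for j xs
    using assms(1) that unfolding mlin_def by (intro lin_on_linear_comp[OF _ assms(2)]) blast
qed (simp add: fld_def)

lemma lin_on_ev:
  assumes "\<And>x. x \<in> carr X \<Longrightarrow> k x \<in> G" "\<And>f. f \<in> \<Phi> \<Longrightarrow> lin_on X fld (\<lambda>x. f (k x))"
  shows "lin_on X (presented \<Phi> G) (\<lambda>x. ev \<Phi> (k x))"
  unfolding lin_on_def
proof (intro conjI ballI allI)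
  show "ev \<Phi> (k x) \<in> carr (presented \<Phi> G)" if "x \<in> carr X" for x
    using assms(1)[OF that] by (rule ev_in_presented)
  show "ev \<Phi> (k (x + y)) = ev \<Phi> (k x) + ev \<Phi> (k y)" if "x \<in> carr X" "y \<in> carr X" for x y
    using assms(2) that by (auto simp: ev_def fun_eq_iff lin_on_def)
  show "ev \<Phi> (k (smul X c x)) = smul (presented \<Phi> G) c (ev \<Phi> (k x))" if "x \<in> carr X" for c x
    using assms(2) that
    by (auto simp: ev_def fun_eq_iff lin_on_def presented_def fscale_def fld_def)
qed

text \<open>The universal property of \<open>V\<^sup>\<otimes>\<^sup>n\<close>.\<close>

theorem tens_mlin: "mlin (replicate n V) (tpow V n) (tens V)"
proof -
  have len: "length xs = n" if "xs \<in> tuples (replicate n V)" for xs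
    using length_tuples[OF that] by simp
  show ?thesis
    unfolding mlin_def
  proof (intro conjI ballI allI impI)
    show "tens V xs \<in> carr (tpow V n)" if "xs \<in> tuples (replicate n V)" for xs
      using that len by (simp add: tpow_def tens_def ev_in_presented)
    show "lin_on (replicate n V ! j) (tpow V n) (\<lambda>x. tens V (xs[j := x]))"
      if "j < length (replicate n V)" "xs \<in> tuples (replicate n V)" for j xs
      using that len[OF that(2)] tuples_update[OF that(2,1)]
      by (auto simp: tpow_def tens_def tforms_def mlin_def intro!: lin_on_ev)
  qed
qed

theorem tpow_universal:
  assumes "vec_space W" "mlin (replicate n V) W F"
  shows "lin_on (tpow V n) W (tlift V n W F)"
    and "\<And>xs. xs \<in> tuples (replicate n V) \<Longrightarrow> tlift V n W F (tens V xs) = F xs"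
    and "\<And>h t. lin_on (tpow V n) W h \<Longrightarrow>
           (\<And>xs. xs \<in> tuples (replicate n V) \<Longrightarrow> h (tens V xs) = F xs) \<Longrightarrow>
           t \<in> carr (tpow V n) \<Longrightarrow> h t = tlift V n W F t"
proof -
  have FW: "F xs \<in> carr W" if "xs \<in> tuples (replicate n V)" for xs
    using assms(2) that by (simp add: mlin_def)
  have F: "(\<lambda>xs. l (F xs)) \<in> tforms V n" if "Vector_Spaces.linear (smul W) (*) l" for l
    using mlin_linear_comp[OF assms(2) that] by (simp add: tforms_def)
  have len: "tens V xs = ev (tforms V n) xs" if "xs \<in> tuples (replicate n V)" for xs
    using length_tuples[OF that] by (simp add: tens_def)
  note L = lift_presented[where F = F and G = "tuples (replicate n V)" and \<Phi> = "tforms V n", OF assms(1) FW F]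
  show 1: "lin_on (tpow V n) W (tlift V n W F)"
    unfolding tpow_def tlift_def by (rule L(1))
  show 2: "tlift V n W F (tens V xs) = F xs" if "xs \<in> tuples (replicate n V)" for xs
    unfolding len[OF that] tlift_def by (rule L(2)[OF _ _ that])
  show "h t = tlift V n W F t" if "lin_on (tpow V n) W h"
      "\<And>xs. xs \<in> tuples (replicate n V) \<Longrightarrow> h (tens V xs) = F xs" "t \<in> carr (tpow V n)" for h t
    using presented_unique[OF assms(1) that(1)[unfolded tpow_def] 1[unfolded tpow_def], of t]
      that 2 len by (simp add: tpow_def)
qed

text \<open>The universal property of \<open>\<Oplus>\<^sub>n S\<^sub>n \<otimes> V\<^sup>\<otimes>\<^sup>n\<close>.\<close>

theorem sgen_mlin: "schur_mlin S V (schur S V) (\<lambda>(\<mu>, xs). sgen S V \<mu> xs)"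
proof -
  have len: "length xs = n" if "xs \<in> tuples (replicate n V)" for xs n
    using length_tuples[OF that] by simp
  have gens: "(\<mu>, xs) \<in> schur_gens S V" if "\<mu> \<in> carr (S n)" "xs \<in> tuples (replicate n V)" for \<mu> xs n
    using that len[OF that(2)] by (simp add: schur_gens_def)
  have "mlin (replicate n V) (schur S V) (sgen S V \<mu>)" if \<mu>: "\<mu> \<in> carr (S n)" for n \<mu>
    unfolding mlin_def
  proof (intro conjI ballI allI impI)
    show "sgen S V \<mu> xs \<in> carr (schur S V)" if "xs \<in> tuples (replicate n V)" for xs
      using gens[OF \<mu> that] by (simp add: schur_def sgen_def ev_in_presented)
    show "lin_on (replicate n V ! j) (schur S V) (\<lambda>x. sgen S V \<mu> (xs[j := x]))"
      if "j < length (replicate n V)" "xs \<in> tuples (replicate n V)" for j xs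
      unfolding schur_def sgen_def
    proof (rule lin_on_ev)
      show "(\<mu>, xs[j := x]) \<in> schur_gens S V" if "x \<in> carr (replicate n V ! j)" for x
        using gens[OF \<mu> tuples_update] that \<open>j < _\<close> \<open>xs \<in> _\<close> by blast
      show "lin_on (replicate n V ! j) fld (\<lambda>x. f (\<mu>, xs[j := x]))" if "f \<in> schur_forms S V" for f
        using that \<mu> \<open>j < _\<close> \<open>xs \<in> _\<close>
        unfolding schur_forms_def schur_mlin_def mlin_def by blast
    qed
  qed
  moreover have "lin_on (S n) (schur S V) (\<lambda>\<mu>. sgen S V \<mu> xs)"
    if "xs \<in> tuples (replicate n V)" for n xs
    unfolding schur_def sgen_def
    using gens[OF _ that] that by (intro lin_on_ev) (auto simp: schur_forms_def schur_mlin_def)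
  ultimately show ?thesis by (simp add: schur_mlin_def)
qed

theorem schur_universal:
  assumes "vec_space W" "schur_mlin S V W (\<lambda>(\<mu>, xs). F \<mu> xs)"
  shows "lin_on (schur S V) W (slift S V W F)"
    and "\<And>\<mu> xs. (\<mu>, xs) \<in> schur_gens S V \<Longrightarrow> slift S V W F (sgen S V \<mu> xs) = F \<mu> xs"
    and "\<And>h t. lin_on (schur S V) W h \<Longrightarrow>
           (\<And>\<mu> xs. (\<mu>, xs) \<in> schur_gens S V \<Longrightarrow> h (sgen S V \<mu> xs) = F \<mu> xs) \<Longrightarrow>
           t \<in> carr (schur S V) \<Longrightarrow> h t = slift S V W F t"
proof -
  have FW: "(\<lambda>(\<mu>, xs). F \<mu> xs) g \<in> carr W" if "g \<in> schur_gens S V" for g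
    using assms(2) that by (auto simp: schur_gens_def schur_mlin_def mlin_def)
  have F: "(\<lambda>g. l ((\<lambda>(\<mu>, xs). F \<mu> xs) g)) \<in> schur_forms S V"
    if "Vector_Spaces.linear (smul W) (*) l" for l
    unfolding schur_forms_def mem_Collect_eq schur_mlin_def prod.case
    using assms(2) unfolding schur_mlin_def prod.case
    by (intro allI conjI ballI mlin_linear_comp[OF _ that] lin_on_linear_comp[OF _ that]) blast+
  note L = lift_presented[where F = "\<lambda>(\<mu>, xs). F \<mu> xs" and G = "schur_gens S V" and
      \<Phi> = "schur_forms S V", OF assms(1) FW F]
  show 1: "lin_on (schur S V) W (slift S V W F)"
    unfolding schur_def slift_def by (rule L(1))
  show 2: "slift S V W F (sgen S V \<mu> xs) = F \<mu> xs" if "(\<mu>, xs) \<in> schur_gens S V" for \<mu> xs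
    using L(2)[OF _ _ that] by (simp add: sgen_def slift_def)
  show "h t = slift S V W F t" if "lin_on (schur S V) W h"
      "\<And>\<mu> xs. (\<mu>, xs) \<in> schur_gens S V \<Longrightarrow> h (sgen S V \<mu> xs) = F \<mu> xs" "t \<in> carr (schur S V)" for h t
    using presented_unique[OF assms(1) that(1)[unfolded schur_def] 1[unfolded schur_def], of t]
      that 2 by (auto simp: schur_def sgen_def)
qed

text \<open>The map \<open>quot_map V N\<close> is a linear surjection \<open>V \<rightarrow> quot V N\<close> with kernel \<open>N\<close>.\<close>

theorem quot_map_linear: "lin_on V (quot V N) (quot_map V N)"
  unfolding quot_def quot_map_def by (rule lin_on_ev) (auto simp: quot_forms_def)

theorem quot_map_kernel:
  assumes V: "vec_space V" and N: "module.subspace (smul V) N" and x: "x \<in> carr V"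
  shows "quot_map V N x = 0 \<longleftrightarrow> x \<in> N"
proof
  assume 0: "quot_map V N x = 0"
  show "x \<in> N"
  proof (rule ccontr)
    assume "x \<notin> N"
    then obtain f where f: "Vector_Spaces.linear (smul V) (*) f" "\<And>y. y \<in> N \<Longrightarrow> f y = 0" "f x = 1"
      using separating_form[OF V N] by blast
    then have "f \<in> quot_forms V N"
      by (auto simp: quot_forms_def lin_on_def fld_def Vector_Spaces.linear_iff)
    then show False using fun_cong[OF 0, of f] f(3) by (simp add: quot_map_def ev_def)
  qed
qed (auto simp: quot_map_def ev_def quot_forms_def fun_eq_iff)

theorem quot_map_image:
  fixes V :: "('k::field, 'v::ab_group_add) vs"
  assumes V: "vec_space V"
  shows "quot_map V N ` carr V = carr (quot V N)"
proof -
  interpret D: vector_space "fscale :: 'k \<Rightarrow> (('v \<Rightarrow> 'k) \<Rightarrow> 'k) \<Rightarrow> ('v \<Rightarrow> 'k) \<Rightarrow> 'k"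
    by (rule vector_space_fscale)
  interpret V: vector_space "smul V" using V by (simp add: vec_space_def)
  have sV: "V.subspace (carr V)" using V by (simp add: vec_space_def)
  have lin: "quot_map V N (x + y) = quot_map V N x + quot_map V N y"
      "quot_map V N (smul V c x) = fscale c (quot_map V N x)"
    if "x \<in> carr V" "y \<in> carr V" for x y c
    using quot_map_linear[of V N] that unfolding lin_on_def quot_def presented_def by auto
  have "D.subspace (quot_map V N ` carr V)"
  proof (rule D.subspaceI)
    have "quot_map V N (smul V 0 0) = fscale 0 (quot_map V N 0)"
      using lin(2) V.subspace_0[OF sV] by blast
    then have "quot_map V N 0 = 0" unfolding D.scale_zero_left V.scale_zero_left .
    then show "0 \<in> quot_map V N ` carr V" using V.subspace_0[OF sV] by (rule image_eqI[OF sym])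
  next
    fix a b assume "a \<in> quot_map V N ` carr V" "b \<in> quot_map V N ` carr V"
    then obtain x y where xy: "x \<in> carr V" "y \<in> carr V" "a = quot_map V N x" "b = quot_map V N y"
      by (elim imageE)
    show "a + b \<in> quot_map V N ` carr V"
      unfolding xy(3,4) lin(1)[OF xy(1,2), symmetric]
      by (rule imageI[OF V.subspace_add[OF sV xy(1,2)]])
  next
    fix c a assume "a \<in> quot_map V N ` carr V"
    then obtain x where x: "x \<in> carr V" "a = quot_map V N x" by (elim imageE)
    show "fscale c a \<in> quot_map V N ` carr V"
      unfolding x(2) lin(2)[OF x(1) x(1), symmetric]
      by (rule imageI[OF V.subspace_scale[OF sV x(1)]])
  qed
  then have "D.span (quot_map V N ` carr V) = quot_map V N ` carr V"
    by (rule D.span_eq_iff[THEN iffD2])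
  then show ?thesis unfolding quot_def presented_def quot_map_def vs.simps by (rule sym)
qed

section \<open>Nonsymmetric operads, algebras and coalgebras\<close>

text \<open>
  \<open>ocomp A [i\<^sub>1, \<dots>, i\<^sub>k] \<mu> [\<nu>\<^sub>1, \<dots>, \<nu>\<^sub>k]\<close> is the composite of \<open>\<mu> \<in> A\<^sub>k\<close> with
  \<open>\<nu>\<^sub>j \<in> A\<^bsub>i\<^sub>j\<^esub>\<close>.  The arities are passed explicitly because the spaces \<open>A\<^sub>n\<close> live in a common
  type and need not be disjoint.
\<close>

record ('k, 'a) operad =
  ospace :: "nat \<Rightarrow> ('k, 'a) vs"
  ocomp :: "nat list \<Rightarrow> 'a \<Rightarrow> 'a list \<Rightarrow> 'a"
  ounit :: 'a

abbreviation ops :: "('k, 'a) operad \<Rightarrow> nat \<Rightarrow> 'a set" where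
  "ops A n \<equiv> carr (ospace A n)"

definition ns_operad :: "('k::field, 'a::ab_group_add) operad \<Rightarrow> bool" where
  "ns_operad A \<longleftrightarrow>
     (\<forall>n. vec_space (ospace A n)) \<and>
     ounit A \<in> ops A 1 \<and>
     (\<forall>is. \<forall>\<mu>\<in>ops A (length is).
        mlin (map (ospace A) is) (ospace A (sum_list is)) (ocomp A is \<mu>)) \<and>
     (\<forall>is. \<forall>\<nu>s\<in>tuples (map (ospace A) is).
        lin_on (ospace A (length is)) (ospace A (sum_list is)) (\<lambda>\<mu>. ocomp A is \<mu> \<nu>s)) \<and>
     (\<forall>n. \<forall>\<mu>\<in>ops A n. ocomp A [n] (ounit A) [\<mu>] = \<mu>) \<and>
     (\<forall>n. \<forall>\<mu>\<in>ops A n. ocomp A (replicate n 1) \<mu> (replicate n (ounit A)) = \<mu>) \<and>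
     (\<forall>\<mu> iss \<nu>s \<rho>ss.
        \<mu> \<in> ops A (length iss) \<longrightarrow>
        \<nu>s \<in> tuples (map (\<lambda>is. ospace A (length is)) iss) \<longrightarrow>
        list_all2 (\<lambda>is \<rho>s. \<rho>s \<in> tuples (map (ospace A) is)) iss \<rho>ss \<longrightarrow>
        ocomp A (concat iss) (ocomp A (map length iss) \<mu> \<nu>s) (concat \<rho>ss) =
        ocomp A (map sum_list iss) \<mu>
          (map2 (\<lambda>(is, \<nu>) \<rho>s. ocomp A is \<nu> \<rho>s) (zip iss \<nu>s) \<rho>ss))"

definition connected_operad :: "('k::field, 'a::ab_group_add) operad \<Rightarrow> bool" where
  "connected_operad A \<longleftrightarrow>
     ns_operad A \<and> (\<forall>n. fin_dim (ospace A n)) \<and>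
     ops A 0 = {0} \<and>
     ounit A \<noteq> 0 \<and> ops A 1 = range (\<lambda>c. smul (ospace A 1) c (ounit A))"

definition algebra ::
    "('k::field, 'a::ab_group_add) operad \<Rightarrow> ('k, 'v::ab_group_add) vs \<Rightarrow> ('a \<Rightarrow> 'v list \<Rightarrow> 'v) \<Rightarrow> bool"
where
  "algebra A V act \<longleftrightarrow>
     vec_space V \<and>
     (\<forall>n. \<forall>\<mu>\<in>ops A n. mlin (replicate n V) V (act \<mu>)) \<and>
     (\<forall>n. \<forall>xs\<in>tuples (replicate n V). lin_on (ospace A n) V (\<lambda>\<mu>. act \<mu> xs)) \<and>
     (\<forall>x\<in>carr V. act (ounit A) [x] = x) \<and>
     (\<forall>\<mu> \<nu>s xss.
        \<mu> \<in> ops A (length xss) \<longrightarrow>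
        xss \<in> lists (lists (carr V)) \<longrightarrow>
        \<nu>s \<in> tuples (map (\<lambda>xs. ospace A (length xs)) xss) \<longrightarrow>
        act (ocomp A (map length xss) \<mu> \<nu>s) (concat xss) = act \<mu> (map2 act \<nu>s xss))"

definition coalgebra ::
    "('k::field, 'c::ab_group_add) operad \<Rightarrow> ('k, 'v::ab_group_add) vs
      \<Rightarrow> (nat \<Rightarrow> 'c \<Rightarrow> 'v \<Rightarrow> ('k, 'v) tensor) \<Rightarrow> bool" where
  "coalgebra C V coact \<longleftrightarrow>
     vec_space V \<and>
     (\<forall>n. \<forall>\<delta>\<in>ops C n. lin_on V (tpow V n) (coact n \<delta>)) \<and>
     (\<forall>n. \<forall>x\<in>carr V. lin_on (ospace C n) (tpow V n) (\<lambda>\<delta>. coact n \<delta> x)) \<and>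
     (\<forall>x\<in>carr V. coact 1 (ounit C) x = tens V [x]) \<and>
     (\<forall>is \<delta> \<delta>s.
        \<delta> \<in> ops C (length is) \<longrightarrow> \<delta>s \<in> tuples (map (ospace C) is) \<longrightarrow>
        (\<forall>x\<in>carr V.
           coact (sum_list is) (ocomp C is \<delta> \<delta>s) x =
           tlift V (length is) (tpow V (sum_list is))
             (\<lambda>xs. tconcat V is (map2 (\<lambda>(i, \<delta>') y. coact i \<delta>' y) (zip is \<delta>s) xs))
             (coact (length is) \<delta> x)))"

definition alg_hom ::
    "('k::field, 'a::ab_group_add) operad
      \<Rightarrow> ('k, 'v::ab_group_add) vs \<Rightarrow> ('a \<Rightarrow> 'v list \<Rightarrow> 'v)
      \<Rightarrow> ('k, 'w::ab_group_add) vs \<Rightarrow> ('a \<Rightarrow> 'w list \<Rightarrow> 'w) \<Rightarrow> ('v \<Rightarrow> 'w) \<Rightarrow> bool" where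
  "alg_hom A V act W act' f \<longleftrightarrow>
     lin_on V W f \<and>
     (\<forall>n. \<forall>\<mu>\<in>ops A n. \<forall>xs\<in>tuples (replicate n V). f (act \<mu> xs) = act' \<mu> (map f xs))"

definition coalg_hom ::
    "('k::field, 'c::ab_group_add) operad
      \<Rightarrow> ('k, 'v::ab_group_add) vs \<Rightarrow> (nat \<Rightarrow> 'c \<Rightarrow> 'v \<Rightarrow> ('k, 'v) tensor)
      \<Rightarrow> ('k, 'w::ab_group_add) vs \<Rightarrow> (nat \<Rightarrow> 'c \<Rightarrow> 'w \<Rightarrow> ('k, 'w) tensor) \<Rightarrow> ('v \<Rightarrow> 'w) \<Rightarrow> bool"
where
  "coalg_hom C V coact W coact' f \<longleftrightarrow>
     lin_on V W f \<and>
     (\<forall>n. \<forall>\<delta>\<in>ops C n. \<forall>x\<in>carr V. coact' n \<delta> (f x) = tmap V W n f (coact n \<delta> x))"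

definition coalg_iso ::
    "('k::field, 'c::ab_group_add) operad
      \<Rightarrow> ('k, 'v::ab_group_add) vs \<Rightarrow> (nat \<Rightarrow> 'c \<Rightarrow> 'v \<Rightarrow> ('k, 'v) tensor)
      \<Rightarrow> ('k, 'w::ab_group_add) vs \<Rightarrow> (nat \<Rightarrow> 'c \<Rightarrow> 'w \<Rightarrow> ('k, 'w) tensor) \<Rightarrow> ('v \<Rightarrow> 'w) \<Rightarrow> bool"
where
  "coalg_iso C V coact W coact' f \<longleftrightarrow>
     coalg_hom C V coact W coact' f \<and> bij_betw f (carr V) (carr W)"

definition prim ::
    "('k::field, 'c::ab_group_add) operad \<Rightarrow> ('k, 'v::ab_group_add) vs
      \<Rightarrow> (nat \<Rightarrow> 'c \<Rightarrow> 'v \<Rightarrow> ('k, 'v) tensor) \<Rightarrow> ('k, 'v) vs" where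
  "prim C V coact = V\<lparr>carr := {x \<in> carr V. \<forall>n\<ge>2. \<forall>\<delta>\<in>ops C n. coact n \<delta> x = 0}\<rparr>"

definition filt ::
    "('k::field, 'c::ab_group_add) operad \<Rightarrow> ('k, 'v::ab_group_add) vs
      \<Rightarrow> (nat \<Rightarrow> 'c \<Rightarrow> 'v \<Rightarrow> ('k, 'v) tensor) \<Rightarrow> nat \<Rightarrow> 'v set" where
  "filt C V coact r = {x \<in> carr V. \<forall>n>r. \<forall>\<delta>\<in>ops C n. coact n \<delta> x = 0}"

definition connected_coalgebra ::
    "('k::field, 'c::ab_group_add) operad \<Rightarrow> ('k, 'v::ab_group_add) vs
      \<Rightarrow> (nat \<Rightarrow> 'c \<Rightarrow> 'v \<Rightarrow> ('k, 'v) tensor) \<Rightarrow> bool" where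
  "connected_coalgebra C V coact \<longleftrightarrow> carr V = (\<Union>r. filt C V coact r)"


section \<open>Free algebras and cofree coalgebras\<close>

text \<open>
  The free algebra on \<open>V\<close> is \<open>schur (ospace A) V\<close>; \<open>free_act\<close> is its multilinear action with
  \<open>\<mu>(\<nu>\<^sub>1 \<otimes> xs\<^sub>1, \<dots>, \<nu>\<^sub>k \<otimes> xs\<^sub>k) = \<mu> \<circ> (\<nu>\<^sub>1, \<dots>, \<nu>\<^sub>k) \<otimes> xs\<^sub>1 \<otimes> \<dots> \<otimes> xs\<^sub>k\<close>.
\<close>

definition free_alg ::
    "('k::field, 'a::ab_group_add) operad \<Rightarrow> ('k, 'v::ab_group_add) vs
      \<Rightarrow> ('k, ('k, 'a, 'v) schur) vs" where
  "free_alg A V = schur (ospace A) V"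

definition free_act ::
    "('k::field, 'a::ab_group_add) operad \<Rightarrow> ('k, 'v::ab_group_add) vs
      \<Rightarrow> 'a \<Rightarrow> ('k, 'a, 'v) schur list \<Rightarrow> ('k, 'a, 'v) schur" where
  "free_act A V \<mu> ts =
     (SOME G. mlin (replicate (length ts) (free_alg A V)) (free_alg A V) G \<and>
        (\<forall>xss \<nu>s. length xss = length ts \<longrightarrow>
           xss \<in> lists (lists (carr V)) \<longrightarrow>
           \<nu>s \<in> tuples (map (\<lambda>xs. ospace A (length xs)) xss) \<longrightarrow>
           G (map2 (sgen (ospace A) V) \<nu>s xss) =
           sgen (ospace A) V (ocomp A (map length xss) \<mu> \<nu>s) (concat xss))) ts"

definition free_incl ::
    "('k::field, 'a::ab_group_add) operad \<Rightarrow> ('k, 'v::ab_group_add) vs \<Rightarrow> 'v \<Rightarrow> ('k, 'a, 'v) schur"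
where
  "free_incl A V x = sgen (ospace A) V (ounit A) [x]"

definition unit_coeff :: "('k::field, 'a::ab_group_add) operad \<Rightarrow> 'a \<Rightarrow> 'k" where
  "unit_coeff A \<mu> = (THE c. \<mu> = smul (ospace A 1) c (ounit A))"

definition free_proj ::
    "('k::field, 'a::ab_group_add) operad \<Rightarrow> ('k, 'v::ab_group_add) vs \<Rightarrow> ('k, 'a, 'v) schur \<Rightarrow> 'v"
where
  "free_proj A V = slift (ospace A) V V
     (\<lambda>\<mu> xs. if length xs = 1 then smul V (unit_coeff A \<mu>) (hd xs) else 0)"

definition cospace :: "('k::field, 'c::ab_group_add) operad \<Rightarrow> nat \<Rightarrow> ('k, 'c \<Rightarrow> 'k) vs" where
  "cospace C n = dual (ospace C n)"

definition cofree ::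
    "('k::field, 'c::ab_group_add) operad \<Rightarrow> ('k, 'v::ab_group_add) vs
      \<Rightarrow> ('k, ('k, 'c \<Rightarrow> 'k, 'v) schur) vs" where
  "cofree C V = schur (cospace C) V"

text \<open>
  The coaction on the cofree coalgebra dualizes operadic composition: for \<open>\<delta> \<in> C\<^sub>m\<close>, the form
  \<open>\<xi> \<circ> \<gamma>(\<delta>; -, \<dots>, -)\<close> on \<open>C\<^bsub>i\<^sub>1\<^esub> \<otimes> \<dots> \<otimes> C\<^bsub>i\<^sub>m\<^esub>\<close> is expanded in dual bases of the finite dimensional
  spaces \<open>C\<^bsub>i\<^sub>j\<^esub>\<close>, and the word \<open>xs\<close> is cut accordingly.  The result does not depend on the bases.
\<close>

definition cofree_coact ::
    "('k::field, 'c::ab_group_add) operad \<Rightarrow> ('k, 'v::ab_group_add) vs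
      \<Rightarrow> nat \<Rightarrow> 'c \<Rightarrow> ('k, 'c \<Rightarrow> 'k, 'v) schur \<Rightarrow> ('k, ('k, 'c \<Rightarrow> 'k, 'v) schur) tensor" where
  "cofree_coact C V m \<delta> = slift (cospace C) V (tpow (cofree C V) m)
     (\<lambda>\<xi> xs. \<Sum>is\<in>{is. length is = m \<and> sum_list is = length xs}.
             \<Sum>bs\<in>listset (map (\<lambda>i. some_basis (ospace C i)) is).
               fscale (\<xi> (ocomp C is \<delta> bs))
                 (tens (cofree C V)
                   (map2 (\<lambda>(i, b) ys. sgen (cospace C) V (dual_vec (ospace C i) b) ys)
                      (zip is bs) (blocks is xs))))"

definition cofree_proj ::
    "('k::field, 'c::ab_group_add) operad \<Rightarrow> ('k, 'v::ab_group_add) vs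
      \<Rightarrow> ('k, 'c \<Rightarrow> 'k, 'v) schur \<Rightarrow> 'v" where
  "cofree_proj C V = slift (cospace C) V V
     (\<lambda>\<xi> xs. if length xs = 1 then smul V (\<xi> (ounit C)) (hd xs) else 0)"


section \<open>Generalized bialgebras\<close>

text \<open>
  \<open>rel m n \<delta> \<mu>\<close> lists the summands of the relation for \<open>\<delta> \<in> C\<^sub>m\<close> and \<open>\<mu> \<in> A\<^sub>n\<close>.  A summand \<open>(P, Q)\<close>
  stands for \<open>(\<mu>\<^sub>1 \<otimes> \<dots> \<otimes> \<mu>\<^sub>m) \<circ> (\<delta>\<^sub>1 \<otimes> \<dots> \<otimes> \<delta>\<^sub>n)\<close>, where \<open>P\<close> and \<open>Q\<close> list the \<open>\<mu>\<^sub>j\<close> and the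
  \<open>\<delta>\<^sub>j\<close>, each paired with its arity.
\<close>

type_synonym ('a, 'c) relations =
  "nat \<Rightarrow> nat \<Rightarrow> 'c \<Rightarrow> 'a \<Rightarrow> ((nat \<times> 'a) list \<times> (nat \<times> 'c) list) list"

definition ns_bialgebra_type ::
    "('k::field, 'a::ab_group_add) operad \<Rightarrow> ('k, 'c::ab_group_add) operad
      \<Rightarrow> ('a, 'c) relations \<Rightarrow> bool" where
  "ns_bialgebra_type A C rel \<longleftrightarrow>
     connected_operad A \<and> connected_operad C \<and>
     (\<forall>m n. \<forall>\<delta>\<in>ops C m. \<forall>\<mu>\<in>ops A n. \<forall>(P, Q)\<in>set (rel m n \<delta> \<mu>).
        length P = m \<and> length Q = n \<and>
        (\<forall>(i, \<mu>')\<in>set P. \<mu>' \<in> ops A i) \<and> (\<forall>(i, \<delta>')\<in>set Q. \<delta>' \<in> ops C i) \<and>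
        sum_list (map fst P) = sum_list (map fst Q))"

definition apply_ops ::
    "('k::field, 'v::ab_group_add) vs \<Rightarrow> ('a \<Rightarrow> 'v list \<Rightarrow> 'v) \<Rightarrow> (nat \<times> 'a) list
      \<Rightarrow> ('k, 'v) tensor \<Rightarrow> ('k, 'v) tensor" where
  "apply_ops V act P = tlift V (sum_list (map fst P)) (tpow V (length P))
     (\<lambda>ys. tens V (map2 (\<lambda>(i, \<mu>) zs. act \<mu> zs) P (blocks (map fst P) ys)))"

definition apply_coops ::
    "('k::field, 'v::ab_group_add) vs \<Rightarrow> (nat \<Rightarrow> 'c \<Rightarrow> 'v \<Rightarrow> ('k, 'v) tensor) \<Rightarrow> (nat \<times> 'c) list
      \<Rightarrow> 'v list \<Rightarrow> ('k, 'v) tensor" where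
  "apply_coops V coact Q xs = tconcat V (map fst Q) (map2 (\<lambda>(i, \<delta>) x. coact i \<delta> x) Q xs)"

definition bialgebra ::
    "('k::field, 'a::ab_group_add) operad \<Rightarrow> ('k, 'c::ab_group_add) operad \<Rightarrow> ('a, 'c) relations
      \<Rightarrow> ('k, 'v::ab_group_add) vs \<Rightarrow> ('a \<Rightarrow> 'v list \<Rightarrow> 'v)
      \<Rightarrow> (nat \<Rightarrow> 'c \<Rightarrow> 'v \<Rightarrow> ('k, 'v) tensor) \<Rightarrow> bool" where
  "bialgebra A C rel V act coact \<longleftrightarrow>
     algebra A V act \<and> coalgebra C V coact \<and>
     (\<forall>m n. \<forall>\<delta>\<in>ops C m. \<forall>\<mu>\<in>ops A n. \<forall>xs\<in>tuples (replicate n V).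
        coact m \<delta> (act \<mu> xs) =
        (\<Sum>(P, Q)\<leftarrow>rel m n \<delta> \<mu>. apply_ops V act P (apply_coops V coact Q xs)))"

definition bialg_iso ::
    "('k::field, 'a::ab_group_add) operad \<Rightarrow> ('k, 'c::ab_group_add) operad
      \<Rightarrow> ('k, 'v::ab_group_add) vs \<Rightarrow> ('a \<Rightarrow> 'v list \<Rightarrow> 'v) \<Rightarrow> (nat \<Rightarrow> 'c \<Rightarrow> 'v \<Rightarrow> ('k, 'v) tensor)
      \<Rightarrow> ('k, 'w::ab_group_add) vs \<Rightarrow> ('a \<Rightarrow> 'w list \<Rightarrow> 'w) \<Rightarrow> (nat \<Rightarrow> 'c \<Rightarrow> 'w \<Rightarrow> ('k, 'w) tensor)
      \<Rightarrow> ('v \<Rightarrow> 'w) \<Rightarrow> bool" where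
  "bialg_iso A C V act coact W act' coact' f \<longleftrightarrow>
     alg_hom A V act W act' f \<and> coalg_hom C V coact W coact' f \<and> bij_betw f (carr V) (carr W)"


section \<open>The hypotheses\<close>

text \<open>
  A natural structure assigns a coaction \<open>\<Delta> V\<close> on the free algebra to every vector space \<open>V\<close>.
  Since one cannot quantify over all types, \<open>V\<close> ranges over the subspaces of a space \<open>E\<close>, which
  will be any infinite dimensional space containing the bialgebra under consideration.
  The maps \<open>smap (ospace A) V W f\<close> are algebra morphisms by construction, so functoriality only
  asks them to be coalgebra morphisms.
\<close>

type_synonym ('k, 'a, 'c, 'v) coactions =
  "('k, 'v) vs \<Rightarrow> nat \<Rightarrow> 'c \<Rightarrow> ('k, 'a, 'v) schur \<Rightarrow> ('k, ('k, 'a, 'v) schur) tensor"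

definition H1 ::
    "('k::field, 'a::ab_group_add) operad \<Rightarrow> ('k, 'c::ab_group_add) operad \<Rightarrow> ('a, 'c) relations
      \<Rightarrow> ('k, 'v::ab_group_add) vs \<Rightarrow> ('k, 'a, 'c, 'v) coactions \<Rightarrow> bool" where
  "H1 A C rel E \<Delta> \<longleftrightarrow>
     (\<forall>V. subsp V E \<longrightarrow> bialgebra A C rel (free_alg A V) (free_act A V) (\<Delta> V)) \<and>
     (\<forall>V W f. subsp V E \<longrightarrow> subsp W E \<longrightarrow> lin_on V W f \<longrightarrow>
        coalg_hom C (free_alg A V) (\<Delta> V) (free_alg A W) (\<Delta> W) (smap (ospace A) V W f))"

definition phi ::
    "('k::field, 'a::ab_group_add) operad \<Rightarrow> ('k, 'c::ab_group_add) operad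
      \<Rightarrow> ('k, 'a, 'c, 'v::ab_group_add) coactions \<Rightarrow> ('k, 'v) vs
      \<Rightarrow> ('k, 'a, 'v) schur \<Rightarrow> ('k, 'c \<Rightarrow> 'k, 'v) schur" where
  "phi A C \<Delta> V = (SOME f.
     coalg_hom C (free_alg A V) (\<Delta> V) (cofree C V) (cofree_coact C V) f \<and>
     (\<forall>t\<in>carr (free_alg A V). cofree_proj C V (f t) = free_proj A V t))"

definition ns_H2epi ::
    "('k::field, 'a::ab_group_add) operad \<Rightarrow> ('k, 'c::ab_group_add) operad
      \<Rightarrow> ('k, 'v::ab_group_add) vs \<Rightarrow> ('k, 'a, 'c, 'v) coactions \<Rightarrow> bool" where
  "ns_H2epi A C E \<Delta> \<longleftrightarrow>
     (\<forall>V. subsp V E \<longrightarrow> phi A C \<Delta> V ` carr (free_alg A V) = carr (cofree C V)) \<and>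
     (\<exists>\<sigma>. (\<forall>n. lin_on (cospace C n) (ospace A n) (\<sigma> n)) \<and>
        (\<forall>V. subsp V E \<longrightarrow>
           (let s = slift (cospace C) V (free_alg A V)
                      (\<lambda>\<xi> xs. sgen (ospace A) V (\<sigma> (length xs) \<xi>) xs)
            in coalg_hom C (cofree C V) (cofree_coact C V) (free_alg A V) (\<Delta> V) s \<and>
               (\<forall>t\<in>carr (cofree C V). phi A C \<Delta> V (s t) = t))))"


section \<open>Primitive operations and the functor \<open>U\<close>\<close>

text \<open>
  An element of \<open>A(n) = A\<^sub>n \<otimes> K[S\<^sub>n]\<close> is a family \<open>m\<close> of elements \<open>m \<sigma> \<in> A\<^sub>n\<close> indexed by the
  permutations \<open>\<sigma>\<close> of \<open>{..<n}\<close>; only these values of \<open>m\<close> are used.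
\<close>

definition sym_ops :: "('k::field, 'a::ab_group_add) operad \<Rightarrow> nat \<Rightarrow> ((nat \<Rightarrow> nat) \<Rightarrow> 'a) set" where
  "sym_ops A n = {m. \<forall>\<sigma>. \<sigma> permutes {..<n} \<longrightarrow> m \<sigma> \<in> ops A n}"

definition sym_act ::
    "('a \<Rightarrow> 'v list \<Rightarrow> 'v::ab_group_add) \<Rightarrow> ((nat \<Rightarrow> nat) \<Rightarrow> 'a) \<Rightarrow> 'v list \<Rightarrow> 'v" where
  "sym_act act m xs =
     (\<Sum>\<sigma> | \<sigma> permutes {..<length xs}. act (m \<sigma>) (map (\<lambda>i. xs ! \<sigma> i) [0..<length xs]))"

definition prim_ops ::
    "('k::field, 'a::ab_group_add) operad \<Rightarrow> ('k, 'c::ab_group_add) operad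
      \<Rightarrow> ('k, 'v::ab_group_add) vs \<Rightarrow> ('k, 'a, 'c, 'v) coactions
      \<Rightarrow> nat \<Rightarrow> ((nat \<Rightarrow> nat) \<Rightarrow> 'a) set" where
  "prim_ops A C E \<Delta> n =
     {m \<in> sym_ops A n. \<forall>xs. length xs = n \<longrightarrow> set xs \<subseteq> carr E \<longrightarrow> distinct xs \<longrightarrow>
        \<not> module.dependent (smul E) (set xs) \<longrightarrow>
        (let V = vspan E (set xs)
         in sym_act (free_act A V) m (map (free_incl A V) xs)
              \<in> carr (prim C (free_alg A V) (\<Delta> V)))}"

definition alg_ideal ::
    "('k::field, 'a::ab_group_add) operad \<Rightarrow> ('k, 'v::ab_group_add) vs
      \<Rightarrow> ('a \<Rightarrow> 'v list \<Rightarrow> 'v) \<Rightarrow> 'v set \<Rightarrow> bool" where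
  "alg_ideal A V act I \<longleftrightarrow>
     module.subspace (smul V) I \<and> I \<subseteq> carr V \<and>
     (\<forall>n. \<forall>\<mu>\<in>ops A n. \<forall>xs\<in>tuples (replicate n V). set xs \<inter> I \<noteq> {} \<longrightarrow> act \<mu> xs \<in> I)"

text \<open>
  For an algebra \<open>L\<close> over the operad of primitive operations \<open>P\<close>, with action \<open>pact\<close>, the
  algebra \<open>U(L)\<close> is the quotient of the free algebra on \<open>L\<close> by the ideal generated by the
  elements \<open>m(y\<^sub>1, \<dots>, y\<^sub>n) - pact m [y\<^sub>1, \<dots>, y\<^sub>n]\<close> with \<open>m \<in> P(n)\<close>.
\<close>

definition U_ideal ::
    "('k::field, 'a::ab_group_add) operad \<Rightarrow> (nat \<Rightarrow> ((nat \<Rightarrow> nat) \<Rightarrow> 'a) set)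
      \<Rightarrow> ('k, 'v::ab_group_add) vs \<Rightarrow> (((nat \<Rightarrow> nat) \<Rightarrow> 'a) \<Rightarrow> 'v list \<Rightarrow> 'v)
      \<Rightarrow> ('k, 'a, 'v) schur set" where
  "U_ideal A P L pact = \<Inter>{I. alg_ideal A (free_alg A L) (free_act A L) I \<and>
     (\<forall>n. \<forall>m\<in>P n. \<forall>ys\<in>tuples (replicate n L).
        sym_act (free_act A L) m (map (free_incl A L) ys) - free_incl A L (pact m ys) \<in> I)}"

definition U_space ::
    "('k::field, 'a::ab_group_add) operad \<Rightarrow> (nat \<Rightarrow> ((nat \<Rightarrow> nat) \<Rightarrow> 'a) set)
      \<Rightarrow> ('k, 'v::ab_group_add) vs \<Rightarrow> (((nat \<Rightarrow> nat) \<Rightarrow> 'a) \<Rightarrow> 'v list \<Rightarrow> 'v)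
      \<Rightarrow> ('k, (('k, 'a, 'v) schur \<Rightarrow> 'k) \<Rightarrow> 'k) vs" where
  "U_space A P L pact = quot (free_alg A L) (U_ideal A P L pact)"

definition U_act ::
    "('k::field, 'a::ab_group_add) operad \<Rightarrow> (nat \<Rightarrow> ((nat \<Rightarrow> nat) \<Rightarrow> 'a) set)
      \<Rightarrow> ('k, 'v::ab_group_add) vs \<Rightarrow> (((nat \<Rightarrow> nat) \<Rightarrow> 'a) \<Rightarrow> 'v list \<Rightarrow> 'v)
      \<Rightarrow> 'a \<Rightarrow> ((('k, 'a, 'v) schur \<Rightarrow> 'k) \<Rightarrow> 'k) list \<Rightarrow> (('k, 'a, 'v) schur \<Rightarrow> 'k) \<Rightarrow> 'k" where
  "U_act A P L pact \<mu> qs =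
     (let I = U_ideal A P L pact
      in quot_map (free_alg A L) I (free_act A L \<mu> (map (quot_rep (free_alg A L) I) qs)))"

definition U_coact ::
    "('k::field, 'a::ab_group_add) operad \<Rightarrow> (nat \<Rightarrow> ((nat \<Rightarrow> nat) \<Rightarrow> 'a) set)
      \<Rightarrow> ('k, 'a, 'c, 'v::ab_group_add) coactions
      \<Rightarrow> ('k, 'v) vs \<Rightarrow> (((nat \<Rightarrow> nat) \<Rightarrow> 'a) \<Rightarrow> 'v list \<Rightarrow> 'v)
      \<Rightarrow> nat \<Rightarrow> 'c \<Rightarrow> ((('k, 'a, 'v) schur \<Rightarrow> 'k) \<Rightarrow> 'k)
      \<Rightarrow> ('k, (('k, 'a, 'v) schur \<Rightarrow> 'k) \<Rightarrow> 'k) tensor" where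
  "U_coact A P \<Delta> L pact n \<delta> q =
     (let I = U_ideal A P L pact
      in tmap (free_alg A L) (U_space A P L pact) n (quot_map (free_alg A L) I)
           (\<Delta> L n \<delta> (quot_rep (free_alg A L) I q)))"

end

theory Submission
  imports Defs
begin

text \<open>
  Let \<open>L\<close> be the primitive part of a bialgebra \<open>H\<close>.  Since the compatibility relations involve no
  permutation, they determine \<open>\<delta>(\<mu>(x\<^sub>1, \<dots>, x\<^sub>n))\<close> for primitive \<open>x\<^sub>i\<close>: it vanishes if \<open>\<delta>\<close> has arity
  \<open>> n\<close>, and it is a scalar multiple of \<open>x\<^sub>1 \<otimes> \<dots> \<otimes> x\<^sub>n\<close> if \<open>\<delta>\<close> has arity \<open>n\<close>.  When \<open>\<mu> = \<sigma>(\<xi>)\<close>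
  comes from the splitting, comparison with the cofree coalgebra shows that this scalar is
  \<open>c\<^sup>n \<xi>(\<delta>)\<close> for a fixed \<open>c \<noteq> 0\<close>.

  Hence the map \<open>\<alpha>\<close> from the cofree coalgebra on \<open>L\<close> to \<open>H\<close>, \<open>\<xi> \<otimes> x\<^sub>1 \<dots> x\<^sub>n \<mapsto> \<sigma>(\<xi>)(x\<^sub>1, \<dots>, x\<^sub>n)\<close>,
  is injective.  If \<open>H\<close> is connected it is also surjective: an element of the \<open>r\<close>-th filtration step
  is mapped by the cooperations of arity \<open>r\<close> into \<open>L\<^sup>\<otimes>\<^sup>r\<close>, so subtracting an element of the image of
  \<open>\<alpha>\<close> moves it to step \<open>r - 1\<close>.  The same argument applies to the free algebra on \<open>L\<close>, whose
  primitive elements are values of primitive operations.  So modulo the ideal defining \<open>U(L)\<close> every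
  element of the free algebra lies in the image of the splitting, on which the map to \<open>H\<close> is
  injective; therefore that ideal is the kernel of the map to \<open>H\<close>.
\<close>

section \<open>Linear algebra\<close>

text \<open>What links different bialgebras is that the scalars
  \<open>top_coeff n \<delta> \<mu>\<close> are read off from \<open>rel\<close> alone: they are
  computed in the free algebra on \<open>E\<close> and then used in \<open>H\<close> and in the free
  algebra on \<open>L\<close>. The constant appears because arity one is normalised only up to
  scalars: the chosen basis vector of \<open>C\<^sub>1\<close> is a multiple of the identity, and
  the splitting sends its dual covector to the multiple \<open>c1\<close> of the identity of
  \<open>A\<close>. Injectivity of the splitting forces \<open>c1 \<noteq> 0\<close>, and this also
  shows that the letters of a free algebra are primitive, which (H1) does not assert.

  The obstacle is the primitive part of the free algebra on \<open>L\<close>. Primitive operations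
  are tested on linearly independent letters, whereas a primitive element is a sum over words that
  may repeat letters. Since the relations keep letters in order, the coefficient of a single word
  can be moved to a word in other letters compatibly with all cooperations, so each coefficient is a
  primitive operation. The way back, from independent letters to arbitrary ones, is functoriality;
  it needs independent words of every length, hence an infinite dimensional
  \<open>E\<close>.\<close>

lemma vec_space_vector_space: "vec_space V \<Longrightarrow> vector_space (smul V)"
  by (simp add: vec_space_def)

lemma vs_zero: "vec_space V \<Longrightarrow> 0 \<in> carr V"
  unfolding vec_space_def by (metis module.subspace_0 module_iff_vector_space)

lemma vs_add: "vec_space V \<Longrightarrow> x \<in> carr V \<Longrightarrow> y \<in> carr V \<Longrightarrow> x + y \<in> carr V"
  unfolding vec_space_def by (metis module.subspace_add module_iff_vector_space)

lemma vs_smul: "vec_space V \<Longrightarrow> x \<in> carr V \<Longrightarrow> smul V c x \<in> carr V"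
  unfolding vec_space_def by (metis module.subspace_scale module_iff_vector_space)

lemma vs_diff: "vec_space V \<Longrightarrow> x \<in> carr V \<Longrightarrow> y \<in> carr V \<Longrightarrow> x - y \<in> carr V"
  unfolding vec_space_def by (metis module.subspace_diff module_iff_vector_space)

lemma vs_sum: "vec_space V \<Longrightarrow> (\<And>i. i \<in> I \<Longrightarrow> f i \<in> carr V) \<Longrightarrow> sum f I \<in> carr V"
  by (induction I rule: infinite_finite_induct) (auto simp: vs_zero vs_add)

lemma vs_sum_list: "vec_space V \<Longrightarrow> (\<And>x. x \<in> set xs \<Longrightarrow> f x \<in> carr V) \<Longrightarrow> sum_list (map f xs) \<in> carr V"
  by (induction xs) (auto simp: vs_zero vs_add)

lemma smul_simps:
  assumes "vec_space V"
  shows "smul V 0 x = 0" "smul V c 0 = 0" "smul V 1 x = x"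
    "smul V c (smul V d x) = smul V (c * d) x"
    "smul V (c + d) x = smul V c x + smul V d x" "smul V c (x + y) = smul V c x + smul V c y"
    "smul V c (sum f I) = (\<Sum>i\<in>I. smul V c (f i))" "smul V (sum g J) x = (\<Sum>i\<in>J. smul V (g i) x)"
    "smul V (- c) x = - smul V c x"
proof -
  interpret vector_space "smul V" using assms by (rule vec_space_vector_space)
  show "smul V 0 x = 0" "smul V c 0 = 0" "smul V 1 x = x"
    "smul V c (smul V d x) = smul V (c * d) x"
    "smul V (c + d) x = smul V c x + smul V d x" "smul V c (x + y) = smul V c x + smul V c y"
    "smul V c (sum f I) = (\<Sum>i\<in>I. smul V c (f i))" "smul V (sum g J) x = (\<Sum>i\<in>J. smul V (g i) x)"
    "smul V (- c) x = - smul V c x"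
    by (simp_all add: algebra_simps scale_sum_left scale_sum_right)
qed

lemma vec_space_fld: "vec_space (fld :: ('k::field, 'k) vs)"
proof -
  interpret vector_space "(*) :: 'k \<Rightarrow> 'k \<Rightarrow> 'k" by (rule vector_space_field)
  show ?thesis by (simp add: vec_space_def fld_def vector_space_field)
qed

lemma fld_simps [simp]: "carr fld = UNIV" "smul fld = (*)"
  by (simp_all add: fld_def)

lemma fscale_apply [simp]: "fscale c f x = c * f x"
  by (simp add: fscale_def)

lemma sum_fun_apply: "(\<Sum>i\<in>I. f i) x = (\<Sum>i\<in>I. f i x)"
  by (induction I rule: infinite_finite_induct) auto

lemma lin_onD:
  assumes "lin_on V W f"
  shows "x \<in> carr V \<Longrightarrow> f x \<in> carr W"
    and "x \<in> carr V \<Longrightarrow> y \<in> carr V \<Longrightarrow> f (x + y) = f x + f y"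
    and "x \<in> carr V \<Longrightarrow> f (smul V c x) = smul W c (f x)"
  using assms by (auto simp: lin_on_def)

lemma lin_on_zero: "vec_space V \<Longrightarrow> lin_on V W f \<Longrightarrow> f 0 = 0"
  using lin_onD(2)[of V W f 0 0] by (simp add: vs_zero)

lemma lin_on_diff:
  assumes "vec_space V" "lin_on V W f" "x \<in> carr V" "y \<in> carr V"
  shows "f (x - y) = f x - f y"
proof -
  have "f (x - y + y) = f (x - y) + f y"
    using assms vs_diff by (intro lin_onD(2)[of V W]) blast+
  then show ?thesis by simp
qed

lemma lin_on_sum:
  assumes "vec_space V" "lin_on V W f" "\<And>i. i \<in> I \<Longrightarrow> x i \<in> carr V"
  shows "f (\<Sum>i\<in>I. smul V (a i) (x i)) = (\<Sum>i\<in>I. smul W (a i) (f (x i)))"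
  using assms(3)
proof (induction I rule: infinite_finite_induct)
  case (insert i I)
  have "f (smul V (a i) (x i) + (\<Sum>i\<in>I. smul V (a i) (x i)))
      = f (smul V (a i) (x i)) + f (\<Sum>i\<in>I. smul V (a i) (x i))"
    using insert.prems assms by (intro lin_onD(2)[OF assms(2)] vs_smul vs_sum) auto
  then show ?case using insert by (simp add: lin_onD(3)[OF assms(2)])
qed (auto simp: lin_on_zero[OF assms(1,2)])

lemma lin_on_sum_list:
  assumes "vec_space V" "lin_on V W f" "\<And>x. x \<in> set xs \<Longrightarrow> g x \<in> carr V"
  shows "f (sum_list (map g xs)) = (\<Sum>x\<leftarrow>xs. f (g x))"
  using assms(3)
proof (induction xs)
  case (Cons a xs)
  then show ?case using lin_onD(2)[OF assms(2), of "g a" "sum_list (map g xs)"]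
    by (simp add: vs_sum_list[OF assms(1)])
qed (auto simp: lin_on_zero[OF assms(1,2)])

lemma lin_on_comp: "lin_on U V f \<Longrightarrow> lin_on V W g \<Longrightarrow> lin_on U W (\<lambda>x. g (f x))"
  by (auto simp: lin_on_def)

lemma lin_on_cong: "vec_space V \<Longrightarrow> (\<And>x. x \<in> carr V \<Longrightarrow> f x = g x) \<Longrightarrow> lin_on V W f \<longleftrightarrow> lin_on V W g"
  by (simp add: lin_on_def vs_add vs_smul)

lemma lin_on_scaled: "vec_space W \<Longrightarrow> lin_on V W f \<Longrightarrow> lin_on V W (\<lambda>x. smul W c (f x))"
  by (auto simp: lin_on_def vs_smul smul_simps mult.commute)

lemma lin_on_const_zero: "vec_space W \<Longrightarrow> lin_on V W (\<lambda>x. 0)"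
  by (auto simp: lin_on_def vs_zero smul_simps)

lemma lin_on_plus:
  "vec_space W \<Longrightarrow> lin_on V W f \<Longrightarrow> lin_on V W g \<Longrightarrow> lin_on V W (\<lambda>x. f x + g x)"
  by (auto simp: lin_on_def vs_add smul_simps algebra_simps)

lemma lin_on_sum_fun:
  "vec_space W \<Longrightarrow> (\<And>i. i \<in> I \<Longrightarrow> lin_on V W (f i)) \<Longrightarrow> lin_on V W (\<lambda>x. \<Sum>i\<in>I. f i x)"
  by (induction I rule: infinite_finite_induct) (auto simp: lin_on_const_zero lin_on_plus)

lemma lin_on_fld_iff: "lin_on V fld f \<longleftrightarrow>
    (\<forall>x\<in>carr V. \<forall>y\<in>carr V. f (x + y) = f x + f y) \<and> (\<forall>c. \<forall>x\<in>carr V. f (smul V c x) = c * f x)"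
  by (simp add: lin_on_def)

lemma linear_imp_lin_on: "Vector_Spaces.linear (smul V) (*) l \<Longrightarrow> lin_on V fld l"
  by (auto simp: lin_on_def Vector_Spaces.linear_iff)

text \<open>The case \<open>N = 0\<close> of \<open>separating_form\<close>. Later proofs that a
  tensor or a generator is nonzero evaluate it on forms produced here.\<close>

lemma separating_point:
  fixes V :: "('k::field, 'v::ab_group_add) vs"
  assumes "vec_space V" "x \<noteq> 0"
  obtains f :: "'v \<Rightarrow> 'k" where "lin_on V fld f" "f x = 1"
proof -
  interpret vector_space "smul V" using assms by (simp add: vec_space_def)
  obtain f where "Vector_Spaces.linear (smul V) (*) f" "f x = 1"
    using separating_form[OF assms(1) subspace_single_0, of x] assms(2) by blast
  then show ?thesis using that linear_imp_lin_on by blast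
qed

section \<open>Presented spaces: finite sums of generators, compared by evaluating forms\<close>

section \<open>Presented spaces\<close>

lemma smul_presented [simp]: "smul (presented \<Phi> G) = fscale"
  by (simp add: presented_def)

text \<open>Indexing the sum by numbers below \<open>n\<close> allows repeated generators, so
  coefficients never have to be collected during the induction over the span.\<close>

lemma presented_rep:
  fixes \<Phi> :: "('g \<Rightarrow> 'k::field) set"
  assumes "t \<in> carr (presented \<Phi> G)"
  obtains n :: nat and a g where "\<And>i. i < n \<Longrightarrow> g i \<in> G" "t = (\<Sum>i<n. fscale (a i) (ev \<Phi> (g i)))"
proof -
  interpret D: vector_space "fscale :: 'k \<Rightarrow> (('g \<Rightarrow> 'k) \<Rightarrow> 'k) \<Rightarrow> ('g \<Rightarrow> 'k) \<Rightarrow> 'k"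
    by (rule vector_space_fscale)
  have "t \<in> D.span (ev \<Phi> ` G)" using assms by (simp add: presented_def)
  then have "\<exists>n a g. (\<forall>i<n::nat. g i \<in> G) \<and> t = (\<Sum>i<n. fscale (a i) (ev \<Phi> (g i)))"
  proof (induction rule: D.span_induct_alt)
    case base
    show ?case by (rule exI[of _ 0]) simp
  next
    case (step c x y)
    then obtain n a g h where "\<forall>i<n::nat. g i \<in> G" "y = (\<Sum>i<n. fscale (a i) (ev \<Phi> (g i)))"
      "h \<in> G" "x = ev \<Phi> h" by blast
    moreover have "(\<Sum>i<n. fscale ((a(n:=c)) i) (ev \<Phi> ((g(n:=h)) i))) = (\<Sum>i<n. fscale (a i) (ev \<Phi> (g i)))"
      by (rule sum.cong) auto
    ultimately have "fscale c x + y = (\<Sum>i<Suc n. fscale ((a(n:=c)) i) (ev \<Phi> ((g(n:=h)) i)))"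
      "\<forall>i<Suc n. (g(n := h)) i \<in> G"
      by (simp_all only: sum.lessThan_Suc fun_upd_same add.commute) (auto simp: less_Suc_eq)
    then show ?case by blast
  qed
  then show ?thesis using that by blast
qed

lemma presented_off: "t \<in> carr (presented \<Phi> G) \<Longrightarrow> f \<notin> \<Phi> \<Longrightarrow> t f = 0"
  by (erule presented_rep) (simp add: sum_fun_apply ev_def)

text \<open>Outside \<open>\<Phi>\<close> every element vanishes because \<open>ev\<close> has
  default value 0 there, so only the forms respecting the relations need testing. Most identities
  between tensors below are proved in this way.\<close>

lemma presented_ext:
  assumes "t \<in> carr (presented \<Phi> G)" "t' \<in> carr (presented \<Phi> G)" "\<And>f. f \<in> \<Phi> \<Longrightarrow> t f = t' f"
  shows "t = t'"
  using assms presented_off by (metis ext)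

lemma presented_eval:
  assumes "f \<in> \<Phi>"
  shows "(\<Sum>i\<in>I. fscale (a i) (ev \<Phi> (g i))) f = (\<Sum>i\<in>I. a i * f (g i))"
  using assms by (simp add: sum_fun_apply ev_def)

text \<open>Forms are total functions with arbitrary values off the generators; an element of the
  presented space does not see those values.\<close>

lemma presented_cong:
  assumes "t \<in> carr (presented \<Phi> G)" "f \<in> \<Phi>" "f' \<in> \<Phi>" "\<And>g. g \<in> G \<Longrightarrow> f g = f' g"
  shows "t f = t f'"
proof -
  obtain n :: nat and a g where "\<And>i. i < n \<Longrightarrow> g i \<in> G" "t = (\<Sum>i<n. fscale (a i) (ev \<Phi> (g i)))"
    using presented_rep[OF assms(1)] by blast
  then show ?thesis using assms by (simp add: presented_eval)
qed

lemma lin_on_presentedI: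
  assumes "vec_space X" "\<And>x. x \<in> carr X \<Longrightarrow> F x \<in> carr (presented \<Phi> G)"
    "\<And>f. f \<in> \<Phi> \<Longrightarrow> lin_on X fld (\<lambda>x. F x f)"
  shows "lin_on X (presented \<Phi> G) F"
  unfolding lin_on_def
proof (intro conjI ballI allI)
  show "F (x + y) = F x + F y" if "x \<in> carr X" "y \<in> carr X" for x y
    using assms(3) that assms(2)[OF vs_add[OF assms(1) that]] assms(2)[OF that(1)] assms(2)[OF that(2)]
    by (intro presented_ext[of _ \<Phi> G] vs_add[OF vec_space_presented]) (auto simp: lin_on_def)
  show "F (smul X c x) = smul (presented \<Phi> G) c (F x)" if "x \<in> carr X" for c x
    using assms(3) that assms(2)[OF vs_smul[OF assms(1) that]] assms(2)[OF that]
    by (intro presented_ext[of _ \<Phi> G] vs_smul[OF vec_space_presented]) (auto simp: lin_on_def)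
qed (rule assms(2))

section \<open>Multilinearity in curried form, under concatenation and under cutting into
  blocks\<close>

section \<open>Multilinear maps\<close>

lemma tuples_Nil [simp]: "xs \<in> tuples [] \<longleftrightarrow> xs = []"
  by (simp add: tuples_def)

lemma tuples_Cons: "xs \<in> tuples (X # Xs) \<longleftrightarrow> (\<exists>y ys. xs = y # ys \<and> y \<in> carr X \<and> ys \<in> tuples Xs)"
  by (auto simp: tuples_def set_Cons_def)

lemma Cons_in_tuples [simp]: "x # xs \<in> tuples (X # Xs) \<longleftrightarrow> x \<in> carr X \<and> xs \<in> tuples Xs"
  by (simp add: tuples_Cons)

lemma tuples_replicate: "xs \<in> tuples (replicate n V) \<longleftrightarrow> length xs = n \<and> set xs \<subseteq> carr V"
  by (induction n arbitrary: xs) (auto simp: tuples_Cons length_Suc_conv)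

lemma tuples_iff: "xs \<in> tuples Xs \<longleftrightarrow> list_all2 (\<lambda>x X. x \<in> carr X) xs Xs"
  by (induction Xs arbitrary: xs) (auto simp: tuples_Cons list_all2_Cons2)

lemma tuples_append: "xs \<in> tuples Xs \<Longrightarrow> ys \<in> tuples Ys \<Longrightarrow> xs @ ys \<in> tuples (Xs @ Ys)"
  by (auto simp: tuples_iff intro: list_all2_appendI)

lemma mlinD: "mlin Xs W F \<Longrightarrow> xs \<in> tuples Xs \<Longrightarrow> F xs \<in> carr W"
  by (simp add: mlin_def)

lemma mlin_Nil: "mlin [] W F \<longleftrightarrow> F [] \<in> carr W"
  by (auto simp: mlin_def)

text \<open>\<open>mlin\<close> is stated through list updates; this curried form is what inductions
  on the number of slots use.\<close>

lemma mlin_Cons: "mlin (X # Xs) W F \<longleftrightarrow>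
    (\<forall>x\<in>carr X. mlin Xs W (\<lambda>xs. F (x # xs))) \<and> (\<forall>xs\<in>tuples Xs. lin_on X W (\<lambda>x. F (x # xs)))"
  (is "?L \<longleftrightarrow> ?R")
proof
  assume L: ?L
  have "lin_on X W (\<lambda>x. F (x # xs))" if "xs \<in> tuples Xs" for xs
  \<comment> \<open>\<open>X\<close> is an arbitrary record, so some element must be found to occupy
    the slot that the update overwrites; with an empty carrier linearity is vacuous.\<close>
  proof (cases "carr X = {}")
    case False
    then obtain y where "y \<in> carr X" by blast
    then have "lin_on ((X # Xs) ! 0) W (\<lambda>x. F ((y # xs)[0 := x]))"
      using L[unfolded mlin_def, THEN conjunct2, rule_format, of 0 "y # xs"] that by simp
    then show ?thesis by simp
  qed (simp add: lin_on_def)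
  moreover have "mlin Xs W (\<lambda>xs. F (x # xs))" if x: "x \<in> carr X" for x
    unfolding mlin_def
  proof (intro conjI allI ballI impI)
    show "F (x # xs) \<in> carr W" if "xs \<in> tuples Xs" for xs
      using L x that by (auto simp: mlin_def)
    show "lin_on (Xs ! j) W (\<lambda>y. F (x # xs[j := y]))" if "j < length Xs" "xs \<in> tuples Xs" for j xs
    proof -
      have "lin_on ((X # Xs) ! Suc j) W (\<lambda>y. F ((x # xs)[Suc j := y]))"
        using L[unfolded mlin_def, THEN conjunct2, rule_format, of "Suc j" "x # xs"] x that by simp
      then show ?thesis by simp
    qed
  qed
  ultimately show ?R by blast
next
  assume R: ?R
  show ?L
    unfolding mlin_def
  proof (intro conjI allI ballI impI)
    show "F xs \<in> carr W" if "xs \<in> tuples (X # Xs)" for xs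
      using R that by (auto simp: mlin_def tuples_Cons)
    show "lin_on ((X # Xs) ! j) W (\<lambda>y. F (xs[j := y]))"
      if j: "j < length (X # Xs)" and xs: "xs \<in> tuples (X # Xs)" for j xs
    proof -
      obtain y ys where y: "xs = y # ys" "y \<in> carr X" "ys \<in> tuples Xs" using xs by (auto simp: tuples_Cons)
      show ?thesis
      proof (cases j)
        case 0 then show ?thesis using R y by simp
      next
        case (Suc i)
        have "mlin Xs W (\<lambda>xs. F (y # xs))" using R y by blast
        then show ?thesis using j y Suc by (simp add: mlin_def)
      qed
    qed
  qed
qed

text \<open>Stands in for the isomorphism between a tensor power of order \<open>p + q\<close> and
  the product of those of orders \<open>p\<close> and \<open>q\<close>.\<close>

lemma mlin_append_iff: "mlin (Xs @ Ys) W F \<longleftrightarrow>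
    (\<forall>xs\<in>tuples Xs. mlin Ys W (\<lambda>ys. F (xs @ ys))) \<and> (\<forall>ys\<in>tuples Ys. mlin Xs W (\<lambda>xs. F (xs @ ys)))"
proof (induction Xs arbitrary: F)
  case Nil
  show ?case by (auto simp: mlin_Nil dest: mlinD)
next
  case (Cons X Xs)
  have app: "us \<in> tuples (Xs @ Ys) \<longleftrightarrow> (\<exists>xs ys. us = xs @ ys \<and> xs \<in> tuples Xs \<and> ys \<in> tuples Ys)" for us
    by (auto simp: tuples_iff list_all2_append2 dest: list_all2_lengthD)
  show ?case
    unfolding append_Cons mlin_Cons Cons.IH
  proof (rule iffI; elim conjE)
    assume 1: "\<forall>x\<in>carr X. (\<forall>xs\<in>tuples Xs. mlin Ys W (\<lambda>ys. F (x # xs @ ys))) \<and>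
        (\<forall>ys\<in>tuples Ys. mlin Xs W (\<lambda>xs. F (x # xs @ ys)))"
      and 2: "\<forall>xs\<in>tuples (Xs @ Ys). lin_on X W (\<lambda>x. F (x # xs))"
    show "(\<forall>xs\<in>tuples (X # Xs). mlin Ys W (\<lambda>ys. F (xs @ ys))) \<and>
      (\<forall>ys\<in>tuples Ys. (\<forall>x\<in>carr X. mlin Xs W (\<lambda>xs. F (x # xs @ ys))) \<and>
        (\<forall>xs\<in>tuples Xs. lin_on X W (\<lambda>x. F (x # xs @ ys))))"
      using 1 2 by (auto simp: tuples_Cons tuples_append)
  next
    assume 1: "\<forall>xs\<in>tuples (X # Xs). mlin Ys W (\<lambda>ys. F (xs @ ys))"
      and 2: "\<forall>ys\<in>tuples Ys. (\<forall>x\<in>carr X. mlin Xs W (\<lambda>xs. F (x # xs @ ys))) \<and>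
        (\<forall>xs\<in>tuples Xs. lin_on X W (\<lambda>x. F (x # xs @ ys)))"
    have "mlin Ys W (\<lambda>ys. F (x # xs @ ys))" if "x \<in> carr X" "xs \<in> tuples Xs" for x xs
      using 1[rule_format, of "x # xs"] that by simp
    moreover have "lin_on X W (\<lambda>x. F (x # us))" if "us \<in> tuples (Xs @ Ys)" for us
      using that 2 unfolding app by auto
    ultimately show "(\<forall>x\<in>carr X. (\<forall>xs\<in>tuples Xs. mlin Ys W (\<lambda>ys. F (x # xs @ ys))) \<and>
        (\<forall>ys\<in>tuples Ys. mlin Xs W (\<lambda>xs. F (x # xs @ ys)))) \<and>
      (\<forall>xs\<in>tuples (Xs @ Ys). lin_on X W (\<lambda>x. F (x # xs)))"
      using 2 by simp
  qed
qed

lemma mlin_iff: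
  assumes "vec_space V"
  shows "mlin (replicate n V) W F \<longleftrightarrow>
    (\<forall>xs. length xs = n \<longrightarrow> set xs \<subseteq> carr V \<longrightarrow> F xs \<in> carr W) \<and>
    (\<forall>us vs. length us + length vs + 1 = n \<longrightarrow> set us \<subseteq> carr V \<longrightarrow> set vs \<subseteq> carr V \<longrightarrow>
       lin_on V W (\<lambda>x. F (us @ x # vs)))" (is "?L \<longleftrightarrow> ?R")
proof
  assume L: ?L
  have "lin_on V W (\<lambda>x. F (us @ x # vs))"
    if "length us + length vs + 1 = n" "set us \<subseteq> carr V" "set vs \<subseteq> carr V" for us vs
  proof -
    \<comment> \<open>The entry 0 is a mere placeholder, overwritten by the update.\<close>
    have "us @ 0 # vs \<in> tuples (replicate n V)" "length us < length (replicate n V)"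
      using that vs_zero[OF assms] by (auto simp: tuples_replicate)
    then have "lin_on (replicate n V ! length us) W (\<lambda>x. F ((us @ 0 # vs)[length us := x]))"
      using L unfolding mlin_def by blast
    then show ?thesis using that by simp
  qed
  then show ?R using L by (auto simp: mlin_def tuples_replicate)
next
  assume R: ?R
  show ?L
    unfolding mlin_def
  proof (intro conjI allI ballI impI)
    show "F xs \<in> carr W" if "xs \<in> tuples (replicate n V)" for xs
      using R that by (auto simp: tuples_replicate)
    show "lin_on (replicate n V ! j) W (\<lambda>x. F (xs[j := x]))"
      if "j < length (replicate n V)" "xs \<in> tuples (replicate n V)" for j xs
      using R[THEN conjunct2, rule_format, of "take j xs" "drop (Suc j) xs"] that
      by (auto simp: upd_conv_take_nth_drop tuples_replicate dest: in_set_takeD in_set_dropD)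
  qed
qed

lemma mlin_slot:
  assumes "vec_space V" "mlin (replicate n V) W F" "length us + length vs + 1 = n"
    "set us \<subseteq> carr V" "set vs \<subseteq> carr V"
  shows "lin_on V W (\<lambda>x. F (us @ x # vs))"
  using assms(2)[unfolded mlin_iff[OF assms(1)]] assms(3-5) by blast

text \<open>Multilinearity concerns only words of the right length over \<open>carr V\<close>, so
  functions involving \<open>length\<close>, \<open>take\<close> or chosen lifts may be replaced by
  their values on such words.\<close>

lemma mlin_cong:
  assumes "vec_space V" "\<And>xs. length xs = n \<Longrightarrow> set xs \<subseteq> carr V \<Longrightarrow> F xs = G xs"
  shows "mlin (replicate n V) W F \<longleftrightarrow> mlin (replicate n V) W G"
  unfolding mlin_iff[OF assms(1)] using assms(2)
  by (intro conj_cong all_cong1 imp_cong refl lin_on_cong[OF assms(1)]) auto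

lemma mlin_zero_entry:
  assumes "vec_space V" "mlin (replicate n V) W F" "length xs = n" "set xs \<subseteq> carr V" "0 \<in> set xs"
  shows "F xs = 0"
proof -
  obtain us vs where xs: "xs = us @ 0 # vs" using assms(5) by (meson split_list)
  show ?thesis unfolding xs
    by (rule lin_on_zero[OF assms(1) mlin_slot[OF assms(1,2)]]) (use assms xs in auto)
qed

lemma mlin_comp_lin: "mlin Xs W F \<Longrightarrow> lin_on W U h \<Longrightarrow> mlin Xs U (\<lambda>xs. h (F xs))"
  by (simp add: mlin_def lin_on_def)

lemma mlin_scaled: "vec_space W \<Longrightarrow> mlin Xs W F \<Longrightarrow> mlin Xs W (\<lambda>xs. smul W c (F xs))"
  by (simp add: mlin_def vs_smul lin_on_scaled)

lemma mlin_plus: "vec_space W \<Longrightarrow> mlin Xs W F \<Longrightarrow> mlin Xs W G \<Longrightarrow> mlin Xs W (\<lambda>xs. F xs + G xs)"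
  by (simp add: mlin_def vs_add lin_on_plus)

lemma mlin_const_zero: "vec_space W \<Longrightarrow> mlin Xs W (\<lambda>xs. 0)"
  by (simp add: mlin_def vs_zero lin_on_const_zero)

lemma mlin_sum: "vec_space W \<Longrightarrow> (\<And>i. i \<in> I \<Longrightarrow> mlin Xs W (F i)) \<Longrightarrow> mlin Xs W (\<lambda>xs. \<Sum>i\<in>I. F i xs)"
  by (simp add: mlin_def vs_sum lin_on_sum_fun)

lemma mlin_split:
  assumes "vec_space V"
    "\<And>ys. length ys = q \<Longrightarrow> set ys \<subseteq> carr V \<Longrightarrow> mlin (replicate p V) W (\<lambda>xs. F xs ys)"
    "\<And>xs. length xs = p \<Longrightarrow> set xs \<subseteq> carr V \<Longrightarrow> mlin (replicate q V) W (F xs)"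
  shows "mlin (replicate (p + q) V) W (\<lambda>zs. F (take p zs) (drop p zs))"
proof -
  have "mlin (replicate p V) W (\<lambda>xs. F (take p (xs @ ys)) (drop p (xs @ ys)))"
    if "ys \<in> tuples (replicate q V)" for ys
  proof (subst mlin_cong[OF assms(1)])
    show "mlin (replicate p V) W (\<lambda>xs. F xs ys)" using that assms(2) by (simp add: tuples_replicate)
  qed auto
  moreover have "mlin (replicate q V) W (\<lambda>ys. F (take p (xs @ ys)) (drop p (xs @ ys)))"
    if "xs \<in> tuples (replicate p V)" for xs
    using that assms(3) by (simp add: tuples_replicate)
  ultimately show ?thesis by (simp add: replicate_add mlin_append_iff)
qed

lemma mlin_map2:
  assumes "vec_space V" "\<forall>h\<in>set hs. lin_on V W h" "mlin (replicate (length hs) W) U g"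
  shows "mlin (replicate (length hs) V) U (\<lambda>xs. g (map2 (\<lambda>h x. h x) hs xs))"
  using assms(2,3)
proof (induction hs arbitrary: g)
  case (Cons h hs)
  have t: "map2 (\<lambda>h x. h x) hs xs \<in> tuples (replicate (length hs) W)"
    if "xs \<in> tuples (replicate (length hs) V)" for xs
    using that Cons.prems(1)
    by (auto simp: tuples_replicate set_zip subset_iff intro!: lin_onD(1)[of V W])
  show ?case
    unfolding list.size add_Suc_right add_0_right replicate_Suc mlin_Cons zip_Cons_Cons list.map prod.case
  proof (intro conjI ballI)
    show "mlin (replicate (length hs) V) U (\<lambda>xs. g (h x # map2 (\<lambda>h x. h x) hs xs))" if "x \<in> carr V" for x
      using Cons.prems that by (intro Cons.IH) (auto simp: mlin_Cons lin_onD(1))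
    show "lin_on V U (\<lambda>x. g (h x # map2 (\<lambda>h x. h x) hs xs))" if "xs \<in> tuples (replicate (length hs) V)" for xs
      by (rule lin_on_comp[of V W h U "\<lambda>y. g (y # map2 (\<lambda>h x. h x) hs xs)"])
        (use Cons.prems t[OF that] in \<open>simp_all add: mlin_Cons\<close>)
  qed
qed (simp add: mlin_Nil)

lemma mlin_map:
  assumes "vec_space V" "lin_on V W h" "mlin (replicate n W) U g"
  shows "mlin (replicate n V) U (\<lambda>xs. g (map h xs))"
proof (subst mlin_cong[OF assms(1)])
  show "mlin (replicate n V) U (\<lambda>xs. g (map2 (\<lambda>h x. h x) (replicate n h) xs))"
    using mlin_map2[OF assms(1), of "replicate n h" W U g] assms by simp
qed (simp add: zip_replicate1 o_def)

lemma length_blocks [simp]: "length (blocks is xs) = length is"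
  by (induction "is" arbitrary: xs) auto

lemma set_blocks: "ys \<in> set (blocks is xs) \<Longrightarrow> set ys \<subseteq> set xs"
  by (induction "is" arbitrary: xs) (auto dest: in_set_takeD in_set_dropD)

lemma length_nth_blocks: "length xs = sum_list is \<Longrightarrow> j < length is \<Longrightarrow> length (blocks is xs ! j) = is ! j"
  by (induction "is" arbitrary: xs j) (auto simp: nth_Cons split: nat.splits)

lemma blocks_replicate_1: "length xs = n \<Longrightarrow> blocks (replicate n (Suc 0)) xs = map (\<lambda>x. [x]) xs"
  by (induction n arbitrary: xs) (auto simp: length_Suc_conv)

text \<open>Applying a tensor product of operations and the cofree coaction both cut a word into
  consecutive blocks; this supplies the multilinearity that their lifts require.\<close>

lemma mlin_blocks:
  assumes "vec_space V" "length Fs = length is"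
    "\<And>j. j < length is \<Longrightarrow> mlin (replicate (is ! j) V) W (Fs ! j)"
    "mlin (replicate (length is) W) U g"
  shows "mlin (replicate (sum_list is) V) U (\<lambda>xs. g (map2 (\<lambda>F ys. F ys) Fs (blocks is xs)))"
  using assms(2-4)
proof (induction "is" arbitrary: Fs g)
  case (Cons i "is")
  then obtain F Fs' where Fs: "Fs = F # Fs'" "length Fs' = length is" by (auto simp: length_Suc_conv)
  have F: "mlin (replicate i V) W F" using Cons.prems(2)[of 0] Fs by simp
  have Fs': "mlin (replicate (is ! j) V) W (Fs' ! j)" if "j < length is" for j
    using Cons.prems(2)[of "Suc j"] Fs that by simp
  have t: "map2 (\<lambda>F ys. F ys) Fs' (blocks is ys) \<in> tuples (replicate (length is) W)"
    if "length ys = sum_list is" "set ys \<subseteq> carr V" for ys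
    unfolding tuples_replicate
  proof (intro conjI subsetI)
    fix w assume "w \<in> set (map2 (\<lambda>F ys. F ys) Fs' (blocks is ys))"
    then obtain j where j: "j < length is" "w = (Fs' ! j) (blocks is ys ! j)"
      using Fs by (auto simp: set_zip)
    moreover have "set (blocks is ys ! j) \<subseteq> carr V"
      using set_blocks[of "blocks is ys ! j" "is" ys] j that by auto
    ultimately show "w \<in> carr W"
      using Fs' that by (auto intro!: mlinD[OF Fs'] simp: tuples_replicate length_nth_blocks)
  qed (use Fs in simp)
  have "mlin (replicate (i + sum_list is) V) U
      (\<lambda>zs. (\<lambda>xs ys. g (F xs # map2 (\<lambda>F ys. F ys) Fs' (blocks is ys))) (take i zs) (drop i zs))"
  proof (rule mlin_split[OF assms(1)])
    show "mlin (replicate i V) U (\<lambda>xs. g (F xs # map2 (\<lambda>F ys. F ys) Fs' (blocks is ys)))"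
      if "length ys = sum_list is" "set ys \<subseteq> carr V" for ys
      using Cons.prems(3) t[OF that] by (intro mlin_comp_lin[OF F]) (auto simp: mlin_Cons)
    show "mlin (replicate (sum_list is) V) U (\<lambda>ys. g (F xs # map2 (\<lambda>F ys. F ys) Fs' (blocks is ys)))"
      if "length xs = i" "set xs \<subseteq> carr V" for xs
      using Cons.prems(3) mlinD[OF F, of xs] that
      by (intro Cons.IH Fs Fs') (auto simp: mlin_Cons tuples_replicate)
  qed
  then show ?case by (simp add: Fs)
qed (simp add: mlin_Nil)

lemma mlin_prod_list: "mlin (replicate n (fld :: ('k::field, 'k) vs)) fld prod_list"
  unfolding mlin_iff[OF vec_space_fld]
  by (auto simp: lin_on_def algebra_simps)

text \<open>Products of linear forms, one per letter, are the test forms that separate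
  words.\<close>

lemma mlin_form_prod:
  fixes V :: "('k::field, 'v::ab_group_add) vs"
  assumes "vec_space V" "\<forall>f\<in>set fs. lin_on V fld f"
  shows "mlin (replicate (length fs) V) fld (\<lambda>xs. prod_list (map2 (\<lambda>f x. f x) fs xs))"
  by (rule mlin_map2[OF assms mlin_prod_list])

lemma mlin_scale_all:
  assumes "vec_space V" "vec_space W" "mlin (replicate n V) W F"
    "length cs = n" "length xs = n" "set xs \<subseteq> carr V"
  shows "F (map2 (smul V) cs xs) = smul W (prod_list cs) (F xs)"
  using assms(3-6)
proof (induction n arbitrary: F cs xs)
  case 0
  then show ?case by (simp add: smul_simps[OF assms(2)])
next
  case (Suc n)
  obtain c cs' where cs: "cs = c # cs'" "length cs' = n" using Suc.prems by (auto simp: length_Suc_conv)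
  obtain x xs' where xs: "xs = x # xs'" "length xs' = n" using Suc.prems by (auto simp: length_Suc_conv)
  have x: "x \<in> carr V" "set xs' \<subseteq> carr V" using Suc.prems xs by auto
  have IH: "F (smul V c x # map2 (smul V) cs' xs') = smul W (prod_list cs') (F (smul V c x # xs'))"
    using Suc.IH[of "\<lambda>xs. F (smul V c x # xs)" cs' xs'] Suc.prems(1) cs xs x vs_smul[OF assms(1) x(1)]
    by (simp add: mlin_Cons)
  have "F (smul V c x # xs') = smul W c (F (x # xs'))"
    using Suc.prems(1) x xs by (auto simp: mlin_Cons tuples_replicate lin_on_def)
  then show ?case using IH by (simp add: cs xs smul_simps[OF assms(2)] mult.commute)
qed

text \<open>With all slots but the first frozen this is \<open>presented_unique\<close>; the
  induction hypothesis provides agreement when the first slot holds a generator.\<close>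

lemma mlin_presented_unique:
  fixes \<Phi> :: "('g \<Rightarrow> 'k::field) set" and W :: "('k, 'w::ab_group_add) vs"
  assumes W: "vec_space W"
    and "mlin (replicate n (presented \<Phi> G)) W F" "mlin (replicate n (presented \<Phi> G)) W F'"
    and "\<And>gs. length gs = n \<Longrightarrow> set gs \<subseteq> G \<Longrightarrow> F (map (ev \<Phi>) gs) = F' (map (ev \<Phi>) gs)"
    and "ts \<in> tuples (replicate n (presented \<Phi> G))"
  shows "F ts = F' ts"
  using assms(2-)
proof (induction n arbitrary: F F' ts)
  case (Suc n)
  obtain t ts' where ts: "ts = t # ts'" "t \<in> carr (presented \<Phi> G)" "ts' \<in> tuples (replicate n (presented \<Phi> G))"
    using Suc.prems(4) by (auto simp: tuples_Cons)
  have "F (ev \<Phi> g # ts') = F' (ev \<Phi> g # ts')" if "g \<in> G" for g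
  proof (rule Suc.IH[OF _ _ _ ts(3)])
    show "F (ev \<Phi> g # map (ev \<Phi>) gs) = F' (ev \<Phi> g # map (ev \<Phi>) gs)"
      if "length gs = n" "set gs \<subseteq> G" for gs
      using Suc.prems(3)[of "g # gs"] that \<open>g \<in> G\<close> by simp
  qed (use Suc.prems(1,2)[unfolded replicate_Suc mlin_Cons] ev_in_presented[OF that] in blast)+
  moreover have "lin_on (presented \<Phi> G) W (\<lambda>t. F (t # ts'))" "lin_on (presented \<Phi> G) W (\<lambda>t. F' (t # ts'))"
    using Suc.prems(1,2) ts(3) by (simp_all add: mlin_Cons)
  ultimately show ?case
    unfolding ts(1) using presented_unique[OF W _ _ _ ts(2)] by blast
qed simp

section \<open>Tensor powers: evaluation formulas, multiplication, nonvanishing,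
  functoriality\<close>

section \<open>Tensor powers\<close>

lemma smul_tpow [simp]: "smul (tpow V n) = fscale"
  by (simp add: tpow_def)

lemma vec_space_tpow: "vec_space (tpow V n)"
  by (simp add: tpow_def vec_space_presented)

lemma tforms_iff: "f \<in> tforms V n \<longleftrightarrow> mlin (replicate n V) fld f"
  by (simp add: tforms_def)

lemma tens_in: "length xs = n \<Longrightarrow> set xs \<subseteq> carr V \<Longrightarrow> tens V xs \<in> carr (tpow V n)"
  unfolding tpow_def tens_def by (auto intro!: ev_in_presented simp: tuples_replicate)

lemma tens_eval: "f \<in> tforms V (length xs) \<Longrightarrow> tens V xs f = f xs"
  by (simp add: tens_def ev_def)

lemma tpow_rep:
  assumes "t \<in> carr (tpow V n)"
  obtains m :: nat and a xs where "\<And>i. i < m \<Longrightarrow> length (xs i) = n \<and> set (xs i) \<subseteq> carr V"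
    "t = (\<Sum>i<m. fscale (a i) (tens V (xs i)))"
proof -
  obtain m :: nat and a xs where *: "\<And>i. i < m \<Longrightarrow> xs i \<in> tuples (replicate n V)"
    "t = (\<Sum>i<m. fscale (a i) (ev (tforms V n) (xs i)))"
    using presented_rep[OF assms[unfolded tpow_def]] by blast
  have "t = (\<Sum>i<m. fscale (a i) (tens V (xs i)))"
    unfolding *(2) tens_def using *(1) by (intro sum.cong) (auto simp: tuples_replicate)
  then show ?thesis using that[of m xs a] *(1) by (auto simp: tuples_replicate)
qed

lemma tpow_ext:
  assumes "t \<in> carr (tpow V n)" "t' \<in> carr (tpow V n)" "\<And>f. f \<in> tforms V n \<Longrightarrow> t f = t' f"
  shows "t = t'"
  using assms presented_ext unfolding tpow_def by blast

lemma tpow_sum_eval: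
  assumes "f \<in> tforms V n" "\<And>i. i \<in> I \<Longrightarrow> length (xs i) = n"
  shows "(\<Sum>i\<in>I. fscale (a i) (tens V (xs i))) f = (\<Sum>i\<in>I. a i * f (xs i))"
  using assms by (simp add: sum_fun_apply tens_eval)

lemma tpow_sum_in:
  assumes "\<And>i. i \<in> I \<Longrightarrow> length (xs i) = n \<and> set (xs i) \<subseteq> carr V"
  shows "(\<Sum>i\<in>I. fscale (a i) (tens V (xs i))) \<in> carr (tpow V n)"
  using assms vs_smul[OF vec_space_tpow, of "tens V (xs i)" V n for i]
  by (intro vs_sum[OF vec_space_tpow]) (auto simp: tens_in)

lemma tpow_cong:
  assumes "t \<in> carr (tpow V n)" "f \<in> tforms V n" "f' \<in> tforms V n"
    "\<And>xs. length xs = n \<Longrightarrow> set xs \<subseteq> carr V \<Longrightarrow> f xs = f' xs"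
  shows "t f = t f'"
  using presented_cong[OF assms(1)[unfolded tpow_def] assms(2,3)] assms(4) by (simp add: tuples_replicate)

text \<open>Tensors are functions added and scaled pointwise, so evaluation at a fixed
  \<open>f\<close> is linear even if \<open>f\<close> is not a form.\<close>

lemma mlin_tpow_eval: "mlin Xs (tpow V n) F \<Longrightarrow> mlin Xs fld (\<lambda>xs. F xs f)"
  by (auto simp: mlin_def lin_on_def)

lemma mlin_tpowI:
  assumes V: "vec_space V"
    and F: "\<And>xs. length xs = n \<Longrightarrow> set xs \<subseteq> carr V \<Longrightarrow> F xs \<in> carr (tpow W m)"
    "\<And>g. g \<in> tforms W m \<Longrightarrow> mlin (replicate n V) fld (\<lambda>xs. F xs g)"
  shows "mlin (replicate n V) (tpow W m) F"
  unfolding mlin_iff[OF V]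
proof (intro conjI allI impI)
  fix us vs :: "'b list"
  assume uv: "length us + length vs + 1 = n" "set us \<subseteq> carr V" "set vs \<subseteq> carr V"
  show "lin_on V (tpow W m) (\<lambda>x. F (us @ x # vs))"
    unfolding tpow_def
  proof (rule lin_on_presentedI[OF V])
    show "F (us @ x # vs) \<in> carr (presented (tforms W m) (tuples (replicate m W)))" if "x \<in> carr V" for x
      using F(1) uv that by (auto simp: tpow_def)
    show "lin_on V fld (\<lambda>x. F (us @ x # vs) f)" if "f \<in> tforms W m" for f
      using F(2)[OF that] uv by (rule mlin_slot[OF V])
  qed
qed (use F in auto)

lemma lin_on_tpowI:
  assumes "vec_space X" "\<And>x. x \<in> carr X \<Longrightarrow> F x \<in> carr (tpow W m)"
    "\<And>g. g \<in> tforms W m \<Longrightarrow> lin_on X fld (\<lambda>x. F x g)"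
  shows "lin_on X (tpow W m) F"
  using assms unfolding tpow_def by (intro lin_on_presentedI)

text \<open>Partial contraction: pairing the last \<open>q\<close> letters with \<open>t\<close>
  leaves a form in the first \<open>p\<close>. Expanding \<open>t\<close> into pure tensors exhibits
  it as a finite sum of forms.\<close>

lemma tforms_eval:
  assumes V: "vec_space V" and U: "vec_space U" and t: "t \<in> carr (tpow V q)"
    and G: "\<And>ys. length ys = q \<Longrightarrow> set ys \<subseteq> carr V \<Longrightarrow> mlin (replicate p U) fld (\<lambda>xs. G xs ys)"
      "\<And>xs. length xs = p \<Longrightarrow> set xs \<subseteq> carr U \<Longrightarrow> G xs \<in> tforms V q"
  shows "(\<lambda>xs. t (G xs)) \<in> tforms U p"
proof -
  obtain m :: nat and a ys where ys: "\<And>i. i < m \<Longrightarrow> length (ys i) = q \<and> set (ys i) \<subseteq> carr V"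
    "t = (\<Sum>i<m. fscale (a i) (tens V (ys i)))" using tpow_rep[OF t] by blast
  have "mlin (replicate p U) fld (\<lambda>xs. \<Sum>i<m. a i * G xs (ys i))"
    using mlin_scaled[OF vec_space_fld G(1)] ys by (intro mlin_sum[OF vec_space_fld]) auto
  then show ?thesis
    unfolding tforms_iff
    by (rule iffD2[OF mlin_cong[OF U], rotated])
      (unfold ys(2), rule tpow_sum_eval[OF G(2)], use ys(1) in auto)
qed

lemma tlift_props:
  assumes "vec_space W" "mlin (replicate n V) W F"
  shows "lin_on (tpow V n) W (tlift V n W F)"
    and "length xs = n \<Longrightarrow> set xs \<subseteq> carr V \<Longrightarrow> tlift V n W F (tens V xs) = F xs"
  using tpow_universal[OF assms] by (auto simp: tuples_replicate)

lemma tlift_sum: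
  assumes "vec_space W" "mlin (replicate n V) W F"
    "\<And>i. i \<in> I \<Longrightarrow> length (xs i) = n \<and> set (xs i) \<subseteq> carr V"
  shows "tlift V n W F (\<Sum>i\<in>I. fscale (a i) (tens V (xs i))) = (\<Sum>i\<in>I. smul W (a i) (F (xs i)))"
  using lin_on_sum[OF vec_space_tpow tlift_props(1)[OF assms(1,2)], of I "\<lambda>i. tens V (xs i)" a] assms(3)
  by (simp add: tens_in tlift_props(2)[OF assms(1,2)])

text \<open>Although \<open>tlift\<close> is a choice, it is explicitly the transpose of pulling the
  test form back along \<open>F\<close>. This formula makes the choice computable.\<close>

lemma tlift_eval:
  assumes F: "mlin (replicate n V) (tpow W m) F" and t: "t \<in> carr (tpow V n)"
  shows "tlift V n (tpow W m) F t g = t (\<lambda>xs. F xs g)"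
proof -
  obtain k :: nat and a xs where xs: "\<And>i. i < k \<Longrightarrow> length (xs i) = n \<and> set (xs i) \<subseteq> carr V"
    "t = (\<Sum>i<k. fscale (a i) (tens V (xs i)))" using tpow_rep[OF t] by blast
  have G: "(\<lambda>xs. F xs g) \<in> tforms V n" using F by (simp add: tforms_iff mlin_tpow_eval)
  have "tlift V n (tpow W m) F t = (\<Sum>i<k. fscale (a i) (F (xs i)))"
    unfolding xs(2) using tlift_sum[OF vec_space_tpow F, of "{..<k}" xs a] xs(1) by simp
  moreover have "t (\<lambda>xs. F xs g) = (\<Sum>i<k. a i * F (xs i) g)"
    unfolding xs(2) using xs(1) by (intro tpow_sum_eval[OF G]) simp
  ultimately show ?thesis by (simp add: sum_fun_apply)
qed

lemma tforms_append_left: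
  assumes "g \<in> tforms V (p + q)" "length xs = p" "set xs \<subseteq> carr V"
  shows "(\<lambda>ys. g (xs @ ys)) \<in> tforms V q"
  using assms by (auto simp: tforms_iff replicate_add mlin_append_iff tuples_replicate)

lemma tforms_append_right:
  assumes "g \<in> tforms V (p + q)" "length ys = q" "set ys \<subseteq> carr V"
  shows "(\<lambda>xs. g (xs @ ys)) \<in> tforms V p"
  using assms by (auto simp: tforms_iff replicate_add mlin_append_iff tuples_replicate)

text \<open>A Fubini formula: \<open>t\<close> is contracted with the trailing letters, then
  \<open>s\<close> with the leading ones. As \<open>tmul\<close> is a lift of a lift, the inner lift
  must first be shown multilinear in the leading letters.\<close>

lemma
  assumes V: "vec_space V" and s: "s \<in> carr (tpow V p)" and t: "t \<in> carr (tpow V q)"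
  shows tmul_in: "tmul V p q s t \<in> carr (tpow V (p + q))"
    and tmul_eval: "g \<in> tforms V (p + q) \<Longrightarrow> tmul V p q s t g = s (\<lambda>xs. t (\<lambda>ys. g (xs @ ys)))"
proof -
  have 1: "mlin (replicate q V) (tpow V (p + q)) (\<lambda>ys. tens V (xs @ ys))"
    if "length xs = p" "set xs \<subseteq> carr V" for xs
    using tens_mlin[of "p + q" V] that by (simp add: replicate_add mlin_append_iff tuples_replicate)
  have 2: "tlift V q (tpow V (p + q)) (\<lambda>ys. tens V (xs @ ys)) t g = t (\<lambda>ys. g (xs @ ys))"
    if "length xs = p" "set xs \<subseteq> carr V" "g \<in> tforms V (p + q)" for xs g
    unfolding tlift_eval[OF 1[OF that(1,2)] t]
  proof (rule tpow_cong[OF t])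
    show "(\<lambda>ys. tens V (xs @ ys) g) \<in> tforms V q"
      unfolding tforms_iff by (rule mlin_tpow_eval[OF 1[OF that(1,2)]])
    show "(\<lambda>ys. g (xs @ ys)) \<in> tforms V q" using that by (intro tforms_append_left)
  qed (use that in \<open>simp add: tens_eval\<close>)
  have 3: "(\<lambda>xs. t (\<lambda>ys. g (xs @ ys))) \<in> tforms V p" if "g \<in> tforms V (p + q)" for g
    using tforms_append_left[OF that] tforms_append_right[OF that]
    by (intro tforms_eval[OF V V t]) (auto simp: tforms_iff)
  have 4: "mlin (replicate p V) (tpow V (p + q)) (\<lambda>xs. tlift V q (tpow V (p + q)) (\<lambda>ys. tens V (xs @ ys)) t)"
  proof (rule mlin_tpowI[OF V])
    show "tlift V q (tpow V (p + q)) (\<lambda>ys. tens V (xs @ ys)) t \<in> carr (tpow V (p + q))"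
      if "length xs = p" "set xs \<subseteq> carr V" for xs
      by (rule lin_onD(1)[OF tlift_props(1)[OF vec_space_tpow 1[OF that]] t])
    show "mlin (replicate p V) fld (\<lambda>xs. tlift V q (tpow V (p + q)) (\<lambda>ys. tens V (xs @ ys)) t g)"
      if "g \<in> tforms V (p + q)" for g
      using 3[OF that] that 2 unfolding tforms_iff by (subst mlin_cong[OF V]) auto
  qed
  show "tmul V p q s t \<in> carr (tpow V (p + q))"
    unfolding tmul_def by (rule lin_onD(1)[OF tlift_props(1)[OF vec_space_tpow 4] s])
  show "tmul V p q s t g = s (\<lambda>xs. t (\<lambda>ys. g (xs @ ys)))" if g: "g \<in> tforms V (p + q)"
    unfolding tmul_def tlift_eval[OF 4 s]
  proof (rule tpow_cong[OF s])
    show "(\<lambda>xs. tlift V q (tpow V (p + q)) (\<lambda>ys. tens V (xs @ ys)) t g) \<in> tforms V p"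
      unfolding tforms_iff by (rule mlin_tpow_eval[OF 4])
  qed (use 2 3 g in auto)
qed

lemma tconcat_in:
  assumes "vec_space V" "list_all2 (\<lambda>t i. t \<in> carr (tpow V i)) ts is"
  shows "tconcat V is ts \<in> carr (tpow V (sum_list is))"
  using assms(2)
proof (induction "is" arbitrary: ts rule: list.induct)
  case (Cons i "is")
  then show ?case by (auto simp: list_all2_Cons2 intro!: tmul_in[OF assms(1)])
qed (simp add: tens_in)

lemma tmul_lin_left:
  assumes V: "vec_space V" and t: "t \<in> carr (tpow V q)"
  shows "lin_on (tpow V p) (tpow V (p + q)) (\<lambda>s. tmul V p q s t)"
proof (rule lin_on_tpowI[OF vec_space_tpow])
  fix g assume g: "g \<in> tforms V (p + q)"
  have "lin_on (tpow V p) fld (\<lambda>s. s (\<lambda>xs. t (\<lambda>ys. g (xs @ ys))))" by (simp add: lin_on_def)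
  then show "lin_on (tpow V p) fld (\<lambda>s. tmul V p q s t g)"
    by (subst lin_on_cong[OF vec_space_tpow]) (rule tmul_eval[OF V _ t g])
qed (rule tmul_in[OF V _ t])

text \<open>Here \<open>t\<close> sits inside the form to which \<open>s\<close> is applied, and
  linearity of \<open>s\<close> in forms is not built into its type. Expanding \<open>s\<close> into
  pure tensors brings \<open>t\<close> outside.\<close>

lemma tmul_lin_right:
  assumes V: "vec_space V" and s: "s \<in> carr (tpow V p)"
  shows "lin_on (tpow V q) (tpow V (p + q)) (\<lambda>t. tmul V p q s t)"
proof (rule lin_on_tpowI[OF vec_space_tpow])
  show "tmul V p q s t \<in> carr (tpow V (p + q))" if "t \<in> carr (tpow V q)" for t
    by (rule tmul_in[OF V s that])
  fix g assume g: "g \<in> tforms V (p + q)"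
  obtain m :: nat and a xs where xs: "\<And>i. i < m \<Longrightarrow> length (xs i) = p \<and> set (xs i) \<subseteq> carr V"
    "s = (\<Sum>i<m. fscale (a i) (tens V (xs i)))" using tpow_rep[OF s] by blast
  have 3: "(\<lambda>xs. t (\<lambda>ys. g (xs @ ys))) \<in> tforms V p" if "t \<in> carr (tpow V q)" for t
    using tforms_append_left[OF g] tforms_append_right[OF g]
    by (intro tforms_eval[OF V V that]) (auto simp: tforms_iff)
  have "lin_on (tpow V q) fld (\<lambda>t. \<Sum>i<m. a i * t (\<lambda>ys. g (xs i @ ys)))"
    by (auto simp: lin_on_def algebra_simps sum.distrib sum_distrib_left)
  moreover have "tmul V p q s t g = (\<Sum>i<m. a i * t (\<lambda>ys. g (xs i @ ys)))" if "t \<in> carr (tpow V q)" for t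
    unfolding tmul_eval[OF V s that g] unfolding xs(2) using 3[OF that] xs(1)
    by (intro tpow_sum_eval[OF 3[OF that]]) auto
  ultimately show "lin_on (tpow V q) fld (\<lambda>t. tmul V p q s t g)"
    by (subst lin_on_cong[OF vec_space_tpow]) auto
qed

text \<open>Licenses the lift in the compatibility axiom of \<open>coalgebra\<close>, where each
  slot of a word is expanded into a tensor and the results are multiplied.\<close>

lemma mlin_tconcat:
  assumes V: "vec_space V" and H: "vec_space H"
    and "list_all2 (\<lambda>F i. lin_on H (tpow V i) F) Fs is"
  shows "mlin (replicate (length is) H) (tpow V (sum_list is)) (\<lambda>xs. tconcat V is (map2 (\<lambda>F x. F x) Fs xs))"
  using assms(3)
proof (induction "is" arbitrary: Fs rule: list.induct)
  case Nil
  show ?case by (simp add: mlin_Nil tens_in)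
next
  case (Cons i "is")
  then obtain F Fs' where Fs: "Fs = F # Fs'" "lin_on H (tpow V i) F"
    "list_all2 (\<lambda>F i. lin_on H (tpow V i) F) Fs' is" by (auto simp: list_all2_Cons2)
  note IH = Cons.IH[OF Fs(3)]
  have in_tup: "tconcat V is (map2 (\<lambda>F x. F x) Fs' xs) \<in> carr (tpow V (sum_list is))"
    if "xs \<in> tuples (replicate (length is) H)" for xs
    by (rule mlinD[OF IH that])
  show ?case
    unfolding list.size add_Suc_right add_0_right replicate_Suc mlin_Cons Fs(1) zip_Cons_Cons list.map
      prod.case tconcat.simps list.sel sum_list.Cons
  proof (intro conjI ballI)
    show "mlin (replicate (length is) H) (tpow V (i + sum_list is))
        (\<lambda>xs. tmul V i (sum_list is) (F x) (tconcat V is (map2 (\<lambda>F x. F x) Fs' xs)))" if "x \<in> carr H" for x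
      using IH by (rule mlin_comp_lin) (rule tmul_lin_right[OF V lin_onD(1)[OF Fs(2) that]])
    show "lin_on H (tpow V (i + sum_list is))
        (\<lambda>x. tmul V i (sum_list is) (F x) (tconcat V is (map2 (\<lambda>F x. F x) Fs' xs)))"
      if "xs \<in> tuples (replicate (length is) H)" for xs
      using Fs(2) by (rule lin_on_comp) (rule tmul_lin_left[OF V in_tup[OF that]])
  qed
qed

lemma tmul_tens:
  assumes "vec_space V" "length xs = p" "length ys = q" "set xs \<subseteq> carr V" "set ys \<subseteq> carr V"
  shows "tmul V p q (tens V xs) (tens V ys) = tens V (xs @ ys)"
proof (rule tpow_ext)
  fix g assume g: "g \<in> tforms V (p + q)"
  have 1: "(\<lambda>xs. tens V ys (\<lambda>ys. g (xs @ ys))) \<in> tforms V p"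
    using tforms_append_left[OF g] tforms_append_right[OF g]
    by (intro tforms_eval[OF assms(1,1) tens_in[OF assms(3,5)], where G = "\<lambda>xs ys. g (xs @ ys)"])
      (auto simp: tforms_iff)
  show "tmul V p q (tens V xs) (tens V ys) g = tens V (xs @ ys) g"
    using assms g 1 tforms_append_left[OF g assms(2,4)]
    by (simp add: tmul_eval tens_in tens_eval)
qed (use assms in \<open>auto intro!: tmul_in tens_in\<close>)

lemma tmul_scaled_tens:
  assumes "vec_space V" "length xs = p" "length ys = q" "set xs \<subseteq> carr V" "set ys \<subseteq> carr V"
  shows "tmul V p q (fscale c (tens V xs)) (fscale d (tens V ys)) = fscale (c * d) (tens V (xs @ ys))"
proof -
  have x: "tens V xs \<in> carr (tpow V p)" and y: "tens V ys \<in> carr (tpow V q)"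
    "fscale d (tens V ys) \<in> carr (tpow V q)"
    using assms vs_smul[OF vec_space_tpow, of "tens V ys" V q d] by (auto simp: tens_in)
  show ?thesis
    using lin_onD(3)[OF tmul_lin_left[OF assms(1) y(2)] x, of c] lin_onD(3)[OF tmul_lin_right[OF assms(1) x] y(1), of d]
    by (simp add: tmul_tens[OF assms] fscale_def fun_eq_iff mult.assoc)
qed

lemma tmul_zero:
  assumes "vec_space V"
  shows "t \<in> carr (tpow V q) \<Longrightarrow> tmul V p q 0 t = 0" "s \<in> carr (tpow V p) \<Longrightarrow> tmul V p q s 0 = 0"
  using lin_on_zero[OF vec_space_tpow tmul_lin_left[OF assms]] lin_on_zero[OF vec_space_tpow tmul_lin_right[OF assms]]
  by blast+

lemma tens_zero_entry: "vec_space V \<Longrightarrow> set xs \<subseteq> carr V \<Longrightarrow> 0 \<in> set xs \<Longrightarrow> tens V xs = 0"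
  by (rule mlin_zero_entry[OF _ tens_mlin refl])

lemma tens_scale_all:
  "vec_space V \<Longrightarrow> length cs = length xs \<Longrightarrow> set xs \<subseteq> carr V \<Longrightarrow>
    tens V (map2 (smul V) cs xs) = fscale (prod_list cs) (tens V xs)"
  using mlin_scale_all[OF _ vec_space_tpow tens_mlin, of V cs "length xs" xs] by simp

lemma tens_singleton_eq_0:
  assumes "vec_space V" "x \<in> carr V" "tens V [x] = 0"
  shows "x = 0"
proof (rule ccontr)
  assume "x \<noteq> 0"
  then obtain f where f: "lin_on V fld f" "f x = 1" using separating_point[OF assms(1)] by blast
  have "(\<lambda>xs. f (hd xs)) \<in> tforms V 1"
    using f(1) by (simp add: tforms_iff mlin_Cons mlin_Nil)
  then show False using tens_eval[of "\<lambda>xs. f (hd xs)" V "[x]"] assms(3) f(2) by simp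
qed

text \<open>Choosing for each letter a linear form with value 1 on it gives a product form with
  value 1 on the word.\<close>

lemma tens_nonzero:
  assumes V: "vec_space V" and xs: "set xs \<subseteq> carr V" "0 \<notin> set xs"
  shows "tens V xs \<noteq> 0"
proof
  assume 0: "tens V xs = 0"
  have "\<forall>x\<in>set xs. \<exists>f. lin_on V fld f \<and> f x = 1"
    using separating_point[OF V] xs(2) by metis
  then obtain f where f: "\<And>x. x \<in> set xs \<Longrightarrow> lin_on V fld (f x)" "\<And>x. x \<in> set xs \<Longrightarrow> f x x = 1"
    by metis
  let ?g = "\<lambda>ys. prod_list (map2 (\<lambda>f x. f x) (map f xs) ys)"
  have "?g \<in> tforms V (length xs)"
    using mlin_form_prod[OF V, of "map f xs"] f(1) by (simp add: tforms_iff)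
  moreover have "map2 (\<lambda>f x. f x) (map f xs) xs = map (\<lambda>x. 1) xs"
    using f(2) by (simp add: zip_map1 zip_same_conv_map)
  ultimately show False using tens_eval[of ?g V xs] 0 by (simp add: map_replicate_const)
qed

lemma mlin_tens_map2:
  assumes "vec_space V" "\<forall>h\<in>set hs. lin_on V W h"
  shows "mlin (replicate (length hs) V) (tpow W (length hs)) (\<lambda>xs. tens W (map2 (\<lambda>h x. h x) hs xs))"
  by (rule mlin_map2[OF assms tens_mlin])

lemma mlin_tens_map:
  assumes "vec_space V" "lin_on V W f"
  shows "mlin (replicate n V) (tpow W n) (\<lambda>xs. tens W (map f xs))"
  by (rule mlin_map[OF assms tens_mlin])

lemma
  assumes V: "vec_space V" and f: "lin_on V W f"
  shows tmap_lin: "lin_on (tpow V n) (tpow W n) (tmap V W n f)"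
    and tmap_tens: "length xs = n \<Longrightarrow> set xs \<subseteq> carr V \<Longrightarrow> tmap V W n f (tens V xs) = tens W (map f xs)"
    and tmap_sum: "(\<And>i. i \<in> I \<Longrightarrow> length (ys i) = n \<and> set (ys i) \<subseteq> carr V) \<Longrightarrow>
      tmap V W n f (\<Sum>i\<in>I. fscale (a i) (tens V (ys i))) = (\<Sum>i\<in>I. fscale (a i) (tens W (map f (ys i))))"
proof -
  note M = mlin_tens_map[OF V f, of n]
  show "lin_on (tpow V n) (tpow W n) (tmap V W n f)"
    unfolding tmap_def by (rule tlift_props(1)[OF vec_space_tpow M])
  show "tmap V W n f (tens V xs) = tens W (map f xs)" if "length xs = n" "set xs \<subseteq> carr V"
    unfolding tmap_def by (rule tlift_props(2)[OF vec_space_tpow M that])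
  show "tmap V W n f (\<Sum>i\<in>I. fscale (a i) (tens V (ys i))) = (\<Sum>i\<in>I. fscale (a i) (tens W (map f (ys i))))"
    if "\<And>i. i \<in> I \<Longrightarrow> length (ys i) = n \<and> set (ys i) \<subseteq> carr V"
    unfolding tmap_def using tlift_sum[OF vec_space_tpow M, of I ys a] that by simp
qed

lemma tmap_comp:
  assumes V: "vec_space V" and W: "vec_space W" and f: "lin_on V W f" and g: "lin_on W U g"
    and h: "lin_on V U h" "\<And>x. x \<in> carr V \<Longrightarrow> h x = g (f x)" and t: "t \<in> carr (tpow V n)"
  shows "tmap W U n g (tmap V W n f t) = tmap V U n h t"
proof -
  obtain m :: nat and a xs where xs: "\<And>i. i < m \<Longrightarrow> length (xs i) = n \<and> set (xs i) \<subseteq> carr V"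
    "t = (\<Sum>i<m. fscale (a i) (tens V (xs i)))" using tpow_rep[OF t] by blast
  have m: "set (map f (xs i)) \<subseteq> carr W" "map g (map f (xs i)) = map h (xs i)" if "i < m" for i
    using xs(1)[OF that] lin_onD(1)[OF f] h(2) by auto
  have "tmap V W n f t = (\<Sum>i<m. fscale (a i) (tens W (map f (xs i))))"
    unfolding xs(2) using xs(1) by (intro tmap_sum[OF V f]) simp
  moreover have "tmap W U n g (\<Sum>i<m. fscale (a i) (tens W (map f (xs i))))
      = (\<Sum>i<m. fscale (a i) (tens U (map g (map f (xs i)))))"
    using xs(1) m(1) by (intro tmap_sum[OF W g]) simp
  ultimately have "tmap W U n g (tmap V W n f t) = (\<Sum>i<m. fscale (a i) (tens U (map g (map f (xs i)))))"
    by simp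
  also have "\<dots> = (\<Sum>i<m. fscale (a i) (tens U (map h (xs i))))"
    by (rule sum.cong) (simp_all only: m(2) lessThan_iff)
  also have "\<dots> = tmap V U n h t"
    unfolding xs(2) using xs(1) by (intro tmap_sum[OF V h(1), symmetric]) simp
  finally show ?thesis .
qed

lemma tmap_id:
  assumes V: "vec_space V" and f: "lin_on V V f" "\<And>x. x \<in> carr V \<Longrightarrow> f x = x" and t: "t \<in> carr (tpow V n)"
  shows "tmap V V n f t = t"
proof -
  obtain m :: nat and a xs where xs: "\<And>i. i < m \<Longrightarrow> length (xs i) = n \<and> set (xs i) \<subseteq> carr V"
    "t = (\<Sum>i<m. fscale (a i) (tens V (xs i)))" using tpow_rep[OF t] by blast
  have m: "map f (xs i) = xs i" if "i < m" for i
    using xs(1)[OF that] f(2) by (simp add: map_idI subset_iff)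
  have "tmap V V n f t = (\<Sum>i<m. fscale (a i) (tens V (map f (xs i))))"
    unfolding xs(2) using xs(1) by (intro tmap_sum[OF V f(1)]) simp
  then show ?thesis using m by (simp add: xs(2))
qed

text \<open>Makes \<open>tmap\<close> injective along an isomorphism, so that vanishing of a
  cooperation can be reflected.\<close>

lemma tmap_left_inverse:
  assumes "vec_space V" "vec_space W" "lin_on V W f" "lin_on W V g" "\<And>x. x \<in> carr V \<Longrightarrow> g (f x) = x"
    "t \<in> carr (tpow V n)"
  shows "tmap W V n g (tmap V W n f t) = t"
proof -
  have id: "lin_on V V (\<lambda>x. x)" by (simp add: lin_on_def)
  have "tmap W V n g (tmap V W n f t) = tmap V V n (\<lambda>x. x) t"
    using assms id by (intro tmap_comp) auto
  then show ?thesis using tmap_id[OF assms(1) id _ assms(6)] by simp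
qed

lemma inv_lin_on:
  assumes V: "vec_space V" and f: "lin_on V W f" and bij: "bij_betw f (carr V) (carr W)"
  shows "lin_on W V (inv_into (carr V) f)"
proof -
  let ?g = "inv_into (carr V) f"
  have gf: "?g (f x) = x" if "x \<in> carr V" for x
    using bij that by (simp add: bij_betw_def)
  have ex: "\<exists>x. x \<in> carr V \<and> y = f x" if "y \<in> carr W" for y
    using bij that by (auto simp: bij_betw_def)
  show ?thesis
    unfolding lin_on_def
  proof (intro conjI ballI allI)
    fix x y c assume "x \<in> carr W" "y \<in> carr W"
    then obtain u v where u: "u \<in> carr V" "x = f u" and v: "v \<in> carr V" "y = f v" using ex by blast
    show "?g x \<in> carr V" using u gf by simp
    have "?g (f (u + v)) = u + v" using gf[OF vs_add[OF V u(1) v(1)]] .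
    then show "?g (x + y) = ?g x + ?g y" using u v gf by (simp add: lin_onD(2)[OF f])
    have "?g (f (smul V c u)) = smul V c u" using gf[OF vs_smul[OF V u(1)]] .
    then show "?g (smul W c x) = smul V c (?g x)" using u gf by (simp add: lin_onD(3)[OF f])
  qed
qed

section \<open>Direct sums over arities, and multilinear extension from their generators\<close>

section \<open>Schur functors and free algebras\<close>

lemma smul_schur [simp]: "smul (schur S V) = fscale"
  by (simp add: schur_def)

lemma vec_space_schur: "vec_space (schur S V)"
  by (simp add: schur_def vec_space_presented)

lemma schur_gens_iff: "(\<mu>, xs) \<in> schur_gens S V \<longleftrightarrow> \<mu> \<in> carr (S (length xs)) \<and> set xs \<subseteq> carr V"
  by (simp add: schur_gens_def tuples_replicate)

lemma sgen_in: "\<mu> \<in> carr (S (length xs)) \<Longrightarrow> set xs \<subseteq> carr V \<Longrightarrow> sgen S V \<mu> xs \<in> carr (schur S V)"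
  unfolding schur_def sgen_def by (intro ev_in_presented) (simp add: schur_gens_iff)

lemma sgen_eval: "f \<in> schur_forms S V \<Longrightarrow> sgen S V \<mu> xs f = f (\<mu>, xs)"
  by (simp add: sgen_def ev_def)

lemma schur_rep:
  assumes "t \<in> carr (schur S V)"
  obtains m :: nat and \<mu> xs a where
    "\<And>i. i < m \<Longrightarrow> \<mu> i \<in> carr (S (length (xs i))) \<and> set (xs i) \<subseteq> carr V"
    "t = (\<Sum>i<m. fscale (a i) (sgen S V (\<mu> i) (xs i)))"
proof -
  obtain m :: nat and a g where *: "\<And>i. i < m \<Longrightarrow> g i \<in> schur_gens S V"
    "t = (\<Sum>i<m. fscale (a i) (ev (schur_forms S V) (g i)))"
    using presented_rep[OF assms[unfolded schur_def]] by blast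
  have "t = (\<Sum>i<m. fscale (a i) (sgen S V (fst (g i)) (snd (g i))))"
    unfolding *(2) sgen_def by simp
  then show ?thesis
    using that[of m "\<lambda>i. fst (g i)" "\<lambda>i. snd (g i)" a] *(1) schur_gens_iff[of "fst (g i)" "snd (g i)" S V for i]
    by simp
qed

lemma schur_ext:
  assumes "t \<in> carr (schur S V)" "t' \<in> carr (schur S V)" "\<And>f. f \<in> schur_forms S V \<Longrightarrow> t f = t' f"
  shows "t = t'"
  using assms presented_ext unfolding schur_def by blast

lemma schur_sum_in:
  assumes "\<And>i. i \<in> I \<Longrightarrow> \<mu> i \<in> carr (S (length (xs i))) \<and> set (xs i) \<subseteq> carr V"
  shows "(\<Sum>i\<in>I. fscale (a i) (sgen S V (\<mu> i) (xs i))) \<in> carr (schur S V)"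
  using assms vs_smul[OF vec_space_schur, of "sgen S V (\<mu> i) (xs i)" S V for i]
  by (intro vs_sum[OF vec_space_schur]) (auto simp: sgen_in)

lemma sgen_lin:
  assumes "set xs \<subseteq> carr V"
  shows "lin_on (S (length xs)) (schur S V) (\<lambda>\<mu>. sgen S V \<mu> xs)"
  using sgen_mlin[of S V] assms by (auto simp: schur_mlin_def tuples_replicate)

lemma mlin_sgen: "\<mu> \<in> carr (S n) \<Longrightarrow> mlin (replicate n V) (schur S V) (sgen S V \<mu>)"
  using sgen_mlin[of S V] by (auto simp: schur_mlin_def)

lemma
  assumes "vec_space W" "schur_mlin S V W (\<lambda>(\<mu>, xs). F \<mu> xs)"
  shows slift_lin: "lin_on (schur S V) W (slift S V W F)"
    and slift_sgen: "\<mu> \<in> carr (S (length xs)) \<Longrightarrow> set xs \<subseteq> carr V \<Longrightarrow> slift S V W F (sgen S V \<mu> xs) = F \<mu> xs"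
  using schur_universal[OF assms] by (simp_all add: schur_gens_iff)

lemma lin_on_schur_sum:
  assumes "lin_on (schur S V) W h" "\<And>i. i \<in> I \<Longrightarrow> \<mu> i \<in> carr (S (length (xs i))) \<and> set (xs i) \<subseteq> carr V"
  shows "h (\<Sum>i\<in>I. fscale (a i) (sgen S V (\<mu> i) (xs i))) = (\<Sum>i\<in>I. smul W (a i) (h (sgen S V (\<mu> i) (xs i))))"
  using lin_on_sum[OF vec_space_schur assms(1), of I "\<lambda>i. sgen S V (\<mu> i) (xs i)" a] assms(2)
  by (simp add: sgen_in)

lemma lin_on_schur_unique:
  assumes "lin_on (schur S V) W h" "lin_on (schur S V) W h'"
    "\<And>\<mu> xs. \<mu> \<in> carr (S (length xs)) \<Longrightarrow> set xs \<subseteq> carr V \<Longrightarrow> h (sgen S V \<mu> xs) = h' (sgen S V \<mu> xs)"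
    "t \<in> carr (schur S V)"
  shows "h t = h' t"
proof -
  obtain m :: nat and \<mu> xs a where
    t: "\<And>i. i < m \<Longrightarrow> \<mu> i \<in> carr (S (length (xs i))) \<and> set (xs i) \<subseteq> carr V"
      "t = (\<Sum>i<m. fscale (a i) (sgen S V (\<mu> i) (xs i)))"
    by (rule schur_rep[OF assms(4)]) (rule that)
  have "h t = (\<Sum>i<m. smul W (a i) (h (sgen S V (\<mu> i) (xs i))))"
    unfolding t(2) by (rule lin_on_schur_sum[OF assms(1)]) (use t(1) in blast)
  moreover have "h' t = (\<Sum>i<m. smul W (a i) (h' (sgen S V (\<mu> i) (xs i))))"
    unfolding t(2) by (rule lin_on_schur_sum[OF assms(2)]) (use t(1) in blast)
  ultimately show ?thesis using assms(3) t(1) by simp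
qed

lemma schur_mlin_iff:
  assumes V: "vec_space V"
  shows "schur_mlin S V W F \<longleftrightarrow>
    (\<forall>n \<mu>. \<mu> \<in> carr (S n) \<longrightarrow> mlin (replicate n V) W (\<lambda>xs. F (\<mu>, xs))) \<and>
    (\<forall>xs. set xs \<subseteq> carr V \<longrightarrow> lin_on (S (length xs)) W (\<lambda>\<mu>. F (\<mu>, xs)))"
  unfolding schur_mlin_def by (auto simp: tuples_replicate)

text \<open>Since the sum over arities is direct, a map may be prescribed in one arity and set to 0
  in all others. This is the source of every coefficient functional below.\<close>

lemma schur_mlin_single:
  fixes V :: "('k::field, 'v::ab_group_add) vs"
  assumes V: "vec_space V" and W: "vec_space W" and S: "\<And>n. vec_space (S n)"
    and g: "lin_on (S n) W g" and fs: "length fs = n" "\<forall>f\<in>set fs. lin_on V fld f"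
  shows "schur_mlin S V W (\<lambda>(\<nu>, ys).
    if length ys = n then smul W (prod_list (map2 (\<lambda>f y. f y) fs ys)) (g \<nu>) else 0)"
  unfolding schur_mlin_iff[OF V]
proof (intro conjI allI impI, goal_cases)
  case (1 k \<mu>)
  show ?case
  proof (cases "k = n")
    case False
    then show ?thesis
      by (subst mlin_cong[OF V, of _ _ "\<lambda>xs. 0"]) (auto simp: mlin_const_zero W)
  next
    case True
    have g\<mu>: "g \<mu> \<in> carr W" using 1 True lin_onD(1)[OF g] by simp
    have "lin_on fld W (\<lambda>c. smul W c (g \<mu>))"
      using g\<mu> by (simp add: lin_on_def vs_smul[OF W] smul_simps[OF W])
    from mlin_comp_lin[OF mlin_form_prod[OF V fs(2)] this]
    show ?thesis unfolding True fs(1)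
      by (subst mlin_cong[OF V, of _ _ "\<lambda>xs. smul W (prod_list (map2 (\<lambda>f x. f x) fs xs)) (g \<mu>)"]) auto
  qed
next
  case (2 ys)
  show ?case
  proof (cases "length ys = n")
    case True
    then show ?thesis using g lin_on_scaled[OF W g] by simp
  qed (simp add: lin_on_const_zero W)
qed

text \<open>As for \<open>tens_nonzero\<close>, with one more factor: a form on operations with
  value 1 at \<open>\<mu>\<close>.\<close>

lemma sgen_nonzero:
  fixes V :: "('k::field, 'v::ab_group_add) vs"
  assumes V: "vec_space V" and S: "\<And>n. vec_space (S n)"
    and "\<mu> \<in> carr (S (length xs))" "\<mu> \<noteq> 0" "set xs \<subseteq> carr V" "0 \<notin> set xs"
  shows "sgen S V \<mu> xs \<noteq> 0"
proof
  assume 0: "sgen S V \<mu> xs = 0"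
  have "\<forall>x\<in>set xs. \<exists>f. lin_on V fld f \<and> f x = 1"
    using separating_point[OF V] assms(6) by metis
  then obtain f where f: "\<And>x. x \<in> set xs \<Longrightarrow> lin_on V fld (f x)" "\<And>x. x \<in> set xs \<Longrightarrow> f x x = 1"
    by metis
  obtain g where g: "lin_on (S (length xs)) fld g" "g \<mu> = 1"
    using separating_point[OF S assms(4)] by blast
  let ?F = "\<lambda>(\<nu>, ys). if length ys = length xs
    then smul fld (prod_list (map2 (\<lambda>f y. f y) (map f xs) ys)) (g \<nu>) else 0"
  have "?F \<in> schur_forms S V"
    unfolding schur_forms_def mem_Collect_eq
    by (rule schur_mlin_single[OF V vec_space_fld, where n = "length xs"]) (use f S g(1) in auto)
  from sgen_eval[OF this, of \<mu> xs] 0 g(2)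
  have "prod_list (map2 (\<lambda>f y. f y) (map f xs) xs) = 0" by simp
  moreover have "map2 (\<lambda>f x. f x) (map f xs) xs = map (\<lambda>x. 1) xs"
    using f(2) by (simp add: zip_map1 zip_same_conv_map)
  ultimately show False by (simp add: map_replicate_const)
qed

lemma smap_sgen:
  assumes V: "vec_space V" and f: "lin_on V W f"
  shows "\<mu> \<in> carr (S (length xs)) \<Longrightarrow> set xs \<subseteq> carr V \<Longrightarrow>
      smap S V W f (sgen S V \<mu> xs) = sgen S W \<mu> (map f xs)"
proof -
  have "schur_mlin S V (schur S W) (\<lambda>(\<mu>, xs). sgen S W \<mu> (map f xs))"
    unfolding schur_mlin_iff[OF V] prod.case
  proof (intro conjI allI impI)
    show "mlin (replicate n V) (schur S W) (\<lambda>xs. sgen S W \<mu> (map f xs))" if "\<mu> \<in> carr (S n)" for n \<mu>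
      by (rule mlin_map[OF V f mlin_sgen[of _ S, OF that]])
    show "lin_on (S (length xs)) (schur S W) (\<lambda>\<mu>. sgen S W \<mu> (map f xs))" if "set xs \<subseteq> carr V" for xs
      using sgen_lin[of "map f xs" W S] lin_onD(1)[OF f] that by (simp add: subset_iff image_iff) blast
  qed
  from slift_sgen[OF vec_space_schur this]
  show "\<mu> \<in> carr (S (length xs)) \<Longrightarrow> set xs \<subseteq> carr V \<Longrightarrow>
      smap S V W f (sgen S V \<mu> xs) = sgen S W \<mu> (map f xs)"
    unfolding smap_def by blast+
qed

text \<open>Extension in several variables, one variable at a time: with the first generator
  \<open>g\<close> fixed, the induction hypothesis extends in the others to \<open>K g\<close>;
  uniqueness of that extension makes \<open>K g\<close> respect the relations in \<open>g\<close>,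
  so it lifts in the first variable too.\<close>

lemma multi_slift:
  fixes V :: "('k::field, 'v::ab_group_add) vs" and W :: "('k, 'w::ab_group_add) vs"
    and S :: "nat \<Rightarrow> ('k, 's::ab_group_add) vs"
  assumes V: "vec_space V" and W: "vec_space W" and S: "\<And>n. vec_space (S n)"
    and "\<And>gs. length gs = k \<Longrightarrow> set gs \<subseteq> schur_gens S V \<Longrightarrow> F gs \<in> carr W"
    and "\<And>us vs. length us + length vs + 1 = k \<Longrightarrow> set us \<subseteq> schur_gens S V \<Longrightarrow> set vs \<subseteq> schur_gens S V \<Longrightarrow>
      schur_mlin S V W (\<lambda>g. F (us @ g # vs))"
  shows "\<exists>G. mlin (replicate k (schur S V)) W G \<and>
    (\<forall>gs. length gs = k \<longrightarrow> set gs \<subseteq> schur_gens S V \<longrightarrow> G (map (ev (schur_forms S V)) gs) = F gs)"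
  using assms(4,5)
proof (induction k arbitrary: F)
  case 0
  then show ?case by (intro exI[of _ "\<lambda>_. F []"]) (simp add: mlin_Nil)
next
  case (Suc k)
  let ?\<Phi> = "schur_forms S V" and ?G = "schur_gens S V"
  have "\<forall>g\<in>?G. \<exists>G. mlin (replicate k (schur S V)) W G \<and>
      (\<forall>gs. length gs = k \<longrightarrow> set gs \<subseteq> ?G \<longrightarrow> G (map (ev ?\<Phi>) gs) = F (g # gs))"
  proof
    fix g assume "g \<in> ?G"
    then show "\<exists>G. mlin (replicate k (schur S V)) W G \<and>
      (\<forall>gs. length gs = k \<longrightarrow> set gs \<subseteq> ?G \<longrightarrow> G (map (ev ?\<Phi>) gs) = F (g # gs))"
      using Suc.prems(1) Suc.prems(2)[of "g # us" for us] by (intro Suc.IH[of "\<lambda>gs. F (g # gs)"]) simp_all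
  qed
  then obtain K where K: "\<And>g. g \<in> ?G \<Longrightarrow> mlin (replicate k (schur S V)) W (K g)"
    "\<And>g gs. g \<in> ?G \<Longrightarrow> length gs = k \<Longrightarrow> set gs \<subseteq> ?G \<Longrightarrow> K g (map (ev ?\<Phi>) gs) = F (g # gs)"
    by metis
  have sm: "schur_mlin S V W (\<lambda>g. F (g # gs))" if "length gs = k" "set gs \<subseteq> ?G" for gs
    using Suc.prems(2)[of "[]" gs] that by simp
  \<comment> \<open>Uniqueness turns linear relations between the values of \<open>F\<close> on
    generators into the same relations between the extensions \<open>K g\<close>; \<open>add\<close>
    and \<open>scale\<close> are the two instances needed.\<close>
  have ext: "H ts = H' ts"
    if "mlin (replicate k (schur S V)) W H" "mlin (replicate k (schur S V)) W H'"
      "\<And>gs. length gs = k \<Longrightarrow> set gs \<subseteq> ?G \<Longrightarrow> H (map (ev ?\<Phi>) gs) = H' (map (ev ?\<Phi>) gs)"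
      "ts \<in> tuples (replicate k (schur S V))" for H H' ts
    using mlin_presented_unique[OF W that(1,2)[unfolded schur_def] that(3) that(4)[unfolded schur_def]] by blast
  have add: "K g3 ts = K g1 ts + K g2 ts"
    if "g1 \<in> ?G" "g2 \<in> ?G" "g3 \<in> ?G" "ts \<in> tuples (replicate k (schur S V))"
      "\<And>gs. length gs = k \<Longrightarrow> set gs \<subseteq> ?G \<Longrightarrow> F (g3 # gs) = F (g1 # gs) + F (g2 # gs)" for g1 g2 g3 ts
    using ext[OF K(1)[OF that(3)] mlin_plus[OF W K(1)[OF that(1)] K(1)[OF that(2)]] _ that(4)] that(1-3,5)
    by (simp add: K(2))
  have scale: "K g2 ts = smul W c (K g1 ts)"
    if "g1 \<in> ?G" "g2 \<in> ?G" "ts \<in> tuples (replicate k (schur S V))"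
      "\<And>gs. length gs = k \<Longrightarrow> set gs \<subseteq> ?G \<Longrightarrow> F (g2 # gs) = smul W c (F (g1 # gs))" for g1 g2 c ts
    using ext[OF K(1)[OF that(2)] mlin_scaled[OF W K(1)[OF that(1)]] _ that(3)] that(1,2,4)
    by (simp add: K(2))
  have Ksm: "schur_mlin S V W (\<lambda>(\<mu>, xs). K (\<mu>, xs) ts)"
    if ts: "ts \<in> tuples (replicate k (schur S V))" for ts
    unfolding schur_mlin_iff[OF V] prod.case
  proof (intro conjI allI impI)
    fix n \<mu> assume \<mu>: "\<mu> \<in> carr (S n)"
    have sm1: "mlin (replicate n V) W (\<lambda>xs. F ((\<mu>, xs) # gs))" if "length gs = k" "set gs \<subseteq> ?G" for gs
      using sm[OF that] \<mu> by (simp add: schur_mlin_iff[OF V])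
    show "mlin (replicate n V) W (\<lambda>xs. K (\<mu>, xs) ts)"
      unfolding mlin_iff[OF V]
    proof (intro conjI allI impI)
      show "K (\<mu>, xs) ts \<in> carr W" if "length xs = n" "set xs \<subseteq> carr V" for xs
        using that \<mu> by (intro mlinD[OF K(1) ts]) (simp add: schur_gens_iff)
      fix us vs assume uv: "length us + length vs + 1 = n" "set us \<subseteq> carr V" "set vs \<subseteq> carr V"
      have gen: "(\<mu>, us @ x # vs) \<in> ?G" if "x \<in> carr V" for x
        using uv \<mu> that by (auto simp: schur_gens_iff)
      have lin: "lin_on V W (\<lambda>x. F ((\<mu>, us @ x # vs) # gs))" if "length gs = k" "set gs \<subseteq> ?G" for gs
        using mlin_slot[OF V sm1[OF that] uv] by simp
      show "lin_on V W (\<lambda>x. K (\<mu>, us @ x # vs) ts)"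
        unfolding lin_on_def
        by (intro conjI ballI allI mlinD[OF K(1) ts] add[OF _ _ _ ts] scale[OF _ _ ts] gen
            vs_add[OF V] vs_smul[OF V] lin_onD(2)[OF lin] lin_onD(3)[OF lin])
    qed
  next
    fix xs assume xs: "set xs \<subseteq> carr V"
    have gen: "(\<mu>, xs) \<in> ?G" if "\<mu> \<in> carr (S (length xs))" for \<mu>
      using xs that by (simp add: schur_gens_iff)
    have lin: "lin_on (S (length xs)) W (\<lambda>\<mu>. F ((\<mu>, xs) # gs))" if "length gs = k" "set gs \<subseteq> ?G" for gs
      using sm[OF that] xs by (simp add: schur_mlin_iff[OF V])
    show "lin_on (S (length xs)) W (\<lambda>\<mu>. K (\<mu>, xs) ts)"
      unfolding lin_on_def
      by (intro conjI ballI allI mlinD[OF K(1) ts] add[OF _ _ _ ts] scale[OF _ _ ts] gen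
          vs_add[OF S] vs_smul[OF S] lin_onD(2)[OF lin] lin_onD(3)[OF lin])
  qed
  \<comment> \<open>The first variable is lifted last. Multilinearity in the others survives because
    each \<open>t\<close> is a finite sum of generators.\<close>
  let ?H = "\<lambda>ts. slift S V W (\<lambda>\<mu> xs. K (\<mu>, xs) (tl ts)) (hd ts)"
  have "mlin (replicate (Suc k) (schur S V)) W ?H"
    unfolding replicate_Suc mlin_Cons list.sel
  proof (intro conjI ballI)
    show "lin_on (schur S V) W (slift S V W (\<lambda>\<mu> xs. K (\<mu>, xs) ts))"
      if "ts \<in> tuples (replicate k (schur S V))" for ts
      by (rule slift_lin[OF W Ksm[OF that]])
    fix t assume t0: "t \<in> carr (schur S V)"
    obtain m :: nat and \<mu> xs a where
      t: "\<And>i. i < m \<Longrightarrow> \<mu> i \<in> carr (S (length (xs i))) \<and> set (xs i) \<subseteq> carr V"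
        "t = (\<Sum>i<m. fscale (a i) (sgen S V (\<mu> i) (xs i)))"
      by (rule schur_rep[OF t0]) (rule that)
    have eq: "slift S V W (\<lambda>\<mu> xs. K (\<mu>, xs) ts) t = (\<Sum>i<m. smul W (a i) (K (\<mu> i, xs i) ts))"
      if "ts \<in> tuples (replicate k (schur S V))" for ts
    proof -
      have "slift S V W (\<lambda>\<mu> xs. K (\<mu>, xs) ts) t =
          (\<Sum>i<m. smul W (a i) (slift S V W (\<lambda>\<mu> xs. K (\<mu>, xs) ts) (sgen S V (\<mu> i) (xs i))))"
        unfolding t(2) by (rule lin_on_schur_sum[OF slift_lin[OF W Ksm[OF that]]]) (use t(1) in blast)
      then show ?thesis using t(1) by (simp add: slift_sgen[OF W Ksm[OF that]])
    qed
    have "mlin (replicate k (schur S V)) W (\<lambda>ts. \<Sum>i<m. smul W (a i) (K (\<mu> i, xs i) ts))"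
      using t(1) by (intro mlin_sum[OF W] mlin_scaled[OF W] K(1)) (simp add: schur_gens_iff)
    then show "mlin (replicate k (schur S V)) W (\<lambda>ts. slift S V W (\<lambda>\<mu> xs. K (\<mu>, xs) ts) t)"
      by (subst mlin_cong[OF vec_space_schur]) (simp_all add: eq tuples_replicate)
  qed
  moreover have "?H (map (ev ?\<Phi>) gs) = F gs" if gs: "length gs = Suc k" "set gs \<subseteq> ?G" for gs
  proof -
    obtain \<mu> xs gs' where gs': "gs = (\<mu>, xs) # gs'" "length gs' = k" "set gs' \<subseteq> ?G" "(\<mu>, xs) \<in> ?G"
      using gs by (auto simp: length_Suc_conv)
    have "map (ev ?\<Phi>) gs' \<in> tuples (replicate k (schur S V))"
      using gs' ev_in_presented[of _ "?G" ?\<Phi>] by (auto simp: tuples_replicate schur_def)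
    from slift_sgen[OF W Ksm[OF this], of \<mu> xs] show ?thesis
      using gs' K(2)[of "(\<mu>, xs)" gs'] by (simp add: schur_gens_iff sgen_def)
  qed
  ultimately show ?case by blast
qed

section \<open>Operad units, and the existence and values of the action on the free algebra\<close>

section \<open>Operads and free algebras\<close>

lemma connected_operadD:
  assumes "connected_operad A"
  shows "ns_operad A" "vec_space (ospace A n)" "fin_dim (ospace A n)" "\<mu> \<in> ops A 0 \<Longrightarrow> \<mu> = 0"
    "ounit A \<in> ops A (Suc 0)" "ounit A \<noteq> 0"
    "\<mu> \<in> ops A (Suc 0) \<Longrightarrow> \<exists>c. \<mu> = smul (ospace A (Suc 0)) c (ounit A)"
  using assms by (auto simp: connected_operad_def ns_operad_def)

lemma unit_coeff_unique:
  assumes "connected_operad A"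
  shows "unit_coeff A (smul (ospace A (Suc 0)) c (ounit A)) = c"
proof -
  interpret vector_space "smul (ospace A (Suc 0))"
    using connected_operadD(2)[OF assms] by (rule vec_space_vector_space)
  show ?thesis
    unfolding unit_coeff_def using connected_operadD(6)[OF assms] by (auto simp: scale_right_imp_eq)
qed

lemma unit_coeff:
  assumes "connected_operad A" "\<mu> \<in> ops A (Suc 0)"
  shows "\<mu> = smul (ospace A (Suc 0)) (unit_coeff A \<mu>) (ounit A)"
  using connected_operadD(7)[OF assms] unit_coeff_unique[OF assms(1)] by auto

lemma ocomp_in:
  assumes "ns_operad A" "\<mu> \<in> ops A (length is)" "\<nu>s \<in> tuples (map (ospace A) is)"
  shows "ocomp A is \<mu> \<nu>s \<in> ops A (sum_list is)"
  using assms unfolding ns_operad_def by (metis mlinD)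

lemma ocomp_slot_lin:
  assumes "ns_operad A" "\<mu> \<in> ops A (length (is @ n # js))"
    "\<nu>s \<in> tuples (map (ospace A) is)" "\<rho>s \<in> tuples (map (ospace A) js)"
  shows "lin_on (ospace A n) (ospace A (sum_list (is @ n # js))) (\<lambda>\<nu>. ocomp A (is @ n # js) \<mu> (\<nu>s @ \<nu> # \<rho>s))"
proof -
  have "mlin (map (ospace A) (is @ n # js)) (ospace A (sum_list (is @ n # js))) (ocomp A (is @ n # js) \<mu>)"
    using assms unfolding ns_operad_def by blast
  then have "mlin (ospace A n # map (ospace A) js) (ospace A (sum_list (is @ n # js)))
      (\<lambda>\<nu>s'. ocomp A (is @ n # js) \<mu> (\<nu>s @ \<nu>s'))"
    unfolding map_append list.map mlin_append_iff using assms(3) by blast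
  then show ?thesis using assms(4) unfolding mlin_Cons by blast
qed

lemma algebraD:
  assumes "algebra A V act"
  shows "vec_space V" "\<mu> \<in> ops A n \<Longrightarrow> mlin (replicate n V) V (act \<mu>)"
    "set xs \<subseteq> carr V \<Longrightarrow> lin_on (ospace A (length xs)) V (\<lambda>\<mu>. act \<mu> xs)"
    "x \<in> carr V \<Longrightarrow> act (ounit A) [x] = x"
    "\<mu> \<in> ops A (length xss) \<Longrightarrow> xss \<in> lists (lists (carr V)) \<Longrightarrow>
        \<nu>s \<in> tuples (map (\<lambda>xs. ospace A (length xs)) xss) \<Longrightarrow>
        act (ocomp A (map length xss) \<mu> \<nu>s) (concat xss) = act \<mu> (map2 act \<nu>s xss)"
  using assms unfolding algebra_def by (blast | simp add: tuples_replicate)+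

lemma act_in: "algebra A V act \<Longrightarrow> \<mu> \<in> ops A (length xs) \<Longrightarrow> set xs \<subseteq> carr V \<Longrightarrow> act \<mu> xs \<in> carr V"
  by (rule mlinD[OF algebraD(2)]) (auto simp: tuples_replicate)

lemma coalgebraD:
  assumes "coalgebra C V coact"
  shows "vec_space V" "\<delta> \<in> ops C n \<Longrightarrow> lin_on V (tpow V n) (coact n \<delta>)"
    "x \<in> carr V \<Longrightarrow> lin_on (ospace C n) (tpow V n) (\<lambda>\<delta>. coact n \<delta> x)"
    "x \<in> carr V \<Longrightarrow> coact (Suc 0) (ounit C) x = tens V [x]"
    "\<delta> \<in> ops C (length is) \<Longrightarrow> \<delta>s \<in> tuples (map (ospace C) is) \<Longrightarrow> x \<in> carr V \<Longrightarrow>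
          coact (sum_list is) (ocomp C is \<delta> \<delta>s) x =
          tlift V (length is) (tpow V (sum_list is))
             (\<lambda>xs. tconcat V is (map2 (\<lambda>(i, \<delta>') y. coact i \<delta>' y) (zip is \<delta>s) xs))
             (coact (length is) \<delta> x)"
  using assms unfolding coalgebra_def by (blast | simp)+

lemma mlin_sgen_around:
  assumes "\<mu> \<in> carr (S (length us + n + length vs))" "set us \<subseteq> carr V" "set vs \<subseteq> carr V"
  shows "mlin (replicate n V) (schur S V) (\<lambda>xs. sgen S V \<mu> (us @ xs @ vs))"
  using mlin_sgen[of \<mu> S "length us + n + length vs" V] assms
  by (simp add: replicate_add mlin_append_iff tuples_replicate)

text \<open>\<open>free_act\<close> is a choice, so its defining property must be shown satisfiable.
  Operad composition dictates the value on generators, and \<open>multi_slift\<close> extends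
  it.\<close>

lemma free_act_ex:
  fixes A :: "('k::field, 'a::ab_group_add) operad" and V :: "('k, 'v::ab_group_add) vs"
  assumes A: "ns_operad A" and V: "vec_space V" and \<mu>: "\<mu> \<in> ops A k"
  shows "\<exists>G. mlin (replicate k (free_alg A V)) (free_alg A V) G \<and>
    (\<forall>xss \<nu>s. length xss = k \<longrightarrow> xss \<in> lists (lists (carr V)) \<longrightarrow>
       \<nu>s \<in> tuples (map (\<lambda>xs. ospace A (length xs)) xss) \<longrightarrow>
       G (map2 (sgen (ospace A) V) \<nu>s xss) = sgen (ospace A) V (ocomp A (map length xss) \<mu> \<nu>s) (concat xss))"
proof -
  let ?S = "ospace A" and ?G = "schur_gens (ospace A) V"
  define F where "F gs = sgen ?S V (ocomp A (map (length \<circ> snd) gs) \<mu> (map fst gs)) (concat (map snd gs))"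
    for gs :: "('a \<times> 'v list) list"
  have S: "vec_space (?S n)" for n using A by (simp add: ns_operad_def)
  have tup: "map fst gs \<in> tuples (map ?S (map (length \<circ> snd) gs))" if "set gs \<subseteq> ?G" for gs
    using that by (induction gs) (auto simp: schur_gens_iff)
  have conc: "set (concat (map snd gs)) \<subseteq> carr V" if "set gs \<subseteq> ?G" for gs
    using that by (induction gs) (auto simp: schur_gens_iff)
  have len: "length (concat (map snd gs)) = sum_list (map (length \<circ> snd) gs)" for gs :: "('a \<times> 'v list) list"
    by (simp add: length_concat)
  have "\<exists>G. mlin (replicate k (schur ?S V)) (schur ?S V) G \<and>
    (\<forall>gs. length gs = k \<longrightarrow> set gs \<subseteq> ?G \<longrightarrow> G (map (ev (schur_forms ?S V)) gs) = F gs)"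
  proof (rule multi_slift[OF V vec_space_schur S])
    show "F gs \<in> carr (schur ?S V)" if "length gs = k" "set gs \<subseteq> ?G" for gs
      unfolding F_def
      using ocomp_in[OF A _ tup[OF that(2)], of \<mu>] \<mu> that(1) conc[OF that(2)] len[of gs]
      by (intro sgen_in) simp_all
    fix us vs assume uv: "length us + length vs + 1 = k" "set us \<subseteq> ?G" "set vs \<subseteq> ?G"
    let ?is = "map (length \<circ> snd) us" and ?js = "map (length \<circ> snd) vs"
    have \<mu>': "\<mu> \<in> ops A (length (?is @ n # ?js))" for n using \<mu> uv by simp
    show "schur_mlin ?S V (schur ?S V) (\<lambda>g. F (us @ g # vs))"
      unfolding schur_mlin_iff[OF V]
    proof (intro conjI allI impI)
      fix n \<nu> assume \<nu>: "\<nu> \<in> ops A n"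
      let ?\<theta> = "ocomp A (?is @ n # ?js) \<mu> (map fst us @ \<nu> # map fst vs)"
      have "?\<theta> \<in> ops A (sum_list (?is @ n # ?js))"
        using \<nu> lin_onD(1)[OF ocomp_slot_lin[OF A \<mu>' tup[OF uv(2)] tup[OF uv(3)]]] by blast
      then have "mlin (replicate n V) (schur ?S V)
          (\<lambda>xs. sgen ?S V ?\<theta> (concat (map snd us) @ xs @ concat (map snd vs)))"
        using conc[OF uv(2)] conc[OF uv(3)] by (intro mlin_sgen_around) (simp_all add: len add.assoc)
      then show "mlin (replicate n V) (schur ?S V) (\<lambda>xs. F (us @ (\<nu>, xs) # vs))"
        by (subst mlin_cong[OF V]) (auto simp: F_def)
    next
      fix xs assume xs: "set xs \<subseteq> carr V"
      let ?ys = "concat (map snd us) @ xs @ concat (map snd vs)"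
      have "set ?ys \<subseteq> carr V" using conc[OF uv(2)] conc[OF uv(3)] xs by simp
      from sgen_lin[OF this, of ?S]
      have "lin_on (?S (sum_list (?is @ length xs # ?js))) (schur ?S V) (\<lambda>\<theta>. sgen ?S V \<theta> ?ys)"
        by (simp add: len)
      from lin_on_comp[OF ocomp_slot_lin[OF A \<mu>' tup[OF uv(2)] tup[OF uv(3)]] this]
      show "lin_on (?S (length xs)) (schur ?S V) (\<lambda>\<nu>. F (us @ (\<nu>, xs) # vs))"
        by (simp add: F_def)
    qed
  qed
  then obtain G where G: "mlin (replicate k (schur ?S V)) (schur ?S V) G"
    "\<And>gs. length gs = k \<Longrightarrow> set gs \<subseteq> ?G \<Longrightarrow> G (map (ev (schur_forms ?S V)) gs) = F gs" by blast
  have "G (map2 (sgen ?S V) \<nu>s xss) = sgen ?S V (ocomp A (map length xss) \<mu> \<nu>s) (concat xss)"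
    if "length xss = k" "xss \<in> lists (lists (carr V))" "\<nu>s \<in> tuples (map (\<lambda>xs. ?S (length xs)) xss)" for xss \<nu>s
  proof -
    have l: "length \<nu>s = length xss" using length_tuples[OF that(3)] by simp
    have "set (zip \<nu>s xss) \<subseteq> ?G"
      using that(2,3) l by (auto simp: set_zip schur_gens_iff tuples_iff list_all2_conv_all_nth in_lists_conv_set)
        (metis in_lists_conv_set in_listsD nth_mem subsetD)
    from G(2)[OF _ this] show ?thesis
      using l that(1) by (simp add: F_def sgen_def[abs_def] case_prod_unfold map_fst_zip map_snd_zip comp_def
          flip: map_map[of length snd, unfolded comp_def])
  qed
  then show ?thesis using G(1) unfolding free_alg_def by blast
qed

lemma free_act_sgen:
  fixes A :: "('k::field, 'a::ab_group_add) operad" and V :: "('k, 'v::ab_group_add) vs"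
  assumes A: "ns_operad A" and V: "vec_space V" and \<mu>: "\<mu> \<in> ops A (length xss)"
    and xss: "xss \<in> lists (lists (carr V))"
    and \<nu>s: "\<nu>s \<in> tuples (map (\<lambda>xs. ospace A (length xs)) xss)"
  shows "free_act A V \<mu> (map2 (sgen (ospace A) V) \<nu>s xss) =
      sgen (ospace A) V (ocomp A (map length xss) \<mu> \<nu>s) (concat xss)"
proof -
  have l: "length (map2 (sgen (ospace A) V) \<nu>s xss) = length xss"
    using length_tuples[OF \<nu>s] by simp
  show ?thesis
    unfolding free_act_def l
    using someI_ex[OF free_act_ex[OF A V \<mu>]] xss \<nu>s by blast
qed

text \<open>The unit axiom of the operad. It lets statements about operations applied to primitive
  elements be applied to generators of a free algebra, once the letters are known to be
  primitive.\<close>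

lemma sgen_eq_free_act:
  assumes A: "ns_operad A" and V: "vec_space V" and \<mu>: "\<mu> \<in> ops A (length xs)" and xs: "set xs \<subseteq> carr V"
  shows "sgen (ospace A) V \<mu> xs = free_act A V \<mu> (map (free_incl A V) xs)"
proof -
  let ?xss = "map (\<lambda>x. [x]) xs" and ?\<nu>s = "replicate (length xs) (ounit A)"
  have u: "ounit A \<in> ops A (Suc 0)" using A by (simp add: ns_operad_def)
  have 1: "map length ?xss = replicate (length xs) 1" by (simp add: map_replicate_const comp_def)
  have 2: "map2 (sgen (ospace A) V) ?\<nu>s ?xss = map (free_incl A V) xs"
    by (simp add: zip_replicate1 free_incl_def comp_def)
  have 3: "ocomp A (replicate (length xs) 1) \<mu> ?\<nu>s = \<mu>"
    using A \<mu> unfolding ns_operad_def by blast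
  have "?\<nu>s \<in> tuples (map (\<lambda>xs. ospace A (length xs)) ?xss)"
    using u by (simp add: tuples_iff list_all2_conv_all_nth)
  moreover have "?xss \<in> lists (lists (carr V))" using xs by (auto simp: in_lists_conv_set)
  ultimately have "free_act A V \<mu> (map2 (sgen (ospace A) V) ?\<nu>s ?xss) =
      sgen (ospace A) V (ocomp A (map length ?xss) \<mu> ?\<nu>s) (concat ?xss)"
    using \<mu> by (intro free_act_sgen[OF A V]) simp_all
  then show ?thesis unfolding 1 2 3 by (simp add: concat_map_singleton[where f = "\<lambda>x. x", simplified])
qed

lemma vec_space_free_alg: "vec_space (free_alg A V)"
  by (simp add: free_alg_def vec_space_schur)

lemma smul_free_alg [simp]: "smul (free_alg A V) = fscale"
  by (simp add: free_alg_def)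

lemma free_incl_in:
  "connected_operad A \<Longrightarrow> x \<in> carr V \<Longrightarrow> free_incl A V x \<in> carr (free_alg A V)"
  unfolding free_incl_def free_alg_def using connected_operadD(5) by (intro sgen_in) auto

section \<open>The extension of an inclusion to the free algebra\<close>

lemma
  assumes alg: "algebra A H act" and L: "vec_space L" "carr L \<subseteq> carr H" "smul L = smul H"
  shows free_ext_lin: "lin_on (free_alg A L) H (slift (ospace A) L H act)"
    and free_ext_sgen: "\<mu> \<in> ops A (length xs) \<Longrightarrow> set xs \<subseteq> carr L \<Longrightarrow>
      slift (ospace A) L H act (sgen (ospace A) L \<mu> xs) = act \<mu> xs"
proof -
  have "schur_mlin (ospace A) L H (\<lambda>(\<mu>, xs). act \<mu> xs)"
    unfolding schur_mlin_iff[OF L(1)] prod.case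
  proof (intro conjI allI impI)
    show "mlin (replicate n L) H (act \<mu>)" if "\<mu> \<in> ops A n" for n \<mu>
    proof -
      have inc: "lin_on L H (\<lambda>x. x)" using L by (auto simp: lin_on_def)
      show ?thesis using mlin_map[OF L(1) inc algebraD(2)[OF alg that]] by simp
    qed
    show "lin_on (ospace A (length xs)) H (\<lambda>\<mu>. act \<mu> xs)" if "set xs \<subseteq> carr L" for xs
      using that L by (intro algebraD(3)[OF alg]) auto
  qed
  from slift_lin[OF algebraD(1)[OF alg] this] slift_sgen[OF algebraD(1)[OF alg] this]
  show "lin_on (free_alg A L) H (slift (ospace A) L H act)"
    and "\<mu> \<in> ops A (length xs) \<Longrightarrow> set xs \<subseteq> carr L \<Longrightarrow>
      slift (ospace A) L H act (sgen (ospace A) L \<mu> xs) = act \<mu> xs"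
    unfolding free_alg_def by blast+
qed

text \<open>Both sides are multilinear, so generators suffice; there the claim is the associativity
  axiom of the algebra \<open>H\<close>.\<close>

lemma free_ext_act:
  assumes A: "ns_operad A" and alg: "algebra A H act"
    and L: "vec_space L" "carr L \<subseteq> carr H" "smul L = smul H"
    and free: "algebra A (free_alg A L) (free_act A L)"
    and \<mu>: "\<mu> \<in> ops A (length ts)" and ts: "set ts \<subseteq> carr (free_alg A L)"
  shows "slift (ospace A) L H act (free_act A L \<mu> ts) = act \<mu> (map (slift (ospace A) L H act) ts)"
proof -
  let ?S = "ospace A" and ?\<theta> = "slift (ospace A) L H act" and ?n = "length ts"
  note lin = free_ext_lin[OF alg L] and sg = free_ext_sgen[OF alg L]
  show ?thesis
  proof (rule mlin_presented_unique[where F = "\<lambda>ts. ?\<theta> (free_act A L \<mu> ts)" and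
        F' = "\<lambda>ts. act \<mu> (map ?\<theta> ts)" and n = ?n and W = H and \<Phi> = "schur_forms ?S L" and G = "schur_gens ?S L"])
    show "mlin (replicate ?n (presented (schur_forms ?S L) (schur_gens ?S L))) H (\<lambda>ts. ?\<theta> (free_act A L \<mu> ts))"
      using mlin_comp_lin[OF algebraD(2)[OF free \<mu>] lin] by (simp add: free_alg_def schur_def)
    show "mlin (replicate ?n (presented (schur_forms ?S L) (schur_gens ?S L))) H (\<lambda>ts. act \<mu> (map ?\<theta> ts))"
      using mlin_map[OF vec_space_free_alg lin algebraD(2)[OF alg \<mu>]] by (simp add: free_alg_def schur_def)
    show "ts \<in> tuples (replicate ?n (presented (schur_forms ?S L) (schur_gens ?S L)))"
      using ts by (simp add: tuples_replicate free_alg_def schur_def)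
    fix gs assume gs: "length gs = ?n" "set gs \<subseteq> schur_gens ?S L"
    let ?xss = "map snd gs" and ?\<nu>s = "map fst gs"
    have xss: "?xss \<in> lists (lists (carr L))"
      using gs(2) by (fastforce simp: in_lists_conv_set schur_gens_def tuples_replicate)
    then have xssH: "?xss \<in> lists (lists (carr H))" using L(2) by (auto simp: in_lists_conv_set)
    have \<nu>s: "?\<nu>s \<in> tuples (map (\<lambda>xs. ?S (length xs)) ?xss)"
      using gs(2) by (induction gs) (auto simp: schur_gens_iff)
    have ev: "map (ev (schur_forms ?S L)) gs = map2 (sgen ?S L) ?\<nu>s ?xss"
      by (simp add: zip_map_fst_snd case_prod_unfold sgen_def)
    have \<mu>': "\<mu> \<in> ops A (length ?xss)" using \<mu> gs by simp
    have "ocomp A (map length ?xss) \<mu> ?\<nu>s \<in> ops A (sum_list (map length ?xss))"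
      using \<mu>' \<nu>s by (intro ocomp_in[OF A]) (simp_all add: comp_def)
    moreover have "set (concat ?xss) \<subseteq> carr L" using xss by (auto simp: in_lists_conv_set)
    ultimately have "?\<theta> (free_act A L \<mu> (map (ev (schur_forms ?S L)) gs)) = act (ocomp A (map length ?xss) \<mu> ?\<nu>s) (concat ?xss)"
      unfolding ev free_act_sgen[OF A L(1) \<mu>' xss \<nu>s] by (intro sg) (simp_all add: length_concat)
    also have "\<dots> = act \<mu> (map2 act ?\<nu>s ?xss)"
      by (rule algebraD(5)[OF alg \<mu>' xssH \<nu>s])
    also have "map2 act ?\<nu>s ?xss = map ?\<theta> (map (ev (schur_forms ?S L)) gs)"
      using gs(2) sg by (auto simp: zip_map_fst_snd case_prod_unfold sgen_def schur_gens_def tuples_replicate)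
    finally show "?\<theta> (free_act A L \<mu> (map (ev (schur_forms ?S L)) gs)) = act \<mu> (map ?\<theta> (map (ev (schur_forms ?S L)) gs))" .
  qed (rule algebraD(1)[OF alg])
qed

section \<open>Arity counting for relations applied to words whose letters are primitive\<close>

section \<open>Cooperations on words in primitive elements\<close>

text \<open>The component along the identity. For a cooperation it is the scalar by which it acts on
  a primitive element; for an operation it is the scalar by which it acts on a block of one letter.
  The same notion therefore serves both operads.\<close>

definition lin_coeff :: "('k::field, 'a::ab_group_add) operad \<Rightarrow> nat \<times> 'a \<Rightarrow> 'k" where
  "lin_coeff A p = (if fst p = 1 then unit_coeff A (snd p) else 0)"

definition lin_coeffs :: "('k::field, 'a::ab_group_add) operad \<Rightarrow> (nat \<times> 'a) list \<Rightarrow> 'k" where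
  "lin_coeffs A P = prod_list (map (lin_coeff A) P)"

definition act_blocks :: "('a \<Rightarrow> 'v list \<Rightarrow> 'w) \<Rightarrow> (nat \<times> 'a) list \<Rightarrow> 'v list \<Rightarrow> 'w list" where
  "act_blocks act P xs = map2 (\<lambda>(i, \<mu>) zs. act \<mu> zs) P (blocks (map fst P) xs)"

lemma lin_coeffs_simps [simp]:
  "lin_coeffs A [] = 1" "lin_coeffs A (p # P) = lin_coeff A p * lin_coeffs A P"
  by (simp_all add: lin_coeffs_def)

lemma length_act_blocks [simp]: "length (act_blocks act P xs) = length P"
  by (simp add: act_blocks_def)

lemma act_blocks_Nil [simp]: "act_blocks act [] xs = []"
  by (simp add: act_blocks_def)

lemma act_blocks_Cons [simp]:
  "act_blocks act ((i, \<mu>) # P) xs = act \<mu> (take i xs) # act_blocks act P (drop i xs)"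
  by (simp add: act_blocks_def)

lemma lin_coeffs_nonzero: "lin_coeffs A P \<noteq> 0 \<Longrightarrow> map fst P = replicate (length P) (Suc 0)"
  by (induction P) (auto simp: lin_coeff_def split: if_splits)

lemma act_blocks_cong:
  assumes "length xs = sum_list (map fst P)" "\<forall>(i, \<mu>)\<in>set P. \<mu> \<in> M i"
    "\<And>\<mu> zs. \<mu> \<in> M (length zs) \<Longrightarrow> set zs \<subseteq> set xs \<Longrightarrow> f \<mu> zs = g \<mu> zs"
  shows "act_blocks f P xs = act_blocks g P xs"
  using assms
proof (induction P arbitrary: xs)
  case (Cons p P)
  obtain i \<mu> where p: "p = (i, \<mu>)" by force
  have "act_blocks f P (drop i xs) = act_blocks g P (drop i xs)"
    using Cons.prems p set_drop_subset[of i xs] by (intro Cons.IH Cons.prems(3)) auto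
  moreover have "f \<mu> (take i xs) = g \<mu> (take i xs)"
    using Cons.prems p set_take_subset[of i xs] by (intro Cons.prems(3)) auto
  ultimately show ?case by (simp add: p)
qed simp

lemma act_blocks_map: "act_blocks f P (map h xs) = act_blocks (\<lambda>\<mu> zs. f \<mu> (map h zs)) P xs"
  by (induction P arbitrary: xs) (auto simp: take_map drop_map)

lemma map_act_blocks: "map h (act_blocks f P xs) = act_blocks (\<lambda>\<mu> zs. h (f \<mu> zs)) P xs"
  by (induction P arbitrary: xs) auto

lemma set_act_blocks:
  assumes "length xs = sum_list (map fst P)" "\<forall>(i, \<mu>)\<in>set P. \<mu> \<in> M i"
    "\<And>\<mu> zs. \<mu> \<in> M (length zs) \<Longrightarrow> set zs \<subseteq> set xs \<Longrightarrow> f \<mu> zs \<in> X"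
  shows "set (act_blocks f P xs) \<subseteq> X"
  using assms
proof (induction P arbitrary: xs)
  case (Cons p P)
  obtain i \<mu> where p: "p = (i, \<mu>)" by force
  have "set (act_blocks f P (drop i xs)) \<subseteq> X"
    using Cons.prems p set_drop_subset[of i xs] by (intro Cons.IH Cons.prems(3)) auto
  moreover have "f \<mu> (take i xs) \<in> X"
    using Cons.prems p set_take_subset[of i xs] by (intro Cons.prems(3)) auto
  ultimately show ?case by (simp add: p)
qed simp

text \<open>Because \<open>A\<^sub>0 = 0\<close>, an operation on an empty block is 0; this is what
  annihilates summands with too many tensor factors.\<close>

lemma act_blocks_zero_arity:
  assumes A: "connected_operad A" and alg: "algebra A V act" and "\<forall>(i, \<mu>)\<in>set P. \<mu> \<in> ops A i"
    and "0 \<in> set (map fst P)"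
  shows "0 \<in> set (act_blocks act P xs)"
  using assms(3,4)
proof (induction P arbitrary: xs)
  case (Cons p P)
  obtain i \<mu> where p: "p = (i, \<mu>)" by force
  show ?case
  proof (cases "i = 0")
    case True
    then have "\<mu> = 0" using Cons.prems connected_operadD(4)[OF A] p by auto
    moreover have "act 0 [] = 0"
      using lin_on_zero[OF connected_operadD(2)[OF A, of 0] algebraD(3)[OF alg, of "[]", simplified]] by simp
    ultimately show ?thesis by (simp add: p True)
  next
    case False
    then have "0 \<in> set (act_blocks act P (drop i xs))" using Cons.prems p by (intro Cons.IH) auto
    then show ?thesis by (simp add: p)
  qed
qed simp

lemma act_unit_multiple:
  assumes A: "connected_operad A" and alg: "algebra A V act" and "\<mu> \<in> ops A (Suc 0)" "x \<in> carr V"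
  shows "act \<mu> [x] = smul V (unit_coeff A \<mu>) x"
proof -
  have "act (smul (ospace A (Suc 0)) (unit_coeff A \<mu>) (ounit A)) [x] = smul V (unit_coeff A \<mu>) (act (ounit A) [x])"
    using assms(4) connected_operadD(5)[OF A] algebraD(3)[OF alg, of "[x]"] by (intro lin_onD(3)) simp_all
  then show ?thesis
    using unit_coeff[OF A assms(3)] algebraD(4)[OF alg assms(4)] by simp
qed

lemma act_blocks_linear:
  assumes A: "connected_operad A" and alg: "algebra A V act" and "\<forall>(i, \<mu>)\<in>set P. \<mu> \<in> ops A i"
    and "map fst P = replicate (length P) (Suc 0)" "length xs = length P" "set xs \<subseteq> carr V"
  shows "act_blocks act P xs = map2 (smul V) (map (lin_coeff A) P) xs"
  using assms(3-6)
proof (induction P arbitrary: xs)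
  case (Cons p P)
  obtain \<mu> where p: "p = (Suc 0, \<mu>)" using Cons.prems by (cases p) auto
  obtain y ys where xs: "xs = y # ys" using Cons.prems by (cases xs) auto
  show ?case using Cons act_unit_multiple[OF A alg, of \<mu> y] by (simp add: p xs lin_coeff_def)
qed simp

text \<open>A pigeonhole argument. More blocks than letters leave an empty block, which contributes
  0; with equally many, either some block is empty and both sides vanish, or every block is a single
  letter and each operation is a scalar.\<close>

lemma tens_act_blocks:
  assumes A: "connected_operad A" and alg: "algebra A V act" and P: "\<forall>(i, \<mu>)\<in>set P. \<mu> \<in> ops A i"
    and len: "length xs = sum_list (map fst P)" and xs: "set xs \<subseteq> carr V"
  shows "length P > length xs \<Longrightarrow> tens V (act_blocks act P xs) = 0"
    and "length P = length xs \<Longrightarrow> tens V (act_blocks act P xs) = fscale (lin_coeffs A P) (tens V xs)"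
proof -
  note V = algebraD(1)[OF alg]
  have car: "set (act_blocks act P xs) \<subseteq> carr V"
    using xs by (intro set_act_blocks[OF len P] act_in[OF alg]) auto
  have zero: "tens V (act_blocks act P xs) = 0" if "0 \<in> set (map fst P)"
    by (rule tens_zero_entry[OF V car act_blocks_zero_arity[OF A alg P that]])
  have ones: "length is \<le> sum_list is \<and> (sum_list is = length is \<longrightarrow> is = replicate (length is) (Suc 0))"
    if "0 \<notin> set is" for "is" :: "nat list"
    using that by (induction "is") auto
  show "tens V (act_blocks act P xs) = 0" if "length P > length xs"
    using that zero ones[of "map fst P"] len by (cases "0 \<in> set (map fst P)") simp_all
  show "tens V (act_blocks act P xs) = fscale (lin_coeffs A P) (tens V xs)" if eq: "length P = length xs"
  proof (cases "0 \<in> set (map fst P)")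
    case True
    then have "lin_coeffs A P = 0" using lin_coeffs_nonzero[of A P] by (metis in_set_replicate nat.distinct(1))
    then show ?thesis using zero[OF True] by (simp add: fscale_def fun_eq_iff)
  next
    case False
    then have "map fst P = replicate (length P) (Suc 0)" using ones[OF False] len eq by simp
    from act_blocks_linear[OF A alg P this eq[symmetric] xs] show ?thesis
      using tens_scale_all[OF V, of "map (lin_coeff A) P" xs] xs eq by (simp add: lin_coeffs_def)
  qed
qed

lemma
  assumes alg: "algebra A V act" and P: "\<forall>(i, \<mu>)\<in>set P. \<mu> \<in> ops A i"
  shows apply_ops_lin:
      "lin_on (tpow V (sum_list (map fst P))) (tpow V (length P)) (apply_ops V act P)"
    and apply_ops_tens: "length xs = sum_list (map fst P) \<Longrightarrow> set xs \<subseteq> carr V \<Longrightarrow>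
      apply_ops V act P (tens V xs) = tens V (act_blocks act P xs)"
proof -
  note V = algebraD(1)[OF alg]
  have "mlin (replicate (sum_list (map fst P)) V) (tpow V (length P))
      (\<lambda>xs. tens V (map2 (\<lambda>F ys. F ys) (map (act \<circ> snd) P) (blocks (map fst P) xs)))"
  proof (rule mlin_blocks[OF V])
    show "mlin (replicate (map fst P ! j) V) V (map (act \<circ> snd) P ! j)" if "j < length (map fst P)" for j
      using that P nth_mem[of j P] by (auto simp: case_prod_unfold intro!: algebraD(2)[OF alg])
    show "mlin (replicate (length (map fst P)) V) (tpow V (length P)) (tens V)"
      using tens_mlin[of "length P" V] by simp
  qed simp
  then have m: "mlin (replicate (sum_list (map fst P)) V) (tpow V (length P))
      (\<lambda>ys. tens V (map2 (\<lambda>(i, \<mu>) zs. act \<mu> zs) P (blocks (map fst P) ys)))"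
    by (simp add: zip_map1 case_prod_unfold comp_def)
  show "lin_on (tpow V (sum_list (map fst P))) (tpow V (length P)) (apply_ops V act P)"
    unfolding apply_ops_def by (rule tlift_props(1)[OF vec_space_tpow m])
  show "apply_ops V act P (tens V xs) = tens V (act_blocks act P xs)"
    if "length xs = sum_list (map fst P)" "set xs \<subseteq> carr V"
    unfolding apply_ops_def act_blocks_def by (rule tlift_props(2)[OF vec_space_tpow m that])
qed

lemma prim_iff: "x \<in> carr (prim C V coact) \<longleftrightarrow> x \<in> carr V \<and> (\<forall>n\<ge>2. \<forall>\<delta>\<in>ops C n. coact n \<delta> x = 0)"
  by (simp add: prim_def)

lemma smul_prim [simp]: "smul (prim C V coact) = smul V"
  by (simp add: prim_def)

lemma prim_subset: "carr (prim C V coact) \<subseteq> carr V"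
  by (auto simp: prim_iff)

lemma vec_space_prim:
  assumes "coalgebra C V coact"
  shows "vec_space (prim C V coact)"
proof -
  note V = coalgebraD(1)[OF assms]
  interpret vector_space "smul V" using V by (rule vec_space_vector_space)
  have "subspace (carr (prim C V coact))"
  proof (rule subspaceI)
    show "0 \<in> carr (prim C V coact)"
      using lin_on_zero[OF V coalgebraD(2)[OF assms]] by (auto simp: prim_iff vs_zero[OF V])
    show "x + y \<in> carr (prim C V coact)" if "x \<in> carr (prim C V coact)" "y \<in> carr (prim C V coact)" for x y
      using that lin_onD(2)[OF coalgebraD(2)[OF assms]] by (auto simp: prim_iff vs_add[OF V])
    show "smul V c x \<in> carr (prim C V coact)" if "x \<in> carr (prim C V coact)" for c x
      using that lin_onD(3)[OF coalgebraD(2)[OF assms]]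
      by (auto simp: prim_iff vs_smul[OF V] fscale_def fun_eq_iff)
  qed
  then show ?thesis by (simp add: vec_space_def vector_space_axioms)
qed

text \<open>Arity 0 is void since \<open>C\<^sub>0 = 0\<close>, arity 1 consists of multiples of the
  identity, and higher arities vanish by primitivity.\<close>

lemma coact_prim:
  assumes C: "connected_operad C" and coalg: "coalgebra C V coact"
    and x: "x \<in> carr (prim C V coact)" and \<delta>: "\<delta> \<in> ops C i"
  shows "coact i \<delta> x = fscale (lin_coeff C (i, \<delta>)) (tens V [x])"
proof -
  have xV: "x \<in> carr V" using x by (simp add: prim_iff)
  have z: "fscale 0 t = 0" for t :: "('a, 'c) tensor" by (simp add: fscale_def fun_eq_iff)
  consider "i = 0" | "i = Suc 0" | "i \<ge> 2" by linarith
  then show ?thesis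
  proof cases
    case 1
    then have "\<delta> = 0" using \<delta> connected_operadD(4)[OF C] by simp
    then show ?thesis
      using lin_on_zero[OF connected_operadD(2)[OF C] coalgebraD(3)[OF coalg xV]] 1 z by (simp add: lin_coeff_def)
  next
    case 2
    have "coact (Suc 0) (smul (ospace C (Suc 0)) (unit_coeff C \<delta>) (ounit C)) x
        = fscale (unit_coeff C \<delta>) (coact (Suc 0) (ounit C) x)"
      using lin_onD(3)[OF coalgebraD(3)[OF coalg xV] connected_operadD(5)[OF C]] by simp
    then show ?thesis
      using unit_coeff[OF C, of \<delta>] \<delta> 2 coalgebraD(4)[OF coalg xV] by (simp add: lin_coeff_def)
  next
    case 3
    then show ?thesis using x \<delta> z by (simp add: prim_iff lin_coeff_def)
  qed
qed

text \<open>The left side lives in the tensor power given by the sum of the arities in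
  \<open>Q\<close>, the right side in that given by \<open>length xs\<close>. These agree when all
  arities are 1; otherwise the scalar is 0 and so is the left side.\<close>

lemma apply_coops_prim:
  assumes C: "connected_operad C" and coalg: "coalgebra C V coact"
    and "\<forall>(i, \<delta>)\<in>set Q. \<delta> \<in> ops C i" "length xs = length Q" "set xs \<subseteq> carr (prim C V coact)"
  shows "apply_coops V coact Q xs = fscale (lin_coeffs C Q) (tens V xs)"
  using assms(3-5)
proof (induction Q arbitrary: xs)
  case Nil
  then show ?case by (simp add: apply_coops_def fscale_def)
next
  case (Cons p Q)
  note V = coalgebraD(1)[OF coalg]
  obtain i \<delta> where p: "p = (i, \<delta>)" by force
  obtain y ys where xs: "xs = y # ys" "length ys = length Q" using Cons.prems by (cases xs) auto
  have \<delta>: "\<delta> \<in> ops C i" and y: "y \<in> carr (prim C V coact)" using Cons.prems p xs by auto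
  have yV: "y \<in> carr V" "set ys \<subseteq> carr V" using Cons.prems xs prim_subset[of C V coact] by auto
  have z: "fscale 0 t = 0" for t :: "('a, 'c) tensor" by (simp add: fscale_def fun_eq_iff)
  have IH: "apply_coops V coact Q ys = fscale (lin_coeffs C Q) (tens V ys)"
    using Cons.prems xs by (intro Cons.IH) auto
  have eq: "apply_coops V coact (p # Q) xs =
      tmul V i (sum_list (map fst Q)) (fscale (lin_coeff C p) (tens V [y])) (fscale (lin_coeffs C Q) (tens V ys))"
    using IH coact_prim[OF C coalg y \<delta>] by (simp add: apply_coops_def p xs)
  show ?case
  proof (cases "lin_coeff C p = 0 \<or> lin_coeffs C Q = 0")
    case False
    then have "i = Suc 0" "map fst Q = replicate (length Q) (Suc 0)"
      using lin_coeffs_nonzero[of C Q] p by (auto simp: lin_coeff_def split: if_splits)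
    then have "i = Suc 0" "sum_list (map fst Q) = length ys" using xs by (simp_all add: sum_list_replicate)
    then show ?thesis unfolding eq using tmul_scaled_tens[OF V, of "[y]" "Suc 0" ys "length ys"] yV xs by simp
  next
    case True
    \<comment> \<open>A factor 0 annihilates a product only against a genuine tensor of the stated
      order, so membership of both factors is established first.\<close>
    have in1: "fscale (lin_coeff C p) (tens V [y]) \<in> carr (tpow V i)"
      using lin_onD(1)[OF coalgebraD(2)[OF coalg \<delta>] yV(1)] coact_prim[OF C coalg y \<delta>] p by simp
    have "list_all2 (\<lambda>t i. t \<in> carr (tpow V i)) (map2 (\<lambda>(i, \<delta>) x. coact i \<delta> x) Q ys) (map fst Q)"
      unfolding list_all2_conv_all_nth
    proof (intro conjI allI impI)
      fix j assume "j < length (map2 (\<lambda>(i, \<delta>) x. coact i \<delta> x) Q ys)"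
      then have j: "j < length Q" "j < length ys" by simp_all
      obtain k \<epsilon> where k: "Q ! j = (k, \<epsilon>)" by force
      have "\<epsilon> \<in> ops C k" using Cons.prems(1) nth_mem[OF j(1)] k by auto
      moreover have "ys ! j \<in> carr V" using nth_mem[OF j(2)] yV by blast
      ultimately show "map2 (\<lambda>(i, \<delta>) x. coact i \<delta> x) Q ys ! j \<in> carr (tpow V (map fst Q ! j))"
        using j k lin_onD(1)[OF coalgebraD(2)[OF coalg]] by simp
    qed (use xs in simp)
    from tconcat_in[OF V this] have in2: "fscale (lin_coeffs C Q) (tens V ys) \<in> carr (tpow V (sum_list (map fst Q)))"
      using IH by (simp add: apply_coops_def)
    show ?thesis
      using True tmul_zero(1)[OF V in2] tmul_zero(2)[OF V in1] unfolding eq by (auto simp: z)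
  qed
qed

section \<open>Scalars attached to a type of bialgebras\<close>

locale ns_bialgebras =
  fixes A :: "('k::field, 'a::ab_group_add) operad" and C :: "('k, 'c::ab_group_add) operad"
    and rel :: "('a, 'c) relations"
  assumes bialgebra_type: "ns_bialgebra_type A C rel"
begin

lemma A: "connected_operad A" and C: "connected_operad C"
  using bialgebra_type by (simp_all add: ns_bialgebra_type_def)

lemma ns_A: "ns_operad A"
  by (rule connected_operadD(1)[OF A])

lemma rel_props:
  assumes "\<delta> \<in> ops C m" "\<mu> \<in> ops A n" "(P, Q) \<in> set (rel m n \<delta> \<mu>)"
  shows "length P = m" "length Q = n" "\<forall>(i, \<mu>)\<in>set P. \<mu> \<in> ops A i" "\<forall>(i, \<delta>)\<in>set Q. \<delta> \<in> ops C i"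
    "sum_list (map fst P) = sum_list (map fst Q)"
  using assms bialgebra_type unfolding ns_bialgebra_type_def by fast+

text \<open>A nonzero scalar forces all cooperations in \<open>Q\<close> into arity 1, and the
  equality of total arities then fixes the total arity of \<open>P\<close>.\<close>

lemma rel_arity:
  assumes "\<delta> \<in> ops C m" "\<mu> \<in> ops A n" "(P, Q) \<in> set (rel m n \<delta> \<mu>)" "lin_coeffs C Q \<noteq> 0"
  shows "sum_list (map fst P) = n"
  using rel_props[OF assms(1-3)] lin_coeffs_nonzero[OF assms(4)] by (simp add: sum_list_replicate)

lemma bialgebraD:
  assumes "bialgebra A C rel V act coact"
  shows "algebra A V act" "coalgebra C V coact" "vec_space V"
    "\<delta> \<in> ops C m \<Longrightarrow> \<mu> \<in> ops A (length xs) \<Longrightarrow> set xs \<subseteq> carr V \<Longrightarrow> coact m \<delta> (act \<mu> xs) =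
        (\<Sum>(P, Q)\<leftarrow>rel m (length xs) \<delta> \<mu>. apply_ops V act P (apply_coops V coact Q xs))"
  using assms by (auto simp: bialgebra_def algebra_def tuples_replicate)

text \<open>On words of primitive elements the cooperations disappear from the right side of the
  relation: the coaction is expressed by \<open>rel\<close> and the algebra action alone. All later
  comparisons between bialgebras rest on this.\<close>

lemma coact_act_prim:
  assumes H: "bialgebra A C rel V act coact"
    and \<delta>: "\<delta> \<in> ops C m" and \<mu>: "\<mu> \<in> ops A (length xs)" and xs: "set xs \<subseteq> carr (prim C V coact)"
  shows "coact m \<delta> (act \<mu> xs) =
    (\<Sum>(P, Q)\<leftarrow>rel m (length xs) \<delta> \<mu>. fscale (lin_coeffs C Q) (tens V (act_blocks act P xs)))"
proof -
  note alg = bialgebraD(1)[OF H] and coalg = bialgebraD(2)[OF H]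
  have xsV: "set xs \<subseteq> carr V" using xs prim_subset[of C V coact] by blast
  have z: "fscale 0 t = 0" for t :: "('k, 'd) tensor" by (simp add: fscale_def fun_eq_iff)
  have "apply_ops V act P (apply_coops V coact Q xs) = fscale (lin_coeffs C Q) (tens V (act_blocks act P xs))"
    if PQ: "(P, Q) \<in> set (rel m (length xs) \<delta> \<mu>)" for P Q
  proof -
    note r = rel_props[OF \<delta> \<mu> PQ]
    have "apply_coops V coact Q xs = fscale (lin_coeffs C Q) (tens V xs)"
      using r(2) by (intro apply_coops_prim[OF C coalg r(4) _ xs]) simp
    moreover have "apply_ops V act P (fscale (lin_coeffs C Q) (tens V xs)) =
        fscale (lin_coeffs C Q) (tens V (act_blocks act P xs))"
    proof (cases "lin_coeffs C Q = 0")
      case True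
      then show ?thesis using lin_on_zero[OF vec_space_tpow apply_ops_lin[OF alg r(3)]] by (simp add: z)
    next
      case False
      then have len: "length xs = sum_list (map fst P)" using rel_arity[OF \<delta> \<mu> PQ] by simp
      then show ?thesis
        using lin_onD(3)[OF apply_ops_lin[OF alg r(3)] tens_in[OF len xsV]] apply_ops_tens[OF alg r(3) len xsV]
        by simp
    qed
    ultimately show ?thesis by simp
  qed
  then show ?thesis
    unfolding bialgebraD(4)[OF H \<delta> \<mu> xsV] by (intro arg_cong[of _ _ sum_list] map_cong) auto
qed

text \<open>Each surviving summand distributes \<open>length xs\<close> letters over
  \<open>m\<close> operations, which is too many.\<close>

lemma coact_act_above:
  assumes H: "bialgebra A C rel V act coact" and \<delta>: "\<delta> \<in> ops C m" and \<mu>: "\<mu> \<in> ops A (length xs)"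
    and xs: "set xs \<subseteq> carr (prim C V coact)" and m: "m > length xs"
  shows "coact m \<delta> (act \<mu> xs) = 0"
proof -
  have xsV: "set xs \<subseteq> carr V" using xs prim_subset[of C V coact] by blast
  have "fscale (lin_coeffs C Q) (tens V (act_blocks act P xs)) = 0"
    if PQ: "(P, Q) \<in> set (rel m (length xs) \<delta> \<mu>)" for P Q
  proof (cases "lin_coeffs C Q = 0")
    case False
    note r = rel_props[OF \<delta> \<mu> PQ]
    have "length xs = sum_list (map fst P)" using rel_arity[OF \<delta> \<mu> PQ False] by simp
    from tens_act_blocks(1)[OF A bialgebraD(1)[OF H] r(3) this xsV] show ?thesis
      using m r(1) by (simp add: fscale_def fun_eq_iff)
  qed (simp add: fscale_def fun_eq_iff)
  then have "map (\<lambda>(P, Q). fscale (lin_coeffs C Q) (tens V (act_blocks act P xs))) (rel m (length xs) \<delta> \<mu>)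
      = map (\<lambda>_. 0) (rel m (length xs) \<delta> \<mu>)"
    by (intro map_cong) auto
  then show ?thesis
    unfolding coact_act_prim[OF H \<delta> \<mu> xs] by (simp only: sum_list_0)
qed

text \<open>The pairing of \<open>C\<^sub>n\<close> with \<open>A\<^sub>n\<close> imposed by the
  relations. It refers to no bialgebra, so a value found in one bialgebra is valid in all.\<close>

definition top_coeff :: "nat \<Rightarrow> 'c \<Rightarrow> 'a \<Rightarrow> 'k" where
  "top_coeff n \<delta> \<mu> = (\<Sum>(P, Q)\<leftarrow>rel n n \<delta> \<mu>. lin_coeffs C Q * lin_coeffs A P)"

lemma coact_act_top:
  assumes H: "bialgebra A C rel V act coact" and \<delta>: "\<delta> \<in> ops C (length xs)" and \<mu>: "\<mu> \<in> ops A (length xs)"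
    and xs: "set xs \<subseteq> carr (prim C V coact)"
  shows "coact (length xs) \<delta> (act \<mu> xs) = fscale (top_coeff (length xs) \<delta> \<mu>) (tens V xs)"
proof -
  have xsV: "set xs \<subseteq> carr V" using xs prim_subset[of C V coact] by blast
  have "fscale (lin_coeffs C Q) (tens V (act_blocks act P xs)) = fscale (lin_coeffs C Q * lin_coeffs A P) (tens V xs)"
    if PQ: "(P, Q) \<in> set (rel (length xs) (length xs) \<delta> \<mu>)" for P Q
  proof (cases "lin_coeffs C Q = 0")
    case False
    note r = rel_props[OF \<delta> \<mu> PQ]
    have "length xs = sum_list (map fst P)" using rel_arity[OF \<delta> \<mu> PQ False] by simp
    from tens_act_blocks(2)[OF A bialgebraD(1)[OF H] r(3) this xsV r(1)] show ?thesis
      by (simp add: fscale_def fun_eq_iff)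
  qed (simp add: fscale_def fun_eq_iff)
  then have "coact (length xs) \<delta> (act \<mu> xs) =
      (\<Sum>(P, Q)\<leftarrow>rel (length xs) (length xs) \<delta> \<mu>. fscale (lin_coeffs C Q * lin_coeffs A P) (tens V xs))"
    unfolding coact_act_prim[OF H \<delta> \<mu> xs] by (intro arg_cong[of _ _ sum_list] map_cong) auto
  also have "\<dots> = fscale (top_coeff (length xs) \<delta> \<mu>) (tens V xs)"
  proof -
    have "(\<Sum>(P, Q)\<leftarrow>R. fscale (f P Q) t) = fscale (\<Sum>(P, Q)\<leftarrow>R. f P Q) t"
      for R :: "('x \<times> 'y) list" and f and t :: "('k, 'd) tensor"
      by (induction R) (auto simp: fscale_def fun_eq_iff algebra_simps)
    then show ?thesis unfolding top_coeff_def .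
  qed
  finally show ?thesis .
qed

end

section \<open>Top cooperations take values in tensors of primitive elements\<close>

text \<open>\<open>B\<close> is a basis of a complement of \<open>L\<close>, \<open>\<phi>\<close>
  its coordinates and \<open>q\<close> the projection onto \<open>L\<close> along it. Thus a vector
  known to lie in \<open>L\<close> is killed by every \<open>\<phi> b\<close> with
  \<open>b \<in> B\<close>, which is how projecting a slot is shown to change nothing.\<close>

lemma complement_coordinates:
  fixes V L :: "('k::field, 'v::ab_group_add) vs"
  assumes V: "vec_space V" and L: "vec_space L" "carr L \<subseteq> carr V" "smul L = smul V"
  obtains q :: "'v \<Rightarrow> 'v" and B and \<phi> :: "'v \<Rightarrow> 'v \<Rightarrow> 'k"
  where "lin_on V L q" "\<forall>x\<in>carr L. q x = x" "B \<subseteq> carr V" "\<forall>b. lin_on V fld (\<phi> b)"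
    "\<forall>b\<in>B. \<forall>x\<in>carr L. \<phi> b x = 0"
    "\<forall>x\<in>carr V. finite {b \<in> B. \<phi> b x \<noteq> 0}"
    "\<forall>x\<in>carr V. x - q x = (\<Sum>b | b \<in> B \<and> \<phi> b x \<noteq> 0. smul V (\<phi> b x) b)"
proof -
  interpret vector_space "smul V" using V by (rule vec_space_vector_space)
  interpret VV: vector_space_pair "smul V" "smul V" ..
  have sV: "subspace (carr V)" using V by (simp add: vec_space_def)
  have sL: "subspace (carr L)" using L by (simp add: vec_space_def)
  obtain B0 where B0: "B0 \<subseteq> carr L" "independent B0" "carr L \<subseteq> span B0"
    using maximal_independent_subset by blast
  obtain B where B: "B0 \<subseteq> B" "B \<subseteq> carr V" "independent B" "carr V \<subseteq> span B"
    using maximal_independent_subset_extend[of B0 "carr V"] B0 L(2) by blast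
  have sp: "span B0 = carr L" "span B = carr V"
    using span_minimal[OF B0(1) sL] span_minimal[OF B(2) sV] B0(3) B(4) by auto
  define q where "q = VV.construct B (\<lambda>b. if b \<in> B0 then b else 0)"
  have lq: "Vector_Spaces.linear (smul V) (smul V) q"
    unfolding q_def by (rule VV.linear_construct[OF B(3)])
  interpret q: Vector_Spaces.linear "smul V" "smul V" q by (rule lq)
  have qb: "q b = (if b \<in> B0 then b else 0)" if "b \<in> B" for b
    unfolding q_def by (rule VV.construct_basis[OF B(3) that])
  have qL: "q x \<in> carr L" if "x \<in> carr V" for x
  proof -
    have "q ` B \<subseteq> carr L" using qb B0(1) subspace_0[OF sL] by auto
    then have "span (q ` B) \<subseteq> carr L" by (rule span_minimal[OF _ sL])
    then show ?thesis using that sp(2) q.span_image[of B] by blast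
  qed
  have qid: "q x = x" if "x \<in> carr L" for x
  proof -
    have "Vector_Spaces.linear (smul V) (smul V) (\<lambda>x. x)"
      by (simp add: Vector_Spaces.linear_iff vector_space_axioms)
    moreover have "x \<in> span B0" using that sp(1) by simp
    ultimately show ?thesis using VV.linear_eq_on[OF lq, of "\<lambda>x. x" x B0] qb subsetD[OF B(1)] by simp
  qed
  define \<phi> where "\<phi> b x = representation B x b" for b x
  have dec: "x = (\<Sum>b | \<phi> b x \<noteq> 0. smul V (\<phi> b x) b)" "finite {b. \<phi> b x \<noteq> 0}" if "x \<in> carr V" for x
    unfolding \<phi>_def using sum_nonzero_representation_eq[OF B(3)] finite_representation that sp(2) by auto
  have inB: "b \<in> B" if "\<phi> b x \<noteq> 0" for b x
    using representation_ne_zero[of B x b] that by (simp add: \<phi>_def)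
  have "x - q x = (\<Sum>b | b \<in> B - B0 \<and> \<phi> b x \<noteq> 0. smul V (\<phi> b x) b)" if x: "x \<in> carr V" for x
  proof -
    have "q x = (\<Sum>b | \<phi> b x \<noteq> 0. smul V (\<phi> b x) (q b))"
      using arg_cong[OF dec(1)[OF x], of q] by (simp add: q.sum q.scale)
    then have "x - q x = (\<Sum>b | \<phi> b x \<noteq> 0. smul V (\<phi> b x) b) - (\<Sum>b | \<phi> b x \<noteq> 0. smul V (\<phi> b x) (q b))"
      using dec(1)[OF x] by simp
    also have "\<dots> = (\<Sum>b | \<phi> b x \<noteq> 0. smul V (\<phi> b x) (b - q b))"
      by (simp add: sum_subtractf scale_right_diff_distrib)
    also have "\<dots> = (\<Sum>b | b \<in> B - B0 \<and> \<phi> b x \<noteq> 0. smul V (\<phi> b x) (b - q b))"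
      using inB qb by (intro sum.mono_neutral_right dec(2)[OF x]) auto
    also have "\<dots> = (\<Sum>b | b \<in> B - B0 \<and> \<phi> b x \<noteq> 0. smul V (\<phi> b x) b)"
      using qb by (intro sum.cong) auto
    finally show ?thesis .
  qed
  moreover have "lin_on V L q"
    using qL L(3) by (auto simp: lin_on_def q.add q.scale)
  moreover have "lin_on V fld (\<phi> b)" for b
    unfolding \<phi>_def lin_on_fld_iff using representation_add[OF B(3)] representation_scale[OF B(3)] sp(2) by auto
  moreover have "\<phi> b x = 0" if "b \<in> B - B0" "x \<in> carr L" for b x
    using representation_extend[OF B(3) _ B(1), of x] representation_ne_zero[of B0 x b] that sp(1)
    unfolding \<phi>_def by auto
  moreover have "finite {b \<in> B - B0. \<phi> b x \<noteq> 0}" if "x \<in> carr V" for x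
    using dec(2)[OF that] by (rule rev_finite_subset) auto
  ultimately show ?thesis
    using that[of q "B - B0" \<phi>] qid B(2) by blast
qed

lemma tforms_tmul:
  assumes V: "vec_space V" and t: "t \<in> carr (tpow V q)" and g: "g \<in> tforms V (p + q)"
  shows "(\<lambda>xs. t (\<lambda>ys. g (xs @ ys))) \<in> tforms V p"
  using tforms_append_left[OF g] tforms_append_right[OF g]
  by (intro tforms_eval[OF V V t]) (auto simp: tforms_iff)

lemma tconcat_singletons:
  assumes V: "vec_space V" and "set us \<subseteq> carr V" "list_all2 (\<lambda>t i. t \<in> carr (tpow V i)) ts is"
    "G \<in> tforms V (length us + sum_list is)"
  shows "tconcat V (replicate (length us) 1 @ is) (map (\<lambda>x. tens V [x]) us @ ts) G =
    tconcat V is ts (\<lambda>zs. G (us @ zs))"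
  using assms(2,4)
proof (induction us arbitrary: G)
  case (Cons u us)
  let ?q = "length us + sum_list is"
  let ?T = "tconcat V (replicate (length us) 1 @ is) (map (\<lambda>x. tens V [x]) us @ ts)"
  have "list_all2 (\<lambda>t i. t \<in> carr (tpow V i)) (map (\<lambda>x. tens V [x]) us @ ts) (replicate (length us) 1 @ is)"
    using Cons.prems assms(3) by (intro list_all2_appendI) (auto simp: list_all2_conv_all_nth tens_in dest: nth_mem)
  from tconcat_in[OF V this] have T: "?T \<in> carr (tpow V ?q)" by (simp add: sum_list_replicate)
  have u: "tens V [u] \<in> carr (tpow V 1)" using Cons.prems by (simp add: tens_in)
  have G: "G \<in> tforms V (1 + ?q)" using Cons.prems by simp
  have "tmul V 1 ?q (tens V [u]) ?T G = tens V [u] (\<lambda>xs. ?T (\<lambda>ys. G (xs @ ys)))"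
    by (rule tmul_eval[OF V u T G])
  also have "\<dots> = ?T (\<lambda>ys. G (u # ys))"
    using tens_eval[of "\<lambda>xs. ?T (\<lambda>ys. G (xs @ ys))" V "[u]"] tforms_tmul[OF V T G] by simp
  also have "\<dots> = tconcat V is ts (\<lambda>zs. G (u # us @ zs))"
    using Cons.IH[of "\<lambda>ys. G (u # ys)"] Cons.prems(1) tforms_append_left[OF G, of "[u]"] by simp
  finally show ?case by (simp add: sum_list_replicate)
qed simp

lemma tconcat_singletons_eq:
  assumes V: "vec_space V" and "set us \<subseteq> carr V"
  shows "tconcat V (replicate (length us) 1) (map (\<lambda>x. tens V [x]) us) = tens V us"
  using assms(2)
proof (induction us)
  case (Cons u us)
  then show ?case using tmul_tens[OF V, of "[u]" 1 us "length us"] by (simp add: sum_list_replicate)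
qed simp

text \<open>Tensors are not linear in forms by definition, so the scalar is extracted through a
  representation by pure tensors.\<close>

lemma tpow_scaled_form:
  assumes "t \<in> carr (tpow V n)" "f \<in> tforms V n"
  shows "t (\<lambda>xs. c * f xs) = c * t f"
proof -
  obtain m :: nat and a xs where xs: "\<And>i. i < m \<Longrightarrow> length (xs i) = n \<and> set (xs i) \<subseteq> carr V"
    "t = (\<Sum>i<m. fscale (a i) (tens V (xs i)))" using tpow_rep[OF assms(1)] by blast
  have cf: "(\<lambda>xs. c * f xs) \<in> tforms V n"
    using mlin_scaled[OF vec_space_fld assms(2)[unfolded tforms_iff]] by (simp add: tforms_iff)
  have "t (\<lambda>xs. c * f xs) = (\<Sum>i<m. a i * (c * f (xs i)))"
    unfolding xs(2) using xs(1) by (intro tpow_sum_eval[OF cf]) simp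
  moreover have "t f = (\<Sum>i<m. a i * f (xs i))"
    unfolding xs(2) using xs(1) by (intro tpow_sum_eval[OF assms(2)]) simp
  ultimately show ?thesis by (simp add: sum_distrib_left algebra_simps)
qed

text \<open>The outer letters merely fill arguments of the form, leaving a form in the middle ones
  to be paired with \<open>t\<close>.\<close>

lemma tconcat_insert:
  assumes V: "vec_space V" and us: "set us \<subseteq> carr V" and vs: "set vs \<subseteq> carr V"
    and t: "t \<in> carr (tpow V k)" and G: "G \<in> tforms V (length us + (k + length vs))"
  shows "tconcat V (replicate (length us) 1 @ k # replicate (length vs) 1)
      (map (\<lambda>x. tens V [x]) us @ t # map (\<lambda>x. tens V [x]) vs) G = t (\<lambda>zs. G (us @ zs @ vs))"
proof -
  let ?l = "length vs"
  have Tvs: "tens V vs \<in> carr (tpow V ?l)" using vs by (simp add: tens_in)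
  have G1: "(\<lambda>zs. G (us @ zs)) \<in> tforms V (k + ?l)" by (rule tforms_append_left[OF G _ us]) simp
  have "list_all2 (\<lambda>t i. t \<in> carr (tpow V i)) (t # map (\<lambda>x. tens V [x]) vs) (k # replicate ?l 1)"
    using t vs by (auto simp: list_all2_conv_all_nth tens_in nth_Cons split: nat.splits dest: nth_mem)
  from tconcat_singletons[OF V us this, of G]
  have "tconcat V (replicate (length us) 1 @ k # replicate ?l 1)
      (map (\<lambda>x. tens V [x]) us @ t # map (\<lambda>x. tens V [x]) vs) G = tmul V k ?l t (tens V vs) (\<lambda>zs. G (us @ zs))"
    using G tconcat_singletons_eq[OF V vs] by (simp add: sum_list_replicate)
  also have "\<dots> = t (\<lambda>zs. tens V vs (\<lambda>ys. G (us @ zs @ ys)))"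
    by (simp add: tmul_eval[OF V t Tvs G1])
  also have "\<dots> = t (\<lambda>zs. G (us @ zs @ vs))"
  proof (rule tpow_cong[OF t])
    show "(\<lambda>zs. tens V vs (\<lambda>ys. G (us @ zs @ ys))) \<in> tforms V k" by (rule tforms_tmul[OF V Tvs G1])
    show "(\<lambda>zs. G (us @ zs @ vs)) \<in> tforms V k" using tforms_append_right[OF G1 _ vs] by simp
    show "tens V vs (\<lambda>ys. G (us @ zs @ ys)) = G (us @ zs @ vs)" if "length zs = k" "set zs \<subseteq> carr V" for zs
      using tens_eval[of "\<lambda>ys. G (us @ zs @ ys)" V vs] tforms_append_left[OF G1 that] by simp
  qed
  finally show ?thesis .
qed

lemma filtD:
  assumes "x \<in> filt C V coact r"
  shows "x \<in> carr V" "n > r \<Longrightarrow> \<delta> \<in> ops C n \<Longrightarrow> coact n \<delta> x = 0"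
  using assms by (auto simp: filt_def)

text \<open>
  Contracting all but one tensor factor of \<open>coact r \<delta> h\<close> with \<open>h\<close> in the \<open>r\<close>-th filtration step
  yields a primitive element, because inserting a further cooperation gives one of arity \<open>> r\<close>.
\<close>

lemma contraction_prim:
  fixes H :: "('k::field, 'v::ab_group_add) vs" and C :: "('k, 'c::ab_group_add) operad"
  assumes C: "connected_operad C" and H: "coalgebra C H coact"
    and h: "h \<in> filt C H coact r" and \<delta>: "\<delta> \<in> ops C r"
    and t: "coact r \<delta> h = (\<Sum>i<n. fscale (a i) (tens H (us i @ x i # vs i)))"
    and uv: "\<And>i. i < n \<Longrightarrow> length (us i) = j \<and> length (vs i) = l \<and> set (us i) \<subseteq> carr H \<and> set (vs i) \<subseteq> carr H \<and> x i \<in> carr H"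
    and r: "r = j + 1 + l" and g: "g \<in> tforms H r" and b: "b \<in> carr H"
  shows "(\<Sum>i<n. smul H (a i * g (us i @ b # vs i)) (x i)) \<in> carr (prim C H coact)"
  unfolding prim_iff
proof (intro conjI allI impI ballI)
  let ?y = "\<Sum>i<n. smul H (a i * g (us i @ b # vs i)) (x i)"
  note V = coalgebraD(1)[OF H]
  show "?y \<in> carr H" using uv by (intro vs_sum[OF V] vs_smul[OF V]) simp
  fix k \<delta>' assume k: "k \<ge> 2" and \<delta>': "\<delta>' \<in> ops C k"
  note D = coalgebraD(2)[OF H \<delta>']
  have y: "coact k \<delta>' ?y = (\<Sum>i<n. fscale (a i * g (us i @ b # vs i)) (coact k \<delta>' (x i)))"
    using lin_on_sum[OF V D, of "{..<n}" x "\<lambda>i. a i * g (us i @ b # vs i)"] uv by simp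
  show "coact k \<delta>' ?y = 0"
  proof (rule tpow_ext)
    show "coact k \<delta>' ?y \<in> carr (tpow H k)" using lin_onD(1)[OF D] \<open>?y \<in> carr H\<close> by blast
    show "0 \<in> carr (tpow H k)" by (rule vs_zero[OF vec_space_tpow])
    fix G' assume G': "G' \<in> tforms H k"
    \<comment> \<open>\<open>\<delta>\<close> is composed with \<open>\<delta>'\<close> in the slot
      preceded by \<open>j\<close> others, and with the identity in all remaining slots.\<close>
    let ?is = "replicate j 1 @ k # replicate l 1"
    let ?\<delta>s = "replicate j (ounit C) @ \<delta>' # replicate l (ounit C)"
    let ?F = "\<lambda>xs. tconcat H ?is (map2 (\<lambda>(i, \<delta>') y. coact i \<delta>' y) (zip ?is ?\<delta>s) xs)"
    let ?Fs = "replicate j (coact 1 (ounit C)) @ coact k \<delta>' # replicate l (coact 1 (ounit C))"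
    let ?w = "\<lambda>i. us i @ x i # vs i"
    \<comment> \<open>The middle \<open>k\<close> letters, produced by \<open>\<delta>'\<close>, are
      tested by \<open>G'\<close>; the outer ones go into \<open>g\<close>, with \<open>b\<close> in
      the slot left open. Pairing with \<open>G\<close> thus yields the pairing of \<open>G'\<close>
      with \<open>\<delta>'\<close> of the contraction.\<close>
    define G where "G zs = g (take j zs @ b # drop k (drop j zs)) * G' (take k (drop j zs))" for zs
    have u: "ounit C \<in> ops C 1" using connected_operadD(5)[OF C] by simp
    have \<delta>s: "?\<delta>s \<in> tuples (map (ospace C) ?is)"
      using u \<delta>' by (auto simp: tuples_iff list_all2_conv_all_nth nth_append nth_Cons split: nat.splits)
    have \<delta>r: "\<delta> \<in> ops C (length ?is)" using \<delta> r by simp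
    have sum: "sum_list ?is = j + (k + l)" by (simp add: sum_list_replicate)
    have hH: "h \<in> carr H" using filtD(1)[OF h] .
    have all2: "list_all2 (\<lambda>F i. lin_on H (tpow H i) F) ?Fs ?is"
      using coalgebraD(2)[OF H u] D
      by (auto simp: list_all2_conv_all_nth nth_append nth_Cons split: nat.splits)
    have Feq: "?F = (\<lambda>xs. tconcat H ?is (map2 (\<lambda>F x. F x) ?Fs xs))"
    proof -
      have "map (\<lambda>(i, \<delta>'). coact i \<delta>') (zip ?is ?\<delta>s) = ?Fs"
        by (simp add: zip_replicate)
      moreover have "map2 (\<lambda>(i, \<delta>') y. coact i \<delta>' y) ps xs = map2 (\<lambda>F x. F x) (map (\<lambda>(i, \<delta>'). coact i \<delta>') ps) xs"
        for ps xs by (simp add: zip_map1 comp_def case_prod_unfold)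
      ultimately have "map2 (\<lambda>(i, \<delta>') y. coact i \<delta>' y) (zip ?is ?\<delta>s) xs = map2 (\<lambda>F x. F x) ?Fs xs" for xs
        by (simp only:)
      then show ?thesis by simp
    qed
    have mF: "mlin (replicate r H) (tpow H (sum_list ?is)) ?F"
      unfolding Feq using mlin_tconcat[OF V V all2] r by simp
    have "ocomp C ?is \<delta> ?\<delta>s \<in> ops C (sum_list ?is)"
      by (rule ocomp_in[OF connected_operadD(1)[OF C] \<delta>r \<delta>s])
    \<comment> \<open>The composite has arity \<open>j + k + l\<close>, which exceeds
      \<open>r = j + 1 + l\<close> because \<open>k \<ge> 2\<close>.\<close>
    then have "coact (sum_list ?is) (ocomp C ?is \<delta> ?\<delta>s) h = 0"
      using filtD(2)[OF h] k r unfolding sum by simp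
    then have "tlift H r (tpow H (sum_list ?is)) ?F (coact r \<delta> h) = 0"
      using coalgebraD(5)[OF H \<delta>r \<delta>s hH] r by simp
    moreover have "tlift H r (tpow H (sum_list ?is)) ?F (\<Sum>i<n. fscale (a i) (tens H (?w i))) =
        (\<Sum>i<n. smul (tpow H (sum_list ?is)) (a i) (?F (?w i)))"
      using uv r by (intro tlift_sum[OF vec_space_tpow mF]) simp
    ultimately have 0: "(\<Sum>i<n. fscale (a i) (?F (?w i))) = 0" unfolding t by simp
    have "mlin (replicate (j + (k + l)) H) fld
        (\<lambda>zs. (\<lambda>ps ws. g (ps @ b # drop k ws) * G' (take k ws)) (take j zs) (drop j zs))"
    proof (rule mlin_split[OF V])
      fix ps :: "'v list" assume ps: "length ps = j" "set ps \<subseteq> carr H"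
      show "mlin (replicate (k + l) H) fld (\<lambda>ws. g (ps @ b # drop k ws) * G' (take k ws))"
      proof (rule mlin_split[OF V, where F = "\<lambda>ws1 ws2. g (ps @ b # ws2) * G' ws1"])
        show "mlin (replicate k H) fld (\<lambda>ws1. g (ps @ b # ws2) * G' ws1)" if "length ws2 = l" "set ws2 \<subseteq> carr H" for ws2
          using mlin_scaled[OF vec_space_fld G'[unfolded tforms_iff]] by simp
        show "mlin (replicate l H) fld (\<lambda>ws2. g (ps @ b # ws2) * G' ws1)" for ws1
          using mlin_scaled[OF vec_space_fld, of _ "\<lambda>ws2. g ((ps @ [b]) @ ws2)" "G' ws1"]
            tforms_append_left[of g H "j + 1" l "ps @ [b]"] g r ps b by (simp add: tforms_iff mult.commute)
      qed
    next
      fix ws :: "'v list" assume ws: "length ws = k + l" "set ws \<subseteq> carr H"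
      have "set (b # drop k ws) \<subseteq> carr H" using ws b by (auto dest: in_set_dropD)
      from tforms_append_right[of g H j "1 + l" "b # drop k ws", OF _ _ this] ws g r
      show "mlin (replicate j H) fld (\<lambda>ps. g (ps @ b # drop k ws) * G' (take k ws))"
        using mlin_scaled[OF vec_space_fld, of _ "\<lambda>ps. g (ps @ b # drop k ws)" "G' (take k ws)"]
        by (simp add: tforms_iff mult.commute)
    qed
    then have G: "G \<in> tforms H (j + (k + l))" by (simp add: tforms_iff G_def[abs_def])
    have "?F (?w i) G = g (us i @ b # vs i) * coact k \<delta>' (x i) G'" if i: "i < n" for i
    proof -
      have T: "coact k \<delta>' (x i) \<in> carr (tpow H k)" using lin_onD(1)[OF D] uv[OF i] by simp
      have "map2 (\<lambda>F x. F x) (replicate (length ws) (coact 1 (ounit C))) ws = map (\<lambda>x. tens H [x]) ws"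
        if "set ws \<subseteq> carr H" for ws
        using that coalgebraD(4)[OF H] by (auto simp: zip_replicate1)
      from this[of "us i"] this[of "vs i"] have "map2 (\<lambda>F x. F x) ?Fs (?w i) =
          map (\<lambda>x. tens H [x]) (us i) @ coact k \<delta>' (x i) # map (\<lambda>x. tens H [x]) (vs i)"
        using uv[OF i] by (simp add: zip_append)
      then have "?F (?w i) G = coact k \<delta>' (x i) (\<lambda>zs. G (us i @ zs @ vs i))"
        using fun_cong[OF Feq, of "?w i"] tconcat_insert[OF V _ _ T, of "us i" "vs i" G] G uv[OF i]
        by (simp only: length_append list.size)
      also have "\<dots> = coact k \<delta>' (x i) (\<lambda>zs. g (us i @ b # vs i) * G' zs)"
      proof (rule tpow_cong[OF T])
        show "(\<lambda>zs. G (us i @ zs @ vs i)) \<in> tforms H k"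
          using tforms_append_right[OF tforms_append_left[OF G, of "us i"], of "vs i"] uv[OF i] by simp
        show "(\<lambda>zs. g (us i @ b # vs i) * G' zs) \<in> tforms H k"
          using mlin_scaled[OF vec_space_fld G'[unfolded tforms_iff]] by (simp add: tforms_iff)
      qed (use uv[OF i] in \<open>simp add: G_def\<close>)
      finally show ?thesis by (simp add: tpow_scaled_form[OF T G'])
    qed
    then have "(\<Sum>i<n. a i * (g (us i @ b # vs i) * coact k \<delta>' (x i) G')) = 0"
      using fun_cong[OF 0, of G] by (simp add: sum_fun_apply)
    then show "coact k \<delta>' ?y G' = (0 :: ('k, 'v) tensor) G'"
      unfolding y by (simp add: sum_fun_apply mult.assoc)
  qed
qed

text \<open>The projection \<open>q\<close> onto the primitive part is applied slot by slot. Each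
  replacement leaves the tensor unchanged, since the error is a combination of complement
  coordinates of contractions, and contractions are primitive.\<close>

lemma coact_filt_prim:
  fixes H :: "('k::field, 'v::ab_group_add) vs" and C :: "('k, 'c::ab_group_add) operad"
  assumes C: "connected_operad C" and H: "coalgebra C H coact"
    and h: "h \<in> filt C H coact r" and \<delta>: "\<delta> \<in> ops C r"
  obtains n :: nat and xs a where "\<forall>i<n. length (xs i) = r \<and> set (xs i) \<subseteq> carr (prim C H coact)"
    "coact r \<delta> h = (\<Sum>i<n. fscale (a i) (tens H (xs i)))"
proof -
  let ?L = "prim C H coact"
  note V = coalgebraD(1)[OF H]
  have hH: "h \<in> carr H" using filtD(1)[OF h] .
  obtain q B \<phi> where q: "lin_on H ?L q" and B: "B \<subseteq> carr H"
    and "\<forall>b. lin_on H fld (\<phi> b)" "\<forall>b\<in>B. \<forall>x\<in>carr ?L. \<phi> b x = 0"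
    "\<forall>x\<in>carr H. finite {b \<in> B. \<phi> b x \<noteq> 0}"
    "\<forall>x\<in>carr H. x - q x = (\<Sum>b | b \<in> B \<and> \<phi> b x \<noteq> 0. smul H (\<phi> b x) b)"
    by (rule complement_coordinates[OF V vec_space_prim[OF H] prim_subset smul_prim]) (rule that)
  note \<phi> = this(3-6)[rule_format]
  have q': "lin_on H H q" using q prim_subset[of C H coact] by (auto simp: lin_on_def)
  have t: "coact r \<delta> h \<in> carr (tpow H r)" using lin_onD(1)[OF coalgebraD(2)[OF H \<delta>] hH] .
  have "\<exists>(n::nat) xs a. (\<forall>i<n. length (xs i) = r \<and> set (xs i) \<subseteq> carr H) \<and>
      T = (\<Sum>i<n. fscale (a i) (tens H (xs i)))" if "T \<in> carr (tpow H r)" for T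
    using tpow_rep[OF that] by blast
  from this[OF t] obtain n :: nat and xs a where "\<forall>i<n. length (xs i) = r \<and> set (xs i) \<subseteq> carr H"
    "coact r \<delta> h = (\<Sum>i<n. fscale (a i) (tens H (xs i)))" by (elim exE conjE) (rule that)
  note xs = this[rule_format]
  have slot: "(\<Sum>i<n. a i * g (take j (xs i) @ xs i ! j # drop (Suc j) (xs i))) =
      (\<Sum>i<n. a i * g (take j (xs i) @ q (xs i ! j) # drop (Suc j) (xs i)))"
    if g: "g \<in> tforms H r" and j: "j < r" for g j
  proof -
    let ?us = "\<lambda>i. take j (xs i)" and ?x = "\<lambda>i. xs i ! j" and ?vs = "\<lambda>i. drop (Suc j) (xs i)"
    have uv: "length (?us i) = j \<and> length (?vs i) = r - Suc j \<and> set (?us i) \<subseteq> carr H \<and>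
        set (?vs i) \<subseteq> carr H \<and> ?x i \<in> carr H" if "i < n" for i
      using xs(1)[OF that] j set_take_subset[of j "xs i"] set_drop_subset[of "Suc j" "xs i"] nth_mem[of j "xs i"]
      by auto
    have split: "?us i @ ?x i # ?vs i = xs i" if "i < n" for i
      using xs(1)[OF that] j by (simp add: id_take_nth_drop[symmetric])
    have t': "coact r \<delta> h = (\<Sum>i<n. fscale (a i) (tens H (?us i @ ?x i # ?vs i)))"
      unfolding xs(2) using split by (intro sum.cong) auto
    \<comment> \<open>The finitely many complement directions that occur in slot \<open>j\<close>; a
      common index set for all summands permits interchanging the sums.\<close>
    define F where "F = (\<Union>i<n. {b \<in> B. \<phi> b (?x i) \<noteq> 0})"
    have finF: "finite F" unfolding F_def using uv \<phi>(3) by blast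
    have lin: "lin_on H fld (\<lambda>x. g (?us i @ x # ?vs i))" if "i < n" for i
      using mlin_slot[OF V g[unfolded tforms_iff]] uv[OF that] j by simp
    have diff: "g (?us i @ ?x i # ?vs i) - g (?us i @ q (?x i) # ?vs i) =
        (\<Sum>b\<in>F. \<phi> b (?x i) * g (?us i @ b # ?vs i))" if i: "i < n" for i
    proof -
      have x: "?x i \<in> carr H" "q (?x i) \<in> carr H" using uv[OF i] lin_onD(1)[OF q'] by auto
      have "g (?us i @ ?x i # ?vs i) - g (?us i @ q (?x i) # ?vs i) = g (?us i @ (?x i - q (?x i)) # ?vs i)"
        using lin_on_diff[OF V lin[OF i] x] by simp
      also have "?x i - q (?x i) = (\<Sum>b\<in>F. smul H (\<phi> b (?x i)) b)"
        unfolding \<phi>(4)[OF x(1)] using i finF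
        by (intro sum.mono_neutral_left) (auto simp: F_def smul_simps[OF V])
      also have "g (?us i @ \<dots> # ?vs i) = (\<Sum>b\<in>F. \<phi> b (?x i) * g (?us i @ b # ?vs i))"
        using lin_on_sum[OF V lin[OF i], of F "\<lambda>b. b" "\<lambda>b. \<phi> b (?x i)"] B by (auto simp: F_def)
      finally show ?thesis .
    qed
    \<comment> \<open>With direction \<open>b\<close> put into slot \<open>j\<close>, the
      contraction is primitive by \<open>contraction_prim\<close>, so its coordinate
      \<open>\<phi> b\<close> is 0.\<close>
    have "(\<Sum>i<n. a i * (\<phi> b (?x i) * g (?us i @ b # ?vs i))) = 0" if b: "b \<in> F" for b
    proof -
      have bB: "b \<in> B" "b \<in> carr H" using b B by (auto simp: F_def)
      have "(\<Sum>i<n. smul H (a i * g (?us i @ b # ?vs i)) (?x i)) \<in> carr ?L"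
        using j by (intro contraction_prim[OF C H h \<delta> t' uv _ g bB(2)]) auto
      from \<phi>(2)[OF bB(1) this] show ?thesis
        using lin_on_sum[OF V \<phi>(1), of "{..<n}" ?x b "\<lambda>i. a i * g (?us i @ b # ?vs i)"] uv
        by (simp add: algebra_simps)
    qed
    then have "(\<Sum>b\<in>F. \<Sum>i<n. a i * (\<phi> b (?x i) * g (?us i @ b # ?vs i))) = 0" by simp
    then have "(\<Sum>i<n. a i * (\<Sum>b\<in>F. \<phi> b (?x i) * g (?us i @ b # ?vs i))) = 0"
      by (subst (asm) sum.swap) (simp add: sum_distrib_left)
    then have "(\<Sum>i<n. a i * (g (?us i @ ?x i # ?vs i) - g (?us i @ q (?x i) # ?vs i))) = 0"
      using diff by simp
    then show ?thesis by (simp add: algebra_simps sum_subtractf)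
  qed
  have main: "(\<Sum>i<n. a i * g (xs i)) = (\<Sum>i<n. a i * g (map q (take j (xs i)) @ drop j (xs i)))"
    if g: "g \<in> tforms H r" and "j \<le> r" for g j
    using that(2)
  proof (induction j)
    case (Suc j)
    \<comment> \<open>Since \<open>slot\<close> holds for every form, it applies to the form that
      already projects the first \<open>j\<close> letters.\<close>
    let ?g = "\<lambda>zs. g (map q (take j zs) @ drop j zs)"
    have "mlin (replicate (j + (r - j)) H) fld (\<lambda>zs. (\<lambda>us vs. g (map q us @ vs)) (take j zs) (drop j zs))"
    proof (rule mlin_split[OF V])
      show "mlin (replicate j H) fld (\<lambda>us. g (map q us @ vs))" if "length vs = r - j" "set vs \<subseteq> carr H" for vs
        using tforms_append_right[of g H j "r - j" vs] g that Suc.prems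
        by (intro mlin_map[OF V q', of _ fld "\<lambda>us. g (us @ vs)"]) (simp add: tforms_iff)
      show "mlin (replicate (r - j) H) fld (\<lambda>vs. g (map q us @ vs))" if "length us = j" "set us \<subseteq> carr H" for us
        using tforms_append_left[of g H j "r - j" "map q us"] g that Suc.prems lin_onD(1)[OF q']
        by (auto simp: tforms_iff)
    qed
    then have "?g \<in> tforms H r" using Suc.prems by (simp add: tforms_iff)
    from slot[OF this, of j] have "(\<Sum>i<n. a i * ?g (xs i)) =
        (\<Sum>i<n. a i * g (map q (take j (xs i)) @ q (xs i ! j) # drop (Suc j) (xs i)))"
      using Suc.prems xs(1) by (simp add: id_take_nth_drop[symmetric])
    also have "\<dots> = (\<Sum>i<n. a i * g (map q (take (Suc j) (xs i)) @ drop (Suc j) (xs i)))"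
      using Suc.prems xs(1) by (intro sum.cong) (simp_all add: take_Suc_conv_app_nth)
    finally show ?case using Suc by simp
  qed simp
  have q_in: "length (map q (xs i)) = r \<and> set (map q (xs i)) \<subseteq> carr ?L" if "i < n" for i
    using xs(1)[OF that] lin_onD(1)[OF q] by auto
  have "coact r \<delta> h = (\<Sum>i<n. fscale (a i) (tens H (map q (xs i))))"
  proof (rule tpow_ext[OF t])
    show "(\<Sum>i<n. fscale (a i) (tens H (map q (xs i)))) \<in> carr (tpow H r)"
      using q_in prim_subset[of C H coact] by (intro tpow_sum_in) fastforce
    fix g assume g: "g \<in> tforms H r"
    have "coact r \<delta> h g = (\<Sum>i<n. a i * g (xs i))"
      unfolding xs(2) using xs(1) by (intro tpow_sum_eval[OF g]) simp
    moreover have "(\<Sum>i<n. fscale (a i) (tens H (map q (xs i)))) g = (\<Sum>i<n. a i * g (map q (xs i)))"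
      using q_in by (intro tpow_sum_eval[OF g]) simp
    ultimately show "coact r \<delta> h g = (\<Sum>i<n. fscale (a i) (tens H (map q (xs i)))) g"
      using main[OF g, of r] xs(1) by simp
  qed
  then show ?thesis using that[of n "\<lambda>i. map q (xs i)" a] q_in by blast
qed

section \<open>The cofree coalgebra in coordinates: connectedness and leading coefficient\<close>

section \<open>Dual bases and cofree coalgebras\<close>

lemma some_basis:
  fixes V :: "('k::field, 'v::ab_group_add) vs"
  assumes V: "vec_space V"
  shows "\<not> module.dependent (smul V) (some_basis V)" "module.span (smul V) (some_basis V) = carr V"
proof -
  interpret vector_space "smul V" using V by (rule vec_space_vector_space)
  have sV: "subspace (carr V)" using V by (simp add: vec_space_def)
  obtain B where "B \<subseteq> carr V" "independent B" "carr V \<subseteq> span B"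
    using maximal_independent_subset by blast
  then have "independent B \<and> span B = carr V" using span_minimal[OF _ sV] by blast
  from someI[of "\<lambda>B. independent B \<and> span B = carr V", OF this]
  show "independent (some_basis V)" "span (some_basis V) = carr V"
    unfolding some_basis_def by blast+
qed

lemma some_basis_in:
  assumes "vec_space V" "b \<in> some_basis V"
  shows "b \<in> carr V" "b \<noteq> 0"
proof -
  interpret vector_space "smul V" using assms(1) by (rule vec_space_vector_space)
  show "b \<in> carr V" using span_base[OF assms(2)] some_basis(2)[OF assms(1)] by simp
  show "b \<noteq> 0" using some_basis(1)[OF assms(1)] assms(2) dependent_zero by blast
qed

lemma finite_some_basis:
  assumes "vec_space V" "fin_dim V"
  shows "finite (some_basis V)"
proof -
  interpret vector_space "smul V" using assms(1) by (rule vec_space_vector_space)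
  obtain B where "finite B" "carr V = span B" using assms(2) by (auto simp: fin_dim_def)
  then show ?thesis
    using independent_span_bound[of B "some_basis V"] some_basis[OF assms(1)] span_superset by auto
qed

lemma smul_dual [simp]: "smul (dual V) = fscale"
  by (simp add: dual_def)

lemma dual_iff: "\<xi> \<in> carr (dual V) \<longleftrightarrow> lin_on V fld \<xi> \<and> (\<forall>x. x \<notin> carr V \<longrightarrow> \<xi> x = 0)"
  by (simp add: dual_def)

lemma vec_space_dual:
  fixes V :: "('k::field, 'v::ab_group_add) vs"
  assumes V: "vec_space V"
  shows "vec_space (dual V)"
proof -
  interpret vector_space "fscale :: 'k \<Rightarrow> ('v \<Rightarrow> 'k) \<Rightarrow> 'v \<Rightarrow> 'k" by (rule vector_space_fscale)
  have "subspace (carr (dual V))"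
    by (rule subspaceI) (auto simp: dual_iff lin_on_fld_iff algebra_simps)
  then show ?thesis by (simp add: vec_space_def vector_space_fscale)
qed

lemma dual_vec_in:
  assumes "vec_space V"
  shows "dual_vec V b \<in> carr (dual V)"
proof -
  interpret vector_space "smul V" using assms by (rule vec_space_vector_space)
  note B = some_basis[OF assms]
  show ?thesis
    unfolding dual_iff dual_vec_def lin_on_fld_iff
    using representation_add[OF B(1)] representation_scale[OF B(1)] B(2)
    by (auto simp: representation_def)
qed

lemma dual_basis_expansion:
  assumes V: "vec_space V" "fin_dim V" and x: "x \<in> carr V"
  shows "x = (\<Sum>b\<in>some_basis V. smul V (dual_vec V b x) b)"
proof -
  interpret vector_space "smul V" using V(1) by (rule vec_space_vector_space)
  note B = some_basis[OF V(1)]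
  have "x = (\<Sum>b | representation (some_basis V) x b \<noteq> 0. smul V (representation (some_basis V) x b) b)"
    using sum_nonzero_representation_eq[OF B(1)] x B(2) by simp
  also have "\<dots> = (\<Sum>b\<in>some_basis V. smul V (representation (some_basis V) x b) b)"
    using representation_ne_zero by (intro sum.mono_neutral_left finite_some_basis[OF V]) auto
  finally show ?thesis by (simp add: dual_vec_def)
qed

lemma dual_form_expansion:
  assumes V: "vec_space V" "fin_dim V" and \<xi>: "\<xi> \<in> carr (dual V)"
  shows "\<xi> = (\<Sum>b\<in>some_basis V. fscale (\<xi> b) (dual_vec V b))"
proof
  fix x
  show "\<xi> x = (\<Sum>b\<in>some_basis V. fscale (\<xi> b) (dual_vec V b)) x"
  proof (cases "x \<in> carr V")
    case True
    have "\<xi> x = \<xi> (\<Sum>b\<in>some_basis V. smul V (dual_vec V b x) b)"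
      using dual_basis_expansion[OF V True] by simp
    also have "\<dots> = (\<Sum>b\<in>some_basis V. dual_vec V b x * \<xi> b)"
      using lin_on_sum[OF V(1), of fld \<xi> "some_basis V" "\<lambda>b. b"] \<xi> some_basis_in(1)[OF V(1)]
      by (simp add: dual_iff)
    finally show ?thesis by (simp add: sum_fun_apply mult.commute)
  next
    case False
    then show ?thesis using \<xi> dual_vec_in[OF V(1)] by (auto simp: dual_iff sum_fun_apply)
  qed
qed

lemma vec_space_cofree: "vec_space (cofree C V)"
  by (simp add: cofree_def vec_space_schur)

lemma smul_cofree [simp]: "smul (cofree C V) = fscale"
  by (simp add: cofree_def)

lemma listset_iff: "xs \<in> listset As \<longleftrightarrow> list_all2 (\<in>) xs As"
  by (induction As arbitrary: xs) (auto simp: set_Cons_def list_all2_Cons2)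

lemma
  fixes C :: "('k::field, 'c::ab_group_add) operad" and V :: "('k, 'v::ab_group_add) vs"
  assumes C: "connected_operad C" and V: "vec_space V" and \<delta>: "\<delta> \<in> ops C m"
  shows cofree_coact_lin: "lin_on (cofree C V) (tpow (cofree C V) m) (cofree_coact C V m \<delta>)"
    and cofree_coact_sgen: "\<xi> \<in> carr (cospace C (length xs)) \<Longrightarrow> set xs \<subseteq> carr V \<Longrightarrow>
      cofree_coact C V m \<delta> (sgen (cospace C) V \<xi> xs) =
      (\<Sum>is\<in>{is. length is = m \<and> sum_list is = length xs}.
             \<Sum>bs\<in>listset (map (\<lambda>i. some_basis (ospace C i)) is).
               fscale (\<xi> (ocomp C is \<delta> bs))
                 (tens (cofree C V) (map2 (\<lambda>(i, b) ys. sgen (cospace C) V (dual_vec (ospace C i) b) ys)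
                      (zip is bs) (blocks is xs))))"
proof -
  let ?S = "cospace C" and ?W = "cofree C V"
  let ?T = "\<lambda>is bs xs. tens ?W (map2 (\<lambda>(i, b) ys. sgen ?S V (dual_vec (ospace C i) b) ys) (zip is bs) (blocks is xs))"
  let ?F = "\<lambda>\<xi> xs. \<Sum>is\<in>{is. length is = m \<and> sum_list is = length xs}.
             \<Sum>bs\<in>listset (map (\<lambda>i. some_basis (ospace C i)) is). fscale (\<xi> (ocomp C is \<delta> bs)) (?T is bs xs)"
  note vC = connected_operadD(2)[OF C]
  have T: "mlin (replicate n V) (tpow ?W m) (?T is bs)"
    if "length is = m" "sum_list is = n" "bs \<in> listset (map (\<lambda>i. some_basis (ospace C i)) is)" for n "is" bs
  proof -
    have l: "length bs = length is" using that(3) by (auto simp: listset_iff dest: list_all2_lengthD)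
    let ?Fs = "map (\<lambda>(i, b). sgen ?S V (dual_vec (ospace C i) b)) (zip is bs)"
    have "mlin (replicate (sum_list is) V) (tpow ?W m) (\<lambda>xs. tens ?W (map2 (\<lambda>F ys. F ys) ?Fs (blocks is xs)))"
    proof (rule mlin_blocks[OF V])
      show "mlin (replicate (is ! j) V) ?W (?Fs ! j)" if "j < length is" for j
        using that l by (simp add: cofree_def mlin_sgen cospace_def dual_vec_in[OF vC])
      show "mlin (replicate (length is) ?W) (tpow ?W m) (tens ?W)" using tens_mlin[of m ?W] that(1) by simp
    qed (simp add: l)
    then show ?thesis using that(2) by (simp add: zip_map1 case_prod_unfold comp_def)
  qed
  have "schur_mlin ?S V (tpow ?W m) (\<lambda>(\<xi>, xs). ?F \<xi> xs)"
    unfolding schur_mlin_iff[OF V] prod.case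
  proof (intro conjI allI impI)
    fix n \<xi> assume "\<xi> \<in> carr (?S n)"
    have "mlin (replicate n V) (tpow ?W m) (\<lambda>xs. \<Sum>is\<in>{is. length is = m \<and> sum_list is = n}.
             \<Sum>bs\<in>listset (map (\<lambda>i. some_basis (ospace C i)) is). fscale (\<xi> (ocomp C is \<delta> bs)) (?T is bs xs))"
      using mlin_scaled[OF vec_space_tpow T] by (intro mlin_sum[OF vec_space_tpow]) simp
    then show "mlin (replicate n V) (tpow ?W m) (?F \<xi>)"
      by (subst mlin_cong[OF V]) auto
  next
    fix xs assume xs: "set xs \<subseteq> carr V"
    have "lin_on (?S (length xs)) (tpow ?W m) (\<lambda>\<xi>. fscale (\<xi> c) t)" if "t \<in> carr (tpow ?W m)" for c t
      using vs_smul[OF vec_space_tpow that] by (auto simp: lin_on_def cospace_def fscale_def fun_eq_iff algebra_simps)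
    moreover have "?T is bs xs \<in> carr (tpow ?W m)"
      if "length is = m" "sum_list is = length xs" "bs \<in> listset (map (\<lambda>i. some_basis (ospace C i)) is)" for "is" bs
      using mlinD[OF T[OF that]] xs by (simp add: tuples_replicate)
    ultimately show "lin_on (?S (length xs)) (tpow ?W m) (\<lambda>\<xi>. ?F \<xi> xs)"
      by (intro lin_on_sum_fun[OF vec_space_tpow]) auto
  qed
  from slift_lin[OF vec_space_tpow this] slift_sgen[OF vec_space_tpow this]
  show "lin_on ?W (tpow ?W m) (cofree_coact C V m \<delta>)"
    and "\<xi> \<in> carr (cospace C (length xs)) \<Longrightarrow> set xs \<subseteq> carr V \<Longrightarrow>
      cofree_coact C V m \<delta> (sgen (cospace C) V \<xi> xs) = ?F \<xi> xs"
    unfolding cofree_coact_def cofree_def by simp_all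
qed

lemma basis_arity_zero:
  assumes "connected_operad C"
  shows "some_basis (ospace C 0) = {}"
  using some_basis_in[OF connected_operadD(2)[OF assms]] connected_operadD(4)[OF assms] by blast

lemma listset_empty_factor: "0 \<in> set is \<Longrightarrow> f 0 = {} \<Longrightarrow> listset (map f is) = {}"
  by (induction "is") (auto simp: set_Cons_def)

text \<open>Cutting \<open>length xs\<close> letters into more than \<open>length xs\<close> blocks
  leaves a block of length 0, and the basis of \<open>C\<^sub>0\<close> is empty, so every inner sum
  is empty.\<close>

lemma cofree_coact_above:
  assumes C: "connected_operad C" and V: "vec_space V" and \<delta>: "\<delta> \<in> ops C m"
    and \<xi>: "\<xi> \<in> carr (cospace C (length xs))" and xs: "set xs \<subseteq> carr V" and m: "m > length xs"
  shows "cofree_coact C V m \<delta> (sgen (cospace C) V \<xi> xs) = 0"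
  unfolding cofree_coact_sgen[OF C V \<delta> \<xi> xs]
proof (rule sum.neutral, rule ballI)
  fix "is" assume "is \<in> {is. length is = m \<and> sum_list is = length xs}"
  then have "length is = m" "sum_list is = length xs" by simp_all
  moreover have "length is \<le> sum_list is" if "0 \<notin> set is" for "is" :: "nat list"
    using that by (induction "is") auto
  ultimately have "0 \<in> set is" using m by (metis leD)
  from listset_empty_factor[OF this, of "\<lambda>i. some_basis (ospace C i)"]
  have "listset (map (\<lambda>i. some_basis (ospace C i)) is) = {}" using basis_arity_zero[OF C] by simp
  then show "(\<Sum>bs\<in>listset (map (\<lambda>i. some_basis (ospace C i)) is). fscale (\<xi> (ocomp C is \<delta> bs))
      (tens (cofree C V) (map2 (\<lambda>(i, b) ys. sgen (cospace C) V (dual_vec (ospace C i) b) ys)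
                      (zip is bs) (blocks is xs)))) = 0" by simp
qed

text \<open>An element is a finite sum of generators, and a generator on a word of length
  \<open>n\<close> is killed by all cooperations of arity above \<open>n\<close>.\<close>

lemma connected_cofree:
  assumes C: "connected_operad C" and V: "vec_space V"
  shows "connected_coalgebra C (cofree C V) (cofree_coact C V)"
  unfolding connected_coalgebra_def
proof (intro equalityI subsetI)
  fix t assume t: "t \<in> carr (cofree C V)"
  obtain n :: nat and \<xi> xs a where
    rep: "\<And>i. i < n \<Longrightarrow> \<xi> i \<in> carr (cospace C (length (xs i))) \<and> set (xs i) \<subseteq> carr V"
      "t = (\<Sum>i<n. fscale (a i) (sgen (cospace C) V (\<xi> i) (xs i)))"
    by (rule schur_rep[OF t[unfolded cofree_def]]) (rule that)
  \<comment> \<open>Any common bound for the word lengths would do; their sum also covers the empty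
    family.\<close>
  define r where "r = (\<Sum>i<n. length (xs i))"
  have le: "length (xs i) \<le> r" if "i < n" for i
    unfolding r_def by (rule member_le_sum) (use that in auto)
  have "cofree_coact C V m \<delta> t = 0" if "m > r" "\<delta> \<in> ops C m" for m \<delta>
  proof -
    have "cofree_coact C V m \<delta> t = (\<Sum>i<n. smul (tpow (cofree C V) m) (a i)
        (cofree_coact C V m \<delta> (sgen (cospace C) V (\<xi> i) (xs i))))"
      unfolding rep(2) by (rule lin_on_schur_sum[OF cofree_coact_lin[OF C V that(2), unfolded cofree_def], folded cofree_def])
        (use rep(1) in blast)
    also have "\<dots> = 0"
    proof (rule sum.neutral, rule ballI)
      fix i assume "i \<in> {..<n}"
      then have "cofree_coact C V m \<delta> (sgen (cospace C) V (\<xi> i) (xs i)) = 0"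
        using rep(1)[of i] le[of i] that by (intro cofree_coact_above[OF C V]) auto
      then show "smul (tpow (cofree C V) m) (a i) (cofree_coact C V m \<delta> (sgen (cospace C) V (\<xi> i) (xs i))) = 0"
        by (simp add: fscale_def fun_eq_iff)
    qed
    finally show ?thesis .
  qed
  then show "t \<in> (\<Union>r. filt C (cofree C V) (cofree_coact C V) r)" using t by (auto simp: filt_def)
qed (auto simp: filt_def)

text \<open>\<open>C\<^sub>1\<close> is spanned by the nonzero identity, which bounds the size of a
  basis by 1 and excludes the empty one.\<close>

lemma basis_arity_one_ex:
  assumes "connected_operad C"
  shows "\<exists>b. some_basis (ospace C (Suc 0)) = {b}"
proof -
  note V = connected_operadD(2)[OF assms, of "Suc 0"]
  interpret vector_space "smul (ospace C (Suc 0))" using V by (rule vec_space_vector_space)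
  let ?B = "some_basis (ospace C (Suc 0))" and ?u = "ounit C"
  have "?B \<subseteq> span {?u}"
    using some_basis_in(1)[OF V] connected_operadD(7)[OF assms] by (force simp: span_singleton)
  then have fin: "finite ?B" and "card ?B \<le> 1"
    using independent_span_bound[of "{?u}" ?B] some_basis(1)[OF V] by auto
  moreover have "?B \<noteq> {}"
    using some_basis(2)[OF V] connected_operadD(5,6)[OF assms] by auto
  ultimately have "card ?B = 1" by (metis card_0_eq le_neq_implies_less less_one)
  then show ?thesis by (meson card_1_singletonE)
qed

text \<open>The cofree coaction is written in arbitrarily chosen bases, so in arity 1 the basis
  vector is only some nonzero multiple of the identity. This multiple is one of the two factors of
  the constant in the leading coefficient.\<close>

definition basis1 :: "('k::field, 'c::ab_group_add) operad \<Rightarrow> 'c" where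
  "basis1 C = (THE b. some_basis (ospace C (Suc 0)) = {b})"

definition covec1 :: "('k::field, 'c::ab_group_add) operad \<Rightarrow> 'c \<Rightarrow> 'k" where
  "covec1 C = dual_vec (ospace C (Suc 0)) (basis1 C)"

lemma basis_arity_one:
  assumes "connected_operad C"
  shows "some_basis (ospace C (Suc 0)) = {basis1 C}"
  using basis_arity_one_ex[OF assms] unfolding basis1_def by (metis (mono_tags, lifting) singleton_inject the_equality)

lemma basis1:
  assumes "connected_operad C"
  shows "basis1 C \<in> ops C (Suc 0)" "basis1 C = smul (ospace C (Suc 0)) (unit_coeff C (basis1 C)) (ounit C)"
    "unit_coeff C (basis1 C) \<noteq> 0"
proof -
  note V = connected_operadD(2)[OF assms, of "Suc 0"]
  show 1: "basis1 C \<in> ops C (Suc 0)" using some_basis_in(1)[OF V, of "basis1 C"] basis_arity_one[OF assms] by simp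
  show 2: "basis1 C = smul (ospace C (Suc 0)) (unit_coeff C (basis1 C)) (ounit C)"
    by (rule unit_coeff[OF assms 1])
  have "basis1 C \<noteq> 0" using some_basis_in(2)[OF V, of "basis1 C"] basis_arity_one[OF assms] by simp
  then show "unit_coeff C (basis1 C) \<noteq> 0" using 2 smul_simps(1)[OF V] by metis
qed

lemma covec1:
  assumes "connected_operad C"
  shows "covec1 C \<in> carr (cospace C (Suc 0))" "covec1 C \<noteq> 0"
proof -
  note V = connected_operadD(2)[OF assms, of "Suc 0"]
  interpret vector_space "smul (ospace C (Suc 0))" using V by (rule vec_space_vector_space)
  show "covec1 C \<in> carr (cospace C (Suc 0))" unfolding covec1_def cospace_def by (rule dual_vec_in[OF V])
  have "covec1 C (basis1 C) = 1"
    unfolding covec1_def dual_vec_def basis_arity_one[OF assms]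
    using representation_basis[of "{basis1 C}" "basis1 C"] some_basis(1)[OF V] basis_arity_one[OF assms] by simp
  then show "covec1 C \<noteq> 0" by auto
qed

text \<open>Only the cut into single letters survives, all others having an empty block. Composing
  \<open>\<delta>\<close> with \<open>n\<close> copies of the basis vector of
  \<open>C\<^sub>1\<close> instead of the identity produces the \<open>n\<close>-th power of the
  scalar.\<close>

lemma cofree_coact_top:
  fixes C :: "('k::field, 'c::ab_group_add) operad" and V :: "('k, 'v::ab_group_add) vs"
  assumes C: "connected_operad C" and V: "vec_space V" and \<delta>: "\<delta> \<in> ops C (length xs)"
    and \<xi>: "\<xi> \<in> carr (cospace C (length xs))" and xs: "set xs \<subseteq> carr V"
  shows "cofree_coact C V (length xs) \<delta> (sgen (cospace C) V \<xi> xs) =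
    fscale (unit_coeff C (basis1 C) ^ length xs * \<xi> \<delta>)
      (tens (cofree C V) (map (\<lambda>x. sgen (cospace C) V (covec1 C) [x]) xs))"
proof -
  let ?n = "length xs" and ?b = "basis1 C" and ?\<beta> = "unit_coeff C (basis1 C)" and ?u = "ounit C"
  let ?I = "{is. length is = ?n \<and> sum_list is = ?n}"
  let ?f = "\<lambda>is. \<Sum>bs\<in>listset (map (\<lambda>i. some_basis (ospace C i)) is). fscale (\<xi> (ocomp C is \<delta> bs))
      (tens (cofree C V) (map2 (\<lambda>(i, b) ys. sgen (cospace C) V (dual_vec (ospace C i) b) ys)
                      (zip is bs) (blocks is xs)))"
  let ?one = "replicate ?n (Suc 0)"
  have ones: "length is \<le> sum_list is \<and> (sum_list is = length is \<longrightarrow> is = replicate (length is) (Suc 0))"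
    if "0 \<notin> set is" for "is" :: "nat list"
    using that by (induction "is") auto
  have "finite ?I"
  proof (rule finite_subset)
    show "?I \<subseteq> {is. set is \<subseteq> {..?n} \<and> length is = ?n}" using member_le_sum_list by fastforce
    show "finite {is. set is \<subseteq> {..?n} \<and> length is = ?n}" by (rule finite_lists_length_eq) simp
  qed
  moreover have "?f is = 0" if "is \<in> ?I - {?one}" for "is"
  proof -
    have "0 \<in> set is" using that ones[of "is"] by auto
    from listset_empty_factor[OF this, of "\<lambda>i. some_basis (ospace C i)"]
    show ?thesis using basis_arity_zero[OF C] by simp
  qed
  ultimately have "sum ?f ?I = sum ?f {?one}"
    by (intro sum.mono_neutral_right) (auto simp: sum_list_replicate)
  also have "\<dots> = fscale (\<xi> (ocomp C ?one \<delta> (replicate ?n ?b)))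
      (tens (cofree C V) (map (\<lambda>x. sgen (cospace C) V (covec1 C) [x]) xs))"
  proof -
    have "listset (replicate n {?b}) = {replicate n ?b}" for n
      by (induction n) (auto simp: set_Cons_def)
    moreover have "map2 (\<lambda>(i, b) ys. sgen (cospace C) V (dual_vec (ospace C i) b) ys)
        (zip ?one (replicate ?n ?b)) (blocks ?one xs) = map (\<lambda>x. sgen (cospace C) V (covec1 C) [x]) xs"
      unfolding blocks_replicate_1[OF refl]
      by (simp add: zip_replicate1 zip_replicate comp_def covec1_def flip: map_replicate_const)
        (simp add: map_replicate_const zip_replicate1 zip_map2 comp_def)
    ultimately show ?thesis using basis_arity_one[OF C] by simp
  qed
  also have "\<xi> (ocomp C ?one \<delta> (replicate ?n ?b)) = ?\<beta> ^ ?n * \<xi> \<delta>"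
  proof -
    have "mlin (map (ospace C) ?one) (ospace C (sum_list ?one)) (ocomp C ?one \<delta>)"
      using connected_operadD(1)[OF C] \<delta> unfolding ns_operad_def by (metis length_replicate)
    then have m: "mlin (replicate ?n (ospace C (Suc 0))) (ospace C ?n) (ocomp C ?one \<delta>)"
      by (simp add: sum_list_replicate)
    have u: "set (replicate ?n ?u) \<subseteq> ops C (Suc 0)" using connected_operadD(5)[OF C] by auto
    have e: "replicate ?n ?b = map2 (smul (ospace C (Suc 0))) (replicate ?n ?\<beta>) (replicate ?n ?u)"
      using basis1(2)[OF C] by (simp add: zip_replicate)
    have "ocomp C ?one \<delta> (replicate ?n ?b) = smul (ospace C ?n) (?\<beta> ^ ?n) (ocomp C ?one \<delta> (replicate ?n ?u))"
      unfolding e using mlin_scale_all[OF connected_operadD(2)[OF C] connected_operadD(2)[OF C] m, of "replicate ?n ?\<beta>" "replicate ?n ?u"] u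
      by (simp add: prod_list_replicate)
    moreover have "ocomp C ?one \<delta> (replicate ?n ?u) = \<delta>"
      using connected_operadD(1)[OF C] \<delta> unfolding ns_operad_def One_nat_def by blast
    ultimately show ?thesis using \<xi> \<delta> by (simp add: cospace_def dual_iff lin_on_fld_iff)
  qed
  finally show ?thesis unfolding cofree_coact_sgen[OF C V \<delta> \<xi> xs] .
qed

section \<open>Injectivity on the cofree coalgebra, and generation by the image of
  \<open>\<sigma>\<close>\<close>

section \<open>Connected bialgebras\<close>

text \<open>Isolates what the splitting contributes: on the image of \<open>\<sigma>\<close> the
  pairing \<open>top_coeff\<close> is evaluation up to \<open>c0 ^ n\<close>. No free algebra is
  mentioned, so the consequences hold in \<open>H\<close> and in free algebras alike.\<close>

locale ns_splitting = ns_bialgebras A C rel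
  for A :: "('k::field, 'a::ab_group_add) operad" and C :: "('k, 'c::ab_group_add) operad" and rel +
  fixes \<sigma> :: "nat \<Rightarrow> ('c \<Rightarrow> 'k) \<Rightarrow> 'a" and c0 :: 'k
  assumes sigma_lin: "lin_on (cospace C n) (ospace A n) (\<sigma> n)"
    and c0: "c0 \<noteq> 0"
    and top_coeff_sigma: "\<delta> \<in> ops C n \<Longrightarrow> \<xi> \<in> carr (cospace C n) \<Longrightarrow> top_coeff n \<delta> (\<sigma> n \<xi>) = c0 ^ n * \<xi> \<delta>"
begin

lemma sigma_in: "\<xi> \<in> carr (cospace C n) \<Longrightarrow> \<sigma> n \<xi> \<in> ops A n"
  by (rule lin_onD(1)[OF sigma_lin])

lemma coact_sigma:
  assumes H: "bialgebra A C rel H act coact" and \<delta>: "\<delta> \<in> ops C m"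
    and \<xi>: "\<xi> \<in> carr (cospace C (length xs))" and xs: "set xs \<subseteq> carr (prim C H coact)" and m: "m \<ge> length xs"
  shows "coact m \<delta> (act (\<sigma> (length xs) \<xi>) xs) =
    (if m = length xs then fscale (c0 ^ length xs * \<xi> \<delta>) (tens H xs) else 0)"
  using coact_act_above[OF H \<delta> sigma_in[OF \<xi>] xs] coact_act_top[OF H _ sigma_in[OF \<xi>] xs] top_coeff_sigma[OF _ \<xi>] \<delta> m
  by (cases "m = length xs") auto

text \<open>
  Subtracting \<open>c0\<^sup>-\<^sup>r \<Sum>\<^sub>b \<sigma>(b\<^sup>*)(b(h))\<close> from \<open>h\<close>, where \<open>b\<close> runs over a basis of \<open>C\<^sub>r\<close>, lowers
  the filtration degree of \<open>h\<close>.
\<close>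

lemma connected_induct:
  fixes H :: "('k, 'd::ab_group_add) vs"
  assumes H: "bialgebra A C rel H act coact" and conn: "connected_coalgebra C H coact"
    and X: "0 \<in> X" "\<And>x y. x \<in> X \<Longrightarrow> y \<in> X \<Longrightarrow> x + y \<in> X" "\<And>c x. x \<in> X \<Longrightarrow> smul H c x \<in> X"
    and gen: "\<And>\<xi> xs. \<xi> \<in> carr (cospace C (length xs)) \<Longrightarrow> set xs \<subseteq> carr (prim C H coact) \<Longrightarrow>
      act (\<sigma> (length xs) \<xi>) xs \<in> X"
  shows "carr H \<subseteq> X"
proof -
  note alg = bialgebraD(1)[OF H] and coalg = bialgebraD(2)[OF H] and V = bialgebraD(3)[OF H]
  note vC = connected_operadD(2)[OF C] and fC = connected_operadD(3)[OF C]
  let ?L = "prim C H coact"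
  have sumX: "sum f I \<in> X" if "\<And>i. i \<in> I \<Longrightarrow> f i \<in> X" for f :: "'i \<Rightarrow> 'd" and I
    using that by (induction I rule: infinite_finite_induct) (auto simp: X)
  have "filt C H coact r \<subseteq> X" for r
  proof (induction r)
    case 0
    show ?case
    proof
      fix h assume h: "h \<in> filt C H coact 0"
      \<comment> \<open>The identity cooperation has arity \<open>1 > 0\<close> and sends
        \<open>h\<close> to \<open>tens H [h]\<close>, so the lowest filtration step is 0.\<close>
      then have "coact 1 (ounit C) h = 0"
        using connected_operadD(5)[OF C] by (auto simp: filt_def)
      then have "tens H [h] = 0" using coalgebraD(4)[OF coalg filtD(1)[OF h]] by simp
      then show "h \<in> X" using tens_singleton_eq_0[OF V filtD(1)[OF h]] X(1) by simp
    qed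
  next
    case (Suc r)
    show ?case
    proof
      fix h assume h: "h \<in> filt C H coact (Suc r)"
      note hH = filtD(1)[OF h]
      let ?r = "Suc r" and ?B = "some_basis (ospace C (Suc r))"
      let ?bv = "dual_vec (ospace C ?r)"
      have bC: "b \<in> ops C ?r" if "b \<in> ?B" for b using some_basis_in(1)[OF vC that] .
      \<comment> \<open>The number of summands, the words and the coefficients all depend on
        \<open>b\<close>; they are bundled into one triple so that a single choice suffices.\<close>
      have "\<forall>b\<in>?B. \<exists>p :: nat \<times> (nat \<Rightarrow> 'd list) \<times> (nat \<Rightarrow> 'k). (\<forall>i<fst p. length (fst (snd p) i) = ?r \<and> set (fst (snd p) i) \<subseteq> carr ?L) \<and>
          coact ?r b h = (\<Sum>i<fst p. fscale (snd (snd p) i) (tens H (fst (snd p) i)))"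
      proof
        fix b assume "b \<in> ?B"
        obtain n :: nat and xs a where "\<forall>i<n. length (xs i) = ?r \<and> set (xs i) \<subseteq> carr ?L"
          "coact ?r b h = (\<Sum>i<n. fscale (a i) (tens H (xs i)))"
          by (rule coact_filt_prim[OF C coalg h bC[OF \<open>b \<in> ?B\<close>]]) (rule that)
        then show "\<exists>p :: nat \<times> (nat \<Rightarrow> 'd list) \<times> (nat \<Rightarrow> 'k). (\<forall>i<fst p. length (fst (snd p) i) = ?r \<and> set (fst (snd p) i) \<subseteq> carr ?L) \<and>
          coact ?r b h = (\<Sum>i<fst p. fscale (snd (snd p) i) (tens H (fst (snd p) i)))"
          by - (rule exI[of _ "(n, xs, a)"], simp)
      qed
      from bchoice[OF this] obtain p :: "'c \<Rightarrow> nat \<times> (nat \<Rightarrow> 'd list) \<times> (nat \<Rightarrow> 'k)" where p: "\<forall>b\<in>?B.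
          (\<forall>i<fst (p b). length (fst (snd (p b)) i) = ?r \<and> set (fst (snd (p b)) i) \<subseteq> carr ?L) \<and>
          coact ?r b h = (\<Sum>i<fst (p b). fscale (snd (snd (p b)) i) (tens H (fst (snd (p b)) i)))" ..
      define N where "N b = fst (p b)" for b
      define xs where "xs b = fst (snd (p b))" for b
      define a where "a b = snd (snd (p b))" for b
      have xs: "length (xs b i) = ?r" "set (xs b i) \<subseteq> carr ?L" "set (xs b i) \<subseteq> carr H"
        if "b \<in> ?B" "i < N b" for b i
        using p that prim_subset[of C H coact] by (auto simp: N_def xs_def)
      have bh: "coact ?r b h = (\<Sum>i<N b. fscale (a b i) (tens H (xs b i)))" if "b \<in> ?B" for b
        using p that by (simp add: N_def xs_def a_def)
      have bvC: "?bv b \<in> carr (cospace C ?r)" for b unfolding cospace_def by (rule dual_vec_in[OF vC])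
      define k where "k b i = act (\<sigma> ?r (?bv b)) (xs b i)" for b i
      have kX: "k b i \<in> X" if "b \<in> ?B" "i < N b" for b i
        using gen[of "?bv b" "xs b i"] bvC xs[OF that] by (simp add: k_def)
      have kH: "k b i \<in> carr H" if "b \<in> ?B" "i < N b" for b i
        unfolding k_def using sigma_in[OF bvC] xs[OF that] by (intro act_in[OF alg]) auto
      have kc: "coact m \<delta> (k b i) = (if m = ?r then fscale (c0 ^ ?r * ?bv b \<delta>) (tens H (xs b i)) else 0)"
        if "b \<in> ?B" "i < N b" "\<delta> \<in> ops C m" "m \<ge> ?r" for b i m \<delta>
        using coact_sigma[OF H that(3), of "?bv b" "xs b i"] bvC xs[OF that(1,2)] that(4) by (simp add: k_def)
      \<comment> \<open>Dividing by \<open>c0 ^ ?r\<close> cancels the scalar in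
        \<open>coact_sigma\<close>; the coefficients come from the tensors
        \<open>coact ?r b h\<close>.\<close>
      define y where "y = (\<Sum>b\<in>?B. \<Sum>i<N b. smul H (a b i / c0 ^ ?r) (k b i))"
      have yX: "y \<in> X" unfolding y_def using kX by (intro sumX X(3)) auto
      have yH: "y \<in> carr H" unfolding y_def using kH by (intro vs_sum[OF V] vs_smul[OF V]) auto
      have yc: "coact m \<delta> y = (\<Sum>b\<in>?B. \<Sum>i<N b. fscale (a b i / c0 ^ ?r) (coact m \<delta> (k b i)))"
        if \<delta>: "\<delta> \<in> ops C m" for m \<delta>
      proof -
        note lin = coalgebraD(2)[OF coalg \<delta>]
        have "coact m \<delta> y = (\<Sum>b\<in>?B. smul (tpow H m) 1 (coact m \<delta> (\<Sum>i<N b. smul H (a b i / c0 ^ ?r) (k b i))))"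
        proof -
          have "(\<Sum>i<N b. smul H (a b i / c0 ^ ?r) (k b i)) \<in> carr H" if "b \<in> ?B" for b
            using kH[OF that] by (intro vs_sum[OF V] vs_smul[OF V]) simp
          from lin_on_sum[OF V lin this, of ?B "\<lambda>b. b" "\<lambda>_. 1"] show ?thesis
            unfolding y_def smul_simps(3)[OF V] by blast
        qed
        also have "\<dots> = (\<Sum>b\<in>?B. \<Sum>i<N b. fscale (a b i / c0 ^ ?r) (coact m \<delta> (k b i)))"
        proof (rule sum.cong[OF refl])
          fix b assume "b \<in> ?B"
          then show "smul (tpow H m) 1 (coact m \<delta> (\<Sum>i<N b. smul H (a b i / c0 ^ ?r) (k b i))) =
              (\<Sum>i<N b. fscale (a b i / c0 ^ ?r) (coact m \<delta> (k b i)))"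
            using lin_on_sum[OF V lin, of "{..<N b}" "k b" "\<lambda>i. a b i / c0 ^ ?r"] kH
            by (simp add: fscale_def)
        qed
        finally show ?thesis .
      qed
      have "coact m \<delta> (h - y) = 0" if m: "m > r" and \<delta>: "\<delta> \<in> ops C m" for m \<delta>
      proof -
        \<comment> \<open>Above \<open>Suc r\<close> both sides vanish. In arity
          \<open>Suc r\<close> the left side is the expansion of \<open>\<delta>\<close> in the
          basis, applied to \<open>h\<close>.\<close>
        have "coact m \<delta> y = coact m \<delta> h"
        proof (cases "m = ?r")
          case False
          have "coact m \<delta> y = (\<Sum>b\<in>?B. \<Sum>i<N b. 0)"
            unfolding yc[OF \<delta>] using kc[OF _ _ \<delta>] m False by (intro sum.cong) (auto simp: fscale_def fun_eq_iff)
          then show ?thesis using filtD(2)[OF h _ \<delta>] m False by simp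
        next
          case True
          have "coact m \<delta> y = (\<Sum>b\<in>?B. \<Sum>i<N b. fscale (?bv b \<delta>) (fscale (a b i) (tens H (xs b i))))"
            unfolding yc[OF \<delta>] using kc[OF _ _ \<delta>] True c0 by (intro sum.cong refl) (auto simp: fscale_def fun_eq_iff)
          also have "\<dots> = (\<Sum>b\<in>?B. fscale (?bv b \<delta>) (coact m b h))"
            using True bh by (intro sum.cong) (auto simp: sum_fun_apply fun_eq_iff sum_distrib_left)
          also have "\<dots> = coact m (\<Sum>b\<in>?B. smul (ospace C ?r) (?bv b \<delta>) b) h"
            using lin_on_sum[OF vC coalgebraD(3)[OF coalg hH, of ?r], of ?B "\<lambda>b. b" "\<lambda>b. ?bv b \<delta>"] True bC by simp
          also have "(\<Sum>b\<in>?B. smul (ospace C ?r) (?bv b \<delta>) b) = \<delta>"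
            using dual_basis_expansion[OF vC fC, of \<delta> ?r] \<delta> True by simp
          finally show ?thesis .
        qed
        then show ?thesis using lin_on_diff[OF V coalgebraD(2)[OF coalg \<delta>] hH yH] by simp
      qed
      then have "h - y \<in> filt C H coact r" using vs_diff[OF V hH yH] by (auto simp: filt_def)
      then have "h - y \<in> X" using Suc.IH by blast
      then show "h \<in> X" using X(2)[OF _ yX] by fastforce
    qed
  qed
  then show ?thesis using conn unfolding connected_coalgebra_def by blast
qed

text \<open>On the component of top arity \<open>N\<close>, the cooperations of arity \<open>N\<close> recover the tensors.\<close>

lemma cofree_map_inj:
  fixes H :: "('k, 'd::ab_group_add) vs"
  assumes H: "bialgebra A C rel H act coact"
  defines "L \<equiv> prim C H coact"
  assumes \<alpha>: "lin_on (cofree C L) H \<alpha>"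
    "\<And>\<xi> xs. \<xi> \<in> carr (cospace C (length xs)) \<Longrightarrow> set xs \<subseteq> carr L \<Longrightarrow>
      \<alpha> (sgen (cospace C) L \<xi> xs) = act (\<sigma> (length xs) \<xi>) xs"
    and u: "u \<in> carr (cofree C L)" "\<alpha> u = 0"
  shows "u = 0"
proof -
  note alg = bialgebraD(1)[OF H] and coalg = bialgebraD(2)[OF H] and V = bialgebraD(3)[OF H]
  note vC = connected_operadD(2)[OF C] and fC = connected_operadD(3)[OF C]
  have L: "vec_space L" "carr L \<subseteq> carr H" "smul L = smul H"
    using vec_space_prim[OF coalg] prim_subset[of C H coact] by (auto simp: L_def)
  \<comment> \<open>Cooperations yield tensors over \<open>H\<close>, while the forms to be tested
    live on \<open>L\<close>; a projection onto \<open>L\<close> pulls these forms back to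
    \<open>H\<close>.\<close>
  obtain q B and \<phi> :: "'d \<Rightarrow> 'd \<Rightarrow> 'k" where q: "lin_on H L q" "\<forall>x\<in>carr L. q x = x"
    by (rule complement_coordinates[OF V L]) (rule that)
  let ?S = "cospace C"
  \<comment> \<open>Stated for all finite index sets so that summands can be discarded;
    \<open>N\<close> is a strict bound on the word lengths, hence a step treats the words of length
    exactly \<open>N\<close>.\<close>
  have main: "(\<Sum>i\<in>I. fscale (a i) (sgen ?S L (\<xi> i) (xs i))) = 0"
    if "finite I" "\<And>i. i \<in> I \<Longrightarrow> \<xi> i \<in> carr (?S (length (xs i))) \<and> set (xs i) \<subseteq> carr L"
      "\<And>i. i \<in> I \<Longrightarrow> length (xs i) < N" "\<alpha> (\<Sum>i\<in>I. fscale (a i) (sgen ?S L (\<xi> i) (xs i))) = 0"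
    for N and I :: "nat set" and \<xi> xs a
    using that
  proof (induction N arbitrary: I)
    case 0
    then have "I = {}" by auto
    then show ?case by simp
  next
    case (Suc N)
    let ?I = "{i \<in> I. length (xs i) = N}" and ?g = "\<lambda>i. fscale (a i) (sgen ?S L (\<xi> i) (xs i))"
    have val: "\<alpha> (\<Sum>i\<in>I. ?g i) = (\<Sum>i\<in>I. smul H (a i) (act (\<sigma> (length (xs i)) (\<xi> i)) (xs i)))"
      using lin_on_schur_sum[OF \<alpha>(1)[unfolded cofree_def], of I \<xi> xs a] Suc.prems(2) \<alpha>(2) by simp
    have actH: "act (\<sigma> (length (xs i)) (\<xi> i)) (xs i) \<in> carr H" if "i \<in> I" for i
      using Suc.prems(2)[OF that] sigma_in L(2) by (intro act_in[OF alg]) auto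
    have zero: "(\<Sum>i\<in>?I. fscale (a i * \<xi> i \<delta>) (tens H (xs i))) = 0" if \<delta>: "\<delta> \<in> ops C N" for \<delta>
    proof -
      have "0 = coact N \<delta> (\<Sum>i\<in>I. smul H (a i) (act (\<sigma> (length (xs i)) (\<xi> i)) (xs i)))"
        unfolding trans[OF sym[OF val] Suc.prems(4)] by (rule lin_on_zero[OF V coalgebraD(2)[OF coalg \<delta>], symmetric])
      also have "\<dots> = (\<Sum>i\<in>I. fscale (a i) (coact N \<delta> (act (\<sigma> (length (xs i)) (\<xi> i)) (xs i))))"
        using lin_on_sum[OF V coalgebraD(2)[OF coalg \<delta>], of I "\<lambda>i. act (\<sigma> (length (xs i)) (\<xi> i)) (xs i)" a] actH
        by simp
      also have "\<dots> = (\<Sum>i\<in>I. if length (xs i) = N then fscale (a i) (fscale (c0 ^ N * \<xi> i \<delta>) (tens H (xs i))) else 0)"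
      proof (rule sum.cong[OF refl])
        fix i assume i: "i \<in> I"
        show "fscale (a i) (coact N \<delta> (act (\<sigma> (length (xs i)) (\<xi> i)) (xs i))) =
          (if length (xs i) = N then fscale (a i) (fscale (c0 ^ N * \<xi> i \<delta>) (tens H (xs i))) else 0)"
          using coact_sigma[OF H \<delta>, of "\<xi> i" "xs i"] Suc.prems(2,3)[OF i]
          by (auto simp: L_def fscale_def fun_eq_iff)
      qed
      also have "\<dots> = (\<Sum>i\<in>?I. fscale (a i) (fscale (c0 ^ N * \<xi> i \<delta>) (tens H (xs i))))"
        by (simp add: sum.inter_filter Suc.prems(1))
      also have "\<dots> = fscale (c0 ^ N) (\<Sum>i\<in>?I. fscale (a i * \<xi> i \<delta>) (tens H (xs i)))"
        by (simp add: fun_eq_iff sum_fun_apply sum_distrib_left algebra_simps)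
      finally have "fscale (c0 ^ N) (\<Sum>i\<in>?I. fscale (a i * \<xi> i \<delta>) (tens H (xs i))) = 0" by simp
      then show ?thesis using c0 by (simp add: fscale_def fun_eq_iff)
    qed
    have top: "(\<Sum>i\<in>?I. ?g i) = 0"
    proof (rule schur_ext)
      show "(\<Sum>i\<in>?I. ?g i) \<in> carr (schur ?S L)" using Suc.prems(2) by (intro schur_sum_in) blast
      show "0 \<in> carr (schur ?S L)" by (rule vs_zero[OF vec_space_schur])
      fix \<Psi> assume \<Psi>: "\<Psi> \<in> schur_forms ?S L"
      let ?B = "some_basis (ospace C N)" and ?bv = "dual_vec (ospace C N)"
      have \<Psi>': "schur_mlin ?S L fld \<Psi>" using \<Psi> by (simp add: schur_forms_def)
      have bv: "?bv b \<in> carr (?S N)" for b unfolding cospace_def by (rule dual_vec_in[OF vC])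
      \<comment> \<open>Expanding \<open>\<xi> i\<close> in the dual basis reduces a form on
        covectors and words to forms on words alone, weighted by the numbers
        \<open>\<xi> i b\<close> that also appear in \<open>zero\<close>.\<close>
      have expand: "\<Psi> (\<xi> i, xs i) = (\<Sum>b\<in>?B. \<xi> i b * \<Psi> (?bv b, xs i))" if i: "i \<in> ?I" for i
      proof -
        have \<xi>i: "\<xi> i \<in> carr (dual (ospace C N))" "set (xs i) \<subseteq> carr L" "length (xs i) = N"
          using i Suc.prems(2)[of i] by (auto simp: cospace_def)
        have lin: "lin_on (?S N) fld (\<lambda>\<xi>. \<Psi> (\<xi>, xs i))" using \<Psi>' \<xi>i by (auto simp: schur_mlin_iff[OF L(1)])
        have "vec_space (?S N)" unfolding cospace_def by (rule vec_space_dual[OF vC])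
        from lin_on_sum[OF this lin, of ?B ?bv "\<xi> i"] bv
        have "\<Psi> (\<Sum>b\<in>?B. fscale (\<xi> i b) (?bv b), xs i) = (\<Sum>b\<in>?B. \<xi> i b * \<Psi> (?bv b, xs i))"
          by (simp add: cospace_def)
        then show ?thesis using dual_form_expansion[OF vC fC \<xi>i(1)] by simp
      qed
      have "(\<Sum>i\<in>?I. a i * \<xi> i b * \<Psi> (?bv b, xs i)) = 0" if b: "b \<in> ?B" for b
      proof -
        have "mlin (replicate N L) fld (\<lambda>xs. \<Psi> (?bv b, xs))"
          using \<Psi>' bv by (auto simp: schur_mlin_iff[OF L(1)])
        from mlin_map[OF V q(1) this] have f: "(\<lambda>xs. \<Psi> (?bv b, map q xs)) \<in> tforms H N"
          by (simp add: tforms_iff)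
        have "(\<Sum>i\<in>?I. fscale (a i * \<xi> i b) (tens H (xs i))) (\<lambda>xs. \<Psi> (?bv b, map q xs)) =
            (\<Sum>i\<in>?I. a i * \<xi> i b * \<Psi> (?bv b, map q (xs i)))"
          by (rule tpow_sum_eval[OF f]) simp
        moreover have "map q (xs i) = xs i" if "i \<in> ?I" for i
          using q(2) Suc.prems(2)[of i] that by (auto intro!: map_idI)
        ultimately show ?thesis using zero[OF some_basis_in(1)[OF vC b]] by simp
      qed
      then have "(\<Sum>b\<in>?B. \<Sum>i\<in>?I. a i * \<xi> i b * \<Psi> (?bv b, xs i)) = 0" by simp
      then have "(\<Sum>i\<in>?I. a i * \<Psi> (\<xi> i, xs i)) = 0"
        using expand by (subst (asm) sum.swap) (simp add: sum_distrib_left mult.assoc)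
      then show "(\<Sum>i\<in>?I. ?g i) \<Psi> = (0 :: ('k, 'c \<Rightarrow> 'k, 'd) schur) \<Psi>"
        by (simp add: sum_fun_apply sgen_eval[OF \<Psi>])
    qed
    let ?J = "{i \<in> I. length (xs i) \<noteq> N}"
    have "(\<Sum>i\<in>?I \<union> ?J. ?g i) = (\<Sum>i\<in>?I. ?g i) + (\<Sum>i\<in>?J. ?g i)"
      by (rule sum.union_disjoint) (use Suc.prems(1) in auto)
    moreover have "?I \<union> ?J = I" by auto
    ultimately have "(\<Sum>i\<in>I. ?g i) = (\<Sum>i\<in>?I. ?g i) + (\<Sum>i\<in>?J. ?g i)" by (simp only:)
    then have eq: "(\<Sum>i\<in>I. ?g i) = (\<Sum>i\<in>?J. ?g i)" by (simp only: top add_0)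
    have "(\<Sum>i\<in>?J. ?g i) = 0"
    proof (rule Suc.IH)
      show "length (xs i) < N" if "i \<in> ?J" for i using that Suc.prems(3)[of i] by simp
      show "\<alpha> (\<Sum>i\<in>?J. ?g i) = 0" unfolding eq[symmetric] by (rule Suc.prems(4))
    qed (use Suc.prems(1,2) in auto)
    then show ?case unfolding eq .
  qed
  obtain n :: nat and \<xi> xs a where
    rep: "\<And>i. i < n \<Longrightarrow> \<xi> i \<in> carr (?S (length (xs i))) \<and> set (xs i) \<subseteq> carr L"
      "u = (\<Sum>i<n. fscale (a i) (sgen ?S L (\<xi> i) (xs i)))"
    by (rule schur_rep[OF u(1)[unfolded cofree_def]]) (rule that)
  show ?thesis
    unfolding rep(2)
  proof (rule main[OF finite_lessThan[of n]])
    show "length (xs i) < Suc (\<Sum>i<n. length (xs i))" if "i \<in> {..<n}" for i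
      using member_le_sum[of i "{..<n}" "\<lambda>i. length (xs i)"] that by simp
    show "\<alpha> (\<Sum>i<n. fscale (a i) (sgen ?S L (\<xi> i) (xs i))) = 0"
      unfolding rep(2)[symmetric] by (rule u(2))
  qed (use rep(1) in blast)
qed

end

section \<open>Free algebras whose letters are primitive\<close>

context ns_bialgebras
begin

lemma free_coact_sgen:
  assumes D: "bialgebra A C rel (free_alg A L) (free_act A L) D" and L: "vec_space L"
    and incl: "free_incl A L ` carr L \<subseteq> carr (prim C (free_alg A L) D)"
    and \<delta>: "\<delta> \<in> ops C m" and \<mu>: "\<mu> \<in> ops A (length xs)" and xs: "set xs \<subseteq> carr L"
  shows "D m \<delta> (sgen (ospace A) L \<mu> xs) =
    (\<Sum>(P, Q)\<leftarrow>rel m (length xs) \<delta> \<mu>. fscale (lin_coeffs C Q)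
       (tens (free_alg A L) (act_blocks (sgen (ospace A) L) P xs)))"
proof -
  let ?xs = "map (free_incl A L) xs"
  have "set ?xs \<subseteq> carr (prim C (free_alg A L) D)" using xs incl by auto
  from coact_act_prim[OF D \<delta> _ this, of \<mu>] \<mu>
  have "D m \<delta> (sgen (ospace A) L \<mu> xs) = (\<Sum>(P, Q)\<leftarrow>rel m (length xs) \<delta> \<mu>. fscale (lin_coeffs C Q)
       (tens (free_alg A L) (act_blocks (free_act A L) P ?xs)))"
    using sgen_eq_free_act[OF ns_A L \<mu> xs] by simp
  moreover have "fscale (lin_coeffs C Q) (tens (free_alg A L) (act_blocks (free_act A L) P ?xs)) =
      fscale (lin_coeffs C Q) (tens (free_alg A L) (act_blocks (sgen (ospace A) L) P xs))"
    if PQ: "(P, Q) \<in> set (rel m (length xs) \<delta> \<mu>)" for P Q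
  proof (cases "lin_coeffs C Q = 0")
    case False
    have "act_blocks (free_act A L) P ?xs = act_blocks (sgen (ospace A) L) P xs"
      unfolding act_blocks_map
      using rel_arity[OF \<delta> \<mu> PQ False] rel_props(3)[OF \<delta> \<mu> PQ] sgen_eq_free_act[OF ns_A L] xs
      by (intro act_blocks_cong[where M = "ops A"]) auto
    then show ?thesis by simp
  qed (simp add: fscale_def)
  ultimately show ?thesis by (auto intro!: arg_cong[of _ _ sum_list] map_cong)
qed

text \<open>With primitive letters, cooperations of arity exceeding the word length vanish on a
  generator, and an element involves finitely many words.\<close>

lemma connected_free:
  assumes D: "bialgebra A C rel (free_alg A L) (free_act A L) D" and L: "vec_space L"
    and incl: "free_incl A L ` carr L \<subseteq> carr (prim C (free_alg A L) D)"
  shows "connected_coalgebra C (free_alg A L) D"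
  unfolding connected_coalgebra_def
proof (intro equalityI subsetI)
  fix t assume t: "t \<in> carr (free_alg A L)"
  obtain n :: nat and \<mu> xs a where
    rep: "\<And>i. i < n \<Longrightarrow> \<mu> i \<in> ops A (length (xs i)) \<and> set (xs i) \<subseteq> carr L"
      "t = (\<Sum>i<n. fscale (a i) (sgen (ospace A) L (\<mu> i) (xs i)))"
    by (rule schur_rep[OF t[unfolded free_alg_def]]) (rule that)
  define r where "r = (\<Sum>i<n. length (xs i))"
  have le: "length (xs i) \<le> r" if "i < n" for i
    unfolding r_def by (rule member_le_sum) (use that in auto)
  have "D m \<delta> t = 0" if m: "m > r" and \<delta>: "\<delta> \<in> ops C m" for m \<delta>
  proof -
    have "D m \<delta> t = (\<Sum>i<n. smul (tpow (free_alg A L) m) (a i) (D m \<delta> (sgen (ospace A) L (\<mu> i) (xs i))))"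
      unfolding rep(2)
      by (rule lin_on_schur_sum[OF coalgebraD(2)[OF bialgebraD(2)[OF D] \<delta>, unfolded free_alg_def], folded free_alg_def])
        (use rep(1) in blast)
    also have "\<dots> = 0"
    proof (rule sum.neutral, rule ballI)
      fix i assume "i \<in> {..<n}"
      then have i: "\<mu> i \<in> ops A (length (xs i))" "set (xs i) \<subseteq> carr L" "length (xs i) < m"
        using rep(1)[of i] le[of i] m by auto
      have "set (map (free_incl A L) (xs i)) \<subseteq> carr (prim C (free_alg A L) D)" using i incl by auto
      from coact_act_above[OF D \<delta> _ this, of "\<mu> i"] i
      have "D m \<delta> (sgen (ospace A) L (\<mu> i) (xs i)) = 0" by (simp add: sgen_eq_free_act[OF ns_A L])
      then show "smul (tpow (free_alg A L) m) (a i) (D m \<delta> (sgen (ospace A) L (\<mu> i) (xs i))) = 0"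
        by (simp add: fscale_def fun_eq_iff)
    qed
    finally show ?thesis .
  qed
  then show "t \<in> (\<Union>r. filt C (free_alg A L) D r)" using t by (auto simp: filt_def)
qed (auto simp: filt_def)

text \<open>On a generator both coactions are sums over the same relation with the same scalars,
  since the letters are primitive in both bialgebras; the extension carries one sum to the other
  term by term.\<close>

lemma free_ext_coalg_hom:
  assumes D: "bialgebra A C rel (free_alg A L) (free_act A L) D" and L: "vec_space L"
    and incl: "free_incl A L ` carr L \<subseteq> carr (prim C (free_alg A L) D)"
    and H: "bialgebra A C rel H act coact" and LH: "carr L \<subseteq> carr (prim C H coact)" "smul L = smul H"
  shows "coalg_hom C (free_alg A L) D H coact (slift (ospace A) L H act)"
proof -
  note alg = bialgebraD(1)[OF H] and coalg = bialgebraD(2)[OF H] and V = bialgebraD(3)[OF H]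
  let ?\<theta> = "slift (ospace A) L H act"
  have LV: "carr L \<subseteq> carr H" using LH(1) prim_subset by blast
  note lin = free_ext_lin[OF alg L LV LH(2)] and sg = free_ext_sgen[OF alg L LV LH(2)]
  have "coact m \<delta> (?\<theta> t) = tmap (free_alg A L) H m ?\<theta> (D m \<delta> t)"
    if \<delta>: "\<delta> \<in> ops C m" and t: "t \<in> carr (free_alg A L)" for m \<delta> t
  proof (rule lin_on_schur_unique[where h = "\<lambda>t. coact m \<delta> (?\<theta> t)" and h' = "\<lambda>t. tmap (free_alg A L) H m ?\<theta> (D m \<delta> t)"])
    note tl = tmap_lin[OF vec_space_free_alg lin, of m]
    show "lin_on (schur (ospace A) L) (tpow H m) (\<lambda>t. coact m \<delta> (?\<theta> t))"
      using lin_on_comp[OF lin coalgebraD(2)[OF coalg \<delta>]] by (simp add: free_alg_def)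
    show "lin_on (schur (ospace A) L) (tpow H m) (\<lambda>t. tmap (free_alg A L) H m ?\<theta> (D m \<delta> t))"
      using lin_on_comp[OF coalgebraD(2)[OF bialgebraD(2)[OF D] \<delta>] tl] by (simp add: free_alg_def)
    show "t \<in> carr (schur (ospace A) L)" using t by (simp add: free_alg_def)
    fix \<mu> xs assume \<mu>: "\<mu> \<in> ops A (length xs)" and xs: "set xs \<subseteq> carr L"
    have xsp: "set xs \<subseteq> carr (prim C H coact)" using xs LH(1) by blast
    let ?t = "\<lambda>P Q. fscale (lin_coeffs C Q) (tens (free_alg A L) (act_blocks (sgen (ospace A) L) P xs))"
    have term_in: "tens (free_alg A L) (act_blocks (sgen (ospace A) L) P xs) \<in> carr (tpow (free_alg A L) m)"
      and term_map: "tmap (free_alg A L) H m ?\<theta> (tens (free_alg A L) (act_blocks (sgen (ospace A) L) P xs)) =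
          tens H (act_blocks act P xs)"
      if PQ: "(P, Q) \<in> set (rel m (length xs) \<delta> \<mu>)" and nz: "lin_coeffs C Q \<noteq> 0" for P Q
    proof -
      note r = rel_props[OF \<delta> \<mu> PQ]
      have len: "length xs = sum_list (map fst P)" using rel_arity[OF \<delta> \<mu> PQ nz] by simp
      have car: "set (act_blocks (sgen (ospace A) L) P xs) \<subseteq> carr (free_alg A L)"
        unfolding free_alg_def using xs by (intro set_act_blocks[OF len r(3)] sgen_in) auto
      show "tens (free_alg A L) (act_blocks (sgen (ospace A) L) P xs) \<in> carr (tpow (free_alg A L) m)"
        using car r(1) by (intro tens_in) simp_all
      have "act_blocks (\<lambda>\<mu> zs. ?\<theta> (sgen (ospace A) L \<mu> zs)) P xs = act_blocks act P xs"
        using xs sg by (intro act_blocks_cong[OF len r(3)]) auto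
      then show "tmap (free_alg A L) H m ?\<theta> (tens (free_alg A L) (act_blocks (sgen (ospace A) L) P xs)) =
          tens H (act_blocks act P xs)"
        using tmap_tens[OF vec_space_free_alg lin _ car, of m] r(1) by (simp add: map_act_blocks)
    qed
    have z: "fscale 0 t = 0" for t :: "'x \<Rightarrow> 'k" by (simp add: fscale_def fun_eq_iff)
    have t_in: "?t P Q \<in> carr (tpow (free_alg A L) m)" if "(P, Q) \<in> set (rel m (length xs) \<delta> \<mu>)" for P Q
      using vs_smul[OF vec_space_tpow term_in[OF that], of "lin_coeffs C Q"] vs_zero[OF vec_space_tpow, of "free_alg A L" m]
      by (cases "lin_coeffs C Q = 0") (simp_all add: z)
    have t_map: "tmap (free_alg A L) H m ?\<theta> (?t P Q) = fscale (lin_coeffs C Q) (tens H (act_blocks act P xs))"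
      if "(P, Q) \<in> set (rel m (length xs) \<delta> \<mu>)" for P Q
    proof (cases "lin_coeffs C Q = 0")
      case True
      then show ?thesis using lin_on_zero[OF vec_space_tpow tl] by (simp add: z)
    next
      case False
      show ?thesis using lin_onD(3)[OF tl term_in[OF that False], of "lin_coeffs C Q"] term_map[OF that False] by simp
    qed
    have "tmap (free_alg A L) H m ?\<theta> (\<Sum>(P, Q)\<leftarrow>rel m (length xs) \<delta> \<mu>. ?t P Q) =
        (\<Sum>(P, Q)\<leftarrow>rel m (length xs) \<delta> \<mu>. tmap (free_alg A L) H m ?\<theta> (?t P Q))"
      using lin_on_sum_list[OF vec_space_tpow tl, of "rel m (length xs) \<delta> \<mu>" "\<lambda>(P, Q). ?t P Q"] t_in
      by (auto simp: case_prod_unfold)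
    also have "\<dots> = (\<Sum>(P, Q)\<leftarrow>rel m (length xs) \<delta> \<mu>. fscale (lin_coeffs C Q) (tens H (act_blocks act P xs)))"
      using t_map by (intro arg_cong[of _ _ sum_list] map_cong) auto
    also have "\<dots> = coact m \<delta> (act \<mu> xs)"
      by (rule coact_act_prim[OF H \<delta> \<mu> xsp, symmetric])
    finally show "coact m \<delta> (?\<theta> (sgen (ospace A) L \<mu> xs)) =
        tmap (free_alg A L) H m ?\<theta> (D m \<delta> (sgen (ospace A) L \<mu> xs))"
      unfolding free_coact_sgen[OF D L incl \<delta> \<mu> xs] sg[OF \<mu> xs] by simp
  qed
  then show ?thesis using lin by (simp add: coalg_hom_def)
qed

end

section \<open>Coefficients of words, and their transfer to other letters\<close>

section \<open>Primitive elements of free algebras\<close>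

definition word_form :: "('v \<Rightarrow> 'k::field) list \<Rightarrow> 'v list \<Rightarrow> 'k" where
  "word_form fs ys = prod_list (map2 (\<lambda>f y. f y) fs ys)"

text \<open>With coordinate forms for \<open>fs\<close> and the identity for \<open>g\<close> this
  is the coefficient operation of one word; the general \<open>g\<close> allows the coefficient to
  be used at once.\<close>

definition word_extract ::
    "(nat \<Rightarrow> ('k::field, 's::ab_group_add) vs) \<Rightarrow> ('k, 'v::ab_group_add) vs \<Rightarrow> ('k, 'w::ab_group_add) vs
      \<Rightarrow> ('s \<Rightarrow> 'w) \<Rightarrow> ('v \<Rightarrow> 'k) list \<Rightarrow> ('k, 's, 'v) schur \<Rightarrow> 'w" where
  "word_extract S L W g fs =
     slift S L W (\<lambda>\<nu> ys. if length ys = length fs then smul W (word_form fs ys) (g \<nu>) else 0)"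

lemma
  assumes L: "vec_space L" and W: "vec_space W" and S: "\<And>n. vec_space (S n)"
    and g: "lin_on (S (length fs)) W g" and fs: "\<forall>f\<in>set fs. lin_on L fld f"
  shows word_extract_lin: "lin_on (schur S L) W (word_extract S L W g fs)"
    and word_extract_sgen: "\<nu> \<in> carr (S (length ys)) \<Longrightarrow> set ys \<subseteq> carr L \<Longrightarrow>
      word_extract S L W g fs (sgen S L \<nu> ys) =
      (if length ys = length fs then smul W (word_form fs ys) (g \<nu>) else 0)"
proof -
  note sm = schur_mlin_single[where S = S, OF L W S g refl fs, folded word_form_def]
  show "lin_on (schur S L) W (word_extract S L W g fs)"
    unfolding word_extract_def by (rule slift_lin[OF W sm])
  show "word_extract S L W g fs (sgen S L \<nu> ys) =
      (if length ys = length fs then smul W (word_form fs ys) (g \<nu>) else 0)"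
    if "\<nu> \<in> carr (S (length ys))" "set ys \<subseteq> carr L"
    unfolding word_extract_def by (rule slift_sgen[OF W sm that])
qed

lemma word_form_append:
  "length fs = length ys \<Longrightarrow> word_form (fs @ gs) (ys @ zs) = word_form fs ys * word_form gs zs"
  by (simp add: word_form_def zip_append)

lemma word_form_split:
  assumes "length fs = length ys"
  shows "word_form fs ys = word_form (take i fs) (take i ys) * word_form (drop i fs) (drop i ys)"
  using word_form_append[of "take i fs" "take i ys" "drop i fs" "drop i ys"] assms by simp

lemma mlin_expand:
  assumes V: "vec_space V" and W: "vec_space W" and B: "finite B" "B \<subseteq> carr V"
    and "mlin (replicate n V) W F" "length ys = n" "set ys \<subseteq> carr V"
    "\<forall>y\<in>set ys. y = (\<Sum>b\<in>B. smul V (c b y) b)"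
  shows "F ys = (\<Sum>w\<in>{w. set w \<subseteq> B \<and> length w = n}. smul W (word_form (map c w) ys) (F w))"
  using assms(5-)
proof (induction n arbitrary: F ys)
  case 0
  have "{w. set w \<subseteq> B \<and> length w = 0} = {[]}" by auto
  then show ?case using 0 by (simp add: word_form_def smul_simps[OF W])
next
  case (Suc n)
  obtain y ys' where ys: "ys = y # ys'" "length ys' = n" using Suc.prems by (auto simp: length_Suc_conv)
  let ?X = "{w. set w \<subseteq> B \<and> length w = n}"
  have lin: "lin_on V W (\<lambda>y. F (y # ys'))"
    using Suc.prems ys by (simp add: mlin_Cons tuples_replicate)
  have "F ys = F ((\<Sum>b\<in>B. smul V (c b y) b) # ys')" using Suc.prems(4) ys by simp
  also have "\<dots> = (\<Sum>b\<in>B. smul W (c b y) (F (b # ys')))"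
    using lin_on_sum[OF V lin, of B "\<lambda>b. b" "\<lambda>b. c b y"] B by auto
  also have "\<dots> = (\<Sum>b\<in>B. \<Sum>w\<in>?X. smul W (word_form (map c (b # w)) ys) (F (b # w)))"
  proof (rule sum.cong[OF refl])
    fix b assume b: "b \<in> B"
    have "mlin (replicate n V) W (\<lambda>ys. F (b # ys))" using Suc.prems b B by (auto simp: mlin_Cons)
    from Suc.IH[OF this ys(2)] Suc.prems ys
    have "F (b # ys') = (\<Sum>w\<in>?X. smul W (word_form (map c w) ys') (F (b # w)))" by simp
    then show "smul W (c b y) (F (b # ys')) = (\<Sum>w\<in>?X. smul W (word_form (map c (b # w)) ys) (F (b # w)))"
      by (simp add: smul_simps[OF W] ys word_form_def)
  qed
  also have "\<dots> = (\<Sum>(b, w)\<in>B \<times> ?X. smul W (word_form (map c (b # w)) ys) (F (b # w)))"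
    by (rule sum.cartesian_product)
  also have "\<dots> = (\<Sum>w\<in>(\<lambda>(b, w). b # w) ` (B \<times> ?X). smul W (word_form (map c w) ys) (F w))"
    by (subst sum.reindex) (auto simp: inj_on_def case_prod_unfold)
  also have "(\<lambda>(b, w). b # w) ` (B \<times> ?X) = {w. set w \<subseteq> B \<and> length w = Suc n}"
    by (force simp: length_Suc_conv image_iff)
  finally show ?case .
qed

lemma sum_list_fscale:
  fixes g :: "'x \<Rightarrow> 'z \<Rightarrow> 'k::field"
  shows "(\<Sum>(P, Q)\<leftarrow>R. fscale (f Q) (fscale c (g P))) = fscale c (\<Sum>(P, Q)\<leftarrow>R. fscale (f Q) (g P))"
  by (induction R) (auto simp: fscale_def fun_eq_iff algebra_simps)

lemma sum_sum_list_swap: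
  fixes f :: "'i \<Rightarrow> 'x \<Rightarrow> 'y \<Rightarrow> 'z::comm_monoid_add"
  shows "(\<Sum>i\<in>I. \<Sum>(P, Q)\<leftarrow>R. f i P Q) = (\<Sum>(P, Q)\<leftarrow>R. \<Sum>i\<in>I. f i P Q)"
  by (induction R) (auto simp: sum.distrib)

text \<open>Each letter is expanded in a basis of \<open>L\<close>, so \<open>t\<close> becomes a
  sum over words in basis vectors, and extraction at a word recovers its coefficient
  operation.\<close>

lemma schur_word_decomposition:
  fixes L :: "('k::field, 'v::ab_group_add) vs" and S :: "nat \<Rightarrow> ('k, 's::ab_group_add) vs"
  assumes L: "vec_space L" and S: "\<And>n. vec_space (S n)" and t: "t \<in> carr (schur S L)"
  obtains X and c :: "'v \<Rightarrow> 'v \<Rightarrow> 'k" where "finite X" "\<forall>w\<in>X. set w \<subseteq> carr L" "\<forall>b. lin_on L fld (c b)"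
    "t = (\<Sum>w\<in>X. sgen S L (word_extract S L (S (length w)) (\<lambda>\<nu>. \<nu>) (map c w) t) w)"
proof -
  interpret vector_space "smul L" using L by (rule vec_space_vector_space)
  let ?B = "some_basis L"
  note B = some_basis[OF L]
  define c where "c b = (\<lambda>x. if x \<in> carr L then representation ?B x b else 0)" for b
  have c_lin: "lin_on L fld (c b)" for b
    unfolding c_def lin_on_fld_iff
    using representation_add[OF B(1)] representation_scale[OF B(1)] B(2) vs_add[OF L] vs_smul[OF L] by auto
  obtain n :: nat and \<mu> ys a where
    rep: "\<And>i. i < n \<Longrightarrow> \<mu> i \<in> carr (S (length (ys i))) \<and> set (ys i) \<subseteq> carr L"
      "t = (\<Sum>i<n. fscale (a i) (sgen S L (\<mu> i) (ys i)))"
    by (rule schur_rep[OF t]) (rule that)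
  \<comment> \<open>Only finitely many basis vectors occur in the letters of \<open>t\<close>;
    \<open>X\<close> below consists of the words over them whose lengths occur.\<close>
  define F where "F = (\<Union>i<n. \<Union>y\<in>set (ys i). {b. representation ?B y b \<noteq> 0})"
  have F: "finite F" "F \<subseteq> ?B"
    unfolding F_def using finite_representation representation_ne_zero by blast+
  have FL: "F \<subseteq> carr L" using F(2) some_basis_in(1)[OF L] by blast
  have y: "y = (\<Sum>b\<in>F. smul L (c b y) b)" if "i < n" "y \<in> set (ys i)" for i y
  proof -
    have yL: "y \<in> carr L" using rep(1) that by blast
    have "y = (\<Sum>b | representation ?B y b \<noteq> 0. smul L (representation ?B y b) b)"
      using sum_nonzero_representation_eq[OF B(1)] yL B(2) by simp
    also have "\<dots> = (\<Sum>b\<in>F. smul L (representation ?B y b) b)"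
      using that by (intro sum.mono_neutral_left F(1)) (auto simp: F_def)
    finally show ?thesis using yL by (simp add: c_def)
  qed
  let ?N = "(\<lambda>i. length (ys i)) ` {..<n}"
  define X where "X = {w. set w \<subseteq> F \<and> length w \<in> ?N}"
  have finX: "finite X"
  proof -
    have "X = (\<Union>k\<in>?N. {w. set w \<subseteq> F \<and> length w = k})" by (auto simp: X_def)
    then show ?thesis using finite_lists_length_eq[OF F(1)] by simp
  qed
  let ?\<kappa> = "\<lambda>w. word_extract S L (S (length w)) (\<lambda>\<nu>. \<nu>) (map c w)"
  have id: "lin_on (S (length (map c w))) (S (length w)) (\<lambda>\<nu>. \<nu>)" for w
    by (simp add: lin_on_def)
  have cs: "\<forall>f\<in>set (map c w). lin_on L fld f" for w using c_lin by auto
  have \<kappa>: "sgen S L (?\<kappa> w t) w =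
      (\<Sum>i<n. if length (ys i) = length w then fscale (a i * word_form (map c w) (ys i)) (sgen S L (\<mu> i) w) else 0)"
    if w: "set w \<subseteq> carr L" for w
  proof -
    have wL: "lin_on (S (length w)) (schur S L) (\<lambda>\<nu>. sgen S L \<nu> w)" by (rule sgen_lin[OF w])
    have "sgen S L (?\<kappa> w t) w = (\<Sum>i<n. fscale (a i) (sgen S L (?\<kappa> w (sgen S L (\<mu> i) (ys i))) w))"
      unfolding rep(2)
      using lin_on_schur_sum[OF lin_on_comp[OF word_extract_lin[where S = S and W = "S (length w)" and g = "\<lambda>\<nu>. \<nu>" and fs = "map c w", OF L S S id cs] wL], of "{..<n}" \<mu> ys a] rep(1)
      by simp
    also have "\<dots> = (\<Sum>i<n. if length (ys i) = length w then fscale (a i * word_form (map c w) (ys i)) (sgen S L (\<mu> i) w) else 0)"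
    proof (rule sum.cong[OF refl])
      fix i assume "i \<in> {..<n}"
      then have i: "\<mu> i \<in> carr (S (length (ys i)))" "set (ys i) \<subseteq> carr L" using rep(1) by auto
      show "fscale (a i) (sgen S L (?\<kappa> w (sgen S L (\<mu> i) (ys i))) w) =
        (if length (ys i) = length w then fscale (a i * word_form (map c w) (ys i)) (sgen S L (\<mu> i) w) else 0)"
        using word_extract_sgen[where S = S and W = "S (length w)" and g = "\<lambda>\<nu>. \<nu>" and fs = "map c w", OF L S S id cs i] lin_onD(3)[OF wL, of "\<mu> i" "word_form (map c w) (ys i)"]
          lin_on_zero[OF S wL] i
        by (auto simp: fscale_def fun_eq_iff mult.assoc)
    qed
    finally show ?thesis .
  qed
  have "(\<Sum>w\<in>X. sgen S L (?\<kappa> w t) w) = (\<Sum>w\<in>X. \<Sum>i<n. if length (ys i) = length w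
      then fscale (a i * word_form (map c w) (ys i)) (sgen S L (\<mu> i) w) else 0)"
    using \<kappa> FL by (intro sum.cong) (auto simp: X_def)
  also have "\<dots> = (\<Sum>i<n. \<Sum>w\<in>X. if length (ys i) = length w
      then fscale (a i * word_form (map c w) (ys i)) (sgen S L (\<mu> i) w) else 0)"
    by (rule sum.swap)
  also have "\<dots> = (\<Sum>i<n. fscale (a i) (sgen S L (\<mu> i) (ys i)))"
  proof (rule sum.cong[OF refl])
    fix i assume i: "i \<in> {..<n}"
    let ?Y = "{w. set w \<subseteq> F \<and> length w = length (ys i)}"
    have "sgen S L (\<mu> i) (ys i) =
        (\<Sum>w\<in>?Y. smul (schur S L) (word_form (map c w) (ys i)) (sgen S L (\<mu> i) w))"
      using i rep(1)[of i] y[of i] by (intro mlin_expand[OF L vec_space_schur F(1) FL mlin_sgen]) auto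
    then have "fscale (a i) (sgen S L (\<mu> i) (ys i)) =
        (\<Sum>w\<in>?Y. fscale (a i * word_form (map c w) (ys i)) (sgen S L (\<mu> i) w))"
      by (simp add: fun_eq_iff sum_fun_apply sum_distrib_left mult.assoc)
    also have "\<dots> = (\<Sum>w\<in>X. if w \<in> ?Y then fscale (a i * word_form (map c w) (ys i)) (sgen S L (\<mu> i) w) else 0)"
    proof -
      have "{w \<in> X. w \<in> ?Y} = ?Y" using i by (auto simp: X_def)
      then show ?thesis by (intro trans[OF _ sum.inter_filter[OF finX]]) (simp only:)
    qed
    also have "\<dots> = (\<Sum>w\<in>X. if length (ys i) = length w
      then fscale (a i * word_form (map c w) (ys i)) (sgen S L (\<mu> i) w) else 0)"
      by (intro sum.cong) (auto simp: X_def)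
    finally show "(\<Sum>w\<in>X. if length (ys i) = length w
      then fscale (a i * word_form (map c w) (ys i)) (sgen S L (\<mu> i) w) else 0) =
      fscale (a i) (sgen S L (\<mu> i) (ys i))" by simp
  qed
  finally have "t = (\<Sum>w\<in>X. sgen S L (?\<kappa> w t) w)" using rep(2) by simp
  then show ?thesis using that[OF finX, of c] c_lin FL by (auto simp: X_def)
qed

context ns_bialgebras
begin

text \<open>Takes the coefficient selected by \<open>fs\<close> and attaches it to the word
  \<open>xs\<close>, which may lie in a different space.\<close>

abbreviation word_replace ::
    "('k, 'v::ab_group_add) vs \<Rightarrow> ('k, 'w::ab_group_add) vs \<Rightarrow> ('v \<Rightarrow> 'k) list \<Rightarrow> 'w list
      \<Rightarrow> ('k, 'a, 'v) schur \<Rightarrow> ('k, 'a, 'w) schur" where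
  "word_replace L V fs xs \<equiv> word_extract (ospace A) L (free_alg A V) (\<lambda>\<nu>. sgen (ospace A) V \<nu> xs) fs"

lemma
  assumes L: "vec_space L" and len: "length fs = length xs" and xs: "set xs \<subseteq> carr V"
    and fs: "\<forall>f\<in>set fs. lin_on L fld f"
  shows word_replace_lin: "lin_on (free_alg A L) (free_alg A V) (word_replace L V fs xs)"
    and word_replace_sgen: "\<nu> \<in> ops A (length ys) \<Longrightarrow> set ys \<subseteq> carr L \<Longrightarrow>
      word_replace L V fs xs (sgen (ospace A) L \<nu> ys) =
      (if length ys = length fs then fscale (word_form fs ys) (sgen (ospace A) V \<nu> xs) else 0)"
proof -
  have g: "lin_on (ospace A (length fs)) (free_alg A V) (\<lambda>\<nu>. sgen (ospace A) V \<nu> xs)"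
    unfolding free_alg_def len by (rule sgen_lin[OF xs])
  note vA = connected_operadD(2)[OF A]
  show "lin_on (free_alg A L) (free_alg A V) (word_replace L V fs xs)"
    using word_extract_lin[where S = "ospace A", OF L vec_space_free_alg vA g fs] by (simp add: free_alg_def)
  show "word_replace L V fs xs (sgen (ospace A) L \<nu> ys) =
      (if length ys = length fs then fscale (word_form fs ys) (sgen (ospace A) V \<nu> xs) else 0)"
    if "\<nu> \<in> ops A (length ys)" "set ys \<subseteq> carr L"
    using word_extract_sgen[where S = "ospace A", OF L vec_space_free_alg vA g fs that] by simp
qed

text \<open>The version for tensor factors: \<open>fs\<close> and \<open>xs\<close> are cut alike,
  and each factor has its own block replaced.\<close>

definition block_replace where
  "block_replace L V is fs xs = map2 (\<lambda>gs zs. word_replace L V gs zs) (blocks is fs) (blocks is xs)"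

lemma block_replace_simps [simp]:
  "block_replace L V [] fs xs = []"
  "block_replace L V (i # is) fs xs =
    word_replace L V (take i fs) (take i xs) # block_replace L V is (drop i fs) (drop i xs)"
  by (simp_all add: block_replace_def)

lemma length_block_replace [simp]: "length (block_replace L V is fs xs) = length is"
  by (simp add: block_replace_def)

lemma block_replace_lin:
  assumes L: "vec_space L" and "length fs = length xs" "set xs \<subseteq> carr V" "\<forall>f\<in>set fs. lin_on L fld f"
  shows "\<forall>h\<in>set (block_replace L V is fs xs). lin_on (free_alg A L) (free_alg A V) h"
  using assms(2-)
proof (induction "is" arbitrary: fs xs)
  case (Cons i "is")
  have "lin_on (free_alg A L) (free_alg A V) (word_replace L V (take i fs) (take i xs))"
    using Cons.prems set_take_subset[of i xs] set_take_subset[of i fs] by (intro word_replace_lin[OF L]) auto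
  moreover have "\<forall>h\<in>set (block_replace L V is (drop i fs) (drop i xs)). lin_on (free_alg A L) (free_alg A V) h"
    using Cons.prems set_drop_subset[of i xs] set_drop_subset[of i fs] by (intro Cons.IH) auto
  ultimately show ?case by simp
qed simp

text \<open>\<open>cs\<close> lists the scalars of the separate blocks. The word form is
  multiplicative under cutting, so their product is the scalar of the whole word and blockwise
  replacement agrees with global replacement.\<close>

lemma block_replace_match:
  assumes L: "vec_space L"
    and "length fs = length xs" "length ys = length xs" "length xs = sum_list (map fst P)"
    "set xs \<subseteq> carr V" "set ys \<subseteq> carr L" "\<forall>f\<in>set fs. lin_on L fld f" "\<forall>(i, \<mu>)\<in>set P. \<mu> \<in> ops A i"
  shows "\<exists>cs. length cs = length P \<and> prod_list cs = word_form fs ys \<and>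
    map2 (\<lambda>h t. h t) (block_replace L V (map fst P) fs xs) (act_blocks (sgen (ospace A) L) P ys) =
    map2 fscale cs (act_blocks (sgen (ospace A) V) P xs)"
  using assms(2-)
proof (induction P arbitrary: fs xs ys)
  case Nil
  then show ?case by (simp add: word_form_def)
next
  case (Cons p P)
  obtain i \<mu> where p: "p = (i, \<mu>)" by force
  have "\<exists>cs. length cs = length P \<and> prod_list cs = word_form (drop i fs) (drop i ys) \<and>
    map2 (\<lambda>h t. h t) (block_replace L V (map fst P) (drop i fs) (drop i xs)) (act_blocks (sgen (ospace A) L) P (drop i ys)) =
    map2 fscale cs (act_blocks (sgen (ospace A) V) P (drop i xs))"
    using Cons.prems p set_drop_subset[of i xs] set_drop_subset[of i ys] set_drop_subset[of i fs]
    by (intro Cons.IH) auto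
  then obtain cs where cs: "length cs = length P" "prod_list cs = word_form (drop i fs) (drop i ys)"
    "map2 (\<lambda>h t. h t) (block_replace L V (map fst P) (drop i fs) (drop i xs)) (act_blocks (sgen (ospace A) L) P (drop i ys)) =
    map2 fscale cs (act_blocks (sgen (ospace A) V) P (drop i xs))" by blast
  have "word_replace L V (take i fs) (take i xs) (sgen (ospace A) L \<mu> (take i ys)) =
      fscale (word_form (take i fs) (take i ys)) (sgen (ospace A) V \<mu> (take i xs))"
    using Cons.prems p set_take_subset[of i xs] set_take_subset[of i ys] set_take_subset[of i fs]
    by (subst word_replace_sgen[OF L]) auto
  then have eq: "map2 (\<lambda>h t. h t) (block_replace L V (map fst (p # P)) fs xs) (act_blocks (sgen (ospace A) L) (p # P) ys) =
      map2 fscale (word_form (take i fs) (take i ys) # cs) (act_blocks (sgen (ospace A) V) (p # P) xs)"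
    using cs(3) by (simp only: p list.map fst_conv block_replace_simps act_blocks_Cons zip_Cons_Cons prod.case)
  show ?case
    by (rule exI[of _ "word_form (take i fs) (take i ys) # cs"], intro conjI eq)
      (use cs word_form_split[of fs ys i] Cons.prems in simp_all)
qed

text \<open>At the first place where the lengths differ, a replacement meets a word of the wrong
  length and gives 0.\<close>

lemma block_replace_mismatch:
  assumes L: "vec_space L"
    and "length fs = length xs" "length xs = sum_list is" "length ys = sum_list (map fst P)"
    "length is = length P" "is \<noteq> map fst P"
    "set xs \<subseteq> carr V" "set ys \<subseteq> carr L" "\<forall>f\<in>set fs. lin_on L fld f" "\<forall>(i, \<mu>)\<in>set P. \<mu> \<in> ops A i"
  shows "0 \<in> set (map2 (\<lambda>h t. h t) (block_replace L V is fs xs) (act_blocks (sgen (ospace A) L) P ys))"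
  using assms(2-)
proof (induction P arbitrary: "is" fs xs ys)
  case (Cons p P)
  obtain i \<mu> where p: "p = (i, \<mu>)" by force
  obtain k ks where k: "is = k # ks" using Cons.prems by (cases "is") auto
  have eq: "map2 (\<lambda>h t. h t) (block_replace L V is fs xs) (act_blocks (sgen (ospace A) L) (p # P) ys) =
      word_replace L V (take k fs) (take k xs) (sgen (ospace A) L \<mu> (take i ys)) #
      map2 (\<lambda>h t. h t) (block_replace L V ks (drop k fs) (drop k xs)) (act_blocks (sgen (ospace A) L) P (drop i ys))"
    by (simp add: p k)
  show ?case
  proof (cases "k = i")
    case True
    then have "0 \<in> set (map2 (\<lambda>h t. h t) (block_replace L V ks (drop k fs) (drop k xs)) (act_blocks (sgen (ospace A) L) P (drop i ys)))"
      using Cons.prems p k set_drop_subset[of i xs] set_drop_subset[of i ys] set_drop_subset[of i fs]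
      by (intro Cons.IH) auto
    then show ?thesis unfolding eq by (rule list.set_intros(2))
  next
    case False
    then have "word_replace L V (take k fs) (take k xs) (sgen (ospace A) L \<mu> (take i ys)) = 0"
      using Cons.prems p k set_take_subset[of k xs] set_take_subset[of i ys] set_take_subset[of k fs]
      by (subst word_replace_sgen[OF L]) auto
    then show ?thesis unfolding eq by (metis list.set_intros(1))
  qed
qed simp

text \<open>This is where it matters that the relations involve no permutation.\<close>

lemma coact_word_replace:
  fixes L :: "('k, 'v::ab_group_add) vs" and V :: "('k, 'w::ab_group_add) vs"
  assumes D: "bialgebra A C rel (free_alg A L) (free_act A L) D" and L: "vec_space L"
    and incl: "free_incl A L ` carr L \<subseteq> carr (prim C (free_alg A L) D)"
    and D': "bialgebra A C rel (free_alg A V) (free_act A V) D'" and V: "vec_space V"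
    and incl': "free_incl A V ` carr V \<subseteq> carr (prim C (free_alg A V) D')"
    and len: "length fs = length xs" and xs: "set xs \<subseteq> carr V" and fs: "\<forall>f\<in>set fs. lin_on L fld f"
    and \<delta>: "\<delta> \<in> ops C m" and t: "t \<in> carr (free_alg A L)"
  shows "D' m \<delta> (word_replace L V fs xs t) =
    (\<Sum>is\<in>{is. length is = m \<and> sum_list is = length xs}.
       tlift (free_alg A L) m (tpow (free_alg A V) m)
         (\<lambda>ts. tens (free_alg A V) (map2 (\<lambda>h t. h t) (block_replace L V is fs xs) ts)) (D m \<delta> t))"
proof -
  let ?S = "ospace A" and ?F = "free_alg A L" and ?G = "free_alg A V" and ?n = "length xs"
  let ?I = "{is. length is = m \<and> sum_list is = ?n}"
  let ?h = "\<lambda>is ts. tens ?G (map2 (\<lambda>h t. h t) (block_replace L V is fs xs) ts)"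
  let ?H = "\<lambda>is. tlift ?F m (tpow ?G m) (?h is)"
  note lin = word_replace_lin[OF L len xs fs] and val = word_replace_sgen[OF L len xs fs]
  have hm: "mlin (replicate m ?F) (tpow ?G m) (?h is)" if "is \<in> ?I" for "is"
    using mlin_tens_map2[OF vec_space_free_alg block_replace_lin[OF L len xs fs, of "is"]] that by simp
  have H: "lin_on (tpow ?F m) (tpow ?G m) (?H is)" if "is \<in> ?I" for "is"
    by (rule tlift_props(1)[OF vec_space_tpow hm[OF that]])
  have Ht: "?H is (tens ?F ts) = ?h is ts" if "is \<in> ?I" "length ts = m" "set ts \<subseteq> carr ?F" for "is" ts
    by (rule tlift_props(2)[OF vec_space_tpow hm[OF that(1)] that(2,3)])
  note coD = bialgebraD(2)[OF D] and coD' = bialgebraD(2)[OF D']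
  have finI: "finite ?I"
  proof (rule finite_subset)
    show "?I \<subseteq> {is. set is \<subseteq> {..?n} \<and> length is = m}" using member_le_sum_list by fastforce
    show "finite {is. set is \<subseteq> {..?n} \<and> length is = m}" by (rule finite_lists_length_eq) simp
  qed
  have z: "fscale 0 t = 0" for t :: "'x \<Rightarrow> 'k" by (simp add: fscale_def fun_eq_iff)
  show ?thesis
  proof (rule lin_on_schur_unique[where h = "\<lambda>t. D' m \<delta> (word_replace L V fs xs t)" and W = "tpow ?G m" and
        h' = "\<lambda>t. \<Sum>is\<in>?I. ?H is (D m \<delta> t)"])
    show "lin_on (schur ?S L) (tpow ?G m) (\<lambda>t. D' m \<delta> (word_replace L V fs xs t))"
      using lin_on_comp[OF lin coalgebraD(2)[OF coD' \<delta>]] by (simp add: free_alg_def)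
    show "lin_on (schur ?S L) (tpow ?G m) (\<lambda>t. \<Sum>is\<in>?I. ?H is (D m \<delta> t))"
      using lin_on_comp[OF coalgebraD(2)[OF coD \<delta>] H]
      by (intro lin_on_sum_fun[OF vec_space_tpow]) (simp add: free_alg_def)
    show "t \<in> carr (schur ?S L)" using t by (simp add: free_alg_def)
    fix \<mu> ys assume \<mu>: "\<mu> \<in> ops A (length ys)" and ys: "set ys \<subseteq> carr L"
    let ?R = "rel m (length ys) \<delta> \<mu>"
    let ?t = "\<lambda>P. tens ?F (act_blocks (sgen ?S L) P ys)"
    have Dt: "D m \<delta> (sgen ?S L \<mu> ys) = (\<Sum>(P, Q)\<leftarrow>?R. fscale (lin_coeffs C Q) (?t P))"
      by (rule free_coact_sgen[OF D L incl \<delta> \<mu> ys])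
    have len_ys: "length ys = sum_list (map fst P)" and car: "set (act_blocks (sgen ?S L) P ys) \<subseteq> carr ?F"
      and tin: "?t P \<in> carr (tpow ?F m)"
      if PQ: "(P, Q) \<in> set ?R" and nz: "lin_coeffs C Q \<noteq> 0" for P Q
    proof -
      note r = rel_props[OF \<delta> \<mu> PQ]
      show 1: "length ys = sum_list (map fst P)" using rel_arity[OF \<delta> \<mu> PQ nz] by simp
      show 2: "set (act_blocks (sgen ?S L) P ys) \<subseteq> carr ?F"
        unfolding free_alg_def using ys by (intro set_act_blocks[OF 1 r(3)] sgen_in) auto
      show "?t P \<in> carr (tpow ?F m)" using 2 r(1) by (intro tens_in) simp_all
    qed
    have HD: "?H is (D m \<delta> (sgen ?S L \<mu> ys)) = (\<Sum>(P, Q)\<leftarrow>?R. ?H is (fscale (lin_coeffs C Q) (?t P)))"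
      if "is \<in> ?I" for "is"
    proof -
      have "fscale (lin_coeffs C Q) (?t P) \<in> carr (tpow ?F m)" if "(P, Q) \<in> set ?R" for P Q
        using vs_smul[OF vec_space_tpow tin[OF that], of "lin_coeffs C Q"] vs_zero[OF vec_space_tpow, of ?F m]
        by (cases "lin_coeffs C Q = 0") (simp_all add: z)
      then show ?thesis
        unfolding Dt
        using lin_on_sum_list[OF vec_space_tpow H[OF that], of ?R "\<lambda>(P, Q). fscale (lin_coeffs C Q) (?t P)"]
        by (auto simp: case_prod_unfold)
    qed
    \<comment> \<open>The factors of one summand are generators on consecutive blocks of lengths
      \<open>map fst P\<close>. Only the cut with these lengths survives, and for a nonzero scalar
      it is among those summed exactly when \<open>ys\<close> has the length of
      \<open>xs\<close>.\<close>
    have single: "(\<Sum>is\<in>?I. ?H is (fscale (lin_coeffs C Q) (?t P))) =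
        (if length ys = ?n then fscale (lin_coeffs C Q) (fscale (word_form fs ys) (tens ?G (act_blocks (sgen ?S V) P xs))) else 0)"
      if PQ: "(P, Q) \<in> set ?R" for P Q
    proof (cases "lin_coeffs C Q = 0")
      case True
      then show ?thesis using lin_on_zero[OF vec_space_tpow H] by (simp add: z)
    next
      case False
      note r = rel_props[OF \<delta> \<mu> PQ] and l = len_ys[OF PQ False] and c = car[OF PQ False]
      have Hterm: "?H is (fscale (lin_coeffs C Q) (?t P)) =
          fscale (lin_coeffs C Q) (?h is (act_blocks (sgen ?S L) P ys))" if "is \<in> ?I" for "is"
        using lin_onD(3)[OF H[OF that] tin[OF PQ False]] Ht[OF that _ c] r(1) by simp
      have zero: "?H is (fscale (lin_coeffs C Q) (?t P)) = 0" if i: "is \<in> ?I" "is \<noteq> map fst P" for "is"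
      proof -
        have "set (map2 (\<lambda>h t. h t) (block_replace L V is fs xs) (act_blocks (sgen ?S L) P ys)) \<subseteq> carr ?G"
        proof
          fix x assume "x \<in> set (map2 (\<lambda>h t. h t) (block_replace L V is fs xs) (act_blocks (sgen ?S L) P ys))"
          then obtain h t where ht: "(h, t) \<in> set (zip (block_replace L V is fs xs) (act_blocks (sgen ?S L) P ys))" "x = h t"
            by auto
          have "h \<in> set (block_replace L V is fs xs)" "t \<in> carr ?F"
            using set_zip_leftD[OF ht(1)] set_zip_rightD[OF ht(1)] c by auto
          then show "x \<in> carr ?G" using block_replace_lin[OF L len xs fs, of "is"] ht(2) lin_onD(1) by blast
        qed
        moreover have "0 \<in> set (map2 (\<lambda>h t. h t) (block_replace L V is fs xs) (act_blocks (sgen ?S L) P ys))"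
          using i r(1) by (intro block_replace_mismatch[OF L len _ l _ _ xs ys fs r(3)]) auto
        ultimately have "?h is (act_blocks (sgen ?S L) P ys) = 0" by (rule tens_zero_entry[OF vec_space_free_alg])
        then have "fscale (lin_coeffs C Q) (?h is (act_blocks (sgen ?S L) P ys)) = fscale (lin_coeffs C Q) 0" by (rule arg_cong)
        then show ?thesis unfolding Hterm[OF i(1)] by (simp add: fscale_def fun_eq_iff)
      qed
      show ?thesis
      proof (cases "length ys = ?n")
        case False
        then have "map fst P \<notin> ?I" using l by simp
        then show ?thesis using zero False by (metis (no_types, lifting) sum.neutral)
      next
        case True
        then have PI: "map fst P \<in> ?I" using l r(1) by simp
        have "(\<Sum>is\<in>?I. ?H is (fscale (lin_coeffs C Q) (?t P))) =
            (\<Sum>is\<in>{map fst P}. ?H is (fscale (lin_coeffs C Q) (?t P)))"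
          using zero PI by (intro sum.mono_neutral_right finI) auto
        also have "\<dots> = fscale (lin_coeffs C Q) (?h (map fst P) (act_blocks (sgen ?S L) P ys))"
          using Hterm[OF PI] by simp
        also have "?h (map fst P) (act_blocks (sgen ?S L) P ys) =
            fscale (word_form fs ys) (tens ?G (act_blocks (sgen ?S V) P xs))"
        proof -
          have lx: "length xs = sum_list (map fst P)" using True l by simp
          obtain cs where cs: "length cs = length P" "prod_list cs = word_form fs ys"
            "map2 (\<lambda>h t. h t) (block_replace L V (map fst P) fs xs) (act_blocks (sgen ?S L) P ys) =
              map2 fscale cs (act_blocks (sgen ?S V) P xs)"
            using block_replace_match[OF L len True lx xs ys fs r(3)] by blast
          have "set (act_blocks (sgen ?S V) P xs) \<subseteq> carr ?G"
            unfolding free_alg_def using xs by (intro set_act_blocks[OF lx r(3)] sgen_in) auto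
          from tens_scale_all[OF vec_space_free_alg _ this, of cs] show ?thesis
            using cs by simp
        qed
        finally show ?thesis unfolding if_P[OF True] .
      qed
    qed
    have "(\<Sum>is\<in>?I. ?H is (D m \<delta> (sgen ?S L \<mu> ys))) =
        (\<Sum>is\<in>?I. \<Sum>(P, Q)\<leftarrow>?R. ?H is (fscale (lin_coeffs C Q) (?t P)))"
      using HD by (rule sum.cong[OF refl])
    also have "\<dots> = (\<Sum>(P, Q)\<leftarrow>?R. \<Sum>is\<in>?I. ?H is (fscale (lin_coeffs C Q) (?t P)))"
      by (rule sum_sum_list_swap)
    also have "\<dots> = (\<Sum>(P, Q)\<leftarrow>?R. if length ys = ?n then fscale (lin_coeffs C Q)
        (fscale (word_form fs ys) (tens ?G (act_blocks (sgen ?S V) P xs))) else 0)"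
      using single by (intro arg_cong[of _ _ sum_list] map_cong) auto
    also have "\<dots> = (if length ys = ?n then fscale (word_form fs ys)
        (\<Sum>(P, Q)\<leftarrow>?R. fscale (lin_coeffs C Q) (tens ?G (act_blocks (sgen ?S V) P xs))) else 0)"
    proof (cases "length ys = ?n")
      case True
      show ?thesis unfolding if_P[OF True] by (rule sum_list_fscale)
    qed (simp add: case_prod_unfold)
    also have "\<dots> = D' m \<delta> (word_replace L V fs xs (sgen ?S L \<mu> ys))"
    proof (cases "length ys = ?n")
      case False
      then show ?thesis
        using val[OF \<mu> ys] len lin_on_zero[OF vec_space_free_alg coalgebraD(2)[OF coD' \<delta>]] by simp
    next
      case True
      have \<mu>': "\<mu> \<in> ops A (length xs)" using \<mu> True by simp
      have "sgen ?S V \<mu> xs \<in> carr ?G" unfolding free_alg_def using \<mu>' xs by (intro sgen_in)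
      from lin_onD(3)[OF coalgebraD(2)[OF coD' \<delta>] this, of "word_form fs ys"]
      show ?thesis
        using val[OF \<mu> ys] len True free_coact_sgen[OF D' V incl' \<delta> \<mu>' xs] by simp
    qed
    finally show "D' m \<delta> (word_replace L V fs xs (sgen ?S L \<mu> ys)) = (\<Sum>is\<in>?I. ?H is (D m \<delta> (sgen ?S L \<mu> ys)))"
      by simp
  qed
qed

text \<open>By \<open>coact_word_replace\<close> the coaction of the replaced element depends
  linearly on that of \<open>p\<close>, which vanishes.\<close>

lemma word_replace_prim:
  assumes D: "bialgebra A C rel (free_alg A L) (free_act A L) D" and L: "vec_space L"
    and incl: "free_incl A L ` carr L \<subseteq> carr (prim C (free_alg A L) D)"
    and D': "bialgebra A C rel (free_alg A V) (free_act A V) D'" and V: "vec_space V"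
    and incl': "free_incl A V ` carr V \<subseteq> carr (prim C (free_alg A V) D')"
    and len: "length fs = length xs" and xs: "set xs \<subseteq> carr V" and fs: "\<forall>f\<in>set fs. lin_on L fld f"
    and p: "p \<in> carr (prim C (free_alg A L) D)"
  shows "word_replace L V fs xs p \<in> carr (prim C (free_alg A V) D')"
  unfolding prim_iff
proof (intro conjI allI impI ballI)
  have pF: "p \<in> carr (free_alg A L)" using p by (simp add: prim_iff)
  show "word_replace L V fs xs p \<in> carr (free_alg A V)"
    by (rule lin_onD(1)[OF word_replace_lin[OF L len xs fs] pF])
  fix m \<delta> assume m: "2 \<le> m" and \<delta>: "\<delta> \<in> ops C m"
  have "D m \<delta> p = 0" using p m \<delta> by (simp add: prim_iff)
  moreover have "tlift (free_alg A L) m (tpow (free_alg A V) m)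
      (\<lambda>ts. tens (free_alg A V) (map2 (\<lambda>h t. h t) (block_replace L V is fs xs) ts)) 0 = 0"
    if "length is = m" for "is"
  proof -
    have "mlin (replicate m (free_alg A L)) (tpow (free_alg A V) m)
        (\<lambda>ts. tens (free_alg A V) (map2 (\<lambda>h t. h t) (block_replace L V is fs xs) ts))"
      using mlin_tens_map2[OF vec_space_free_alg block_replace_lin[OF L len xs fs, of "is"]] that by simp
    from lin_on_zero[OF vec_space_tpow tlift_props(1)[OF vec_space_tpow this]] show ?thesis .
  qed
  ultimately show "D' m \<delta> (word_replace L V fs xs p) = 0"
    unfolding coact_word_replace[OF D L incl D' V incl' len xs fs \<delta> pF] by simp
qed

end

section \<open>Transport of connectedness and primitivity along coalgebra maps\<close>

section \<open>Isomorphisms of coalgebras\<close>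

lemma coalg_homD:
  assumes "coalg_hom C V coact W coact' f"
  shows "lin_on V W f" "\<delta> \<in> ops C n \<Longrightarrow> x \<in> carr V \<Longrightarrow> coact' n \<delta> (f x) = tmap V W n f (coact n \<delta> x)"
  using assms by (auto simp: coalg_hom_def)

lemma coalg_iso_inverse:
  assumes V: "vec_space V" and W: "vec_space W"
    and coact: "\<And>n \<delta> x. \<delta> \<in> ops C n \<Longrightarrow> x \<in> carr V \<Longrightarrow> coact n \<delta> x \<in> carr (tpow V n)"
    and f: "coalg_iso C V coact W coact' f"
  shows "coalg_iso C W coact' V coact (inv_into (carr V) f)"
proof -
  let ?g = "inv_into (carr V) f"
  have hom: "coalg_hom C V coact W coact' f" and bij: "bij_betw f (carr V) (carr W)"
    using f by (auto simp: coalg_iso_def)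
  note lf = coalg_homD(1)[OF hom] and lg = inv_lin_on[OF V coalg_homD(1)[OF hom] bij]
  have gf: "?g (f x) = x" if "x \<in> carr V" for x
    using bij that by (simp add: bij_betw_def)
  have "coact n \<delta> (?g y) = tmap W V n ?g (coact' n \<delta> y)" if \<delta>: "\<delta> \<in> ops C n" and y: "y \<in> carr W" for n \<delta> y
  proof -
    obtain x where x: "x \<in> carr V" "y = f x" using y bij by (auto simp: bij_betw_def)
    show ?thesis
      unfolding x(2) gf[OF x(1)] coalg_homD(2)[OF hom \<delta> x(1)]
      by (rule tmap_left_inverse[OF V W lf lg gf coact[OF \<delta> x(1)], symmetric])
  qed
  then show ?thesis using lg bij_betw_inv_into[OF bij] by (simp add: coalg_iso_def coalg_hom_def)
qed

text \<open>The inverse of \<open>f\<close> makes \<open>tmap\<close> of \<open>f\<close> injective,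
  so a cooperation that kills \<open>f x\<close> kills \<open>x\<close>; filtration degrees are thus
  reflected.\<close>

lemma connected_reflect:
  assumes V: "vec_space V" and W: "vec_space W"
    and coact: "\<And>n \<delta> x. \<delta> \<in> ops C n \<Longrightarrow> x \<in> carr V \<Longrightarrow> coact n \<delta> x \<in> carr (tpow V n)"
    and f: "coalg_iso C V coact W coact' f" and conn: "connected_coalgebra C W coact'"
  shows "connected_coalgebra C V coact"
  unfolding connected_coalgebra_def
proof (intro equalityI subsetI)
  fix x assume x: "x \<in> carr V"
  have hom: "coalg_hom C V coact W coact' f" and bij: "bij_betw f (carr V) (carr W)"
    using f by (auto simp: coalg_iso_def)
  note lf = coalg_homD(1)[OF hom] and lg = inv_lin_on[OF V coalg_homD(1)[OF hom] bij]
  have "f x \<in> carr W" by (rule lin_onD(1)[OF lf x])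
  then obtain r where r: "f x \<in> filt C W coact' r" using conn unfolding connected_coalgebra_def by blast
  have "coact n \<delta> x = 0" if "n > r" "\<delta> \<in> ops C n" for n \<delta>
  proof -
    have gf: "inv_into (carr V) f (f x) = x" if "x \<in> carr V" for x
      using bij that by (simp add: bij_betw_def)
    have "tmap V W n f (coact n \<delta> x) = 0"
      using filtD(2)[OF r that] coalg_homD(2)[OF hom that(2) x] by simp
    then show ?thesis
      using tmap_left_inverse[OF V W lf lg gf coact[OF that(2) x]] lin_on_zero[OF vec_space_tpow tmap_lin[OF W lg]]
      by simp
  qed
  then show "x \<in> (\<Union>r. filt C V coact r)" using x by (auto simp: filt_def)
qed (auto simp: filt_def)

lemma coalg_hom_prim:
  assumes "coalg_hom C V coact W coact' f" "vec_space V" "x \<in> carr (prim C V coact)"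
  shows "f x \<in> carr (prim C W coact')"
proof -
  note hom = coalg_homD[OF assms(1)]
  have x: "x \<in> carr V" using assms(3) by (simp add: prim_iff)
  have "coact' n \<delta> (f x) = 0" if "n \<ge> 2" "\<delta> \<in> ops C n" for n \<delta>
  proof -
    have "coact n \<delta> x = 0" using assms(3) that by (simp add: prim_iff)
    then show ?thesis
      using hom(2)[OF that(2) x] lin_on_zero[OF vec_space_tpow tmap_lin[OF assms(2) hom(1)]] by simp
  qed
  then show ?thesis using lin_onD(1)[OF hom(1) x] by (simp add: prim_iff)
qed

section \<open>Algebra ideals\<close>

text \<open>Arguments are exchanged one at a time; \<open>us\<close> holds those already exchanged,
  and each exchange changes the value by an operation with an argument in the ideal.\<close>

lemma alg_ideal_cong:
  assumes alg: "algebra A V act" and I: "alg_ideal A V act I" and \<mu>: "\<mu> \<in> ops A n"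
    and "length ps = length qs" "length us + length ps = n" "set us \<subseteq> carr V" "set ps \<subseteq> carr V" "set qs \<subseteq> carr V"
    "\<forall>(p, q)\<in>set (zip ps qs). p - q \<in> I"
  shows "act \<mu> (us @ ps) - act \<mu> (us @ qs) \<in> I"
proof -
  note V = algebraD(1)[OF alg]
  interpret vector_space "smul V" using V by (rule vec_space_vector_space)
  have sI: "subspace I" "I \<subseteq> carr V" using I by (auto simp: alg_ideal_def)
  show ?thesis
    using assms(4-)
  proof (induction ps qs arbitrary: us rule: list_induct2)
    case Nil
    then show ?case by (simp add: subspace_0[OF sI(1)])
  next
    case (Cons p ps q qs)
    have pq: "p \<in> carr V" "q \<in> carr V" "p - q \<in> I" using Cons.prems by auto
    have lin: "lin_on V V (\<lambda>x. act \<mu> (us @ x # ps))"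
      using Cons.prems by (intro mlin_slot[OF V algebraD(2)[OF alg \<mu>]]) auto
    have "us @ (p - q) # ps \<in> tuples (replicate n V)" "set (us @ (p - q) # ps) \<inter> I \<noteq> {}"
      using Cons.prems pq vs_diff[OF V pq(1,2)] by (auto simp: tuples_replicate)
    then have "act \<mu> (us @ (p - q) # ps) \<in> I" using I \<mu> unfolding alg_ideal_def by blast
    then have 1: "act \<mu> (us @ p # ps) - act \<mu> (us @ q # ps) \<in> I"
      using lin_on_diff[OF V lin pq(1,2)] by simp
    have 2: "act \<mu> ((us @ [q]) @ ps) - act \<mu> ((us @ [q]) @ qs) \<in> I"
      using Cons.prems by (intro Cons.IH) auto
    show ?case using subspace_add[OF sI(1) 1 2] by simp
  qed
qed

lemma alg_ideal_Inter:
  assumes V: "vec_space V" and "\<And>I. I \<in> \<I> \<Longrightarrow> alg_ideal A V act I" "\<I> \<noteq> {}"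
  shows "alg_ideal A V act (\<Inter>\<I>)"
proof -
  interpret vector_space "smul V" using V by (rule vec_space_vector_space)
  have "subspace (\<Inter>\<I>)" using assms(2) by (intro subspace_Inter) (simp add: alg_ideal_def)
  moreover have "\<Inter>\<I> \<subseteq> carr V" using assms(2,3) by (auto simp: alg_ideal_def)
  moreover have "act \<mu> xs \<in> \<Inter>\<I>"
    if "\<mu> \<in> ops A n" "xs \<in> tuples (replicate n V)" "set xs \<inter> \<Inter>\<I> \<noteq> {}" for n \<mu> xs
  proof
    fix I assume I: "I \<in> \<I>"
    then have "set xs \<inter> I \<noteq> {}" using that(3) by blast
    then show "act \<mu> xs \<in> I" using assms(2)[OF I] that(1,2) unfolding alg_ideal_def by blast
  qed
  ultimately show ?thesis unfolding alg_ideal_def by blast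
qed

lemma alg_ideal_kernel:
  assumes alg: "algebra A V act" and alg': "algebra A W act'" and f: "alg_hom A V act W act' f"
  shows "alg_ideal A V act {x \<in> carr V. f x = 0}"
proof -
  note V = algebraD(1)[OF alg] and W = algebraD(1)[OF alg']
  have lf: "lin_on V W f" using f by (simp add: alg_hom_def)
  interpret vector_space "smul V" using V by (rule vec_space_vector_space)
  have "subspace {x \<in> carr V. f x = 0}"
    using lin_on_zero[OF V lf] lin_onD(2,3)[OF lf]
    by (intro subspaceI) (auto simp: vs_zero[OF V] vs_add[OF V] vs_smul[OF V] smul_simps[OF W])
  moreover have "act \<mu> xs \<in> {x \<in> carr V. f x = 0}"
    if \<mu>: "\<mu> \<in> ops A n" and xs: "xs \<in> tuples (replicate n V)" "set xs \<inter> {x \<in> carr V. f x = 0} \<noteq> {}" for n \<mu> xs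
  proof -
    have "f (act \<mu> xs) = act' \<mu> (map f xs)" using f \<mu> xs unfolding alg_hom_def by blast
    also have "\<dots> = 0"
    proof (rule mlin_zero_entry[OF W algebraD(2)[OF alg' \<mu>]])
      show "0 \<in> set (map f xs)" using xs(2) by (force simp: image_iff)
    qed (use xs(1) lin_onD(1)[OF lf] in \<open>auto simp: tuples_replicate\<close>)
    finally show ?thesis using mlinD[OF algebraD(2)[OF alg \<mu>] xs(1)] by simp
  qed
  ultimately show ?thesis by (auto simp: alg_ideal_def)
qed

section \<open>Symmetric operations on free algebras\<close>

lemma sym_act_free:
  assumes A: "ns_operad A" and V: "vec_space V" and m: "m \<in> sym_ops A (length xs)" and xs: "set xs \<subseteq> carr V"
  shows "sym_act (free_act A V) m (map (free_incl A V) xs) =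
    (\<Sum>\<sigma> | \<sigma> permutes {..<length xs}. sgen (ospace A) V (m \<sigma>) (map (\<lambda>i. xs ! \<sigma> i) [0..<length xs]))"
  unfolding sym_act_def
proof (rule sum.cong)
  fix \<sigma> assume "\<sigma> \<in> {\<sigma>. \<sigma> permutes {..<length xs}}"
  then have \<sigma>: "\<sigma> permutes {..<length xs}" by simp
  have lt: "\<sigma> i < length xs" if "i < length xs" for i using permutes_in_image[OF \<sigma>, of i] that by simp
  let ?ys = "map (\<lambda>i. xs ! \<sigma> i) [0..<length xs]"
  have eq: "map (\<lambda>i. map (free_incl A V) xs ! \<sigma> i) [0..<length xs] = map (free_incl A V) ?ys"
    using lt by simp
  have h1: "m \<sigma> \<in> ops A (length ?ys)" using m \<sigma> by (simp add: sym_ops_def)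
  have h2: "set ?ys \<subseteq> carr V" using xs lt by (auto dest: nth_mem)
  show "free_act A V (m \<sigma>) (map (\<lambda>i. map (free_incl A V) xs ! \<sigma> i) [0..<length (map (free_incl A V) xs)]) =
      sgen (ospace A) V (m \<sigma>) ?ys"
    using sgen_eq_free_act[OF A V h1 h2] eq by (simp only: length_map)
qed simp

lemma permuted_in:
  assumes "\<sigma> permutes {..<length xs}" "set xs \<subseteq> X"
  shows "set (map (\<lambda>i. xs ! \<sigma> i) [0..<length xs]) \<subseteq> X"
  using assms permutes_in_image[OF assms(1)] by (auto dest!: nth_mem)

text \<open>The embedding of \<open>A\<^sub>n\<close> into the symmetric operad, supported at the
  identity permutation.\<close>

definition ns_op :: "'a::zero \<Rightarrow> (nat \<Rightarrow> nat) \<Rightarrow> 'a" where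
  "ns_op \<nu> = (\<lambda>\<sigma>. if \<sigma> = id then \<nu> else 0)"

lemma sym_act_free_ns_op:
  assumes A: "connected_operad A" and V: "vec_space V" and \<nu>: "\<nu> \<in> ops A (length xs)" and xs: "set xs \<subseteq> carr V"
  shows "ns_op \<nu> \<in> sym_ops A (length xs)"
    and "sym_act (free_act A V) (ns_op \<nu>) (map (free_incl A V) xs) = sgen (ospace A) V \<nu> xs"
proof -
  show m: "ns_op \<nu> \<in> sym_ops A (length xs)"
    using \<nu> vs_zero[OF connected_operadD(2)[OF A]] by (simp add: sym_ops_def ns_op_def)
  let ?X = "{\<sigma>. \<sigma> permutes {..<length xs}}"
  let ?f = "\<lambda>\<sigma>. sgen (ospace A) V (ns_op \<nu> \<sigma>) (map (\<lambda>i. xs ! \<sigma> i) [0..<length xs])"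
  have "?f \<sigma> = 0" if "\<sigma> \<in> ?X - {id}" for \<sigma>
  proof -
    have "set (map (\<lambda>i. xs ! \<sigma> i) [0..<length xs]) \<subseteq> carr V" using that xs by (intro permuted_in) auto
    from lin_on_zero[OF connected_operadD(2)[OF A] sgen_lin[OF this, of "ospace A"]] that
    show ?thesis by (simp add: ns_op_def)
  qed
  then have "sum ?f ?X = sum ?f {id}"
    by (intro sum.mono_neutral_right finite_permutations) (auto simp: permutes_id)
  also have "\<dots> = sgen (ospace A) V \<nu> xs" by (simp add: ns_op_def map_nth)
  finally show "sym_act (free_act A V) (ns_op \<nu>) (map (free_incl A V) xs) = sgen (ospace A) V \<nu> xs"
    using sym_act_free[OF connected_operadD(1)[OF A] V m xs] by simp
qed

section \<open>The scalar of the splitting, and primitive operations versus primitive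
  elements\<close>

section \<open>Splittings induced by maps of operations\<close>

locale ns_triple = ns_bialgebras A C rel
  for A :: "('k::field, 'a::ab_group_add) operad" and C :: "('k, 'c::ab_group_add) operad" and rel +
  fixes E :: "('k, 'v::ab_group_add) vs" and \<Delta> :: "('k, 'a, 'c, 'v) coactions"
    and \<sigma> :: "nat \<Rightarrow> ('c \<Rightarrow> 'k) \<Rightarrow> 'a"
  assumes E: "vec_space E" and inf_E: "\<not> fin_dim E" and H1: "H1 A C rel E \<Delta>"
    and sigma: "lin_on (cospace C n) (ospace A n) (\<sigma> n)"
    and splitting: "subsp V E \<Longrightarrow> coalg_hom C (cofree C V) (cofree_coact C V) (free_alg A V) (\<Delta> V)
      (slift (cospace C) V (free_alg A V) (\<lambda>\<xi> xs. sgen (ospace A) V (\<sigma> (length xs) \<xi>) xs))"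
    and retraction: "subsp V E \<Longrightarrow> t \<in> carr (cofree C V) \<Longrightarrow> phi A C \<Delta> V
      (slift (cospace C) V (free_alg A V) (\<lambda>\<xi> xs. sgen (ospace A) V (\<sigma> (length xs) \<xi>) xs) t) = t"
begin

definition spl :: "('k, 'v) vs \<Rightarrow> ('k, 'c \<Rightarrow> 'k, 'v) schur \<Rightarrow> ('k, 'a, 'v) schur" where
  "spl V = slift (cospace C) V (free_alg A V) (\<lambda>\<xi> xs. sgen (ospace A) V (\<sigma> (length xs) \<xi>) xs)"

lemma subspD: "subsp V E \<Longrightarrow> vec_space V" "subsp V E \<Longrightarrow> carr V \<subseteq> carr E" "subsp V E \<Longrightarrow> smul V = smul E"
  by (simp_all add: subsp_def)

lemma subsp_E: "subsp E E"
  using E by (simp add: subsp_def)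

lemma free_bialgebra: "subsp V E \<Longrightarrow> bialgebra A C rel (free_alg A V) (free_act A V) (\<Delta> V)"
  using H1 by (simp add: H1_def)

lemma spl_lin: "subsp V E \<Longrightarrow> lin_on (cofree C V) (free_alg A V) (spl V)"
  using splitting by (simp add: coalg_hom_def spl_def)

lemma spl_sgen:
  assumes V: "subsp V E" and \<xi>: "\<xi> \<in> carr (cospace C (length xs))" and xs: "set xs \<subseteq> carr V"
  shows "spl V (sgen (cospace C) V \<xi> xs) = sgen (ospace A) V (\<sigma> (length xs) \<xi>) xs"
proof -
  note vV = subspD(1)[OF V]
  have "schur_mlin (cospace C) V (free_alg A V) (\<lambda>(\<xi>, xs). sgen (ospace A) V (\<sigma> (length xs) \<xi>) xs)"
    unfolding schur_mlin_iff[OF vV] prod.case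
  proof (intro conjI allI impI)
    fix n \<xi> assume "\<xi> \<in> carr (cospace C n)"
    then have "mlin (replicate n V) (free_alg A V) (sgen (ospace A) V (\<sigma> n \<xi>))"
      unfolding free_alg_def by (intro mlin_sgen lin_onD(1)[OF sigma])
    then show "mlin (replicate n V) (free_alg A V) (\<lambda>xs. sgen (ospace A) V (\<sigma> (length xs) \<xi>) xs)"
      by (subst mlin_cong[OF vV]) auto
  next
    fix xs assume "set xs \<subseteq> carr V"
    from lin_on_comp[OF sigma sgen_lin[OF this]]
    show "lin_on (cospace C (length xs)) (free_alg A V) (\<lambda>\<xi>. sgen (ospace A) V (\<sigma> (length xs) \<xi>) xs)"
      by (simp add: free_alg_def)
  qed
  from slift_sgen[OF vec_space_free_alg this \<xi> xs] show ?thesis by (simp add: spl_def)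
qed

text \<open>The retraction identity recovers \<open>u\<close> from its image, and the argument 0 has
  the same image.\<close>

lemma spl_inj:
  assumes V: "subsp V E" and u: "u \<in> carr (cofree C V)" "spl V u = 0"
  shows "u = 0"
proof -
  have "spl V 0 = 0" by (rule lin_on_zero[OF vec_space_cofree spl_lin[OF V]])
  then show ?thesis
    using retraction[OF V u(1)] retraction[OF V vs_zero[OF vec_space_cofree]] u(2) by (simp add: spl_def)
qed

text \<open>In arity 1 the splitting is a scalar, because \<open>A\<^sub>1\<close> is spanned by the
  identity.\<close>

definition c1 :: 'k where "c1 = unit_coeff A (\<sigma> (Suc 0) (covec1 C))"

lemma spl_covec1:
  assumes V: "subsp V E" and x: "x \<in> carr V"
  shows "spl V (sgen (cospace C) V (covec1 C) [x]) = fscale c1 (free_incl A V x)"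
proof -
  have "\<sigma> (Suc 0) (covec1 C) \<in> ops A (Suc 0)" using lin_onD(1)[OF sigma covec1(1)[OF C]] .
  from unit_coeff[OF A this] have "\<sigma> (Suc 0) (covec1 C) = smul (ospace A (Suc 0)) c1 (ounit A)"
    by (simp add: c1_def)
  then show ?thesis
    using spl_sgen[OF V, of "covec1 C" "[x]"] covec1(1)[OF C] x
      lin_onD(3)[OF sgen_lin[of "[x]" V "ospace A"], of "ounit A" c1] connected_operadD(5)[OF A]
    by (simp add: free_incl_def)
qed

lemma nonzero_vector: "\<exists>x\<in>carr E. x \<noteq> 0"
proof (rule ccontr)
  interpret vector_space "smul E" using E by (rule vec_space_vector_space)
  assume "\<not> (\<exists>x\<in>carr E. x \<noteq> 0)"
  then have "carr E = span {}" using vs_zero[OF E] by auto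
  then show False using inf_E unfolding fin_dim_def by blast
qed

text \<open>Otherwise the splitting would kill \<open>covec1 C\<close> on a nonzero letter, which is
  a nonzero element of the cofree coalgebra.\<close>

lemma c1_nonzero: "c1 \<noteq> 0"
proof
  assume c1: "c1 = 0"
  obtain x where x: "x \<in> carr E" "x \<noteq> 0" using nonzero_vector by blast
  have S: "vec_space (cospace C n)" for n
    unfolding cospace_def by (rule vec_space_dual[OF connected_operadD(2)[OF C]])
  have "sgen (cospace C) E (covec1 C) [x] \<in> carr (cofree C E)"
    unfolding cofree_def using covec1(1)[OF C] x by (intro sgen_in) auto
  moreover have "spl E (sgen (cospace C) E (covec1 C) [x]) = 0"
    using spl_covec1[OF subsp_E x(1)] c1 by (simp add: fscale_def fun_eq_iff)
  ultimately have "sgen (cospace C) E (covec1 C) [x] = 0" by (rule spl_inj[OF subsp_E])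
  then show False using sgen_nonzero[where S = "cospace C", OF E S, of "covec1 C" "[x]"] covec1[OF C] x by simp
qed

text \<open>In the cofree coalgebra a word of length 1 is killed in arities above 1. The splitting
  is a coalgebra map taking such an element to \<open>c1\<close> times the letter, and
  \<open>c1 \<noteq> 0\<close>.\<close>

lemma free_incl_prim:
  assumes V: "subsp V E" and x: "x \<in> carr V"
  shows "free_incl A V x \<in> carr (prim C (free_alg A V) (\<Delta> V))"
  unfolding prim_iff
proof (intro conjI allI impI ballI)
  note vV = subspD(1)[OF V]
  show iF: "free_incl A V x \<in> carr (free_alg A V)" by (rule free_incl_in[OF A x])
  fix m \<delta> assume m: "2 \<le> m" and \<delta>: "\<delta> \<in> ops C m"
  let ?u = "sgen (cospace C) V (covec1 C) [x]"
  have u: "?u \<in> carr (cofree C V)"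
    unfolding cofree_def using covec1(1)[OF C] x by (intro sgen_in) auto
  have "cofree_coact C V m \<delta> ?u = 0"
    using m x covec1(1)[OF C] by (intro cofree_coact_above[OF C vV \<delta>]) auto
  then have "\<Delta> V m \<delta> (spl V ?u) = 0"
    using coalg_homD(2)[OF splitting[OF V] \<delta> u] lin_on_zero[OF vec_space_tpow tmap_lin[OF vec_space_cofree spl_lin[OF V]]]
    by (simp add: spl_def)
  then have "fscale c1 (\<Delta> V m \<delta> (free_incl A V x)) = 0"
    using lin_onD(3)[OF coalgebraD(2)[OF bialgebraD(2)[OF free_bialgebra[OF V]] \<delta>] iF, of c1] spl_covec1[OF V x]
    by simp
  then show "\<Delta> V m \<delta> (free_incl A V x) = 0" using c1_nonzero by (simp add: fscale_def fun_eq_iff)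
qed

lemma free_incl_image: "subsp V E \<Longrightarrow> free_incl A V ` carr V \<subseteq> carr (prim C (free_alg A V) (\<Delta> V))"
  using free_incl_prim by blast

text \<open>The coaction on the image of a word is computed twice, by the relations and through the
  splitting from the cofree coalgebra. Both give multiples of the same nonzero tensor. The basis
  vector of \<open>C\<^sub>1\<close> and the splitting each contribute one scalar per
  letter.\<close>

lemma top_coeff_value:
  assumes \<delta>: "\<delta> \<in> ops C n" and \<xi>: "\<xi> \<in> carr (cospace C n)"
  shows "top_coeff n \<delta> (\<sigma> n \<xi>) = (unit_coeff C (basis1 C) * c1) ^ n * \<xi> \<delta>"
proof -
  obtain x where x: "x \<in> carr E" "x \<noteq> 0" using nonzero_vector by blast
  \<comment> \<open>Repeating one nonzero letter is enough, since neither scalar depends on the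
    word.\<close>
  let ?xs = "replicate n x" and ?\<beta> = "unit_coeff C (basis1 C)" and ?F = "free_alg A E"
  let ?u = "sgen (cospace C) E \<xi> ?xs" and ?e = "\<lambda>x. sgen (cospace C) E (covec1 C) [x]"
  have xs: "set ?xs \<subseteq> carr E" using x by auto
  have \<sigma>\<xi>: "\<sigma> n \<xi> \<in> ops A n" by (rule lin_onD(1)[OF sigma \<xi>])
  have u: "?u \<in> carr (cofree C E)" unfolding cofree_def using \<xi> xs by (intro sgen_in) auto
  have e: "?e x \<in> carr (cofree C E)"
    unfolding cofree_def using covec1(1)[OF C] x by (intro sgen_in) auto
  have i: "free_incl A E x \<in> carr ?F" by (rule free_incl_in[OF A x(1)])
  have te: "tens (cofree C E) (map ?e ?xs) \<in> carr (tpow (cofree C E) n)"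
    using e by (intro tens_in) auto
  note tl = tmap_lin[OF vec_space_cofree spl_lin[OF subsp_E], of n]
  have "spl E ?u = free_act A E (\<sigma> n \<xi>) (map (free_incl A E) ?xs)"
    using spl_sgen[OF subsp_E, of \<xi> ?xs] sgen_eq_free_act[OF ns_A E, of "\<sigma> n \<xi>" ?xs] \<xi> \<sigma>\<xi> xs by simp
  then have "fscale (top_coeff n \<delta> (\<sigma> n \<xi>)) (tens ?F (map (free_incl A E) ?xs)) = \<Delta> E n \<delta> (spl E ?u)"
    using coact_act_top[OF free_bialgebra[OF subsp_E], of \<delta> "map (free_incl A E) ?xs" "\<sigma> n \<xi>"]
      \<delta> \<sigma>\<xi> free_incl_prim[OF subsp_E x(1)] by (simp add: set_replicate_conv_if)
  also have "\<dots> = tmap (cofree C E) ?F n (spl E) (cofree_coact C E n \<delta> ?u)"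
    using coalg_homD(2)[OF splitting[OF subsp_E] \<delta> u] by (simp add: spl_def)
  also have "cofree_coact C E n \<delta> ?u = fscale (?\<beta> ^ n * \<xi> \<delta>) (tens (cofree C E) (map ?e ?xs))"
    using cofree_coact_top[OF C E, of \<delta> ?xs \<xi>] \<delta> \<xi> xs by simp
  also have "tmap (cofree C E) ?F n (spl E) \<dots> = fscale (?\<beta> ^ n * \<xi> \<delta>) (tens ?F (map (spl E) (map ?e ?xs)))"
    using lin_onD(3)[OF tl te, of "?\<beta> ^ n * \<xi> \<delta>"] tmap_tens[OF vec_space_cofree spl_lin[OF subsp_E], of "map ?e ?xs" n] e
    by (simp add: set_replicate_conv_if)
  also have "map (spl E) (map ?e ?xs) = map2 (smul ?F) (replicate n c1) (map (free_incl A E) ?xs)"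
    using spl_covec1[OF subsp_E x(1)] by (simp add: zip_replicate)
  also have "tens ?F \<dots> = fscale (c1 ^ n) (tens ?F (map (free_incl A E) ?xs))"
    using tens_scale_all[OF vec_space_free_alg, of "replicate n c1" "map (free_incl A E) ?xs"] i
    by (simp add: prod_list_replicate set_replicate_conv_if)
  finally have eq: "fscale (top_coeff n \<delta> (\<sigma> n \<xi>)) (tens ?F (map (free_incl A E) ?xs)) =
      fscale (?\<beta> ^ n * \<xi> \<delta>) (fscale (c1 ^ n) (tens ?F (map (free_incl A E) ?xs)))" .
  have "free_incl A E x \<noteq> 0"
    using sgen_nonzero[where S = "ospace A", OF E connected_operadD(2)[OF A], of "ounit A" "[x]"]
      connected_operadD(5,6)[OF A] x by (simp add: free_incl_def)
  then have "tens ?F (map (free_incl A E) ?xs) \<noteq> 0"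
    using i by (intro tens_nonzero[OF vec_space_free_alg]) auto
  then obtain g where "tens ?F (map (free_incl A E) ?xs) g \<noteq> 0" by (auto simp: fun_eq_iff)
  then show ?thesis using fun_cong[OF eq, of g] by (simp add: power_mult_distrib)
qed

sublocale ns_splitting A C rel \<sigma> "unit_coeff C (basis1 C) * c1"
  by unfold_locales (use sigma basis1(3)[OF C] c1_nonzero top_coeff_value in auto)

text \<open>Without such words the condition in \<open>prim_ops\<close> would be vacuous in large
  arities and would say nothing about values on other words.\<close>

lemma independent_word:
  obtains xs where "length xs = n" "distinct xs" "set xs \<subseteq> carr E" "\<not> module.dependent (smul E) (set xs)"
proof -
  interpret vector_space "smul E" using E by (rule vec_space_vector_space)
  note B = some_basis[OF E]
  have "infinite (some_basis E)" using inf_E B(2) unfolding fin_dim_def by metis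
  then obtain X where X: "finite X" "card X = n" "X \<subseteq> some_basis E"
    using infinite_arbitrarily_large by blast
  obtain xs where "set xs = X" "distinct xs" using finite_distinct_list[OF X(1)] by blast
  then show ?thesis
    using that[of xs] X distinct_card[of xs] independent_mono[OF B(1)] some_basis_in(1)[OF E] by auto
qed

lemma subsp_vspan:
  assumes "set xs \<subseteq> carr E"
  shows "subsp (vspan E (set xs)) E" "set xs \<subseteq> carr (vspan E (set xs))"
proof -
  interpret vector_space "smul E" using E by (rule vec_space_vector_space)
  have sE: "subspace (carr E)" using E by (simp add: vec_space_def)
  show "subsp (vspan E (set xs)) E" "set xs \<subseteq> carr (vspan E (set xs))"
    using span_minimal[OF assms sE] span_base
    by (auto simp: subsp_def vspan_def vec_space_def vector_space_axioms)
qed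

text \<open>A primitive operation is tested on independent letters only. The linear map sending
  these letters to \<open>ys\<close> induces a coalgebra map of free algebras by functoriality, and
  this carries the primitive value along.\<close>

lemma prim_ops_eval:
  assumes m: "m \<in> prim_ops A C E \<Delta> (length ys)" and L: "subsp L E" and ys: "set ys \<subseteq> carr L"
  shows "sym_act (free_act A L) m (map (free_incl A L) ys) \<in> carr (prim C (free_alg A L) (\<Delta> L))"
proof -
  interpret vector_space "smul E" using E by (rule vec_space_vector_space)
  interpret EE: vector_space_pair "smul E" "smul E" ..
  let ?n = "length ys"
  note vL = subspD(1)[OF L]
  obtain xs where xs: "length xs = ?n" "distinct xs" "set xs \<subseteq> carr E" "independent (set xs)"
    using independent_word by blast
  let ?V = "vspan E (set xs)"
  note V = subsp_vspan(1)[OF xs(3)] and xsV = subsp_vspan(2)[OF xs(3)]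
  note vV = subspD(1)[OF V]
  have ms: "m \<in> sym_ops A ?n" using m by (simp add: prim_ops_def)
  have T: "sym_act (free_act A ?V) m (map (free_incl A ?V) xs) \<in> carr (prim C (free_alg A ?V) (\<Delta> ?V))"
    using m xs unfolding prim_ops_def Let_def by blast
  \<comment> \<open>Independence permits arbitrary images for the letters; distinctness makes the
    table of images well defined even if \<open>ys\<close> repeats letters.\<close>
  define g where "g = EE.construct (set xs) (\<lambda>x. the (map_of (zip xs ys) x))"
  have lg: "Vector_Spaces.linear (smul E) (smul E) g"
    unfolding g_def by (rule EE.linear_construct[OF xs(4)])
  interpret g: Vector_Spaces.linear "smul E" "smul E" g by (rule lg)
  have gx: "g (xs ! i) = ys ! i" if "i < ?n" for i
  proof -
    have "g (xs ! i) = the (map_of (zip xs ys) (xs ! i))"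
      unfolding g_def using that xs(1) by (intro EE.construct_basis[OF xs(4)]) simp
    then show ?thesis using map_of_zip_nth[OF xs(1,2) that] by simp
  qed
  have sL: "subspace (carr L)" using vL subspD(3)[OF L] by (simp add: vec_space_def)
  have "g ` set xs \<subseteq> carr L"
    using gx subsetD[OF ys nth_mem] xs(1) by (auto simp: in_set_conv_nth)
  then have "g ` span (set xs) \<subseteq> carr L"
    using span_minimal[OF _ sL] g.span_image by metis
  then have glin: "lin_on ?V L g"
    using subspD(3)[OF L] by (auto simp: lin_on_def vspan_def g.add g.scale)
  have hom: "coalg_hom C (free_alg A ?V) (\<Delta> ?V) (free_alg A L) (\<Delta> L) (smap (ospace A) ?V L g)"
    using H1 V L glin by (simp add: H1_def)
  have "smap (ospace A) ?V L g (sym_act (free_act A ?V) m (map (free_incl A ?V) xs)) =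
      (\<Sum>\<sigma> | \<sigma> permutes {..<?n}. smap (ospace A) ?V L g (sgen (ospace A) ?V (m \<sigma>) (map (\<lambda>i. xs ! \<sigma> i) [0..<?n])))"
  proof -
    have "sgen (ospace A) ?V (m \<sigma>) (map (\<lambda>i. xs ! \<sigma> i) [0..<?n]) \<in> carr (free_alg A ?V)" if "\<sigma> permutes {..<?n}" for \<sigma>
      unfolding free_alg_def using ms that permuted_in[of \<sigma> xs] xsV xs(1) by (intro sgen_in) (auto simp: sym_ops_def)
    then have "smap (ospace A) ?V L g (\<Sum>\<sigma> | \<sigma> permutes {..<?n}.
        smul (free_alg A ?V) 1 (sgen (ospace A) ?V (m \<sigma>) (map (\<lambda>i. xs ! \<sigma> i) [0..<?n]))) =
      (\<Sum>\<sigma> | \<sigma> permutes {..<?n}. smul (free_alg A L) 1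
        (smap (ospace A) ?V L g (sgen (ospace A) ?V (m \<sigma>) (map (\<lambda>i. xs ! \<sigma> i) [0..<?n]))))"
      by (intro lin_on_sum[OF vec_space_free_alg coalg_homD(1)[OF hom]]) simp
    then show ?thesis
      using sym_act_free[OF ns_A vV, of m xs] ms xs(1) xsV
      by (simp only: smul_simps(3)[OF vec_space_free_alg])
  qed
  also have "\<dots> = (\<Sum>\<sigma> | \<sigma> permutes {..<?n}. sgen (ospace A) L (m \<sigma>) (map (\<lambda>i. ys ! \<sigma> i) [0..<?n]))"
  proof (rule sum.cong[OF refl])
    fix \<sigma> assume "\<sigma> \<in> {\<sigma>. \<sigma> permutes {..<?n}}"
    then have \<sigma>: "\<sigma> permutes {..<?n}" by simp
    have eq: "map g (map (\<lambda>i. xs ! \<sigma> i) [0..<?n]) = map (\<lambda>i. ys ! \<sigma> i) [0..<?n]"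
      using gx permutes_in_image[OF \<sigma>] by simp
    show "smap (ospace A) ?V L g (sgen (ospace A) ?V (m \<sigma>) (map (\<lambda>i. xs ! \<sigma> i) [0..<?n])) =
        sgen (ospace A) L (m \<sigma>) (map (\<lambda>i. ys ! \<sigma> i) [0..<?n])"
      unfolding eq[symmetric]
      by (rule smap_sgen[OF vV glin]) (use ms \<sigma> permuted_in[of \<sigma> xs "carr ?V"] xsV xs(1) in \<open>simp_all add: sym_ops_def\<close>)
  qed
  also have "\<dots> = sym_act (free_act A L) m (map (free_incl A L) ys)"
    using sym_act_free[OF ns_A vL ms ys] by simp
  finally show ?thesis using coalg_hom_prim[OF hom vec_space_free_alg T] by simp
qed

text \<open>Every coefficient operation of a primitive element is primitive: placed on independent
  letters it is a word replacement of \<open>p\<close>, and replacement preserves primitivity. Since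
  words are not permuted, nonsymmetric operations suffice.\<close>

lemma prim_free_decomposition:
  assumes L: "subsp L E" and p: "p \<in> carr (prim C (free_alg A L) (\<Delta> L))"
  obtains X \<nu> where "finite X" "\<forall>w\<in>X. set w \<subseteq> carr L \<and> \<nu> w \<in> ops A (length w) \<and>
      ns_op (\<nu> w) \<in> prim_ops A C E \<Delta> (length w)"
    "p = (\<Sum>w\<in>X. sgen (ospace A) L (\<nu> w) w)"
proof -
  note vL = subspD(1)[OF L] and vA = connected_operadD(2)[OF A]
  have pF: "p \<in> carr (schur (ospace A) L)" using p by (simp add: prim_iff free_alg_def)
  obtain X and c :: "'v \<Rightarrow> 'v \<Rightarrow> 'k" where X: "finite X" "\<forall>w\<in>X. set w \<subseteq> carr L" and c: "\<forall>b. lin_on L fld (c b)"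
    and dec: "p = (\<Sum>w\<in>X. sgen (ospace A) L (word_extract (ospace A) L (ospace A (length w)) (\<lambda>\<nu>. \<nu>) (map c w) p) w)"
    by (rule schur_word_decomposition[where S = "ospace A", OF vL vA pF]) (rule that)
  define \<nu> where "\<nu> w = word_extract (ospace A) L (ospace A (length w)) (\<lambda>\<nu>. \<nu>) (map c w) p" for w
  have id: "lin_on (ospace A (length (map c w))) (ospace A (length w)) (\<lambda>\<nu>. \<nu>)" for w
    by (simp add: lin_on_def)
  have cs: "\<forall>f\<in>set (map c w). lin_on L fld f" for w using c by auto
  note el = word_extract_lin[where S = "ospace A" and g = "\<lambda>\<nu>. \<nu>", OF vL vA vA id cs]
    and es = word_extract_sgen[where S = "ospace A" and g = "\<lambda>\<nu>. \<nu>", OF vL vA vA id cs]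
  have \<nu>A: "\<nu> w \<in> ops A (length w)" for w
    unfolding \<nu>_def by (rule lin_onD(1)[OF el pF])
  have prim: "ns_op (\<nu> w) \<in> prim_ops A C E \<Delta> (length w)" for w
    unfolding prim_ops_def mem_Collect_eq Let_def
  proof (intro conjI allI impI)
    show "ns_op (\<nu> w) \<in> sym_ops A (length w)"
      using \<nu>A[of w] vs_zero[OF vA] by (simp add: sym_ops_def ns_op_def)
    fix xs assume xs: "length xs = length w" "set xs \<subseteq> carr E"
    let ?V = "vspan E (set xs)"
    note V = subsp_vspan(1)[OF xs(2)] and xsV = subsp_vspan(2)[OF xs(2)]
    note vV = subspD(1)[OF V]
    have len: "length (map c w) = length xs" using xs by simp
    \<comment> \<open>Extracting the coefficient and then attaching it to \<open>xs\<close> is the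
      replacement map; both sides are linear in \<open>p\<close>, so generators suffice.\<close>
    have "word_replace L ?V (map c w) xs p = sgen (ospace A) ?V (\<nu> w) xs"
      unfolding \<nu>_def
    proof (rule lin_on_schur_unique[where h = "word_replace L ?V (map c w) xs" and W = "free_alg A ?V" and
          h' = "\<lambda>p. sgen (ospace A) ?V (word_extract (ospace A) L (ospace A (length w)) (\<lambda>\<nu>. \<nu>) (map c w) p) xs"])
      have sl: "lin_on (ospace A (length w)) (free_alg A ?V) (\<lambda>\<nu>. sgen (ospace A) ?V \<nu> xs)"
        using sgen_lin[OF xsV, of "ospace A"] xs(1) by (simp add: free_alg_def)
      show "lin_on (schur (ospace A) L) (free_alg A ?V) (word_replace L ?V (map c w) xs)"
        using word_replace_lin[OF vL len xsV cs] by (simp add: free_alg_def)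
      show "lin_on (schur (ospace A) L) (free_alg A ?V)
          (\<lambda>p. sgen (ospace A) ?V (word_extract (ospace A) L (ospace A (length w)) (\<lambda>\<nu>. \<nu>) (map c w) p) xs)"
        by (rule lin_on_comp[OF el sl])
      fix \<mu> ys assume \<mu>: "\<mu> \<in> ops A (length ys)" and ys: "set ys \<subseteq> carr L"
      show "word_replace L ?V (map c w) xs (sgen (ospace A) L \<mu> ys) =
          sgen (ospace A) ?V (word_extract (ospace A) L (ospace A (length w)) (\<lambda>\<nu>. \<nu>) (map c w) (sgen (ospace A) L \<mu> ys)) xs"
        unfolding word_replace_sgen[OF vL len xsV cs \<mu> ys] es[OF \<mu> ys]
        using lin_onD(3)[OF sl, of \<mu>] lin_on_zero[OF vA sl] \<mu> by auto
    qed (rule pF)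
    then show "sym_act (free_act A ?V) (ns_op (\<nu> w)) (map (free_incl A ?V) xs) \<in> carr (prim C (free_alg A ?V) (\<Delta> ?V))"
      using word_replace_prim[OF free_bialgebra[OF L] vL free_incl_image[OF L] free_bialgebra[OF V] vV
          free_incl_image[OF V] len xsV cs p]
        sym_act_free_ns_op(2)[OF A vV, of "\<nu> w" xs] \<nu>A[of w] xs(1) xsV by simp
  qed
  have "p = (\<Sum>w\<in>X. sgen (ospace A) L (\<nu> w) w)" unfolding \<nu>_def by (rule dec)
  from that[OF X(1) _ this] show ?thesis using X(2) \<nu>A prim by blast
qed

end

section \<open>The comparison maps from the free algebra and the cofree coalgebra on
  \<open>L\<close> to \<open>H\<close>\<close>

section \<open>The structure theorem\<close>

locale ns_triple_bialgebra = ns_triple A C rel E \<Delta> \<sigma>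
  for A :: "('k::field, 'a::ab_group_add) operad" and C :: "('k, 'c::ab_group_add) operad" and rel
    and E :: "('k, 'v::ab_group_add) vs" and \<Delta> \<sigma> +
  fixes H :: "('k, 'v) vs" and act :: "'a \<Rightarrow> 'v list \<Rightarrow> 'v"
    and coact :: "nat \<Rightarrow> 'c \<Rightarrow> 'v \<Rightarrow> ('k, 'v) tensor"
  assumes H: "subsp H E" and bialg: "bialgebra A C rel H act coact"
begin

definition L :: "('k, 'v) vs" where "L = prim C H coact"

definition \<theta> :: "('k, 'a, 'v) schur \<Rightarrow> 'v" where "\<theta> = slift (ospace A) L H act"

text \<open>The map whose inverse will be the isomorphism in (c): it is bijective once
  \<open>H\<close> is connected.\<close>

definition \<alpha> :: "('k, 'c \<Rightarrow> 'k, 'v) schur \<Rightarrow> 'v" where "\<alpha> u = \<theta> (spl L u)"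

abbreviation "F \<equiv> free_alg A L"
abbreviation "I \<equiv> U_ideal A (prim_ops A C E \<Delta>) L (sym_act act)"
abbreviation "U \<equiv> U_space A (prim_ops A C E \<Delta>) L (sym_act act)"
abbreviation "Uact \<equiv> U_act A (prim_ops A C E \<Delta>) L (sym_act act)"
abbreviation "Ucoact \<equiv> U_coact A (prim_ops A C E \<Delta>) \<Delta> L (sym_act act)"

lemma alg: "algebra A H act" and coalg: "coalgebra C H coact" and vH: "vec_space H"
  using bialgebraD[OF bialg] by simp_all

lemma L: "vec_space L" "carr L \<subseteq> carr H" "smul L = smul H"
  using vec_space_prim[OF coalg] prim_subset[of C H coact] by (auto simp: L_def)

lemma L_subsp: "subsp L E"
  using L subspD[OF H] by (auto simp: subsp_def)

lemma coact_in: "\<delta> \<in> ops C n \<Longrightarrow> x \<in> carr H \<Longrightarrow> coact n \<delta> x \<in> carr (tpow H n)"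
  by (rule lin_onD(1)[OF coalgebraD(2)[OF coalg]])

lemmas free_bialg = free_bialgebra[OF L_subsp]
lemmas free_algebra = bialgebraD(1)[OF free_bialg]
lemmas free_coalgebra = bialgebraD(2)[OF free_bialg]
lemmas free_incl_L = free_incl_image[OF L_subsp]

lemma theta_lin: "lin_on F H \<theta>" and theta_sgen: "\<mu> \<in> ops A (length xs) \<Longrightarrow> set xs \<subseteq> carr L \<Longrightarrow>
    \<theta> (sgen (ospace A) L \<mu> xs) = act \<mu> xs"
  using free_ext_lin[OF alg L] free_ext_sgen[OF alg L] by (simp_all add: \<theta>_def)

lemma theta_act: "\<mu> \<in> ops A (length ts) \<Longrightarrow> set ts \<subseteq> carr F \<Longrightarrow> \<theta> (free_act A L \<mu> ts) = act \<mu> (map \<theta> ts)"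
  unfolding \<theta>_def by (rule free_ext_act[OF ns_A alg L free_algebra])

lemma theta_coalg: "coalg_hom C F (\<Delta> L) H coact \<theta>"
  unfolding \<theta>_def
  by (rule free_ext_coalg_hom[OF free_bialg L(1) free_incl_L bialg _ L(3)]) (simp add: L_def)

lemma theta_incl: "x \<in> carr L \<Longrightarrow> \<theta> (free_incl A L x) = x"
  using theta_sgen[of "ounit A" "[x]"] connected_operadD(5)[OF A] algebraD(4)[OF alg] L(2)
  by (auto simp: free_incl_def)

lemma alpha_lin: "lin_on (cofree C L) H \<alpha>"
  using lin_on_comp[OF spl_lin[OF L_subsp] theta_lin] by (simp add: \<alpha>_def[abs_def])

lemma alpha_sgen: "\<xi> \<in> carr (cospace C (length xs)) \<Longrightarrow> set xs \<subseteq> carr L \<Longrightarrow>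
    \<alpha> (sgen (cospace C) L \<xi> xs) = act (\<sigma> (length xs) \<xi>) xs"
  using spl_sgen[OF L_subsp] theta_sgen[of "\<sigma> (length xs) \<xi>" xs] lin_onD(1)[OF sigma]
  by (simp add: \<alpha>_def)

text \<open>A composite of two coalgebra maps, the splitting and \<open>\<theta>\<close>.\<close>

lemma alpha_coalg: "coalg_hom C (cofree C L) (cofree_coact C L) H coact \<alpha>"
  unfolding coalg_hom_def
proof (intro conjI allI ballI)
  show "lin_on (cofree C L) H \<alpha>" by (rule alpha_lin)
  fix n \<delta> u assume \<delta>: "\<delta> \<in> ops C n" and u: "u \<in> carr (cofree C L)"
  note sp = splitting[OF L_subsp, folded spl_def]
  have s: "spl L u \<in> carr F" by (rule lin_onD(1)[OF spl_lin[OF L_subsp] u])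
  have "coact n \<delta> (\<alpha> u) = tmap F H n \<theta> (tmap (cofree C L) F n (spl L) (cofree_coact C L n \<delta> u))"
    using coalg_homD(2)[OF theta_coalg \<delta> s] coalg_homD(2)[OF sp \<delta> u] by (simp add: \<alpha>_def)
  also have "\<dots> = tmap (cofree C L) H n \<alpha> (cofree_coact C L n \<delta> u)"
    using lin_onD(1)[OF cofree_coact_lin[OF C L(1) \<delta>] u]
    by (intro tmap_comp[OF vec_space_cofree vec_space_free_alg spl_lin[OF L_subsp] theta_lin alpha_lin])
      (simp_all add: \<alpha>_def)
  finally show "coact n \<delta> (\<alpha> u) = tmap (cofree C L) H n \<alpha> (cofree_coact C L n \<delta> u)" .
qed

lemma alpha_inj: "u \<in> carr (cofree C L) \<Longrightarrow> \<alpha> u = 0 \<Longrightarrow> u = 0"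
  using cofree_map_inj[OF bialg, folded L_def, OF alpha_lin alpha_sgen] by blast

lemma alpha_surj:
  assumes "connected_coalgebra C H coact"
  shows "\<alpha> ` carr (cofree C L) = carr H"
proof
  show "\<alpha> ` carr (cofree C L) \<subseteq> carr H" using lin_onD(1)[OF alpha_lin] by blast
  show "carr H \<subseteq> \<alpha> ` carr (cofree C L)"
  proof (rule connected_induct[OF bialg assms])
    show "0 \<in> \<alpha> ` carr (cofree C L)"
      using lin_on_zero[OF vec_space_cofree alpha_lin] vs_zero[OF vec_space_cofree] by (metis image_eqI)
    show "x + y \<in> \<alpha> ` carr (cofree C L)" if "x \<in> \<alpha> ` carr (cofree C L)" "y \<in> \<alpha> ` carr (cofree C L)" for x y
      using that lin_onD(2)[OF alpha_lin] vs_add[OF vec_space_cofree] by (smt (verit) image_iff)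
    show "smul H c x \<in> \<alpha> ` carr (cofree C L)" if "x \<in> \<alpha> ` carr (cofree C L)" for c x
      using that lin_onD(3)[OF alpha_lin] vs_smul[OF vec_space_cofree] by (smt (verit) image_iff)
    show "act (\<sigma> (length xs) \<xi>) xs \<in> \<alpha> ` carr (cofree C L)"
      if "\<xi> \<in> carr (cospace C (length xs))" "set xs \<subseteq> carr (prim C H coact)" for \<xi> xs
    proof (rule image_eqI)
      show "act (\<sigma> (length xs) \<xi>) xs = \<alpha> (sgen (cospace C) L \<xi> xs)"
        using alpha_sgen that by (simp add: L_def)
      show "sgen (cospace C) L \<xi> xs \<in> carr (cofree C L)"
        unfolding cofree_def using that by (intro sgen_in) (simp_all add: L_def)
    qed
  qed
qed

lemma connected_iff_cofree:
  "connected_coalgebra C H coact \<longleftrightarrow> (\<exists>f. coalg_iso C H coact (cofree C L) (cofree_coact C L) f)"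
proof
  assume conn: "connected_coalgebra C H coact"
  have "inj_on \<alpha> (carr (cofree C L))"
  proof (rule inj_onI)
    fix u v assume u: "u \<in> carr (cofree C L)" and v: "v \<in> carr (cofree C L)" and "\<alpha> u = \<alpha> v"
    then have "\<alpha> (u - v) = 0" using lin_on_diff[OF vec_space_cofree alpha_lin] by simp
    then show "u = v" using alpha_inj[OF vs_diff[OF vec_space_cofree u v]] by simp
  qed
  then have "coalg_iso C (cofree C L) (cofree_coact C L) H coact \<alpha>"
    using alpha_coalg alpha_surj[OF conn] by (simp add: coalg_iso_def bij_betw_def)
  from coalg_iso_inverse[OF vec_space_cofree vH _ this] lin_onD(1)[OF cofree_coact_lin[OF C L(1)]]
  show "\<exists>f. coalg_iso C H coact (cofree C L) (cofree_coact C L) f" by blast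
next
  assume "\<exists>f. coalg_iso C H coact (cofree C L) (cofree_coact C L) f"
  then obtain f where "coalg_iso C H coact (cofree C L) (cofree_coact C L) f" ..
  from connected_reflect[OF vH vec_space_cofree coact_in this connected_cofree[OF C L(1)]]
  show "connected_coalgebra C H coact" .
qed

text \<open>The value in the free algebra is primitive, and \<open>\<theta>\<close> is a coalgebra
  map; hence \<open>L\<close> is closed under primitive operations and \<open>sym_act act\<close> is
  a legitimate action on it.\<close>

lemma sym_act_prim:
  assumes m: "m \<in> prim_ops A C E \<Delta> (length ys)" and ys: "set ys \<subseteq> carr L"
  shows "sym_act (free_act A L) m (map (free_incl A L) ys) \<in> carr F"
    "\<theta> (sym_act (free_act A L) m (map (free_incl A L) ys)) = sym_act act m ys"
    "sym_act act m ys \<in> carr L"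
proof -
  note pr = prim_ops_eval[OF m L_subsp ys]
  have ms: "m \<in> sym_ops A (length ys)" using m by (simp add: prim_ops_def)
  show 1: "sym_act (free_act A L) m (map (free_incl A L) ys) \<in> carr F"
    using pr by (simp add: prim_iff)
  let ?X = "{\<sigma>. \<sigma> permutes {..<length ys}}" and ?w = "\<lambda>\<sigma>. map (\<lambda>i. ys ! \<sigma> i) [0..<length ys]"
  let ?t = "\<lambda>\<sigma>. sgen (ospace A) L (m \<sigma>) (?w \<sigma>)"
  have w: "m \<sigma> \<in> ops A (length (?w \<sigma>))" "set (?w \<sigma>) \<subseteq> carr L" if "\<sigma> \<in> ?X" for \<sigma>
    using ms that permuted_in[OF _ ys] by (auto simp: sym_ops_def)
  have "?t \<sigma> \<in> carr F" if "\<sigma> \<in> ?X" for \<sigma>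
    unfolding free_alg_def using w[OF that] by (intro sgen_in)
  then have "\<theta> (\<Sum>\<sigma>\<in>?X. smul F 1 (?t \<sigma>)) = (\<Sum>\<sigma>\<in>?X. smul H 1 (\<theta> (?t \<sigma>)))"
    by (intro lin_on_sum[OF vec_space_free_alg theta_lin])
  then have "\<theta> (\<Sum>\<sigma>\<in>?X. ?t \<sigma>) = (\<Sum>\<sigma>\<in>?X. \<theta> (?t \<sigma>))"
    by (simp only: smul_simps(3)[OF vec_space_free_alg] smul_simps(3)[OF vH])
  also have "\<dots> = sym_act act m ys"
    unfolding sym_act_def using theta_sgen[OF w] by (intro sum.cong) auto
  finally show 2: "\<theta> (sym_act (free_act A L) m (map (free_incl A L) ys)) = sym_act act m ys"
    using sym_act_free[OF ns_A L(1) ms ys] by simp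
  show "sym_act act m ys \<in> carr L"
    using coalg_hom_prim[OF theta_coalg vec_space_free_alg pr] 2 by (simp add: L_def)
qed

section \<open>The ideal defining \<open>U(L)\<close> as the kernel of
  \<open>\<theta>\<close>\<close>

definition K where "K = {t \<in> carr F. \<theta> t = 0}"

abbreviation "contains_relations J \<equiv> (\<forall>n. \<forall>m\<in>prim_ops A C E \<Delta> n. \<forall>ys\<in>tuples (replicate n L).
  sym_act (free_act A L) m (map (free_incl A L) ys) - free_incl A L (sym_act act m ys) \<in> J)"

lemma K_ideal: "alg_ideal A F (free_act A L) K"
  unfolding K_def
proof (rule alg_ideal_kernel[OF free_algebra alg])
  show "alg_hom A F (free_act A L) H act \<theta>"
    using theta_lin theta_act by (simp add: alg_hom_def tuples_replicate)
qed

text \<open>Both terms of a relation have the same image under \<open>\<theta>\<close>, which fixes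
  the letters.\<close>

lemma K_relations: "contains_relations K"
proof (intro allI ballI)
  fix n m ys assume m: "m \<in> prim_ops A C E \<Delta> n" and "ys \<in> tuples (replicate n L)"
  then have ys: "length ys = n" "set ys \<subseteq> carr L" by (simp_all add: tuples_replicate)
  note s = sym_act_prim[OF _ ys(2), of m, unfolded ys(1), OF m]
  have i: "free_incl A L (sym_act act m ys) \<in> carr F" by (rule free_incl_in[OF A s(3)])
  show "sym_act (free_act A L) m (map (free_incl A L) ys) - free_incl A L (sym_act act m ys) \<in> K"
    using lin_on_diff[OF vec_space_free_alg theta_lin s(1) i] s(2) theta_incl[OF s(3)] vs_diff[OF vec_space_free_alg s(1) i]
    by (simp add: K_def)
qed

lemma I_eq: "I = \<Inter>{J. alg_ideal A F (free_act A L) J \<and> contains_relations J}"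
  by (simp add: U_ideal_def)

lemma I_subset_K: "I \<subseteq> K"
  unfolding I_eq using K_ideal K_relations by blast

lemma I_ideal: "alg_ideal A F (free_act A L) I"
  unfolding I_eq using K_ideal K_relations by (intro alg_ideal_Inter[OF vec_space_free_alg]) auto

lemma I_relations: "contains_relations I"
  unfolding I_eq by blast

lemma I_subspace: "module.subspace (smul F) I" "I \<subseteq> carr F"
  using I_ideal by (auto simp: alg_ideal_def)

lemma I_closed: "0 \<in> I" "s \<in> I \<Longrightarrow> t \<in> I \<Longrightarrow> s + t \<in> I" "t \<in> I \<Longrightarrow> fscale c t \<in> I"
  "(\<And>x. x \<in> X \<Longrightarrow> f x \<in> I) \<Longrightarrow> sum f X \<in> I"
proof -
  interpret vector_space "smul F" using vec_space_free_alg by (rule vec_space_vector_space)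
  note sI = I_subspace(1)
  show "0 \<in> I" "s \<in> I \<Longrightarrow> t \<in> I \<Longrightarrow> s + t \<in> I" "(\<And>x. x \<in> X \<Longrightarrow> f x \<in> I) \<Longrightarrow> sum f X \<in> I"
    using subspace_0[OF sI] subspace_add[OF sI] subspace_sum[OF sI] by blast+
  show "t \<in> I \<Longrightarrow> fscale c t \<in> I" using subspace_scale[OF sI, of t c] by simp
qed

lemma free_incl_lin: "lin_on L F (free_incl A L)"
  using mlin_sgen[of "ounit A" "ospace A" "Suc 0" L] connected_operadD(5)[OF A]
  by (simp add: mlin_Cons mlin_Nil free_incl_def[abs_def] free_alg_def)

text \<open>A primitive element is a sum of primitive operations applied to words in
  \<open>L\<close>, and the defining relations identify each such value with a letter.\<close>

lemma prim_mod_I: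
  assumes p: "p \<in> carr (prim C F (\<Delta> L))"
  shows "\<exists>l\<in>carr L. p - free_incl A L l \<in> I"
proof -
  obtain X \<nu> where X: "finite X" "\<forall>w\<in>X. set w \<subseteq> carr L \<and> \<nu> w \<in> ops A (length w) \<and>
      ns_op (\<nu> w) \<in> prim_ops A C E \<Delta> (length w)" and p_eq: "p = (\<Sum>w\<in>X. sgen (ospace A) L (\<nu> w) w)"
    by (rule prim_free_decomposition[OF L_subsp p]) (rule that)
  let ?l = "\<lambda>w. sym_act act (ns_op (\<nu> w)) w"
  have l: "?l w \<in> carr L" and d: "sgen (ospace A) L (\<nu> w) w - free_incl A L (?l w) \<in> I" if "w \<in> X" for w
  proof -
    have w: "set w \<subseteq> carr L" "\<nu> w \<in> ops A (length w)" "ns_op (\<nu> w) \<in> prim_ops A C E \<Delta> (length w)"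
      using X(2) that by auto
    show "?l w \<in> carr L" by (rule sym_act_prim(3)[OF w(3,1)])
    have "w \<in> tuples (replicate (length w) L)" using w(1) by (simp add: tuples_replicate)
    with I_relations w(3)
    have "sym_act (free_act A L) (ns_op (\<nu> w)) (map (free_incl A L) w) - free_incl A L (?l w) \<in> I" by blast
    then show "sgen (ospace A) L (\<nu> w) w - free_incl A L (?l w) \<in> I"
      using sym_act_free_ns_op(2)[OF A L(1) w(2,1)] by simp
  qed
  have "free_incl A L (\<Sum>w\<in>X. smul L 1 (?l w)) = (\<Sum>w\<in>X. smul F 1 (free_incl A L (?l w)))"
    by (rule lin_on_sum[OF L(1) free_incl_lin l])
  then have "free_incl A L (\<Sum>w\<in>X. ?l w) = (\<Sum>w\<in>X. free_incl A L (?l w))"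
    by (simp only: smul_simps(3)[OF L(1)] smul_simps(3)[OF vec_space_free_alg])
  then have "p - free_incl A L (\<Sum>w\<in>X. ?l w) = (\<Sum>w\<in>X. sgen (ospace A) L (\<nu> w) w - free_incl A L (?l w))"
    unfolding p_eq by (simp only: sum_subtractf)
  also have "\<dots> \<in> I" by (rule I_closed(4)) (rule d)
  finally show ?thesis by (rule bexI[where x = "\<Sum>w\<in>X. ?l w"]) (rule vs_sum[OF L(1) l])
qed

text \<open>\<open>connected_induct\<close>, applied to the free algebra itself, yields generators
  \<open>\<sigma>(\<xi>)(p\<^sub>1, \<dots>, p\<^sub>n)\<close> whose arguments are arbitrary
  primitive elements. Modulo the ideal these may be replaced by letters, and on letters the value
  lies in the image of the splitting.\<close>

lemma free_eq_spl_plus_I: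
  assumes t: "t \<in> carr F"
  shows "\<exists>u\<in>carr (cofree C L). t - spl L u \<in> I"
proof -
  let ?X = "{t. \<exists>u\<in>carr (cofree C L). t - spl L u \<in> I}"
  note sl = spl_lin[OF L_subsp]
  have "carr F \<subseteq> ?X"
  proof (rule connected_induct[OF free_bialg connected_free[OF free_bialg L(1) free_incl_L]])
    have "0 - spl L 0 \<in> I" using lin_on_zero[OF vec_space_cofree sl] I_closed(1) by simp
    then show "0 \<in> ?X" using vs_zero[OF vec_space_cofree] by blast
    show "x + y \<in> ?X" if xy: "x \<in> ?X" "y \<in> ?X" for x y
    proof -
      obtain u v where uv: "u \<in> carr (cofree C L)" "x - spl L u \<in> I" "v \<in> carr (cofree C L)" "y - spl L v \<in> I"
        using xy by blast
      have "x + y - spl L (u + v) = (x - spl L u) + (y - spl L v)"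
        using lin_onD(2)[OF sl uv(1,3)] by simp
      then have "x + y - spl L (u + v) \<in> I" using I_closed(2)[OF uv(2,4)] by (simp only:)
      then show ?thesis using vs_add[OF vec_space_cofree uv(1,3)] by blast
    qed
    show "smul F c x \<in> ?X" if x: "x \<in> ?X" for c x
    proof -
      obtain u where u: "u \<in> carr (cofree C L)" "x - spl L u \<in> I" using x by blast
      have "smul F c x - spl L (smul (cofree C L) c u) = fscale c (x - spl L u)"
        using lin_onD(3)[OF sl u(1), of c] by (simp add: fun_eq_iff algebra_simps)
      then have "smul F c x - spl L (smul (cofree C L) c u) \<in> I" using I_closed(3)[OF u(2)] by (simp only:)
      then show ?thesis using vs_smul[OF vec_space_cofree u(1)] by blast
    qed
    fix \<xi> ps assume \<xi>: "\<xi> \<in> carr (cospace C (length ps))" and ps: "set ps \<subseteq> carr (prim C F (\<Delta> L))"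
    have "\<forall>p\<in>set ps. \<exists>l. l \<in> carr L \<and> p - free_incl A L l \<in> I" using prim_mod_I ps by blast
    from bchoice[OF this] obtain l where l: "\<forall>p\<in>set ps. l p \<in> carr L \<and> p - free_incl A L (l p) \<in> I" ..
    let ?ls = "map l ps"
    have lsL: "set ?ls \<subseteq> carr L" using l by auto
    have \<sigma>\<xi>: "\<sigma> (length ps) \<xi> \<in> ops A (length ps)" by (rule lin_onD(1)[OF sigma \<xi>])
    have psF: "set ps \<subseteq> carr F" using ps prim_subset[of C F "\<Delta> L"] by blast
    \<comment> \<open>The replacement of the primitive arguments by congruent letters; the empty
      list is the initial stock of exchanged arguments.\<close>
    have "free_act A L (\<sigma> (length ps) \<xi>) ([] @ ps) - free_act A L (\<sigma> (length ps) \<xi>) ([] @ map (free_incl A L) ?ls) \<in> I"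
    proof (rule alg_ideal_cong[OF free_algebra I_ideal \<sigma>\<xi>])
      show "set (map (free_incl A L) ?ls) \<subseteq> carr F" using lsL free_incl_in[OF A] by auto
      show "\<forall>(p, q)\<in>set (zip ps (map (free_incl A L) ?ls)). p - q \<in> I"
        using l by (auto simp: zip_map2 zip_same_conv_map)
    qed (use psF in auto)
    moreover have "free_act A L (\<sigma> (length ps) \<xi>) (map (free_incl A L) ?ls) = spl L (sgen (cospace C) L \<xi> ?ls)"
      using sgen_eq_free_act[OF ns_A L(1), of "\<sigma> (length ps) \<xi>" ?ls] spl_sgen[OF L_subsp, of \<xi> ?ls] \<sigma>\<xi> \<xi> lsL
      by simp
    moreover have "sgen (cospace C) L \<xi> ?ls \<in> carr (cofree C L)"
      unfolding cofree_def using \<xi> lsL by (intro sgen_in) simp_all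
    ultimately show "free_act A L (\<sigma> (length ps) \<xi>) ps \<in> ?X" by (auto simp del: map_map)
  qed
  then show ?thesis using t by blast
qed

text \<open>Injectivity of \<open>\<alpha>\<close> is available for every \<open>H\<close>, so the
  kernel is identified in general; connectedness of \<open>H\<close> enters later, through
  surjectivity.\<close>

lemma I_eq_K: "I = K"
proof
  show "K \<subseteq> I"
  proof
    fix t assume t: "t \<in> K"
    then have tF: "t \<in> carr F" "\<theta> t = 0" by (simp_all add: K_def)
    obtain u where u: "u \<in> carr (cofree C L)" "t - spl L u \<in> I" using free_eq_spl_plus_I[OF tF(1)] by blast
    have s: "spl L u \<in> carr F" by (rule lin_onD(1)[OF spl_lin[OF L_subsp] u(1)])
    have "\<theta> (t - spl L u) = 0" using u(2) I_subset_K by (auto simp: K_def)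
    then have "\<alpha> u = 0"
      using lin_on_diff[OF vec_space_free_alg theta_lin tF(1) s] tF(2) by (simp add: \<alpha>_def)
    then have "spl L u = 0"
      using alpha_inj[OF u(1)] lin_on_zero[OF vec_space_cofree spl_lin[OF L_subsp]] by simp
    then show "t \<in> I" using u(2) by simp
  qed
qed (rule I_subset_K)

section \<open>Comparison of the quotient \<open>U(L)\<close> with \<open>H\<close>\<close>

lemma vec_space_U: "vec_space U"
  by (simp add: U_space_def quot_def vec_space_presented)

abbreviation "\<pi> \<equiv> quot_map F I"
abbreviation "rep \<equiv> quot_rep F I"

lemma pi_lin: "lin_on F U \<pi>"
  unfolding U_space_def by (rule quot_map_linear)

lemma pi_image: "\<pi> ` carr F = carr U"
  unfolding U_space_def by (rule quot_map_image[OF vec_space_free_alg])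

lemma rep: "q \<in> carr U \<Longrightarrow> rep q \<in> carr F" "q \<in> carr U \<Longrightarrow> \<pi> (rep q) = q"
  using inv_into_into[of q \<pi> "carr F"] f_inv_into_f[of q \<pi> "carr F"] by (simp_all add: quot_rep_def pi_image)

text \<open>The two maps out of the free algebra have the same kernel; this gives both existence and
  injectivity of the map from \<open>H\<close> to \<open>U\<close>.\<close>

lemma pi_eq_iff:
  assumes "s \<in> carr F" "t \<in> carr F"
  shows "\<pi> s = \<pi> t \<longleftrightarrow> \<theta> s = \<theta> t"
proof -
  have "\<pi> s = \<pi> t \<longleftrightarrow> \<pi> (s - t) = 0" using lin_on_diff[OF vec_space_free_alg pi_lin assms] by simp
  also have "\<dots> \<longleftrightarrow> s - t \<in> K"
    using quot_map_kernel[OF vec_space_free_alg I_subspace(1) vs_diff[OF vec_space_free_alg assms]] I_eq_K by simp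
  also have "\<dots> \<longleftrightarrow> \<theta> s = \<theta> t"
    using lin_on_diff[OF vec_space_free_alg theta_lin assms] vs_diff[OF vec_space_free_alg assms] by (simp add: K_def)
  finally show ?thesis .
qed

lemma connected_imp_U:
  assumes conn: "connected_coalgebra C H coact"
  shows "\<exists>f. bialg_iso A C H act coact U Uact Ucoact f"
proof -
  have surj: "\<theta> ` carr F = carr H"
  proof
    show "carr H \<subseteq> \<theta> ` carr F"
      unfolding alpha_surj[OF conn, symmetric] using lin_onD(1)[OF spl_lin[OF L_subsp]] by (auto simp: \<alpha>_def)
  qed (use lin_onD(1)[OF theta_lin] in blast)
  \<comment> \<open>A set-theoretic section of \<open>\<theta>\<close>; linearity of the resulting
    \<open>f\<close> comes from \<open>f\<theta>\<close>, not from \<open>g\<close>.\<close>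
  define g where "g = inv_into (carr F) \<theta>"
  have g: "g h \<in> carr F" "\<theta> (g h) = h" if "h \<in> carr H" for h
    using inv_into_into[of h \<theta> "carr F"] f_inv_into_f[of h \<theta> "carr F"] that by (simp_all add: g_def surj)
  define f where "f h = \<pi> (g h)" for h
  have f\<theta>: "f (\<theta> t) = \<pi> t" if t: "t \<in> carr F" for t
    unfolding f_def using g[OF lin_onD(1)[OF theta_lin t]] t by (simp add: pi_eq_iff)
  have f_lin: "lin_on H U f"
    unfolding lin_on_def
  proof (intro conjI ballI allI)
    fix x y c assume x: "x \<in> carr H" and y: "y \<in> carr H"
    note gx = g[OF x] and gy = g[OF y]
    show "f x \<in> carr U" unfolding f_def using gx pi_image by blast
    show "f (x + y) = f x + f y"
      using f\<theta>[OF vs_add[OF vec_space_free_alg gx(1) gy(1)]] lin_onD(2)[OF theta_lin gx(1) gy(1)]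
        lin_onD(2)[OF pi_lin gx(1) gy(1)] gx(2) gy(2) by (simp add: f_def)
    show "f (smul H c x) = smul U c (f x)"
      using f\<theta>[OF vs_smul[OF vec_space_free_alg gx(1)], of c] lin_onD(3)[OF theta_lin gx(1), of c]
        lin_onD(3)[OF pi_lin gx(1), of c] gx(2) by (simp add: f_def)
  qed
  \<comment> \<open>The operations on \<open>U\<close> are defined through the representatives
    \<open>rep\<close>; they are therefore compared with \<open>H\<close> by showing that
    \<open>\<theta>\<close> sends the representative of \<open>f h\<close> back to
    \<open>h\<close>.\<close>
  have rep_f: "rep (f h) \<in> carr F" "\<theta> (rep (f h)) = h" if h: "h \<in> carr H" for h
  proof -
    have fU: "f h \<in> carr U" by (rule lin_onD(1)[OF f_lin h])
    show 1: "rep (f h) \<in> carr F" by (rule rep(1)[OF fU])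
    have "\<pi> (rep (f h)) = \<pi> (g h)" using rep(2)[OF fU] by (simp add: f_def)
    then show "\<theta> (rep (f h)) = h" using pi_eq_iff[OF 1 g(1)[OF h]] g(2)[OF h] by simp
  qed
  have "bij_betw f (carr H) (carr U)"
    unfolding bij_betw_def
  proof
    show "inj_on f (carr H)" using rep_f(2) by (metis inj_onI)
    have "f ` (\<theta> ` carr F) = \<pi> ` carr F" unfolding image_image using f\<theta> by (rule image_cong[OF refl])
    then show "f ` carr H = carr U" by (simp only: surj pi_image)
  qed
  moreover have "alg_hom A H act U Uact f"
    unfolding alg_hom_def
  proof (intro conjI allI ballI f_lin)
    fix n \<mu> hs assume \<mu>: "\<mu> \<in> ops A n" and "hs \<in> tuples (replicate n H)"
    then have hs: "length hs = n" "set hs \<subseteq> carr H" by (simp_all add: tuples_replicate)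
    let ?rs = "map rep (map f hs)"
    have rs: "set ?rs \<subseteq> carr F" "map \<theta> ?rs = hs"
      using rep_f hs(2) by (auto intro!: map_idI)
    have \<mu>r: "\<mu> \<in> ops A (length ?rs)" using \<mu> hs(1) by simp
    have "f (act \<mu> hs) = \<pi> (free_act A L \<mu> ?rs)"
      using f\<theta>[OF act_in[OF free_algebra \<mu>r rs(1)]] theta_act[OF \<mu>r rs(1)] rs(2) by (simp only:)
    then show "f (act \<mu> hs) = Uact \<mu> (map f hs)" by (simp add: U_act_def Let_def)
  qed
  moreover have "coalg_hom C H coact U Ucoact f"
    unfolding coalg_hom_def
  proof (intro conjI allI ballI f_lin)
    fix n \<delta> h assume \<delta>: "\<delta> \<in> ops C n" and h: "h \<in> carr H"
    let ?r = "rep (f h)"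
    have r: "?r \<in> carr F" "\<theta> ?r = h" using rep_f[OF h] by auto
    have "tmap H U n f (coact n \<delta> h) = tmap H U n f (tmap F H n \<theta> (\<Delta> L n \<delta> ?r))"
      using coalg_homD(2)[OF theta_coalg \<delta> r(1)] r(2) by simp
    also have "\<dots> = tmap F U n \<pi> (\<Delta> L n \<delta> ?r)"
      using lin_onD(1)[OF coalgebraD(2)[OF free_coalgebra \<delta>] r(1)] f\<theta>
      by (intro tmap_comp[OF vec_space_free_alg vH theta_lin f_lin pi_lin]) simp_all
    finally show "Ucoact n \<delta> (f h) = tmap H U n f (coact n \<delta> h)" by (simp add: U_coact_def Let_def)
  qed
  ultimately show ?thesis unfolding bialg_iso_def by blast
qed

text \<open>The coaction of \<open>U\<close> is pushed forward from a representative, so the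
  filtration degree of \<open>rep q\<close> in the free algebra bounds that of
  \<open>q\<close>.\<close>

lemma connected_U: "connected_coalgebra C U Ucoact"
  unfolding connected_coalgebra_def
proof (intro equalityI subsetI)
  fix q assume q: "q \<in> carr U"
  obtain r where r: "rep q \<in> filt C F (\<Delta> L) r"
    using connected_free[OF free_bialg L(1) free_incl_L] rep(1)[OF q] unfolding connected_coalgebra_def by blast
  have "Ucoact n \<delta> q = 0" if "n > r" "\<delta> \<in> ops C n" for n \<delta>
    using filtD(2)[OF r that] lin_on_zero[OF vec_space_tpow tmap_lin[OF vec_space_free_alg pi_lin]]
    by (simp add: U_coact_def Let_def)
  then show "q \<in> (\<Union>r. filt C U Ucoact r)" using q by (auto simp: filt_def)
qed (auto simp: filt_def)

lemma connected_iff_U: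
  "connected_coalgebra C H coact \<longleftrightarrow> (\<exists>f. bialg_iso A C H act coact U Uact Ucoact f)"
proof
  assume "\<exists>f. bialg_iso A C H act coact U Uact Ucoact f"
  then obtain f where "coalg_iso C H coact U Ucoact f" by (auto simp: bialg_iso_def coalg_iso_def)
  from connected_reflect[OF vH vec_space_U coact_in this connected_U]
  show "connected_coalgebra C H coact" .
qed (rule connected_imp_U)

end

theorem theorem3p3p1:
  fixes A :: "('k::field, 'a::ab_group_add) operad"
    and C :: "('k, 'c::ab_group_add) operad"
    and rel :: "('a, 'c) relations"
    and E H :: "('k, 'v::ab_group_add) vs"
    and \<Delta> :: "('k, 'a, 'c, 'v) coactions"
    and act :: "'a \<Rightarrow> 'v list \<Rightarrow> 'v"
    and coact :: "nat \<Rightarrow> 'c \<Rightarrow> 'v \<Rightarrow> ('k, 'v) tensor"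
  assumes "ns_bialgebra_type A C rel"
    and "vec_space E" and "\<not> fin_dim E"
    and "H1 A C rel E \<Delta>"
    and "ns_H2epi A C E \<Delta>"
    and "subsp H E"
    and "bialgebra A C rel H act coact"
  defines "P \<equiv> prim_ops A C E \<Delta>"
    and "L \<equiv> prim C H coact"
  shows "(connected_coalgebra C H coact \<longleftrightarrow>
            (\<exists>f. bialg_iso A C H act coact
                   (U_space A P L (sym_act act)) (U_act A P L (sym_act act))
                   (U_coact A P \<Delta> L (sym_act act)) f)) \<and>
         (connected_coalgebra C H coact \<longleftrightarrow>
            (\<exists>f. coalg_iso C H coact (cofree C L) (cofree_coact C L) f))"
proof -
  \<comment> \<open>The same \<open>\<sigma>\<close> serves all subspaces \<open>V\<close>. This
    uniformity lets scalars computed on \<open>E\<close> be used for the splitting on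
    \<open>L\<close>.\<close>
  obtain \<sigma> where "\<forall>n. lin_on (cospace C n) (ospace A n) (\<sigma> n)"
    and "\<forall>V. subsp V E \<longrightarrow>
           (let s = slift (cospace C) V (free_alg A V)
                      (\<lambda>\<xi> xs. sgen (ospace A) V (\<sigma> (length xs) \<xi>) xs)
            in coalg_hom C (cofree C V) (cofree_coact C V) (free_alg A V) (\<Delta> V) s \<and>
               (\<forall>t\<in>carr (cofree C V). phi A C \<Delta> V (s t) = t))"
    using assms(5) unfolding ns_H2epi_def by blast
  then interpret T: ns_triple_bialgebra A C rel E \<Delta> \<sigma> H act coact
    using assms(1-4,6,7) by unfold_locales (simp_all add: Let_def)
  show ?thesis
    using T.connected_iff_U T.connected_iff_cofree unfolding P_def L_def T.L_def by blast
qed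

end
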